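(* Let $A$ be a bialgebra over a field $K$. Suppose that the Jacobson radical $J$ of $A$ is a nilpotent coideal such that $H:=A/J$ is a Hopf algebra which has an $ad$-coinvariant integral, and that every canonical map $A/J^{n+1}\to A/J^n$ splits in ${}^H\mathfrak{M}^H$. Then $A$ is isomorphic as a bialgebra to the bosonization $R\#_bH$ of a certain Yetter–Drinfeld quadruple $(R,\varepsilon,\delta,\omega)$. In fact, $A$ and $R\#_bH$ are isomorphic Hopf algebras.
   Context: ${}^H\mathfrak{M}^H$ is the category of $(H,H)$-bicomodules; $A$ and the quotients $A/J^n$ are bicomodules via the canonical projection $\pi:A\to H$. An $ad$-coinvariant integral of $H$ is $t\in H$ with $ht=\varepsilon(h)t$ for all $h\in H$, $\varepsilon(t)=1$ and $\sum t_{(1)}S(t_{(3)})\otimes t_{(2)}=1\otimes t$. ${}_H^H\mathcal{YD}$: left $H$-modules (action ${}^hv$) and left $H$-comodules (coaction $\rho(v)=\sum v_{\langle-1\rangle}\otimes v_{\langle0\rangle}$) with $\rho({}^hv)=\sum h_{(1)}v_{\langle-1\rangle}S(h_{(3)})\otimes{}^{h_{(2)}}v_{\langle0\rangle}$; tensor product over $K$ with diagonal action and coaction. For an algebra $R$ in ${}_H^H\mathcal{YD}$, $R\otimes R$ is an algebra with $(r\otimes s)(t\otimes v)=\sum r({}^{s_{\langle-1\rangle}}t)\otimes s_{\langle0\rangle}v$, diagonal $H$-action and diagonal coaction $\rho_{R\otimes R}$. Yetter–Drinfeld quadruple: an algebra $R$ in ${}_H^H\mathcal{YD}$ with linear maps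 $\varepsilon:R\to K$, $\delta:R\to R\otimes R$, $\delta(r)=\sum r^{(1)}\otimes r^{(2)}$, and $\omega:H\to R\otimes R$, $\omega(h)=\sum\omega^1(h)\otimes\omega^2(h)$, such that for all $r,s\in R$, $h,k\in H$: 1. $\varepsilon({}^hr)=\varepsilon(r)\varepsilon_H(h)$ and $\sum r_{\langle-1\rangle}\varepsilon(r_{\langle0\rangle})=\varepsilon(r)1_H$; 2. $\varepsilon(rs)=\varepsilon(r)\varepsilon(s)$, $\varepsilon(1_R)=1$; 3. $\rho_{R\otimes R}(\delta(r))=\sum r_{\langle-1\rangle}\otimes\delta(r_{\langle0\rangle})$; 4. $\rho_{R\otimes R}(\omega(h))=\sum h_{(1)}S(h_{(3)})\otimes\omega(h_{(2)})$; 5. $\delta(rs)=\delta(r)\delta(s)$, $\delta(1_R)=1_R\otimes1_R$; 6. $\omega(hk)=\sum\omega(h_{(1)})\,{}^{h_{(2)}}\omega(k)$, $\omega(1_H)=1_R\otimes1_R$; 7. $\sum\delta({}^{h_{(1)}}r)\omega(h_{(2)})=\sum\omega(h_{(1)})\,{}^{h_{(2)}}\delta(r)$; 8. $\sum r^{(1)}\otimes\delta(r^{(2)})=\sum\delta(r^{(1)})\omega(r^{(2)}_{\langle-1\rangle})\otimes r^{(2)}_{\langle0\rangle}$; 9. $\sum\omega^1(h_{(1)})\otimes\delta(\omega^2(h_{(1)}))\omega(h_{(2)})=\sum\delta(\omega^1(h_{(1)}))\,\omega\big(\omega^2(h_{(1)})_{\langle-1\rangle}h_{(2)}\big)\otimes\omega^2(h_{(1)})_{\langle0\rangle}$;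 10. $(\varepsilon\otimes R)\delta=(R\otimes\varepsilon)\delta=\mathrm{Id}_R$; 11. $(\varepsilon\otimes R)\omega=(R\otimes\varepsilon)\omega=\varepsilon_H(\cdot)1_R$. Its bosonization $R\#_bH$ is the bialgebra $R\otimes H$ with smash product $(r\#h)(s\#k)=\sum r({}^{h_{(1)}}s)\#h_{(2)}k$, unit $1_R\#1_H$, counit $\varepsilon(r)\varepsilon_H(h)$ and comultiplication $\Delta(r\#h)=\sum\widetilde\delta^1(r\#h_{(1)})\#\widetilde\delta^2(r\#h_{(1)})_{\langle-1\rangle}h_{(2)}\otimes\widetilde\delta^2(r\#h_{(1)})_{\langle0\rangle}\#h_{(3)}$, where $\widetilde\delta(r\#h)=\delta(r)\omega(h)=\sum\widetilde\delta^1(r\#h)\otimes\widetilde\delta^2(r\#h)$. *)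

theory Defs
  imports "HOL-Algebra.QuotRing" "HOL-Algebra.Ideal_Product" "HOL-Algebra.Module"
begin

section \<open>Linear maps and quotients\<close>

definition k_linear ::
    "('k, 'l) ring_scheme \<Rightarrow> ('k, 'v, 'm) module_scheme \<Rightarrow> ('k, 'w, 'n) module_scheme \<Rightarrow> ('v \<Rightarrow> 'w) \<Rightarrow> bool"
  where "k_linear K V W f \<longleftrightarrow> f \<in> carrier V \<rightarrow> carrier W
    \<and> (\<forall>x \<in> carrier V. \<forall>y \<in> carrier V. f (x \<oplus>\<^bsub>V\<^esub> y) = f x \<oplus>\<^bsub>W\<^esub> f y)
    \<and> (\<forall>c \<in> carrier K. \<forall>x \<in> carrier V. f (c \<odot>\<^bsub>V\<^esub> x) = c \<odot>\<^bsub>W\<^esub> f x)"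

definition k_bilinear ::
    "('k, 'l) ring_scheme \<Rightarrow> ('k, 'u, 'm) module_scheme \<Rightarrow> ('k, 'v, 'n) module_scheme \<Rightarrow>
     ('k, 'w, 'p) module_scheme \<Rightarrow> ('u \<Rightarrow> 'v \<Rightarrow> 'w) \<Rightarrow> bool"
  where "k_bilinear K U V W b \<longleftrightarrow>
    (\<forall>u \<in> carrier U. k_linear K V W (b u)) \<and> (\<forall>v \<in> carrier V. k_linear K U W (\<lambda>u. b u v))"

definition scalars :: "('k, 'l) ring_scheme \<Rightarrow> ('k, 'k) module"
  where "scalars K = \<lparr>carrier = carrier K, mult = mult K, one = \<one>\<^bsub>K\<^esub>, zero = \<zero>\<^bsub>K\<^esub>, add = add K,
    smult = mult K\<rparr>"

text \<open>The factor ring \<open>M Quot I\<close> together with the induced scalar multiplication. For a mere module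
  \<open>M\<close> the fields \<open>mult\<close> and \<open>one\<close> carry no meaning, and only the quotient module is intended.\<close>

definition quot_module :: "('k, 'v, 'm) module_scheme \<Rightarrow> 'v set \<Rightarrow> ('k, 'v set) module"
  where "quot_module M I =
    ring.extend (M Quot I) (module.fields (\<lambda>c X. \<Union>x\<in>X. I +>\<^bsub>M\<^esub> (c \<odot>\<^bsub>M\<^esub> x)))"

definition module_span :: "('k, 'l) ring_scheme \<Rightarrow> ('k, 'v, 'm) module_scheme \<Rightarrow> 'v set \<Rightarrow> 'v set"
  where "module_span K M B = \<Inter>{N. submodule N K M \<and> B \<subseteq> N}"

section \<open>Tensor products\<close>

text \<open>\<open>tensor K V W\<close> is the free \<open>K\<close>-module on \<open>carrier V \<times> carrier W\<close> (finitely supported functions,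
  zero off this set) modulo the submodule generated by the bilinearity relators. Its fields \<open>mult\<close>
  and \<open>one\<close> are not used: products on tensor products are introduced separately.\<close>

definition free_module :: "('k, 'l) ring_scheme \<Rightarrow> 's set \<Rightarrow> ('k, 's \<Rightarrow> 'k) module"
  where "free_module K B =
    \<lparr>carrier = {f. range f \<subseteq> carrier K \<and> finite {p. f p \<noteq> \<zero>\<^bsub>K\<^esub>} \<and> {p. f p \<noteq> \<zero>\<^bsub>K\<^esub>} \<subseteq> B},
     mult = undefined, one = undefined,
     zero = (\<lambda>_. \<zero>\<^bsub>K\<^esub>), add = (\<lambda>f g p. f p \<oplus>\<^bsub>K\<^esub> g p), smult = (\<lambda>c f p. c \<otimes>\<^bsub>K\<^esub> f p)\<rparr>"

definition free_gen :: "('k, 'l) ring_scheme \<Rightarrow> 's \<Rightarrow> 's \<Rightarrow> 'k"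
  where "free_gen K p = (\<lambda>q. if q = p then \<one>\<^bsub>K\<^esub> else \<zero>\<^bsub>K\<^esub>)"

definition tensor_relators ::
    "('k, 'l) ring_scheme \<Rightarrow> ('k, 'v, 'm) module_scheme \<Rightarrow> ('k, 'w, 'n) module_scheme \<Rightarrow> ('v \<times> 'w \<Rightarrow> 'k) set"
  where "tensor_relators K V W = (let F = free_module K (carrier V \<times> carrier W); e = free_gen K in
      {e (v \<oplus>\<^bsub>V\<^esub> v', w) \<ominus>\<^bsub>F\<^esub> (e (v, w) \<oplus>\<^bsub>F\<^esub> e (v', w)) | v v' w.
          v \<in> carrier V \<and> v' \<in> carrier V \<and> w \<in> carrier W}
    \<union> {e (v, w \<oplus>\<^bsub>W\<^esub> w') \<ominus>\<^bsub>F\<^esub> (e (v, w) \<oplus>\<^bsub>F\<^esub> e (v, w')) | v w w'.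
          v \<in> carrier V \<and> w \<in> carrier W \<and> w' \<in> carrier W}
    \<union> {e (c \<odot>\<^bsub>V\<^esub> v, w) \<ominus>\<^bsub>F\<^esub> (c \<odot>\<^bsub>F\<^esub> e (v, w)) | c v w.
          c \<in> carrier K \<and> v \<in> carrier V \<and> w \<in> carrier W}
    \<union> {e (v, c \<odot>\<^bsub>W\<^esub> w) \<ominus>\<^bsub>F\<^esub> (c \<odot>\<^bsub>F\<^esub> e (v, w)) | c v w.
          c \<in> carrier K \<and> v \<in> carrier V \<and> w \<in> carrier W})"

definition tensor_null ::
    "('k, 'l) ring_scheme \<Rightarrow> ('k, 'v, 'm) module_scheme \<Rightarrow> ('k, 'w, 'n) module_scheme \<Rightarrow> ('v \<times> 'w \<Rightarrow> 'k) set"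
  where "tensor_null K V W =
    module_span K (free_module K (carrier V \<times> carrier W)) (tensor_relators K V W)"

definition tensor ::
    "('k, 'l) ring_scheme \<Rightarrow> ('k, 'v, 'm) module_scheme \<Rightarrow> ('k, 'w, 'n) module_scheme \<Rightarrow>
     ('k, ('v \<times> 'w \<Rightarrow> 'k) set) module"
  where "tensor K V W = quot_module (free_module K (carrier V \<times> carrier W)) (tensor_null K V W)"

definition pure ::
    "('k, 'l) ring_scheme \<Rightarrow> ('k, 'v, 'm) module_scheme \<Rightarrow> ('k, 'w, 'n) module_scheme \<Rightarrow>
     'v \<Rightarrow> 'w \<Rightarrow> ('v \<times> 'w \<Rightarrow> 'k) set"
  where "pure K V W v w =
    tensor_null K V W +>\<^bsub>free_module K (carrier V \<times> carrier W)\<^esub> free_gen K (v, w)"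

text \<open>\<open>tlift K X b\<close> is the linear map into \<open>X\<close> induced by a bilinear map \<open>b\<close>; the result does not
  depend on the representative chosen (see \<open>tlift_pure\<close> and \<open>tlift_linear\<close> below). It replaces Sweedler notation: if
  \<open>T = \<Sum> T\<^sub>1 \<otimes> T\<^sub>2\<close> then \<open>\<Sum> b T\<^sub>1 T\<^sub>2\<close> is \<open>tlift K X (\<lambda>x y. b x y) T\<close>.\<close>

definition tlift ::
    "('k, 'l) ring_scheme \<Rightarrow> ('k, 'x, 'm) module_scheme \<Rightarrow> ('v \<Rightarrow> 'w \<Rightarrow> 'x) \<Rightarrow> ('v \<times> 'w \<Rightarrow> 'k) set \<Rightarrow> 'x"
  where "tlift K X b T = (let f = (SOME f. f \<in> T) in
    (\<Oplus>\<^bsub>X\<^esub>p\<in>{p. f p \<noteq> \<zero>\<^bsub>K\<^esub>}. f p \<odot>\<^bsub>X\<^esub> b (fst p) (snd p)))"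

subsection \<open>Universal property\<close>

lemma free_module_simps:
  "carrier (free_module K B) = {f. (\<forall>p. f p \<in> carrier K) \<and> finite {p. f p \<noteq> \<zero>\<^bsub>K\<^esub>} \<and> (\<forall>p. f p \<noteq> \<zero>\<^bsub>K\<^esub> \<longrightarrow> p \<in> B)}"
  "zero (free_module K B) = (\<lambda>_. \<zero>\<^bsub>K\<^esub>)"
  "add (free_module K B) f g = (\<lambda>p. f p \<oplus>\<^bsub>K\<^esub> g p)"
  "smult (free_module K B) c f = (\<lambda>p. c \<otimes>\<^bsub>K\<^esub> f p)"
  by (auto simp add: free_module_def)

lemma free_module_module:
  fixes K :: "('a, 'l) ring_scheme" and B :: "'s set"
  assumes "cring K" shows "module K (free_module K B)"
proof -
  interpret cring K by fact
  have add_supp: "{p. f p \<oplus>\<^bsub>K\<^esub> g p \<noteq> \<zero>\<^bsub>K\<^esub>} \<subseteq> {p. f p \<noteq> \<zero>\<^bsub>K\<^esub>} \<union> {p. g p \<noteq> \<zero>\<^bsub>K\<^esub>}" for f g :: "'s \<Rightarrow> 'a"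
    by auto
  show ?thesis
  proof (rule moduleI)
    show "abelian_group (free_module K B)"
    proof (rule abelian_groupI)
      fix f g assume fg: "f \<in> carrier (free_module K B)" "g \<in> carrier (free_module K B)"
      then have "finite ({p. f p \<noteq> \<zero>\<^bsub>K\<^esub>} \<union> {p. g p \<noteq> \<zero>\<^bsub>K\<^esub>})" 
        by (auto simp: free_module_simps)
      then have "finite {p. f p \<oplus>\<^bsub>K\<^esub> g p \<noteq> \<zero>\<^bsub>K\<^esub>}" 
        using add_supp[of f g] finite_subset by blast
      then show "f \<oplus>\<^bsub>free_module K B\<^esub> g \<in> carrier (free_module K B)"
        using fg add_supp[of f g] by (fastforce simp: free_module_simps)
    next
      fix f assume f: "f \<in> carrier (free_module K B)"
      have "{p. \<ominus>\<^bsub>K\<^esub> f p \<noteq> \<zero>\<^bsub>K\<^esub>} \<subseteq> {p. f p \<noteq> \<zero>\<^bsub>K\<^esub>}" by auto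
      then have "(\<lambda>p. \<ominus>\<^bsub>K\<^esub> f p) \<in> carrier (free_module K B)" using f 
        by (auto simp: free_module_simps intro: finite_subset)
      moreover have "(\<lambda>p. \<ominus>\<^bsub>K\<^esub> f p) \<oplus>\<^bsub>free_module K B\<^esub> f = \<zero>\<^bsub>free_module K B\<^esub>"
        using f by (auto simp: free_module_simps l_neg)
      ultimately show "\<exists>y \<in> carrier (free_module K B). y \<oplus>\<^bsub>free_module K B\<^esub> f = \<zero>\<^bsub>free_module K B\<^esub>" by blast
    qed (auto simp: free_module_simps a_ac)
  next
    fix c f assume c: "c \<in> carrier K" and f: "f \<in> carrier (free_module K B)"
    have "{p. c \<otimes>\<^bsub>K\<^esub> f p \<noteq> \<zero>\<^bsub>K\<^esub>} \<subseteq> {p. f p \<noteq> \<zero>\<^bsub>K\<^esub>}" using c by auto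
    then show "c \<odot>\<^bsub>free_module K B\<^esub> f \<in> carrier (free_module K B)" using c f
      by (auto simp: free_module_simps intro: finite_subset)
  qed (auto simp: free_module_simps l_distr r_distr m_assoc is_cring)
qed

lemma module_span_submodule:
  assumes "module K M" "B \<subseteq> carrier M"
  shows "submodule (module_span K M B) K M" "B \<subseteq> module_span K M B"
proof -
  interpret module K M by fact
  have c: "submodule (carrier M) K M" by (rule carrier_is_submodule)
  show "submodule (module_span K M B) K M"
  proof (rule submoduleI)
    show "module_span K M B \<subseteq> carrier M" using c assms(2) by (auto simp: module_span_def)
    show "\<zero>\<^bsub>M\<^esub> \<in> module_span K M B"
      unfolding module_span_def using submodule.axioms(1) subgroup.one_closed by fastforce
  qed (auto simp: module_span_def dest: submoduleE)
  show "B \<subseteq> module_span K M B" by (auto simp: module_span_def)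
qed

lemma free_gen_carrier:
  assumes "cring K" "p \<in> B" shows "free_gen K p \<in> carrier (free_module K B)"
proof -
  interpret cring K by fact
  have "{q. free_gen K p q \<noteq> \<zero>\<^bsub>K\<^esub>} \<subseteq> {p}" by (auto simp: free_gen_def)
  then show ?thesis using assms(2) 
    by (auto simp: free_module_simps free_gen_def intro: finite_subset)
qed

lemma tensor_relators_carrier:
  assumes "module K V" "module K W"
  shows "tensor_relators K V W \<subseteq> carrier (free_module K (carrier V \<times> carrier W))"
proof -
  interpret V: module K V by fact
  interpret W: module K W by fact
  interpret F: module K "free_module K (carrier V \<times> carrier W)"
    by (rule free_module_module) (rule V.is_cring)
  note g = free_gen_carrier[OF V.is_cring, of _ "carrier V \<times> carrier W"]
  show ?thesis unfolding tensor_relators_def Let_def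
    by (auto intro!: F.minus_closed F.a_closed F.smult_closed g)
qed

lemma tensor_null_submodule:
  assumes "module K V" "module K W"
  shows "submodule (tensor_null K V W) K (free_module K (carrier V \<times> carrier W))"
  using module_span_submodule(1)[OF free_module_module tensor_relators_carrier[OF assms]]
    module.axioms(1)[OF assms(1)] by (simp add: tensor_null_def)

lemma quot_module_simps:
  "carrier (quot_module M I) = a_rcosets\<^bsub>M\<^esub> I"
  "zero (quot_module M I) = I"
  "add (quot_module M I) = set_add M"
  "smult (quot_module M I) c X = (\<Union>x\<in>X. I +>\<^bsub>M\<^esub> (c \<odot>\<^bsub>M\<^esub> x))"
  by (simp_all add: quot_module_def ring.extend_def module.fields_def FactRing_def)

text \<open>The value of the linear map on the free module extending \<open>b\<close>.\<close>

lemma (in module) free_eval_linear: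
  fixes b :: "'i \<Rightarrow> 'j \<Rightarrow> 'c"
  assumes b: "\<And>x y. x \<in> S \<Longrightarrow> y \<in> T \<Longrightarrow> b x y \<in> carrier M"
  shows "k_linear R (free_module R (S \<times> T)) M
    (\<lambda>f. \<Oplus>\<^bsub>M\<^esub>p\<in>{p. f p \<noteq> \<zero>}. f p \<odot>\<^bsub>M\<^esub> b (fst p) (snd p))" (is "k_linear R ?F M ?e")
proof -
  let ?t = "\<lambda>f p. f p \<odot>\<^bsub>M\<^esub> b (fst p) (snd p)"
  have ext: "?e f = (\<Oplus>\<^bsub>M\<^esub>p\<in>U. ?t f p)"
    if "f \<in> carrier ?F" "finite U" "{p. f p \<noteq> \<zero>} \<subseteq> U" "U \<subseteq> S \<times> T" for f U
  proof (rule M.add.finprod_mono_neutral_cong_left)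
    show "finite U" "{p. f p \<noteq> \<zero>} \<subseteq> U" using that by auto
    show "?t f p = \<zero>\<^bsub>M\<^esub>" if "p \<in> U - {p. f p \<noteq> \<zero>}" for p
      using that \<open>U \<subseteq> S \<times> T\<close> b by auto
    show "?t f \<in> U \<rightarrow> carrier M" using that b by (auto simp: free_module_simps)
  qed auto
  have tc: "?t f \<in> U \<rightarrow> carrier M" if "f \<in> carrier ?F" "U \<subseteq> S \<times> T" for f U
    using that b by (auto simp: free_module_simps)
  interpret F: module R ?F by (rule free_module_module) (rule is_cring)
  show ?thesis unfolding k_linear_def
  proof (intro conjI ballI)
    show "?e \<in> carrier ?F \<rightarrow> carrier M"
    proof
      fix f assume f: "f \<in> carrier ?F"
      then have "{p. f p \<noteq> \<zero>} \<subseteq> S \<times> T" by (auto simp: free_module_simps)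
      from tc[OF f this] show "?e f \<in> carrier M" by (rule M.finsum_closed)
    qed
  next
    fix f g assume f: "f \<in> carrier ?F" and g: "g \<in> carrier ?F"
    let ?U = "{p. f p \<noteq> \<zero>} \<union> {p. g p \<noteq> \<zero>}"
    have U: "finite ?U" "?U \<subseteq> S \<times> T" using f g by (auto simp: free_module_simps)
    have fgU: "{p. (f \<oplus>\<^bsub>?F\<^esub> g) p \<noteq> \<zero>} \<subseteq> ?U" by (auto simp: free_module_simps)
    have "?e (f \<oplus>\<^bsub>?F\<^esub> g) = (\<Oplus>\<^bsub>M\<^esub>p\<in>?U. ?t (f \<oplus>\<^bsub>?F\<^esub> g) p)"
      by (rule ext[OF F.a_closed[OF f g] U(1) fgU U(2)])
    also have "\<dots> = (\<Oplus>\<^bsub>M\<^esub>p\<in>?U. ?t f p \<oplus>\<^bsub>M\<^esub> ?t g p)"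
    proof (rule M.finsum_cong')
      show "(\<lambda>p. ?t f p \<oplus>\<^bsub>M\<^esub> ?t g p) \<in> ?U \<rightarrow> carrier M" using tc[OF f U(2)] tc[OF g U(2)] by auto
      fix p assume "p \<in> ?U"
      then have "p \<in> S \<times> T" using U(2) by blast
      then show "?t (f \<oplus>\<^bsub>?F\<^esub> g) p = ?t f p \<oplus>\<^bsub>M\<^esub> ?t g p"
        using f g b by (auto simp: free_module_simps intro!: smult_l_distr)
    qed simp
    also have "\<dots> = (\<Oplus>\<^bsub>M\<^esub>p\<in>?U. ?t f p) \<oplus>\<^bsub>M\<^esub> (\<Oplus>\<^bsub>M\<^esub>p\<in>?U. ?t g p)"
      by (rule M.finsum_addf[OF tc[OF f U(2)] tc[OF g U(2)]])
    also have "\<dots> = ?e f \<oplus>\<^bsub>M\<^esub> ?e g"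
      using ext[OF f U(1) _ U(2)] ext[OF g U(1) _ U(2)] by simp
    finally show "?e (f \<oplus>\<^bsub>?F\<^esub> g) = ?e f \<oplus>\<^bsub>M\<^esub> ?e g" .
  next
    fix c f assume c: "c \<in> carrier R" and f: "f \<in> carrier ?F"
    let ?U = "{p. f p \<noteq> \<zero>}"
    have U: "finite ?U" "?U \<subseteq> S \<times> T" using f by (auto simp: free_module_simps)
    have cU: "{p. (c \<odot>\<^bsub>?F\<^esub> f) p \<noteq> \<zero>} \<subseteq> ?U" using c by (auto simp: free_module_simps)
    have "?e (c \<odot>\<^bsub>?F\<^esub> f) = (\<Oplus>\<^bsub>M\<^esub>p\<in>?U. ?t (c \<odot>\<^bsub>?F\<^esub> f) p)"
      by (rule ext[OF F.smult_closed[OF c f] U(1) cU U(2)])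
    also have "\<dots> = (\<Oplus>\<^bsub>M\<^esub>p\<in>?U. c \<odot>\<^bsub>M\<^esub> ?t f p)"
    proof (rule M.finsum_cong')
      show "(\<lambda>p. c \<odot>\<^bsub>M\<^esub> ?t f p) \<in> ?U \<rightarrow> carrier M" using tc[OF f U(2)] c by auto
      fix p assume "p \<in> ?U"
      then have "p \<in> S \<times> T" using U(2) by blast
      then show "?t (c \<odot>\<^bsub>?F\<^esub> f) p = c \<odot>\<^bsub>M\<^esub> ?t f p"
        using f c b by (auto simp: free_module_simps intro!: smult_assoc1)
    qed simp
    also have "\<dots> = c \<odot>\<^bsub>M\<^esub> (\<Oplus>\<^bsub>M\<^esub>p\<in>?U. ?t f p)"
      by (rule finsum_smult_ldistr[OF U(1) c, symmetric]) (use tc[OF f U(2)] in auto)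
    finally show "?e (c \<odot>\<^bsub>?F\<^esub> f) = c \<odot>\<^bsub>M\<^esub> ?e f" .
  qed
qed


lemma submodule_abelian_subgroup:
  assumes "module K M" "submodule N K M" shows "abelian_subgroup N M"
  using assms
  by (intro abelian_subgroupI3 additive_subgroup.intro)
     (auto intro: submodule.axioms module.axioms)

lemma quot_module_smult:
  assumes "module K M" "submodule N K M" "c \<in> carrier K" "x \<in> carrier M"
  shows "c \<odot>\<^bsub>quot_module M N\<^esub> (N +>\<^bsub>M\<^esub> x) = N +>\<^bsub>M\<^esub> (c \<odot>\<^bsub>M\<^esub> x)"
proof -
  interpret M: module K M by fact
  interpret N: abelian_subgroup N M by (rule submodule_abelian_subgroup) fact+
  have eq: "N +>\<^bsub>M\<^esub> (c \<odot>\<^bsub>M\<^esub> y) = N +>\<^bsub>M\<^esub> (c \<odot>\<^bsub>M\<^esub> x)" if "y \<in> N +>\<^bsub>M\<^esub> x" for y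
  proof -
    from that obtain n where n: "n \<in> N" "y = n \<oplus>\<^bsub>M\<^esub> x" by (auto simp: a_r_coset_def')
    have "c \<odot>\<^bsub>M\<^esub> n \<in> N" using submodule.smult_closed[OF assms(2,3) n(1)] .
    then have "c \<odot>\<^bsub>M\<^esub> y \<in> N +>\<^bsub>M\<^esub> (c \<odot>\<^bsub>M\<^esub> x)"
      using n assms(3,4) N.a_Hcarr by (auto simp: a_r_coset_def' M.smult_r_distr)
    then show ?thesis using N.a_repr_independence'[of _ "c \<odot>\<^bsub>M\<^esub> x"] assms(3,4) by auto
  qed
  have "x \<in> N +>\<^bsub>M\<^esub> x" using N.a_rcos_self[OF assms(4)] .
  then have "(\<Union>y \<in> N +>\<^bsub>M\<^esub> x. N +>\<^bsub>M\<^esub> (c \<odot>\<^bsub>M\<^esub> y)) = (\<Union>y \<in> N +>\<^bsub>M\<^esub> x. N +>\<^bsub>M\<^esub> (c \<odot>\<^bsub>M\<^esub> x))"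
    by (intro SUP_cong refl eq)
  also have "\<dots> = N +>\<^bsub>M\<^esub> (c \<odot>\<^bsub>M\<^esub> x)" using \<open>x \<in> N +>\<^bsub>M\<^esub> x\<close> by blast
  finally show ?thesis by (simp only: quot_module_simps)
qed

lemma quot_module_module:
  assumes "module K M" "submodule N K M" shows "module K (quot_module M N)"
proof -
  interpret M: module K M by fact
  interpret N: abelian_subgroup N M by (rule submodule_abelian_subgroup) fact+
  have rep: "\<exists>x \<in> carrier M. X = N +>\<^bsub>M\<^esub> x" if "X \<in> carrier (quot_module M N)" for X
    using that by (auto simp: quot_module_simps A_RCOSETS_def')
  have cl: "N +>\<^bsub>M\<^esub> x \<in> carrier (quot_module M N)" if "x \<in> carrier M" for x
    using that by (auto simp: quot_module_simps A_RCOSETS_def')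
  have ad: "(N +>\<^bsub>M\<^esub> x) \<oplus>\<^bsub>quot_module M N\<^esub> (N +>\<^bsub>M\<^esub> y) = N +>\<^bsub>M\<^esub> (x \<oplus>\<^bsub>M\<^esub> y)"
    if "x \<in> carrier M" "y \<in> carrier M" for x y
    using N.a_rcos_sum[OF that] by (simp add: quot_module_simps)
  note sm = quot_module_smult[OF assms]
  have zero: "\<zero>\<^bsub>quot_module M N\<^esub> = N +>\<^bsub>M\<^esub> \<zero>\<^bsub>M\<^esub>"
    using N.a_subset by (simp add: quot_module_simps)
  have zero_cl: "N +>\<^bsub>M\<^esub> \<zero>\<^bsub>M\<^esub> \<in> carrier (quot_module M N)" by (rule cl) simp
  show ?thesis
  proof (rule moduleI)
    show "abelian_group (quot_module M N)"
    proof (rule abelian_groupI)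
      fix X assume "X \<in> carrier (quot_module M N)"
      with rep obtain x where x: "x \<in> carrier M" "X = N +>\<^bsub>M\<^esub> x" by blast
      show "\<exists>Y \<in> carrier (quot_module M N). Y \<oplus>\<^bsub>quot_module M N\<^esub> X = \<zero>\<^bsub>quot_module M N\<^esub>"
        using x by (intro bexI[of _ "N +>\<^bsub>M\<^esub> (\<ominus>\<^bsub>M\<^esub> x)"]) (auto simp: ad cl zero M.l_neg)
    qed (auto dest!: rep simp: ad cl zero M.a_ac zero_cl)
  next
    fix c X assume "c \<in> carrier K" "X \<in> carrier (quot_module M N)"
    with rep[of X] show "c \<odot>\<^bsub>quot_module M N\<^esub> X \<in> carrier (quot_module M N)" by (auto simp: sm cl)
  next
    fix c d X assume "c \<in> carrier K" "d \<in> carrier K" "X \<in> carrier (quot_module M N)"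
    with rep[of X] show "(c \<oplus>\<^bsub>K\<^esub> d) \<odot>\<^bsub>quot_module M N\<^esub> X =
        c \<odot>\<^bsub>quot_module M N\<^esub> X \<oplus>\<^bsub>quot_module M N\<^esub> d \<odot>\<^bsub>quot_module M N\<^esub> X"
      by (auto simp: sm ad M.smult_l_distr)
  next
    fix c X Y assume "c \<in> carrier K" "X \<in> carrier (quot_module M N)" "Y \<in> carrier (quot_module M N)"
    with rep[of X] rep[of Y] show "c \<odot>\<^bsub>quot_module M N\<^esub> (X \<oplus>\<^bsub>quot_module M N\<^esub> Y) =
        c \<odot>\<^bsub>quot_module M N\<^esub> X \<oplus>\<^bsub>quot_module M N\<^esub> c \<odot>\<^bsub>quot_module M N\<^esub> Y"
      by (auto simp: sm ad M.smult_r_distr)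
  next
    fix c d X assume "c \<in> carrier K" "d \<in> carrier K" "X \<in> carrier (quot_module M N)"
    with rep[of X] show "(c \<otimes>\<^bsub>K\<^esub> d) \<odot>\<^bsub>quot_module M N\<^esub> X =
        c \<odot>\<^bsub>quot_module M N\<^esub> (d \<odot>\<^bsub>quot_module M N\<^esub> X)"
      by (auto simp: sm M.smult_assoc1)
  next
    fix X assume "X \<in> carrier (quot_module M N)"
    with rep[of X] show "\<one>\<^bsub>K\<^esub> \<odot>\<^bsub>quot_module M N\<^esub> X = X" by (auto simp: sm)
  qed (rule M.is_cring)
qed

lemma tensor_module:
  assumes "module K V" "module K W" shows "module K (tensor K V W)"
  unfolding tensor_def
  using quot_module_module[OF free_module_module tensor_null_submodule[OF assms]]
    module.axioms(1)[OF assms(1)] by blast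

lemma tlift_coset:
  assumes V: "module K V" and W: "module K W" and X: "module K X"
    and b: "k_bilinear K V W X b"
    and f: "f \<in> carrier (free_module K (carrier V \<times> carrier W))"
  shows "tlift K X b (tensor_null K V W +>\<^bsub>free_module K (carrier V \<times> carrier W)\<^esub> f)
    = (\<Oplus>\<^bsub>X\<^esub>p\<in>{p. f p \<noteq> \<zero>\<^bsub>K\<^esub>}. f p \<odot>\<^bsub>X\<^esub> b (fst p) (snd p))"
proof -
  let ?F = "free_module K (carrier V \<times> carrier W)"
  let ?e = "\<lambda>f. \<Oplus>\<^bsub>X\<^esub>p\<in>{p. f p \<noteq> \<zero>\<^bsub>K\<^esub>}. f p \<odot>\<^bsub>X\<^esub> b (fst p) (snd p)"
  interpret V: module K V by fact
  interpret W: module K W by fact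
  interpret X: module K X by fact
  interpret F: module K ?F by (rule free_module_module) (rule V.is_cring)
  interpret N: abelian_subgroup "tensor_null K V W" ?F
    by (rule submodule_abelian_subgroup[OF F.module_axioms tensor_null_submodule[OF V W]])
  have bc: "b x y \<in> carrier X" if "x \<in> carrier V" "y \<in> carrier W" for x y
    using b that by (auto simp: k_bilinear_def k_linear_def)
  have lin: "k_linear K ?F X ?e" by (rule X.free_eval_linear) (rule bc)
  have ec: "?e g \<in> carrier X" if "g \<in> carrier ?F" for g
    using lin that unfolding k_linear_def by blast
  have ea: "?e (g \<oplus>\<^bsub>?F\<^esub> h) = ?e g \<oplus>\<^bsub>X\<^esub> ?e h" if "g \<in> carrier ?F" "h \<in> carrier ?F" for g h
    using lin that unfolding k_linear_def by blast
  have es: "?e (c \<odot>\<^bsub>?F\<^esub> g) = c \<odot>\<^bsub>X\<^esub> ?e g" if "c \<in> carrier K" "g \<in> carrier ?F" for c g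
    using lin that unfolding k_linear_def by blast
  have e0: "?e \<zero>\<^bsub>?F\<^esub> = \<zero>\<^bsub>X\<^esub>" by (simp add: free_module_simps)
  have en: "?e (\<ominus>\<^bsub>?F\<^esub> g) = \<ominus>\<^bsub>X\<^esub> ?e g" if g: "g \<in> carrier ?F" for g
  proof -
    have "?e (\<ominus>\<^bsub>?F\<^esub> g) \<oplus>\<^bsub>X\<^esub> ?e g = \<zero>\<^bsub>X\<^esub>"
      unfolding ea[OF F.a_inv_closed[OF g] g, symmetric] F.l_neg[OF g] by (rule e0)
    then show ?thesis using X.minus_equality[OF _ ec[OF g] ec[OF F.a_inv_closed[OF g]]] by simp
  qed
  have em: "?e (g \<ominus>\<^bsub>?F\<^esub> h) = ?e g \<ominus>\<^bsub>X\<^esub> ?e h" if "g \<in> carrier ?F" "h \<in> carrier ?F" for g h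
    unfolding a_minus_def ea[OF that(1) F.a_inv_closed[OF that(2)]] en[OF that(2)] ..
  have eg: "?e (free_gen K p) = b (fst p) (snd p)" if p: "p \<in> carrier V \<times> carrier W" for p
  proof (cases "\<one>\<^bsub>K\<^esub> = \<zero>\<^bsub>K\<^esub>")
    case True
    have triv: "x = \<zero>\<^bsub>X\<^esub>" if "x \<in> carrier X" for x
      using X.smult_one[OF that] X.smult_l_null[OF that] True by metis
    have "b (fst p) (snd p) \<in> carrier X" using bc p by auto
    then show ?thesis using triv[OF ec[OF free_gen_carrier[OF V.is_cring p]]] triv by metis
  next
    case False
    then have "{q. free_gen K p q \<noteq> \<zero>\<^bsub>K\<^esub>} = {p}" by (auto simp: free_gen_def)
    then show ?thesis using bc p
      by (auto simp: free_gen_def X.finsum_insert)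
  qed
  note g = free_gen_carrier[OF V.is_cring, of _ "carrier V \<times> carrier W"]
  have ker: "submodule {h \<in> carrier ?F. ?e h = \<zero>\<^bsub>X\<^esub>} K ?F"
    by (rule F.submoduleI) (auto simp: ea es e0 en)
  have bl: "b (v \<oplus>\<^bsub>V\<^esub> v') w = b v w \<oplus>\<^bsub>X\<^esub> b v' w" if "v \<in> carrier V" "v' \<in> carrier V" "w \<in> carrier W" for v v' w
    using b that by (auto simp: k_bilinear_def k_linear_def)
  have br: "b v (w \<oplus>\<^bsub>W\<^esub> w') = b v w \<oplus>\<^bsub>X\<^esub> b v w'" if "v \<in> carrier V" "w' \<in> carrier W" "w \<in> carrier W" for v w' w
    using b that by (auto simp: k_bilinear_def k_linear_def)
  have bs: "b (c \<odot>\<^bsub>V\<^esub> v) w = c \<odot>\<^bsub>X\<^esub> b v w" "b v (c \<odot>\<^bsub>W\<^esub> w) = c \<odot>\<^bsub>X\<^esub> b v w" if "c \<in> carrier K" "v \<in> carrier V" "w \<in> carrier W" for v c w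
    using b that by (auto simp: k_bilinear_def k_linear_def)
  have mm: "x \<ominus>\<^bsub>X\<^esub> x = \<zero>\<^bsub>X\<^esub>" if "x \<in> carrier X" for x
    using that by (simp add: a_minus_def X.r_neg)
  have "tensor_relators K V W \<subseteq> {h. ?e h = \<zero>\<^bsub>X\<^esub>}"
    unfolding tensor_relators_def Let_def
    apply (intro Un_least subsetI; clarify)
    by (simp_all add: em ea es eg g bl br bs bc mm F.smult_closed)
  then have "tensor_relators K V W \<subseteq> {h \<in> carrier ?F. ?e h = \<zero>\<^bsub>X\<^esub>}"
    using tensor_relators_carrier[OF V W] by auto
  then have null: "tensor_null K V W \<subseteq> {h \<in> carrier ?F. ?e h = \<zero>\<^bsub>X\<^esub>}"
    using ker unfolding tensor_null_def module_span_def by blast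
  let ?g = "SOME g. g \<in> tensor_null K V W +>\<^bsub>?F\<^esub> f"
  have "?g \<in> tensor_null K V W +>\<^bsub>?F\<^esub> f" using N.a_rcos_self[OF f] by (rule someI[of "\<lambda>g. g \<in> tensor_null K V W +>\<^bsub>?F\<^esub> f"])
  then obtain n where n: "n \<in> tensor_null K V W" "?g = n \<oplus>\<^bsub>?F\<^esub> f"
    by (auto simp: a_r_coset_def')
  then have "n \<in> carrier ?F" "?e n = \<zero>\<^bsub>X\<^esub>" using null by auto
  then have "?e ?g = ?e f" unfolding n(2) using ea[OF _ f] ec[OF f] by simp
  then show ?thesis by (simp add: tlift_def)
qed

lemma tensor_rep:
  assumes "T \<in> carrier (tensor K V W)"
  obtains f where "f \<in> carrier (free_module K (carrier V \<times> carrier W))"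
    "T = tensor_null K V W +>\<^bsub>free_module K (carrier V \<times> carrier W)\<^esub> f"
  using assms unfolding tensor_def by (auto simp: quot_module_simps A_RCOSETS_def')

lemma tlift_pure:
  assumes V: "module K V" and W: "module K W" and X: "module K X"
    and b: "k_bilinear K V W X b" and vw: "v \<in> carrier V" "w \<in> carrier W"
  shows "tlift K X b (pure K V W v w) = b v w"
proof -
  interpret V: module K V by fact
  interpret X: module K X by fact
  have bc: "b v w \<in> carrier X"
    using b vw by (auto simp: k_bilinear_def k_linear_def)
  have g: "free_gen K (v, w) \<in> carrier (free_module K (carrier V \<times> carrier W))"
    using vw by (intro free_gen_carrier V.is_cring) auto
  have eq: "tlift K X b (pure K V W v w) =
      (\<Oplus>\<^bsub>X\<^esub>p\<in>{p. free_gen K (v, w) p \<noteq> \<zero>\<^bsub>K\<^esub>}. free_gen K (v, w) p \<odot>\<^bsub>X\<^esub> b (fst p) (snd p))"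
    unfolding pure_def by (rule tlift_coset[OF V W X b g])
  show ?thesis
  proof (cases "\<one>\<^bsub>K\<^esub> = \<zero>\<^bsub>K\<^esub>")
    case True
    have "b v w = \<zero>\<^bsub>X\<^esub>"
      using X.smult_one[OF bc] X.smult_l_null[OF bc] True by metis
    moreover have "{p. free_gen K (v, w) p \<noteq> \<zero>\<^bsub>K\<^esub>} = {}" using True by (auto simp: free_gen_def)
    ultimately show ?thesis unfolding eq by (simp only: X.finsum_empty)
  next
    case False
    then have "{q. free_gen K (v, w) q \<noteq> \<zero>\<^bsub>K\<^esub>} = {(v, w)}" by (auto simp: free_gen_def)
    with eq show ?thesis using bc by (simp add: free_gen_def X.finsum_insert)
  qed
qed

lemma tlift_linear:
  assumes V: "module K V" and W: "module K W" and X: "module K X" and b: "k_bilinear K V W X b"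
  shows "k_linear K (tensor K V W) X (tlift K X b)"
proof -
  let ?F = "free_module K (carrier V \<times> carrier W)" and ?N = "tensor_null K V W"
  interpret V: module K V by fact
  interpret X: module K X by fact
  interpret F: module K ?F by (rule free_module_module) (rule V.is_cring)
  note N = tensor_null_submodule[OF V W]
  interpret N: abelian_subgroup ?N ?F by (rule submodule_abelian_subgroup[OF F.module_axioms N])
  have bc: "b x y \<in> carrier X" if "x \<in> carrier V" "y \<in> carrier W" for x y
    using b that by (auto simp: k_bilinear_def k_linear_def)
  let ?e = "\<lambda>f. \<Oplus>\<^bsub>X\<^esub>p\<in>{p. f p \<noteq> \<zero>\<^bsub>K\<^esub>}. f p \<odot>\<^bsub>X\<^esub> b (fst p) (snd p)"
  have lin: "k_linear K ?F X ?e" by (rule X.free_eval_linear) (rule bc)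
  note t = tlift_coset[OF V W X b]
  show ?thesis unfolding k_linear_def
  proof (intro conjI ballI)
    show "tlift K X b \<in> carrier (tensor K V W) \<rightarrow> carrier X"
      using lin by (auto simp: k_linear_def t elim!: tensor_rep)
  next
    fix S T assume "S \<in> carrier (tensor K V W)" "T \<in> carrier (tensor K V W)"
    then obtain f g where fg: "f \<in> carrier ?F" "S = ?N +>\<^bsub>?F\<^esub> f" "g \<in> carrier ?F" "T = ?N +>\<^bsub>?F\<^esub> g"
      by (elim tensor_rep)
    have "S \<oplus>\<^bsub>tensor K V W\<^esub> T = ?N +>\<^bsub>?F\<^esub> (f \<oplus>\<^bsub>?F\<^esub> g)"
      using N.a_rcos_sum fg by (simp add: tensor_def quot_module_simps)
    then show "tlift K X b (S \<oplus>\<^bsub>tensor K V W\<^esub> T) = tlift K X b S \<oplus>\<^bsub>X\<^esub> tlift K X b T"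
      using lin fg t[OF F.a_closed[OF fg(1,3)]] t[OF fg(1)] t[OF fg(3)] by (simp add: k_linear_def)
  next
    fix c T assume c: "c \<in> carrier K" and "T \<in> carrier (tensor K V W)"
    then obtain f where f: "f \<in> carrier ?F" "T = ?N +>\<^bsub>?F\<^esub> f" by (elim tensor_rep)
    have "c \<odot>\<^bsub>tensor K V W\<^esub> T = ?N +>\<^bsub>?F\<^esub> (c \<odot>\<^bsub>?F\<^esub> f)"
      using quot_module_smult[OF F.module_axioms N c f(1)] f by (simp add: tensor_def)
    then show "tlift K X b (c \<odot>\<^bsub>tensor K V W\<^esub> T) = c \<odot>\<^bsub>X\<^esub> tlift K X b T"
      using lin f c t[OF F.smult_closed[OF c f(1)]] t[OF f(1)] by (simp add: k_linear_def)
  qed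
qed

lemma pure_bilinear:
  assumes V: "module K V" and W: "module K W"
  shows "k_bilinear K V W (tensor K V W) (pure K V W)"
proof -
  let ?F = "free_module K (carrier V \<times> carrier W)" and ?N = "tensor_null K V W"
  let ?T = "tensor K V W"
  interpret V: module K V by fact
  interpret W: module K W by fact
  interpret F: module K ?F by (rule free_module_module) (rule V.is_cring)
  note N = tensor_null_submodule[OF V W]
  interpret N: abelian_subgroup ?N ?F by (rule submodule_abelian_subgroup[OF F.module_axioms N])
  note g = free_gen_carrier[OF V.is_cring, of _ "carrier V \<times> carrier W"]
  have rel: "tensor_relators K V W \<subseteq> ?N"
    unfolding tensor_null_def
    by (rule module_span_submodule(2)[OF F.module_axioms tensor_relators_carrier[OF V W]])
  have eqI: "?N +>\<^bsub>?F\<^esub> f = ?N +>\<^bsub>?F\<^esub> h"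
    if "f \<ominus>\<^bsub>?F\<^esub> h \<in> tensor_relators K V W" "f \<in> carrier ?F" "h \<in> carrier ?F" for f h
  proof -
    have "f = (f \<ominus>\<^bsub>?F\<^esub> h) \<oplus>\<^bsub>?F\<^esub> h"
      using that by (simp add: a_minus_def F.a_assoc F.l_neg)
    then have "f \<in> ?N +>\<^bsub>?F\<^esub> h" using that(1) rel by (auto simp: a_r_coset_def')
    then show ?thesis using N.a_repr_independence'[OF _ that(3)] by simp
  qed
  have ad: "?N +>\<^bsub>?F\<^esub> (f \<oplus>\<^bsub>?F\<^esub> h) = (?N +>\<^bsub>?F\<^esub> f) \<oplus>\<^bsub>?T\<^esub> (?N +>\<^bsub>?F\<^esub> h)"
    if "f \<in> carrier ?F" "h \<in> carrier ?F" for f h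
    using N.a_rcos_sum[OF that] by (simp add: tensor_def quot_module_simps)
  have sm: "?N +>\<^bsub>?F\<^esub> (c \<odot>\<^bsub>?F\<^esub> f) = c \<odot>\<^bsub>?T\<^esub> (?N +>\<^bsub>?F\<^esub> f)"
    if "c \<in> carrier K" "f \<in> carrier ?F" for c f
    using quot_module_smult[OF F.module_axioms N that] by (simp add: tensor_def)
  have cl: "pure K V W v w \<in> carrier ?T" if "v \<in> carrier V" "w \<in> carrier W" for v w
    using g[of "(v, w)"] that by (auto simp: tensor_def quot_module_simps A_RCOSETS_def' pure_def)
  have 1: "pure K V W (v \<oplus>\<^bsub>V\<^esub> v') w = pure K V W v w \<oplus>\<^bsub>?T\<^esub> pure K V W v' w"
    if vw: "v \<in> carrier V" "v' \<in> carrier V" "w \<in> carrier W" for v v' w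
  proof -
    have "free_gen K (v \<oplus>\<^bsub>V\<^esub> v', w) \<ominus>\<^bsub>?F\<^esub> (free_gen K (v, w) \<oplus>\<^bsub>?F\<^esub> free_gen K (v', w)) \<in> tensor_relators K V W"
      unfolding tensor_relators_def Let_def using vw by blast
    from eqI[OF this] show ?thesis
      using vw g[of "(v \<oplus>\<^bsub>V\<^esub> v', w)"] g[of "(v, w)"] g[of "(v', w)"] by (simp add: pure_def ad)
  qed
  have 2: "pure K V W v (w \<oplus>\<^bsub>W\<^esub> w') = pure K V W v w \<oplus>\<^bsub>?T\<^esub> pure K V W v w'"
    if vw: "v \<in> carrier V" "w \<in> carrier W" "w' \<in> carrier W" for v w w'
  proof -
    have "free_gen K (v, w \<oplus>\<^bsub>W\<^esub> w') \<ominus>\<^bsub>?F\<^esub> (free_gen K (v, w) \<oplus>\<^bsub>?F\<^esub> free_gen K (v, w')) \<in> tensor_relators K V W"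
      unfolding tensor_relators_def Let_def using vw by blast
    from eqI[OF this] show ?thesis
      using vw g[of "(v, w \<oplus>\<^bsub>W\<^esub> w')"] g[of "(v, w)"] g[of "(v, w')"] by (simp add: pure_def ad)
  qed
  have 3: "pure K V W (c \<odot>\<^bsub>V\<^esub> v) w = c \<odot>\<^bsub>?T\<^esub> pure K V W v w"
    if vw: "c \<in> carrier K" "v \<in> carrier V" "w \<in> carrier W" for c v w
  proof -
    have "free_gen K (c \<odot>\<^bsub>V\<^esub> v, w) \<ominus>\<^bsub>?F\<^esub> (c \<odot>\<^bsub>?F\<^esub> free_gen K (v, w)) \<in> tensor_relators K V W"
      unfolding tensor_relators_def Let_def using vw by blast
    from eqI[OF this] show ?thesis
      using vw g[of "(c \<odot>\<^bsub>V\<^esub> v, w)"] g[of "(v, w)"] by (simp add: pure_def sm)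
  qed
  have 4: "pure K V W v (c \<odot>\<^bsub>W\<^esub> w) = c \<odot>\<^bsub>?T\<^esub> pure K V W v w"
    if vw: "c \<in> carrier K" "v \<in> carrier V" "w \<in> carrier W" for c v w
  proof -
    have "free_gen K (v, c \<odot>\<^bsub>W\<^esub> w) \<ominus>\<^bsub>?F\<^esub> (c \<odot>\<^bsub>?F\<^esub> free_gen K (v, w)) \<in> tensor_relators K V W"
      unfolding tensor_relators_def Let_def using vw by blast
    from eqI[OF this] show ?thesis
      using vw g[of "(v, c \<odot>\<^bsub>W\<^esub> w)"] g[of "(v, w)"] by (simp add: pure_def sm)
  qed
  show ?thesis unfolding k_bilinear_def k_linear_def using cl 1 2 3 4 by auto
qed

subsection \<open>Tensor products of algebras\<close>

text \<open>Componentwise product on the tensor product of two algebras.\<close>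

definition tensor_mult ::
    "('k, 'l) ring_scheme \<Rightarrow> ('k, 'a, 'm) module_scheme \<Rightarrow> ('k, 'b, 'n) module_scheme \<Rightarrow>
     ('a \<times> 'b \<Rightarrow> 'k) set \<Rightarrow> ('a \<times> 'b \<Rightarrow> 'k) set \<Rightarrow> ('a \<times> 'b \<Rightarrow> 'k) set"
  where "tensor_mult K A B S T =
    tlift K (tensor K A B) (\<lambda>a b.
      tlift K (tensor K A B) (\<lambda>a' b'. pure K A B (a \<otimes>\<^bsub>A\<^esub> a') (b \<otimes>\<^bsub>B\<^esub> b')) T) S"

section \<open>Bialgebras and Hopf algebras\<close>

record ('k, 'c) bialg = "('k, 'c) module" +
  comult :: "'c \<Rightarrow> ('c \<times> 'c \<Rightarrow> 'k) set"
  counit :: "'c \<Rightarrow> 'k"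

locale k_algebra = K?: field K + module K A + A?: ring A for K (structure) and A (structure) +
  assumes smult_mult_left:
      "\<lbrakk>c \<in> carrier K; x \<in> carrier A; y \<in> carrier A\<rbrakk> \<Longrightarrow> (c \<odot>\<^bsub>A\<^esub> x) \<otimes>\<^bsub>A\<^esub> y = c \<odot>\<^bsub>A\<^esub> (x \<otimes>\<^bsub>A\<^esub> y)"
    and smult_mult_right:
      "\<lbrakk>c \<in> carrier K; x \<in> carrier A; y \<in> carrier A\<rbrakk> \<Longrightarrow> x \<otimes>\<^bsub>A\<^esub> (c \<odot>\<^bsub>A\<^esub> y) = c \<odot>\<^bsub>A\<^esub> (x \<otimes>\<^bsub>A\<^esub> y)"

locale k_coalgebra = K?: field K + module K C for K (structure) and C (structure) +
  assumes comult_linear: "k_linear K C (tensor K C C) (comult C)"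
    and counit_linear: "k_linear K C (scalars K) (counit C)"
    and coassoc: "x \<in> carrier C \<Longrightarrow>
      tlift K (tensor K C (tensor K C C))
        (\<lambda>y z. tlift K (tensor K C (tensor K C C))
          (\<lambda>u v. pure K C (tensor K C C) u (pure K C C v z)) (comult C y)) (comult C x)
      = tlift K (tensor K C (tensor K C C))
        (\<lambda>y z. pure K C (tensor K C C) y (comult C z)) (comult C x)"
    and counit_left: "x \<in> carrier C \<Longrightarrow> tlift K C (\<lambda>y z. counit C y \<odot>\<^bsub>C\<^esub> z) (comult C x) = x"
    and counit_right: "x \<in> carrier C \<Longrightarrow> tlift K C (\<lambda>y z. counit C z \<odot>\<^bsub>C\<^esub> y) (comult C x) = x"

locale bialgebra = k_algebra K A + k_coalgebra K A for K (structure) and A (structure) +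
  assumes comult_mult: "\<lbrakk>x \<in> carrier A; y \<in> carrier A\<rbrakk> \<Longrightarrow>
      comult A (x \<otimes>\<^bsub>A\<^esub> y) = tensor_mult K A A (comult A x) (comult A y)"
    and comult_one: "comult A \<one>\<^bsub>A\<^esub> = pure K A A \<one>\<^bsub>A\<^esub> \<one>\<^bsub>A\<^esub>"
    and counit_mult: "\<lbrakk>x \<in> carrier A; y \<in> carrier A\<rbrakk> \<Longrightarrow>
      counit A (x \<otimes>\<^bsub>A\<^esub> y) = counit A x \<otimes>\<^bsub>K\<^esub> counit A y"
    and counit_one: "counit A \<one>\<^bsub>A\<^esub> = \<one>\<^bsub>K\<^esub>"

locale hopf_algebra = bialgebra K H for K (structure) and H (structure) and S +
  assumes antipode_linear: "k_linear K H H S"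
    and antipode_left: "x \<in> carrier H \<Longrightarrow>
      tlift K H (\<lambda>y z. S y \<otimes>\<^bsub>H\<^esub> z) (comult H x) = counit H x \<odot>\<^bsub>H\<^esub> \<one>\<^bsub>H\<^esub>"
    and antipode_right: "x \<in> carrier H \<Longrightarrow>
      tlift K H (\<lambda>y z. y \<otimes>\<^bsub>H\<^esub> S z) (comult H x) = counit H x \<odot>\<^bsub>H\<^esub> \<one>\<^bsub>H\<^esub>"

definition bialgebra_iso ::
    "('k, 'l) ring_scheme \<Rightarrow> ('k, 'a, 'm) bialg_scheme \<Rightarrow> ('k, 'b, 'n) bialg_scheme \<Rightarrow> ('a \<Rightarrow> 'b) \<Rightarrow> bool"
  where "bialgebra_iso K A B f \<longleftrightarrow> bialgebra K A \<and> bialgebra K B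
    \<and> k_linear K A B f \<and> f \<in> ring_hom A B
    \<and> (\<forall>x \<in> carrier A. comult B (f x) =
          tlift K (tensor K B B) (\<lambda>y z. pure K B B (f y) (f z)) (comult A x))
    \<and> (\<forall>x \<in> carrier A. counit B (f x) = counit A x)
    \<and> bij_betw f (carrier A) (carrier B)"

text \<open>\<open>comult3 K H X f h = \<Sum> f h\<^sub>1 h\<^sub>2 h\<^sub>3\<close> for \<open>f\<close> trilinear with values in \<open>X\<close>.\<close>

definition comult3 ::
    "('k, 'l) ring_scheme \<Rightarrow> ('k, 'h, 'm) bialg_scheme \<Rightarrow> ('k, 'x, 'n) module_scheme \<Rightarrow>
     ('h \<Rightarrow> 'h \<Rightarrow> 'h \<Rightarrow> 'x) \<Rightarrow> 'h \<Rightarrow> 'x"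
  where "comult3 K H X f h =
    tlift K X (\<lambda>x h3. tlift K X (\<lambda>h1 h2. f h1 h2 h3) (comult H x)) (comult H h)"

definition ad_coinvariant_integral ::
    "('k, 'l) ring_scheme \<Rightarrow> ('k, 'h, 'm) bialg_scheme \<Rightarrow> ('h \<Rightarrow> 'h) \<Rightarrow> 'h \<Rightarrow> bool"
  where "ad_coinvariant_integral K H S t \<longleftrightarrow> t \<in> carrier H
    \<and> (\<forall>h \<in> carrier H. h \<otimes>\<^bsub>H\<^esub> t = counit H h \<odot>\<^bsub>H\<^esub> t)
    \<and> counit H t = \<one>\<^bsub>K\<^esub>
    \<and> comult3 K H (tensor K H H) (\<lambda>t1 t2 t3. pure K H H (t1 \<otimes>\<^bsub>H\<^esub> S t3) t2) t
        = pure K H H \<one>\<^bsub>H\<^esub> t"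

section \<open>Jacobson radical, coideals, quotients of a bialgebra\<close>

definition left_ideal :: "'a set \<Rightarrow> ('a, 'm) ring_scheme \<Rightarrow> bool"
  where "left_ideal I A \<longleftrightarrow> additive_subgroup I A \<and> (\<forall>a \<in> carrier A. \<forall>x \<in> I. a \<otimes>\<^bsub>A\<^esub> x \<in> I)"

definition maximal_left_ideal :: "'a set \<Rightarrow> ('a, 'm) ring_scheme \<Rightarrow> bool"
  where "maximal_left_ideal I A \<longleftrightarrow> left_ideal I A \<and> I \<noteq> carrier A
    \<and> (\<forall>L. left_ideal L A \<and> I \<subseteq> L \<longrightarrow> L = I \<or> L = carrier A)"

definition jacobson_radical :: "('a, 'm) ring_scheme \<Rightarrow> 'a set"
  where "jacobson_radical A = carrier A \<inter> \<Inter>{I. maximal_left_ideal I A}"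

primrec ideal_power :: "('a, 'm) ring_scheme \<Rightarrow> 'a set \<Rightarrow> nat \<Rightarrow> 'a set"
  where
    "ideal_power A J 0 = carrier A"
  | "ideal_power A J (Suc n) = ideal_prod A J (ideal_power A J n)"

text \<open>\<open>tensor_image K V W P Q\<close> is the image of \<open>P \<otimes> Q\<close> in \<open>V \<otimes> W\<close>, for subspaces \<open>P\<close>, \<open>Q\<close>.\<close>

definition tensor_image ::
    "('k, 'l) ring_scheme \<Rightarrow> ('k, 'v, 'm) module_scheme \<Rightarrow> ('k, 'w, 'n) module_scheme \<Rightarrow>
     'v set \<Rightarrow> 'w set \<Rightarrow> ('v \<times> 'w \<Rightarrow> 'k) set set"
  where "tensor_image K V W P Q =
    module_span K (tensor K V W) {pure K V W v w | v w. v \<in> P \<and> w \<in> Q}"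

definition coideal ::
    "('k, 'l) ring_scheme \<Rightarrow> ('k, 'c, 'm) bialg_scheme \<Rightarrow> 'c set \<Rightarrow> bool"
  where "coideal K C J \<longleftrightarrow> submodule J K C
    \<and> comult C ` J \<subseteq> tensor_image K C C J (carrier C) <+>\<^bsub>tensor K C C\<^esub> tensor_image K C C (carrier C) J
    \<and> counit C ` J \<subseteq> {\<zero>\<^bsub>K\<^esub>}"

definition quot_bialgebra ::
    "('k, 'l) ring_scheme \<Rightarrow> ('k, 'a, 'm) bialg_scheme \<Rightarrow> 'a set \<Rightarrow> ('k, 'a set) bialg"
  where "quot_bialgebra K A J = module.extend (quot_module A J) (bialg.fields
    (\<lambda>X. tlift K (tensor K (quot_module A J) (quot_module A J))
      (\<lambda>x y. pure K (quot_module A J) (quot_module A J) (J +>\<^bsub>A\<^esub> x) (J +>\<^bsub>A\<^esub> y))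
      (comult A (SOME a. a \<in> X)))
    (\<lambda>X. counit A (SOME a. a \<in> X)))"

section \<open>Bicomodules\<close>

locale left_comodule =
  H?: k_coalgebra K H + module K M for K (structure) and H (structure) and M (structure) and \<rho> +
  assumes lcoact_linear: "k_linear K M (tensor K H M) \<rho>"
    and lcoact_coassoc: "m \<in> carrier M \<Longrightarrow>
      tlift K (tensor K H (tensor K H M))
        (\<lambda>h x. tlift K (tensor K H (tensor K H M))
          (\<lambda>h1 h2. pure K H (tensor K H M) h1 (pure K H M h2 x)) (comult H h)) (\<rho> m)
      = tlift K (tensor K H (tensor K H M)) (\<lambda>h x. pure K H (tensor K H M) h (\<rho> x)) (\<rho> m)"
    and lcoact_counit: "m \<in> carrier M \<Longrightarrow> tlift K M (\<lambda>h x. counit H h \<odot>\<^bsub>M\<^esub> x) (\<rho> m) = m"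

locale right_comodule =
  H?: k_coalgebra K H + module K M for K (structure) and H (structure) and M (structure) and \<sigma> +
  assumes rcoact_linear: "k_linear K M (tensor K M H) \<sigma>"
    and rcoact_coassoc: "m \<in> carrier M \<Longrightarrow>
      tlift K (tensor K M (tensor K H H))
        (\<lambda>x h. tlift K (tensor K M (tensor K H H))
          (\<lambda>x0 x1. pure K M (tensor K H H) x0 (pure K H H x1 h)) (\<sigma> x)) (\<sigma> m)
      = tlift K (tensor K M (tensor K H H)) (\<lambda>x h. pure K M (tensor K H H) x (comult H h)) (\<sigma> m)"
    and rcoact_counit: "m \<in> carrier M \<Longrightarrow> tlift K M (\<lambda>x h. counit H h \<odot>\<^bsub>M\<^esub> x) (\<sigma> m) = m"

locale bicomodule =
  left_comodule K H M \<rho> + right_comodule K H M \<sigma>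
  for K (structure) and H (structure) and M (structure) and \<rho> and \<sigma> +
  assumes bicomodule_compat: "m \<in> carrier M \<Longrightarrow>
      tlift K (tensor K H (tensor K M H)) (\<lambda>h x. pure K H (tensor K M H) h (\<sigma> x)) (\<rho> m)
      = tlift K (tensor K H (tensor K M H))
        (\<lambda>x h. tlift K (tensor K H (tensor K M H))
          (\<lambda>g y. pure K H (tensor K M H) g (pure K M H y h)) (\<rho> x)) (\<sigma> m)"

locale bicomodule_hom =
  M?: bicomodule K H M \<rho> \<sigma> + N?: bicomodule K H N \<rho>' \<sigma>'
  for K (structure) and H (structure)
    and M (structure) and \<rho> and \<sigma> and N (structure) and \<rho>' and \<sigma>' and f +
  assumes hom_linear: "k_linear K M N f"
    and hom_lcoact: "m \<in> carrier M \<Longrightarrow>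
      \<rho>' (f m) = tlift K (tensor K H N) (\<lambda>h x. pure K H N h (f x)) (\<rho> m)"
    and hom_rcoact: "m \<in> carrier M \<Longrightarrow>
      \<sigma>' (f m) = tlift K (tensor K N H) (\<lambda>x h. pure K N H (f x) h) (\<sigma> m)"

definition splits_in_bicomodules ::
    "('k, 'l) ring_scheme \<Rightarrow> ('k, 'h, 'p) bialg_scheme \<Rightarrow>
     ('k, 'm, 'q) module_scheme \<Rightarrow> ('m \<Rightarrow> ('h \<times> 'm \<Rightarrow> 'k) set) \<Rightarrow> ('m \<Rightarrow> ('m \<times> 'h \<Rightarrow> 'k) set) \<Rightarrow>
     ('k, 'n, 'r) module_scheme \<Rightarrow> ('n \<Rightarrow> ('h \<times> 'n \<Rightarrow> 'k) set) \<Rightarrow> ('n \<Rightarrow> ('n \<times> 'h \<Rightarrow> 'k) set) \<Rightarrow>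
     ('m \<Rightarrow> 'n) \<Rightarrow> bool"
  where "splits_in_bicomodules K H M \<rho> \<sigma> N \<rho>' \<sigma>' p \<longleftrightarrow>
    bicomodule_hom K H M \<rho> \<sigma> N \<rho>' \<sigma>' p
    \<and> (\<exists>s. bicomodule_hom K H N \<rho>' \<sigma>' M \<rho> \<sigma> s \<and> (\<forall>y \<in> carrier N. p (s y) = y))"

text \<open>The coactions of \<open>H = A/J\<close> on \<open>A/I\<close> induced by \<open>(\<pi> \<otimes> A)\<Delta>\<close> and \<open>(A \<otimes> \<pi>)\<Delta>\<close>, where \<open>\<pi>\<close> is the
  projection \<open>A \<rightarrow> A/J\<close>; they are used for \<open>I = J\<^sup>n\<close>.\<close>

definition quot_lcoact ::
    "('k, 'l) ring_scheme \<Rightarrow> ('k, 'a, 'm) bialg_scheme \<Rightarrow> 'a set \<Rightarrow> 'a set \<Rightarrow>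
     'a set \<Rightarrow> ('a set \<times> 'a set \<Rightarrow> 'k) set"
  where "quot_lcoact K A J I X =
    tlift K (tensor K (quot_bialgebra K A J) (quot_module A I))
      (\<lambda>x y. pure K (quot_bialgebra K A J) (quot_module A I) (J +>\<^bsub>A\<^esub> x) (I +>\<^bsub>A\<^esub> y))
      (comult A (SOME a. a \<in> X))"

definition quot_rcoact ::
    "('k, 'l) ring_scheme \<Rightarrow> ('k, 'a, 'm) bialg_scheme \<Rightarrow> 'a set \<Rightarrow> 'a set \<Rightarrow>
     'a set \<Rightarrow> ('a set \<times> 'a set \<Rightarrow> 'k) set"
  where "quot_rcoact K A J I X =
    tlift K (tensor K (quot_module A I) (quot_bialgebra K A J))
      (\<lambda>x y. pure K (quot_module A I) (quot_bialgebra K A J) (I +>\<^bsub>A\<^esub> x) (J +>\<^bsub>A\<^esub> y))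
      (comult A (SOME a. a \<in> X))"

text \<open>The canonical map \<open>A/J\<^sup>n\<^sup>+\<^sup>1 \<rightarrow> A/J\<^sup>n\<close> sends the coset \<open>X\<close> to \<open>J\<^sup>n + X\<close>.\<close>

definition canonical_map_splits ::
    "('k, 'l) ring_scheme \<Rightarrow> ('k, 'a, 'm) bialg_scheme \<Rightarrow> 'a set \<Rightarrow> nat \<Rightarrow> bool"
  where "canonical_map_splits K A J n \<longleftrightarrow>
    (let I = ideal_power A J (n + 1); I' = ideal_power A J n in
      splits_in_bicomodules K (quot_bialgebra K A J)
        (quot_module A I) (quot_lcoact K A J I) (quot_rcoact K A J I)
        (quot_module A I') (quot_lcoact K A J I') (quot_rcoact K A J I')
        (\<lambda>X. I' <+>\<^bsub>A\<^esub> X))"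

section \<open>Yetter--Drinfeld quadruples and bosonization\<close>

text \<open>In a quadruple \<open>(R, \<epsilon>, \<delta>, \<omega>)\<close>, \<open>\<epsilon>\<close> and \<open>\<delta>\<close> are the fields \<open>counit\<close> and \<open>comult\<close> (although \<open>R\<close>
  need not be a coalgebra) and \<open>\<omega>\<close> is \<open>cocyc\<close>; \<open>act\<close> and \<open>coact\<close> are the \<open>H\<close>-action and
  \<open>H\<close>-coaction on \<open>R\<close>.\<close>

record ('k, 'h, 'r) yd_quad = "('k, 'r) bialg" +
  act :: "'h \<Rightarrow> 'r \<Rightarrow> 'r"
  coact :: "'r \<Rightarrow> ('h \<times> 'r \<Rightarrow> 'k) set"
  cocyc :: "'h \<Rightarrow> ('r \<times> 'r \<Rightarrow> 'k) set"

locale yetter_drinfeld_module =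
  H?: hopf_algebra K H S + left_comodule K H V \<rho>
  for K (structure) and H (structure) and S and V (structure) and a and \<rho> +
  assumes act_bilinear: "k_bilinear K H V V a"
    and act_one: "v \<in> carrier V \<Longrightarrow> a \<one>\<^bsub>H\<^esub> v = v"
    and act_mult: "\<lbrakk>h \<in> carrier H; k \<in> carrier H; v \<in> carrier V\<rbrakk> \<Longrightarrow> a (h \<otimes>\<^bsub>H\<^esub> k) v = a h (a k v)"
    and yd_compat: "\<lbrakk>h \<in> carrier H; v \<in> carrier V\<rbrakk> \<Longrightarrow>
      \<rho> (a h v) = comult3 K H (tensor K H V)
        (\<lambda>h1 h2 h3. tlift K (tensor K H V)
          (\<lambda>g w. pure K H V (h1 \<otimes>\<^bsub>H\<^esub> g \<otimes>\<^bsub>H\<^esub> S h3) (a h2 w)) (\<rho> v)) h"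

text \<open>An algebra in the category of Yetter--Drinfeld modules: multiplication and unit are morphisms.\<close>

locale yetter_drinfeld_algebra =
  yetter_drinfeld_module K H S R "act R" "coact R" + R?: k_algebra K R
  for K (structure) and H (structure) and S and R (structure) +
  assumes act_prod: "\<lbrakk>h \<in> carrier H; r \<in> carrier R; s \<in> carrier R\<rbrakk> \<Longrightarrow>
      act R h (r \<otimes>\<^bsub>R\<^esub> s) = tlift K R (\<lambda>h1 h2. act R h1 r \<otimes>\<^bsub>R\<^esub> act R h2 s) (comult H h)"
    and act_unit: "h \<in> carrier H \<Longrightarrow> act R h \<one>\<^bsub>R\<^esub> = counit H h \<odot>\<^bsub>R\<^esub> \<one>\<^bsub>R\<^esub>"
    and coact_prod: "\<lbrakk>r \<in> carrier R; s \<in> carrier R\<rbrakk> \<Longrightarrow>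
      coact R (r \<otimes>\<^bsub>R\<^esub> s) = tensor_mult K H R (coact R r) (coact R s)"
    and coact_unit: "coact R \<one>\<^bsub>R\<^esub> = pure K H R \<one>\<^bsub>H\<^esub> \<one>\<^bsub>R\<^esub>"

text \<open>The braided product, diagonal action and diagonal coaction on \<open>R \<otimes> R\<close>.\<close>

definition braided_mult ::
    "('k, 'l) ring_scheme \<Rightarrow> ('k, 'h, 'r, 'm) yd_quad_scheme \<Rightarrow>
     ('r \<times> 'r \<Rightarrow> 'k) set \<Rightarrow> ('r \<times> 'r \<Rightarrow> 'k) set \<Rightarrow> ('r \<times> 'r \<Rightarrow> 'k) set"
  where "braided_mult K R X Y =
    tlift K (tensor K R R) (\<lambda>r s.
      tlift K (tensor K R R) (\<lambda>t v.
        tlift K (tensor K R R) (\<lambda>g s0. pure K R R (r \<otimes>\<^bsub>R\<^esub> act R g t) (s0 \<otimes>\<^bsub>R\<^esub> v)) (coact R s)) Y) X"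

definition diag_act ::
    "('k, 'l) ring_scheme \<Rightarrow> ('k, 'h, 'p) bialg_scheme \<Rightarrow> ('k, 'h, 'r, 'm) yd_quad_scheme \<Rightarrow>
     'h \<Rightarrow> ('r \<times> 'r \<Rightarrow> 'k) set \<Rightarrow> ('r \<times> 'r \<Rightarrow> 'k) set"
  where "diag_act K H R h X =
    tlift K (tensor K R R) (\<lambda>h1 h2.
      tlift K (tensor K R R) (\<lambda>r s. pure K R R (act R h1 r) (act R h2 s)) X) (comult H h)"

definition diag_coact ::
    "('k, 'l) ring_scheme \<Rightarrow> ('k, 'h, 'p) bialg_scheme \<Rightarrow> ('k, 'h, 'r, 'm) yd_quad_scheme \<Rightarrow>
     ('r \<times> 'r \<Rightarrow> 'k) set \<Rightarrow> ('h \<times> ('r \<times> 'r \<Rightarrow> 'k) set \<Rightarrow> 'k) set"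
  where "diag_coact K H R X = (let Y = tensor K H (tensor K R R) in
    tlift K Y (\<lambda>r s.
      tlift K Y (\<lambda>g r0.
        tlift K Y (\<lambda>g' s0. pure K H (tensor K R R) (g \<otimes>\<^bsub>H\<^esub> g') (pure K R R r0 s0))
          (coact R s)) (coact R r)) X)"

text \<open>The identification \<open>(R \<otimes> R) \<otimes> R = R \<otimes> (R \<otimes> R)\<close>, evaluated at \<open>X \<otimes> z\<close>.\<close>

definition reassoc ::
    "('k, 'l) ring_scheme \<Rightarrow> ('k, 'r, 'm) module_scheme \<Rightarrow> ('r \<times> 'r \<Rightarrow> 'k) set \<Rightarrow> 'r \<Rightarrow>
     ('r \<times> ('r \<times> 'r \<Rightarrow> 'k) set \<Rightarrow> 'k) set"
  where "reassoc K R X z =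
    tlift K (tensor K R (tensor K R R)) (\<lambda>x y. pure K R (tensor K R R) x (pure K R R y z)) X"

locale yetter_drinfeld_quadruple =
  yetter_drinfeld_algebra K H S R for K (structure) and H (structure) and S and R (structure) +
  assumes eps_linear: "k_linear K R (scalars K) (counit R)"
    and delta_linear: "k_linear K R (tensor K R R) (comult R)"
    and omega_linear: "k_linear K H (tensor K R R) (cocyc R)"
    and eps_act: "\<lbrakk>h \<in> carrier H; r \<in> carrier R\<rbrakk> \<Longrightarrow>
      counit R (act R h r) = counit R r \<otimes>\<^bsub>K\<^esub> counit H h"
    and eps_coact: "r \<in> carrier R \<Longrightarrow>
      tlift K H (\<lambda>g s. counit R s \<odot>\<^bsub>H\<^esub> g) (coact R r) = counit R r \<odot>\<^bsub>H\<^esub> \<one>\<^bsub>H\<^esub>"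
    and eps_mult: "\<lbrakk>r \<in> carrier R; s \<in> carrier R\<rbrakk> \<Longrightarrow>
      counit R (r \<otimes>\<^bsub>R\<^esub> s) = counit R r \<otimes>\<^bsub>K\<^esub> counit R s"
    and eps_one: "counit R \<one>\<^bsub>R\<^esub> = \<one>\<^bsub>K\<^esub>"
    and delta_coact: "r \<in> carrier R \<Longrightarrow>
      diag_coact K H R (comult R r) =
        tlift K (tensor K H (tensor K R R)) (\<lambda>g s. pure K H (tensor K R R) g (comult R s)) (coact R r)"
    and omega_coact: "h \<in> carrier H \<Longrightarrow>
      diag_coact K H R (cocyc R h) =
        comult3 K H (tensor K H (tensor K R R))
          (\<lambda>h1 h2 h3. pure K H (tensor K R R) (h1 \<otimes>\<^bsub>H\<^esub> S h3) (cocyc R h2)) h"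
    and delta_mult: "\<lbrakk>r \<in> carrier R; s \<in> carrier R\<rbrakk> \<Longrightarrow>
      comult R (r \<otimes>\<^bsub>R\<^esub> s) = braided_mult K R (comult R r) (comult R s)"
    and delta_one: "comult R \<one>\<^bsub>R\<^esub> = pure K R R \<one>\<^bsub>R\<^esub> \<one>\<^bsub>R\<^esub>"
    and omega_mult: "\<lbrakk>h \<in> carrier H; k \<in> carrier H\<rbrakk> \<Longrightarrow>
      cocyc R (h \<otimes>\<^bsub>H\<^esub> k) = tlift K (tensor K R R)
        (\<lambda>h1 h2. braided_mult K R (cocyc R h1) (diag_act K H R h2 (cocyc R k))) (comult H h)"
    and omega_one: "cocyc R \<one>\<^bsub>H\<^esub> = pure K R R \<one>\<^bsub>R\<^esub> \<one>\<^bsub>R\<^esub>"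
    and delta_act: "\<lbrakk>h \<in> carrier H; r \<in> carrier R\<rbrakk> \<Longrightarrow>
      tlift K (tensor K R R)
        (\<lambda>h1 h2. braided_mult K R (comult R (act R h1 r)) (cocyc R h2)) (comult H h)
      = tlift K (tensor K R R)
        (\<lambda>h1 h2. braided_mult K R (cocyc R h1) (diag_act K H R h2 (comult R r))) (comult H h)"
    and delta_coassoc: "r \<in> carrier R \<Longrightarrow>
      tlift K (tensor K R (tensor K R R)) (\<lambda>r1 r2. pure K R (tensor K R R) r1 (comult R r2)) (comult R r)
      = tlift K (tensor K R (tensor K R R))
        (\<lambda>r1 r2. tlift K (tensor K R (tensor K R R))
          (\<lambda>g s. reassoc K R (braided_mult K R (comult R r1) (cocyc R g)) s) (coact R r2)) (comult R r)"
    and omega_cocycle: "h \<in> carrier H \<Longrightarrow>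
      tlift K (tensor K R (tensor K R R))
        (\<lambda>h1 h2. tlift K (tensor K R (tensor K R R))
          (\<lambda>x y. pure K R (tensor K R R) x (braided_mult K R (comult R y) (cocyc R h2)))
          (cocyc R h1)) (comult H h)
      = tlift K (tensor K R (tensor K R R))
        (\<lambda>h1 h2. tlift K (tensor K R (tensor K R R))
          (\<lambda>x y. tlift K (tensor K R (tensor K R R))
            (\<lambda>g s. reassoc K R (braided_mult K R (comult R x) (cocyc R (g \<otimes>\<^bsub>H\<^esub> h2))) s)
            (coact R y)) (cocyc R h1)) (comult H h)"
    and delta_counit_left: "r \<in> carrier R \<Longrightarrow>
      tlift K R (\<lambda>r1 r2. counit R r1 \<odot>\<^bsub>R\<^esub> r2) (comult R r) = r"
    and delta_counit_right: "r \<in> carrier R \<Longrightarrow>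
      tlift K R (\<lambda>r1 r2. counit R r2 \<odot>\<^bsub>R\<^esub> r1) (comult R r) = r"
    and omega_counit_left: "h \<in> carrier H \<Longrightarrow>
      tlift K R (\<lambda>x y. counit R x \<odot>\<^bsub>R\<^esub> y) (cocyc R h) = counit H h \<odot>\<^bsub>R\<^esub> \<one>\<^bsub>R\<^esub>"
    and omega_counit_right: "h \<in> carrier H \<Longrightarrow>
      tlift K R (\<lambda>x y. counit R y \<odot>\<^bsub>R\<^esub> x) (cocyc R h) = counit H h \<odot>\<^bsub>R\<^esub> \<one>\<^bsub>R\<^esub>"

definition smash_mult ::
    "('k, 'l) ring_scheme \<Rightarrow> ('k, 'h, 'r, 'm) yd_quad_scheme \<Rightarrow> ('k, 'h, 'p) bialg_scheme \<Rightarrow>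
     ('r \<times> 'h \<Rightarrow> 'k) set \<Rightarrow> ('r \<times> 'h \<Rightarrow> 'k) set \<Rightarrow> ('r \<times> 'h \<Rightarrow> 'k) set"
  where "smash_mult K R H X Y =
    tlift K (tensor K R H) (\<lambda>r h.
      tlift K (tensor K R H) (\<lambda>s k.
        tlift K (tensor K R H) (\<lambda>h1 h2. pure K R H (r \<otimes>\<^bsub>R\<^esub> act R h1 s) (h2 \<otimes>\<^bsub>H\<^esub> k))
          (comult H h)) Y) X"

definition boson_comult ::
    "('k, 'l) ring_scheme \<Rightarrow> ('k, 'h, 'r, 'm) yd_quad_scheme \<Rightarrow> ('k, 'h, 'p) bialg_scheme \<Rightarrow>
     ('r \<times> 'h \<Rightarrow> 'k) set \<Rightarrow> (('r \<times> 'h \<Rightarrow> 'k) set \<times> ('r \<times> 'h \<Rightarrow> 'k) set \<Rightarrow> 'k) set"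
  where "boson_comult K R H X = (let B = tensor K R H; BB = tensor K B B in
    tlift K BB (\<lambda>r h.
      comult3 K H BB (\<lambda>h1 h2 h3.
        tlift K BB (\<lambda>d1 d2.
          tlift K BB (\<lambda>g d0. pure K B B (pure K R H d1 (g \<otimes>\<^bsub>H\<^esub> h2)) (pure K R H d0 h3))
            (coact R d2))
          (braided_mult K R (comult R r) (cocyc R h1))) h) X)"

definition bosonization ::
    "('k, 'l) ring_scheme \<Rightarrow> ('k, 'h, 'r, 'm) yd_quad_scheme \<Rightarrow> ('k, 'h, 'p) bialg_scheme \<Rightarrow>
     ('k, ('r \<times> 'h \<Rightarrow> 'k) set) bialg"
  where "bosonization K R H =
    \<lparr>carrier = carrier (tensor K R H), mult = smash_mult K R H, one = pure K R H \<one>\<^bsub>R\<^esub> \<one>\<^bsub>H\<^esub>,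
     zero = \<zero>\<^bsub>tensor K R H\<^esub>, add = add (tensor K R H), smult = smult (tensor K R H),
     comult = boson_comult K R H,
     counit = tlift K (scalars K) (\<lambda>r h. counit R r \<otimes>\<^bsub>K\<^esub> counit H h)\<rparr>"

end

theory Submission
  imports Defs
begin

text \<open>The given splittings compose to a bicolinear section of \<open>p : A \<rightarrow> A/J = H\<close>. Its multiplicative
  defect takes values in \<open>J\<close>; if it takes values in \<open>J\<^sup>n\<close>, it is a Hochschild cocycle modulo the
  next power of \<open>J\<close>, and averaging over the separability idempotent \<open>\<Sum> t\<^sub>1 \<otimes> S(t\<^sub>2)\<close> of the integral pushes it
  into that power, \<open>ad\<close>-coinvariance of \<open>t\<close> keeping the section bicolinear. As \<open>J\<close> is nilpotent, this ends with
  a bicolinear algebra map \<open>s : H \<rightarrow> A\<close>. It need not be a coalgebra map, which is where \<open>\<omega>\<close> comes from.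

  Let \<open>R\<close> be the algebra of right coinvariants of \<open>p\<close> and \<open>\<tau>(a) = \<Sum> a\<^sub>1 s(S(p(a\<^sub>2)))\<close> the projection of
  \<open>A\<close> onto \<open>R\<close>. With \<open>H\<close> acting by the adjoint action through \<open>s\<close>, with \<open>\<delta>(r) = (\<tau> \<otimes> \<tau>)\<Delta>(r)\<close> and
  \<open>\<omega>(h) = (\<tau> \<otimes> \<tau>)\<Delta>(s(h))\<close>, all axioms of a quadruple are checked after embedding \<open>R \<otimes> R\<close> into the
  algebra \<open>A \<otimes> A\<close>, and \<open>a \<mapsto> \<Sum> \<tau>(a\<^sub>1) # p(a\<^sub>2)\<close> is the isomorphism. Finally \<open>s S p\<close> is a convolution
  inverse of the identity of \<open>A\<close> up to values in \<open>J\<close>, so a geometric series corrects it to an antipode.\<close>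

section \<open>Linear maps\<close>

text \<open>The axioms of a quadruple nest braidings and coactions. \<open>Psi\<close> stores the
  H-leg of the second tensorand in the first factor of A \<otimes> A as a value of \<open>s\<close>.
  There the diagonal action is conjugation by the algebra map \<open>gam\<close>, and \<delta> is
  the coproduct of A. Both \<delta> and \<omega> are one map, \<open>tdelta\<close>, taken on R and
  on s(H), and the formula \<Sum> Psi(\<omega>(h1)) gam(h2) = \<Delta>(s(h)) identifies \<omega> as
  the deviation of \<open>s\<close> from a coalgebra map. Most identities thus become equations
  between convolution products of linear maps out of A or H, settled by cancelling \<phi>(S(h1))
  against \<phi>(h2) for an algebra map \<phi>. The bialgebra laws of the bosonization are
  transported from A along the isomorphism. In the lifting, a section f with defect D is corrected
  by \<Sum> f(t1) D(S(t2), h); the cocycle identity of D together with h t1 \<otimes> S(t2) = t1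
  \<otimes> S(t2) h leaves as new defect only terms with one factor in J and another in the power of
  J reached so far. The unit is recovered at the end: 1 - s(1) is an idempotent in a nilpotent
  ideal.\<close>

lemma k_linear_closed: "\<lbrakk>k_linear K V W f; x \<in> carrier V\<rbrakk> \<Longrightarrow> f x \<in> carrier W"
  by (auto simp: k_linear_def)

lemma k_linear_add:
  "\<lbrakk>k_linear K V W f; x \<in> carrier V; y \<in> carrier V\<rbrakk> \<Longrightarrow> f (x \<oplus>\<^bsub>V\<^esub> y) = f x \<oplus>\<^bsub>W\<^esub> f y"
  by (auto simp: k_linear_def)

lemma k_linear_smult:
  "\<lbrakk>k_linear K V W f; c \<in> carrier K; x \<in> carrier V\<rbrakk> \<Longrightarrow> f (c \<odot>\<^bsub>V\<^esub> x) = c \<odot>\<^bsub>W\<^esub> f x"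
  by (auto simp: k_linear_def)

lemma k_linearI:
  assumes "\<And>x. x \<in> carrier V \<Longrightarrow> f x \<in> carrier W"
    and "\<And>x y. \<lbrakk>x \<in> carrier V; y \<in> carrier V\<rbrakk> \<Longrightarrow> f (x \<oplus>\<^bsub>V\<^esub> y) = f x \<oplus>\<^bsub>W\<^esub> f y"
    and "\<And>c x. \<lbrakk>c \<in> carrier K; x \<in> carrier V\<rbrakk> \<Longrightarrow> f (c \<odot>\<^bsub>V\<^esub> x) = c \<odot>\<^bsub>W\<^esub> f x"
  shows "k_linear K V W f"
  using assms by (auto simp: k_linear_def)

lemma k_linear_zero:
  assumes "module K V" "module K W" "k_linear K V W f"
  shows "f \<zero>\<^bsub>V\<^esub> = \<zero>\<^bsub>W\<^esub>"
proof -
  interpret V: module K V by fact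
  interpret W: module K W by fact
  have "f (\<zero>\<^bsub>K\<^esub> \<odot>\<^bsub>V\<^esub> \<zero>\<^bsub>V\<^esub>) = \<zero>\<^bsub>K\<^esub> \<odot>\<^bsub>W\<^esub> f \<zero>\<^bsub>V\<^esub>"
    by (rule k_linear_smult[OF assms(3)]) auto
  then show ?thesis using k_linear_closed[OF assms(3)] by simp
qed

lemma k_linear_uminus:
  assumes "module K V" "module K W" "k_linear K V W f" "x \<in> carrier V"
  shows "f (\<ominus>\<^bsub>V\<^esub> x) = \<ominus>\<^bsub>W\<^esub> f x"
proof -
  interpret V: module K V by fact
  interpret W: module K W by fact
  have "f (\<ominus>\<^bsub>V\<^esub> x \<oplus>\<^bsub>V\<^esub> x) = f (\<ominus>\<^bsub>V\<^esub> x) \<oplus>\<^bsub>W\<^esub> f x"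
    by (rule k_linear_add[OF assms(3)]) (use assms in auto)
  then have "f (\<ominus>\<^bsub>V\<^esub> x) \<oplus>\<^bsub>W\<^esub> f x = \<zero>\<^bsub>W\<^esub>"
    using assms k_linear_zero[OF assms(1-3)] by (simp add: V.l_neg)
  then show ?thesis using W.minus_equality k_linear_closed[OF assms(3)] assms(4) by simp
qed

lemma k_linear_finsum:
  assumes "module K V" "module K W" "k_linear K V W f" "g \<in> I \<rightarrow> carrier V"
  shows "f (finsum V g I) = (\<Oplus>\<^bsub>W\<^esub>i\<in>I. f (g i))"
proof -
  interpret V: module K V by fact
  interpret W: module K W by fact
  note l = k_linear_closed[OF assms(3)] k_linear_add[OF assms(3)] k_linear_zero[OF assms(1-3)]
  show ?thesis using assms(4)
    by (induction I rule: infinite_finite_induct) (auto simp: l Pi_iff)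
qed

lemma k_linear_id: "k_linear K V V (\<lambda>x. x)"
  by (auto simp: k_linear_def)

lemma k_linear_comp:
  "\<lbrakk>k_linear K W X f; k_linear K V W g\<rbrakk> \<Longrightarrow> k_linear K V X (\<lambda>x. f (g x))"
  by (auto simp: k_linear_def Pi_iff)

lemma k_linear_cong:
  assumes "module K V" "\<And>x. x \<in> carrier V \<Longrightarrow> f x = g x"
  shows "k_linear K V W f = k_linear K V W g"
proof -
  interpret V: module K V by fact
  show ?thesis using assms(2) by (auto simp: k_linear_def Pi_iff)
qed

lemma k_linear_smult_right:
  assumes "module K W" "c \<in> carrier K" "k_linear K V W f"
  shows "k_linear K V W (\<lambda>x. c \<odot>\<^bsub>W\<^esub> f x)"
proof -
  interpret W: module K W by fact
  show ?thesis using assms(2,3)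
    by (auto simp: k_linear_def Pi_iff W.smult_r_distr W.smult_assoc1[symmetric] W.m_comm)
qed

lemma k_linear_plus:
  assumes "module K W" "k_linear K V W f" "k_linear K V W g"
  shows "k_linear K V W (\<lambda>x. f x \<oplus>\<^bsub>W\<^esub> g x)"
proof -
  interpret W: module K W by fact
  show ?thesis using assms(2,3)
    by (auto simp: k_linear_def Pi_iff W.smult_r_distr W.a_ac)
qed

lemma k_linear_neg:
  assumes "module K W" "k_linear K V W f"
  shows "k_linear K V W (\<lambda>x. \<ominus>\<^bsub>W\<^esub> f x)"
proof -
  interpret W: module K W by fact
  show ?thesis using assms(2)
    by (auto simp: k_linear_def Pi_iff W.smult_r_minus W.minus_add)
qed

lemma k_linear_diff:
  assumes "module K W" "k_linear K V W f" "k_linear K V W g"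
  shows "k_linear K V W (\<lambda>x. f x \<ominus>\<^bsub>W\<^esub> g x)"
  unfolding a_minus_def by (intro k_linear_plus k_linear_neg assms)

lemma k_linear_scalar_smult:
  assumes "module K W" "k_linear K V (scalars K) f" "w \<in> carrier W"
  shows "k_linear K V W (\<lambda>x. f x \<odot>\<^bsub>W\<^esub> w)"
proof -
  interpret W: module K W by fact
  show ?thesis using assms(2,3)
    by (auto simp: k_linear_def scalars_def Pi_iff W.smult_l_distr W.smult_assoc1)
qed

lemma k_linear_mult_left:
  assumes "k_algebra K A" "k_linear K V A f" "a \<in> carrier A"
  shows "k_linear K V A (\<lambda>x. f x \<otimes>\<^bsub>A\<^esub> a)"
proof -
  interpret A: k_algebra K A by fact
  show ?thesis using assms(2,3)
    by (auto simp: k_linear_def Pi_iff A.l_distr A.smult_mult_left)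
qed

lemma k_linear_mult_right:
  assumes "k_algebra K A" "k_linear K V A f" "a \<in> carrier A"
  shows "k_linear K V A (\<lambda>x. a \<otimes>\<^bsub>A\<^esub> f x)"
proof -
  interpret A: k_algebra K A by fact
  show ?thesis using assms(2,3)
    by (auto simp: k_linear_def Pi_iff A.r_distr A.smult_mult_right)
qed

lemma k_bilinearI:
  assumes "\<And>u. u \<in> carrier U \<Longrightarrow> k_linear K V W (b u)"
    and "\<And>v. v \<in> carrier V \<Longrightarrow> k_linear K U W (\<lambda>u. b u v)"
  shows "k_bilinear K U V W b"
  using assms by (auto simp: k_bilinear_def)

lemma k_bilinear_closed:
  "\<lbrakk>k_bilinear K U V W b; u \<in> carrier U; v \<in> carrier V\<rbrakk> \<Longrightarrow> b u v \<in> carrier W"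
  by (auto simp: k_bilinear_def k_linear_def)

lemma module_scalars: assumes "cring K" shows "module K (scalars K)"
proof -
  interpret cring K by fact
  show ?thesis
  proof (rule moduleI)
    show "abelian_group (scalars K)"
    proof (rule abelian_groupI)
      fix x assume "x \<in> carrier (scalars K)"
      then show "\<exists>y\<in>carrier (scalars K). y \<oplus>\<^bsub>scalars K\<^esub> x = \<zero>\<^bsub>scalars K\<^esub>"
        by (intro bexI[of _ "\<ominus>\<^bsub>K\<^esub> x"]) (auto simp: scalars_def l_neg)
    qed (auto simp: scalars_def a_ac)
  qed (auto simp: scalars_def l_distr r_distr m_assoc is_cring)
qed

lemma k_algebra_module: "k_algebra K A \<Longrightarrow> module K A"
  by (simp add: k_algebra_def)

lemma k_coalgebra_module: "k_coalgebra K A \<Longrightarrow> module K A"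
  by (simp add: k_coalgebra_def)

section \<open>Sums over tensors\<close>

text \<open>\<open>tlift\<close> reads a tensor through the representative that \<open>SOME\<close>
  picks from its coset. This certifies the pick: it lies in the free module and represents the same
  coset, so facts on \<open>tlift\<close> can be proved on one finite sum.\<close>

lemma tensor_some_rep:
  assumes V: "module K V" and W: "module K W" and T: "T \<in> carrier (tensor K V W)"
  shows "(SOME f. f \<in> T) \<in> carrier (free_module K (carrier V \<times> carrier W))"
    and "T = tensor_null K V W +>\<^bsub>free_module K (carrier V \<times> carrier W)\<^esub> (SOME f. f \<in> T)"
proof -
  let ?F = "free_module K (carrier V \<times> carrier W)" and ?N = "tensor_null K V W"
  interpret V: module K V by fact
  interpret F: module K ?F by (rule free_module_module) (rule V.is_cring)
  interpret N: abelian_subgroup ?N ?F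
    by (rule submodule_abelian_subgroup[OF F.module_axioms tensor_null_submodule[OF V W]])
  obtain f where f: "f \<in> carrier ?F" "T = ?N +>\<^bsub>?F\<^esub> f" by (rule tensor_rep[OF T])
  then have "f \<in> T" using N.a_rcos_self by blast
  then have some: "(SOME f. f \<in> T) \<in> T" by (rule someI[of "\<lambda>f. f \<in> T"])
  then show c: "(SOME f. f \<in> T) \<in> carrier ?F"
    using f N.a_elemrcos_carrier by blast
  show "T = ?N +>\<^bsub>?F\<^esub> (SOME f. f \<in> T)"
    using N.a_repr_independence'[OF _ f(1)] some f(2) by simp
qed

lemma tlift_closed:
  assumes "module K V" "module K W" "module K X" "T \<in> carrier (tensor K V W)"
    and b: "\<And>x y. \<lbrakk>x \<in> carrier V; y \<in> carrier W\<rbrakk> \<Longrightarrow> b x y \<in> carrier X"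
  shows "tlift K X b T \<in> carrier X"
proof -
  interpret X: module K X by fact
  show ?thesis using tensor_some_rep(1)[OF assms(1,2,4)] b unfolding tlift_def Let_def
    by (intro X.finsum_closed) (fastforce simp: free_module_simps)
qed

lemma foldSetD_cong_le:
  assumes "(B, y) \<in> foldSetD D f e" "\<And>x z. x \<in> B \<Longrightarrow> f x z = g x z"
  shows "(B, y) \<in> foldSetD D g e"
  using assms
proof (induction rule: foldSetD.induct)
  case (insertI x A y)
  then show ?case using foldSetD.insertI[of x A g y D e] by simp
qed (auto intro: foldSetD.emptyI)

lemma foldD_cong_on: 
  assumes "\<And>x z. x \<in> B \<Longrightarrow> f x z = g x z"
  shows "foldD D f e B = foldD D g e B"
proof -
  have "(B, y) \<in> foldSetD D f e \<longleftrightarrow> (B, y) \<in> foldSetD D g e" for y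
    using foldSetD_cong_le[of B y D f e g] foldSetD_cong_le[of B y D g e f] assms by metis
  then show ?thesis unfolding foldD_def by simp
qed

lemma finsum_cong_on:
  assumes "\<And>x. x \<in> I \<Longrightarrow> f x = g x" shows "finsum G f I = finsum G g I"
proof -
  have "foldD (carrier G) (\<lambda>x. (\<oplus>\<^bsub>G\<^esub>) (f x)) \<zero>\<^bsub>G\<^esub> I = foldD (carrier G) (\<lambda>x. (\<oplus>\<^bsub>G\<^esub>) (g x)) \<zero>\<^bsub>G\<^esub> I"
    by (rule foldD_cong_on) (simp add: assms)
  then show ?thesis by (simp add: finsum_def finprod_def comp_def)
qed

text \<open>No closure assumption is needed, so that this gives an unconditional congruence rule.\<close>

lemma tlift_cong:
  assumes "module K V" "module K W" "T \<in> carrier (tensor K V W)"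
    and e: "\<And>x y. \<lbrakk>x \<in> carrier V; y \<in> carrier W\<rbrakk> \<Longrightarrow> b x y = b' x y"
  shows "tlift K X b T = tlift K X b' T"
  using tensor_some_rep(1)[OF assms(1-3)] e unfolding tlift_def Let_def
  by (intro finsum_cong_on) (fastforce simp: free_module_simps)

text \<open>Both sides are finite sums over the same chosen representative of \<open>T\<close>;
  linearity moves \<open>g\<close> through the sum, and \<open>b\<close> may be any map into the
  carrier.\<close>

lemma tlift_commute:
  assumes "module K V" "module K W" "module K X" "module K Y" "T \<in> carrier (tensor K V W)"
    and g: "k_linear K X Y g"
    and b: "\<And>x y. \<lbrakk>x \<in> carrier V; y \<in> carrier W\<rbrakk> \<Longrightarrow> b x y \<in> carrier X"
  shows "g (tlift K X b T) = tlift K Y (\<lambda>x y. g (b x y)) T"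
proof -
  interpret X: module K X by fact
  interpret Y: module K Y by fact
  let ?f = "SOME f. f \<in> T"
  have f: "?f \<in> carrier (free_module K (carrier V \<times> carrier W))"
    using tensor_some_rep(1)[OF assms(1,2,5)] .
  have bc: "\<And>p. ?f p \<noteq> \<zero>\<^bsub>K\<^esub> \<Longrightarrow> b (fst p) (snd p) \<in> carrier X" "\<And>p. ?f p \<in> carrier K"
    using f b by (fastforce simp: free_module_simps)+
  have "g (tlift K X b T) = (\<Oplus>\<^bsub>Y\<^esub>p\<in>{p. ?f p \<noteq> \<zero>\<^bsub>K\<^esub>}. g (?f p \<odot>\<^bsub>X\<^esub> b (fst p) (snd p)))"
    unfolding tlift_def Let_def by (rule k_linear_finsum[OF assms(3,4) g]) (use bc in auto)
  also have "\<dots> = (\<Oplus>\<^bsub>Y\<^esub>p\<in>{p. ?f p \<noteq> \<zero>\<^bsub>K\<^esub>}. ?f p \<odot>\<^bsub>Y\<^esub> g (b (fst p) (snd p)))"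
    using bc k_linear_smult[OF g] k_linear_closed[OF g] by (intro Y.finsum_cong') auto
  finally show ?thesis unfolding tlift_def Let_def .
qed

lemma tlift_add:
  assumes "module K V" "module K W" "module K X" "T \<in> carrier (tensor K V W)"
    and b: "\<And>x y. \<lbrakk>x \<in> carrier V; y \<in> carrier W\<rbrakk> \<Longrightarrow> b x y \<in> carrier X"
    and b': "\<And>x y. \<lbrakk>x \<in> carrier V; y \<in> carrier W\<rbrakk> \<Longrightarrow> b' x y \<in> carrier X"
  shows "tlift K X (\<lambda>x y. b x y \<oplus>\<^bsub>X\<^esub> b' x y) T = tlift K X b T \<oplus>\<^bsub>X\<^esub> tlift K X b' T"
proof -
  interpret X: module K X by fact
  let ?f = "SOME f. f \<in> T"
  have f: "?f \<in> carrier (free_module K (carrier V \<times> carrier W))"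
    using tensor_some_rep(1)[OF assms(1,2,4)] .
  have bc: "\<And>p. ?f p \<noteq> \<zero>\<^bsub>K\<^esub> \<Longrightarrow> b (fst p) (snd p) \<in> carrier X" "\<And>p. ?f p \<in> carrier K"
    "\<And>p. ?f p \<noteq> \<zero>\<^bsub>K\<^esub> \<Longrightarrow> b' (fst p) (snd p) \<in> carrier X"
    using f b b' by (fastforce simp: free_module_simps)+
  have "tlift K X (\<lambda>x y. b x y \<oplus>\<^bsub>X\<^esub> b' x y) T = (\<Oplus>\<^bsub>X\<^esub>p\<in>{p. ?f p \<noteq> \<zero>\<^bsub>K\<^esub>}.
      ?f p \<odot>\<^bsub>X\<^esub> b (fst p) (snd p) \<oplus>\<^bsub>X\<^esub> ?f p \<odot>\<^bsub>X\<^esub> b' (fst p) (snd p))"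
    unfolding tlift_def Let_def using bc by (intro X.finsum_cong') (auto simp: X.smult_r_distr)
  also have "\<dots> = tlift K X b T \<oplus>\<^bsub>X\<^esub> tlift K X b' T"
    unfolding tlift_def Let_def using bc by (intro X.finsum_addf) auto
  finally show ?thesis .
qed

lemma tlift_zero:
  assumes "module K V" "module K W" "module K X" "T \<in> carrier (tensor K V W)"
  shows "tlift K X (\<lambda>_ _. \<zero>\<^bsub>X\<^esub>) T = \<zero>\<^bsub>X\<^esub>"
proof -
  interpret X: module K X by fact
  have "k_linear K X X (\<lambda>_. \<zero>\<^bsub>X\<^esub>)" by (simp add: k_linear_def)
  from tlift_commute[OF assms(1-3,3,4) this, of "\<lambda>_ _. \<zero>\<^bsub>X\<^esub>"] show ?thesis by simp
qed

lemma tlift_finsum: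
  assumes "module K V" "module K W" "module K X" "T \<in> carrier (tensor K V W)"
    and b: "\<And>i x y. \<lbrakk>i \<in> I; x \<in> carrier V; y \<in> carrier W\<rbrakk> \<Longrightarrow> b i x y \<in> carrier X"
  shows "tlift K X (\<lambda>x y. \<Oplus>\<^bsub>X\<^esub>i\<in>I. b i x y) T = (\<Oplus>\<^bsub>X\<^esub>i\<in>I. tlift K X (b i) T)"
proof -
  interpret X: module K X by fact
  show ?thesis using b
  proof (induction I rule: infinite_finite_induct)
    case (insert i I)
    have "tlift K X (\<lambda>x y. \<Oplus>\<^bsub>X\<^esub>i\<in>insert i I. b i x y) T
        = tlift K X (\<lambda>x y. b i x y \<oplus>\<^bsub>X\<^esub> (\<Oplus>\<^bsub>X\<^esub>i\<in>I. b i x y)) T"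
      using insert.hyps insert.prems
      by (intro tlift_cong[OF assms(1,2,4)] X.finsum_closed X.finsum_insert) auto
    also have "\<dots> = tlift K X (b i) T \<oplus>\<^bsub>X\<^esub> tlift K X (\<lambda>x y. \<Oplus>\<^bsub>X\<^esub>i\<in>I. b i x y) T"
      using insert.prems by (intro tlift_add[OF assms(1-4)] X.finsum_closed) auto
    also have "\<dots> = tlift K X (b i) T \<oplus>\<^bsub>X\<^esub> (\<Oplus>\<^bsub>X\<^esub>i\<in>I. tlift K X (b i) T)"
      using insert.IH insert.prems by simp
    also have "\<dots> = (\<Oplus>\<^bsub>X\<^esub>i\<in>insert i I. tlift K X (b i) T)"
      using insert.hyps insert.prems
      by (intro X.finsum_insert[symmetric]) (auto intro!: tlift_closed[OF assms(1-4)])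
    finally show ?case .
  qed (auto simp: tlift_zero[OF assms(1-4)])
qed

text \<open>Fubini for two Sweedler sums: only the inner \<open>tlift\<close> on the left is
  expanded over its representative, and the outer one commutes with finite sums and scalars.\<close>

lemma tlift_swap:
  assumes m: "module K V" "module K W" "module K V'" "module K W'" "module K X"
    and T: "T \<in> carrier (tensor K V W)" and T': "T' \<in> carrier (tensor K V' W')"
    and b: "\<And>x y u v. \<lbrakk>x \<in> carrier V; y \<in> carrier W; u \<in> carrier V'; v \<in> carrier W'\<rbrakk>
      \<Longrightarrow> b x y u v \<in> carrier X"
  shows "tlift K X (\<lambda>x y. tlift K X (b x y) T') T
    = tlift K X (\<lambda>u v. tlift K X (\<lambda>x y. b x y u v) T) T'"
proof -
  interpret X: module K X by fact
  let ?f = "SOME f. f \<in> T'"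
  have f: "?f \<in> carrier (free_module K (carrier V' \<times> carrier W'))"
    using tensor_some_rep(1)[OF m(3,4) T'] .
  have bc: "\<And>p. ?f p \<noteq> \<zero>\<^bsub>K\<^esub> \<Longrightarrow> fst p \<in> carrier V'" "\<And>p. ?f p \<in> carrier K"
    "\<And>p. ?f p \<noteq> \<zero>\<^bsub>K\<^esub> \<Longrightarrow> snd p \<in> carrier W'"
    using f by (fastforce simp: free_module_simps)+
  have l: "k_linear K X X (\<lambda>x. c \<odot>\<^bsub>X\<^esub> x)" if "c \<in> carrier K" for c
    by (rule k_linear_smult_right[OF m(5) that k_linear_id])
  have "tlift K X (\<lambda>x y. tlift K X (b x y) T') T
      = tlift K X (\<lambda>x y. \<Oplus>\<^bsub>X\<^esub>p\<in>{p. ?f p \<noteq> \<zero>\<^bsub>K\<^esub>}. ?f p \<odot>\<^bsub>X\<^esub> b x y (fst p) (snd p)) T"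
    unfolding tlift_def[of _ _ _ T'] Let_def ..
  also have "\<dots> = (\<Oplus>\<^bsub>X\<^esub>p\<in>{p. ?f p \<noteq> \<zero>\<^bsub>K\<^esub>}.
      tlift K X (\<lambda>x y. ?f p \<odot>\<^bsub>X\<^esub> b x y (fst p) (snd p)) T)"
    using bc b by (intro tlift_finsum[OF m(1,2,5) T]) auto
  also have "\<dots> = (\<Oplus>\<^bsub>X\<^esub>p\<in>{p. ?f p \<noteq> \<zero>\<^bsub>K\<^esub>}.
      ?f p \<odot>\<^bsub>X\<^esub> tlift K X (\<lambda>x y. b x y (fst p) (snd p)) T)"
    using bc b by (intro X.finsum_cong' tlift_commute[OF m(1,2,5,5) T l, symmetric])
      (auto intro!: tlift_closed[OF m(1,2,5) T])
  finally show ?thesis unfolding tlift_def[of _ _ _ T'] Let_def .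
qed

lemma pure_closed:
  "\<lbrakk>module K V; module K W; v \<in> carrier V; w \<in> carrier W\<rbrakk>
    \<Longrightarrow> pure K V W v w \<in> carrier (tensor K V W)"
  using k_bilinear_closed[OF pure_bilinear] .

text \<open>Induction on the support of a representative. The form chosen, a fixed point of
  \<open>tlift\<close> at \<open>pure\<close>, lets \<open>tlift_commute\<close> reduce any linear
  map on the tensor product to its values on pure tensors, as in \<open>tensor_ext\<close>.\<close>

lemma tensor_expand:
  assumes V: "module K V" and W: "module K W" and T: "T \<in> carrier (tensor K V W)"
  shows "tlift K (tensor K V W) (pure K V W) T = T"
proof -
  let ?F = "free_module K (carrier V \<times> carrier W)" and ?N = "tensor_null K V W"
  let ?T = "tensor K V W"
  interpret V: module K V by fact
  interpret F: module K ?F by (rule free_module_module) (rule V.is_cring)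
  note N = tensor_null_submodule[OF V W]
  interpret N: abelian_subgroup ?N ?F by (rule submodule_abelian_subgroup[OF F.module_axioms N])
  interpret T: module K ?T by (rule tensor_module[OF V W])
  let ?l = "tlift K ?T (pure K V W)"
  note lin = tlift_linear[OF V W tensor_module[OF V W] pure_bilinear[OF V W]]
  have ad: "?N +>\<^bsub>?F\<^esub> (f \<oplus>\<^bsub>?F\<^esub> h) = (?N +>\<^bsub>?F\<^esub> f) \<oplus>\<^bsub>?T\<^esub> (?N +>\<^bsub>?F\<^esub> h)"
    if "f \<in> carrier ?F" "h \<in> carrier ?F" for f h
    using N.a_rcos_sum[OF that] by (simp add: tensor_def quot_module_simps)
  have sm: "?N +>\<^bsub>?F\<^esub> (c \<odot>\<^bsub>?F\<^esub> f) = c \<odot>\<^bsub>?T\<^esub> (?N +>\<^bsub>?F\<^esub> f)"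
    if "c \<in> carrier K" "f \<in> carrier ?F" for c f
    using quot_module_smult[OF F.module_axioms N that] by (simp add: tensor_def)
  have cl: "?N +>\<^bsub>?F\<^esub> f \<in> carrier ?T" if "f \<in> carrier ?F" for f
    using that by (auto simp: tensor_def quot_module_simps A_RCOSETS_def')
  have main: "?l (?N +>\<^bsub>?F\<^esub> f) = ?N +>\<^bsub>?F\<^esub> f"
    if "f \<in> carrier ?F" "{p. f p \<noteq> \<zero>\<^bsub>K\<^esub>} \<subseteq> P" "finite P" "P \<subseteq> carrier V \<times> carrier W" for f P
    using that(3,1,2,4)
  proof (induction P arbitrary: f rule: finite_induct)
    case empty
    then have "f = \<zero>\<^bsub>?F\<^esub>" by (auto simp: free_module_simps)
    then have "?N +>\<^bsub>?F\<^esub> f = \<zero>\<^bsub>?T\<^esub>"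
      using N.a_subset by (simp add: tensor_def quot_module_simps)
    then show ?case using k_linear_zero[OF T.module_axioms T.module_axioms lin] by simp
  next
    case (insert p P)
    let ?g = "free_gen K p" and ?c = "f p"
    have p: "p \<in> carrier V \<times> carrier W" using insert.prems by auto
    have g: "?g \<in> carrier ?F" by (rule free_gen_carrier[OF V.is_cring p])
    have c: "?c \<in> carrier K" using insert.prems(1) unfolding free_module_simps by blast
    \<comment> \<open>The coefficient at \<open>p\<close> is set to zero, so that the support falls
      into \<open>P\<close> and \<open>f\<close> is recovered by adding one multiple of a
      generator.\<close>
    define f' where "f' = f(p := \<zero>\<^bsub>K\<^esub>)"
    have "{q. f' q \<noteq> \<zero>\<^bsub>K\<^esub>} \<subseteq> {q. f q \<noteq> \<zero>\<^bsub>K\<^esub>}" by (auto simp: f'_def)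
    then have f': "f' \<in> carrier ?F" "{q. f' q \<noteq> \<zero>\<^bsub>K\<^esub>} \<subseteq> P" using insert.prems
      by (auto simp: free_module_simps f'_def intro: finite_subset)
    have eq: "f = f' \<oplus>\<^bsub>?F\<^esub> (?c \<odot>\<^bsub>?F\<^esub> ?g)"
    proof
      fix q show "f q = (f' \<oplus>\<^bsub>?F\<^esub> (?c \<odot>\<^bsub>?F\<^esub> ?g)) q"
        using insert.prems(1) c by (simp add: free_module_simps f'_def free_gen_def del: split_paired_All)
    qed
    have gp: "?l (?N +>\<^bsub>?F\<^esub> ?g) = ?N +>\<^bsub>?F\<^esub> ?g"
      using tlift_pure[OF V W tensor_module[OF V W] pure_bilinear[OF V W], of "fst p" "snd p"] p
      by (auto simp: pure_def)
    show ?case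
      by (subst (1 2) eq)
        (simp only: ad[OF f'(1) F.smult_closed[OF c g]] sm[OF c g]
          k_linear_add[OF lin cl[OF f'(1)] T.smult_closed[OF c cl[OF g]]]
          k_linear_smult[OF lin c cl[OF g]] gp insert.IH[OF f'(1,2)] insert.prems(3)[THEN insert_subset[THEN iffD1], THEN conjunct2])
  qed
  have "?l (?N +>\<^bsub>?F\<^esub> f) = ?N +>\<^bsub>?F\<^esub> f" if "f \<in> carrier ?F" for f
    by (rule main[OF that order_refl]) (use that in \<open>auto simp: free_module_simps\<close>)
  then show ?thesis using tensor_some_rep[OF V W T] by metis
qed

lemma tensor_ext:
  assumes "module K V" "module K W" "module K X" "T \<in> carrier (tensor K V W)"
    and f: "k_linear K (tensor K V W) X f" and g: "k_linear K (tensor K V W) X g"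
    and e: "\<And>x y. \<lbrakk>x \<in> carrier V; y \<in> carrier W\<rbrakk> \<Longrightarrow> f (pure K V W x y) = g (pure K V W x y)"
  shows "f T = g T"
proof -
  note t = tensor_module[OF assms(1,2)] and p = pure_closed[OF assms(1,2)]
  have "f T = tlift K X (\<lambda>x y. f (pure K V W x y)) T"
    using tlift_commute[OF assms(1,2) t assms(3,4) f, of "pure K V W"] p
      tensor_expand[OF assms(1,2,4)] by simp
  also have "\<dots> = tlift K X (\<lambda>x y. g (pure K V W x y)) T"
    by (rule tlift_cong[OF assms(1,2,4) e])
  also have "\<dots> = g T"
    using tlift_commute[OF assms(1,2) t assms(3,4) g, of "pure K V W"] p
      tensor_expand[OF assms(1,2,4)] by simp
  finally show ?thesis .
qed

lemma tlift_tlift: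
  assumes "module K V" "module K W" "module K V'" "module K W'" "module K X"
    and "T \<in> carrier (tensor K V W)" and b: "k_bilinear K V' W' X b"
    and "\<And>x y. \<lbrakk>x \<in> carrier V; y \<in> carrier W\<rbrakk> \<Longrightarrow> d x y \<in> carrier (tensor K V' W')"
  shows "tlift K X b (tlift K (tensor K V' W') d T) = tlift K X (\<lambda>x y. tlift K X b (d x y)) T"
  using tlift_commute[OF assms(1,2) tensor_module[OF assms(3,4)] assms(5,6)
      tlift_linear[OF assms(3-5) b] assms(8)] .

lemma k_linear_tlift_inner:
  assumes m: "module K V" "module K W" "module K X" and U: "module K U"
    and T: "T \<in> carrier (tensor K V W)"
    and b: "\<And>x y. \<lbrakk>x \<in> carrier V; y \<in> carrier W\<rbrakk> \<Longrightarrow> k_linear K U X (\<lambda>u. b u x y)"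
  shows "k_linear K U X (\<lambda>u. tlift K X (b u) T)"
proof (rule k_linearI)
  interpret U: module K U by fact
  interpret X: module K X by fact
  note cl = k_linear_closed[OF b]
  show "tlift K X (b u) T \<in> carrier X" if "u \<in> carrier U" for u
    using cl that by (intro tlift_closed[OF m T])
  show "tlift K X (b (x \<oplus>\<^bsub>U\<^esub> y)) T = tlift K X (b x) T \<oplus>\<^bsub>X\<^esub> tlift K X (b y) T"
    if "x \<in> carrier U" "y \<in> carrier U" for x y
  proof -
    have "tlift K X (b (x \<oplus>\<^bsub>U\<^esub> y)) T = tlift K X (\<lambda>u v. b x u v \<oplus>\<^bsub>X\<^esub> b y u v) T"
      using that cl by (intro tlift_cong[OF m(1,2) T]) (auto simp: k_linear_add[OF b])
    then show ?thesis using tlift_add[OF m T, of "b x" "b y"] cl that by simp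
  qed
  show "tlift K X (b (c \<odot>\<^bsub>U\<^esub> x)) T = c \<odot>\<^bsub>X\<^esub> tlift K X (b x) T"
    if "c \<in> carrier K" "x \<in> carrier U" for c x
  proof -
    have "tlift K X (b (c \<odot>\<^bsub>U\<^esub> x)) T = tlift K X (\<lambda>u v. c \<odot>\<^bsub>X\<^esub> b x u v) T"
      using that cl by (intro tlift_cong[OF m(1,2) T]) (auto simp: k_linear_smult[OF b])
    then show ?thesis
      using tlift_commute[OF m m(3) T k_linear_smult_right[OF m(3) that(1) k_linear_id], of "b x"]
        cl that by simp
  qed
qed

lemma k_linear_pure_left:
  assumes "module K V" "module K W" "k_linear K U V f" "w \<in> carrier W"
  shows "k_linear K U (tensor K V W) (\<lambda>u. pure K V W (f u) w)"
  using k_linear_comp[OF _ assms(3), of "tensor K V W" "\<lambda>v. pure K V W v w"]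
    pure_bilinear[OF assms(1,2)] assms(4) by (simp add: k_bilinear_def)

lemma k_linear_pure_right:
  assumes "module K V" "module K W" "k_linear K U W f" "v \<in> carrier V"
  shows "k_linear K U (tensor K V W) (\<lambda>u. pure K V W v (f u))"
  using k_linear_comp[OF _ assms(3), of "tensor K V W" "pure K V W v"]
    pure_bilinear[OF assms(1,2)] assms(4) by (simp add: k_bilinear_def)

lemma k_linear_tlift_outer:
  assumes "module K V" "module K W" "module K X" "k_bilinear K V W X b"
    "k_linear K U (tensor K V W) g"
  shows "k_linear K U X (\<lambda>u. tlift K X b (g u))"
  using k_linear_comp[OF tlift_linear[OF assms(1-4)] assms(5)] .

section \<open>Sweedler sums and convolution\<close>

text \<open>\<open>sweedler K C X b h = \<Sum> b h\<^sub>1 h\<^sub>2\<close>; the value off \<open>C\<close> is fixed so that equality of summands on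
  \<open>C\<close> gives equality of functions.\<close>

definition sweedler ::
    "('k, 'l) ring_scheme \<Rightarrow> ('k, 'c, 'm) bialg_scheme \<Rightarrow> ('k, 'x, 'n) module_scheme \<Rightarrow>
     ('c \<Rightarrow> 'c \<Rightarrow> 'x) \<Rightarrow> 'c \<Rightarrow> 'x"
  where "sweedler K C X b h =
    (if k_coalgebra K C \<and> h \<in> carrier C then tlift K X b (comult C h) else undefined)"

lemma comult_closed:
  assumes "k_coalgebra K C" "h \<in> carrier C" shows "comult C h \<in> carrier (tensor K C C)"
  using k_linear_closed[OF k_coalgebra.comult_linear] assms .

lemma sweedler_eq:
  "\<lbrakk>k_coalgebra K C; h \<in> carrier C\<rbrakk> \<Longrightarrow> sweedler K C X b h = tlift K X b (comult C h)"
  by (simp add: sweedler_def)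

lemma sweedler_cong [cong]:
  assumes "\<And>x y. \<lbrakk>x \<in> carrier C; y \<in> carrier C\<rbrakk> \<Longrightarrow> b x y = b' x y"
  shows "sweedler K C X b = sweedler K C X b'"
proof
  fix h
  show "sweedler K C X b h = sweedler K C X b' h"
    unfolding sweedler_def
    by (intro if_cong refl tlift_cong[OF _ _ _ assms]) (auto intro: k_coalgebra_module comult_closed)
qed

lemma sweedler_closed:
  assumes "k_coalgebra K C" "module K X" "h \<in> carrier C"
    "\<And>x y. \<lbrakk>x \<in> carrier C; y \<in> carrier C\<rbrakk> \<Longrightarrow> b x y \<in> carrier X"
  shows "sweedler K C X b h \<in> carrier X"
  unfolding sweedler_eq[OF assms(1,3)]
  by (rule tlift_closed[OF k_coalgebra_module k_coalgebra_module assms(2) comult_closed, OF assms(1,1,1,3,4)])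

lemma sweedler_commute:
  assumes "k_linear K X Y g" "k_coalgebra K C" "module K X" "module K Y" "h \<in> carrier C"
    "\<And>x y. \<lbrakk>x \<in> carrier C; y \<in> carrier C\<rbrakk> \<Longrightarrow> b x y \<in> carrier X"
  shows "g (sweedler K C X b h) = sweedler K C Y (\<lambda>x y. g (b x y)) h"
  unfolding sweedler_eq[OF assms(2,5)]
  by (rule tlift_commute[OF k_coalgebra_module k_coalgebra_module assms(3,4) comult_closed assms(1), OF assms(2,2,2,5,6)])

lemma sweedler_add:
  assumes "k_coalgebra K C" "module K X" "h \<in> carrier C"
    "\<And>x y. \<lbrakk>x \<in> carrier C; y \<in> carrier C\<rbrakk> \<Longrightarrow> b x y \<in> carrier X"
    "\<And>x y. \<lbrakk>x \<in> carrier C; y \<in> carrier C\<rbrakk> \<Longrightarrow> b' x y \<in> carrier X"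
  shows "sweedler K C X (\<lambda>x y. b x y \<oplus>\<^bsub>X\<^esub> b' x y) h = sweedler K C X b h \<oplus>\<^bsub>X\<^esub> sweedler K C X b' h"
  unfolding sweedler_eq[OF assms(1,3)]
  by (rule tlift_add[OF k_coalgebra_module k_coalgebra_module assms(2) comult_closed, OF assms(1,1,1,3,4,5)])

lemma sweedler_swap:
  assumes "k_coalgebra K C" "k_coalgebra K D" "module K X" "h \<in> carrier C" "k \<in> carrier D"
    "\<And>x y u v. \<lbrakk>x \<in> carrier C; y \<in> carrier C; u \<in> carrier D; v \<in> carrier D\<rbrakk> \<Longrightarrow> b x y u v \<in> carrier X"
  shows "sweedler K C X (\<lambda>x y. sweedler K D X (b x y) k) h
    = sweedler K D X (\<lambda>u v. sweedler K C X (\<lambda>x y. b x y u v) h) k"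
  unfolding sweedler_eq[OF assms(1,4)] sweedler_eq[OF assms(2,5)]
  by (rule tlift_swap[OF k_coalgebra_module k_coalgebra_module k_coalgebra_module k_coalgebra_module
      assms(3) comult_closed comult_closed, OF assms(1,1,2,2,1,4,2,5,6)])

lemma k_linear_sweedler_inner:
  assumes "k_coalgebra K C" "module K X" "module K U" "h \<in> carrier C"
    "\<And>x y. \<lbrakk>x \<in> carrier C; y \<in> carrier C\<rbrakk> \<Longrightarrow> k_linear K U X (\<lambda>u. b u x y)"
  shows "k_linear K U X (\<lambda>u. sweedler K C X (b u) h)"
  unfolding sweedler_eq[OF assms(1,4)]
  by (rule k_linear_tlift_inner[OF k_coalgebra_module k_coalgebra_module assms(2,3) comult_closed,
        OF assms(1,1,1,4,5)])

lemma k_linear_sweedler_outer: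
  assumes "k_coalgebra K C" "module K X" "module K U" "k_linear K U C g"
    "\<And>x. x \<in> carrier C \<Longrightarrow> k_linear K C X (b x)"
    "\<And>y. y \<in> carrier C \<Longrightarrow> k_linear K C X (\<lambda>x. b x y)"
  shows "k_linear K U X (\<lambda>u. sweedler K C X b (g u))"
proof -
  have "k_linear K U X (\<lambda>u. tlift K X b (comult C (g u)))"
    by (rule k_linear_tlift_outer[OF k_coalgebra_module k_coalgebra_module assms(2) k_bilinearI
        k_linear_comp[OF k_coalgebra.comult_linear]]) (fact assms)+
  moreover have "k_linear K U X (\<lambda>u. sweedler K C X b (g u))
      = k_linear K U X (\<lambda>u. tlift K X b (comult C (g u)))"
    by (rule k_linear_cong[OF assms(3) sweedler_eq[OF assms(1) k_linear_closed[OF assms(4)]]])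
  ultimately show ?thesis by simp
qed

text \<open>The linear extension \<open>?B\<close> of the trilinear \<open>f\<close> to C \<otimes>
  (C \<otimes> C) is applied to both sides of the coassociativity axiom. Off the carrier both sides
  are the same default value, so the equation is unconditional in \<open>h\<close> and rewrites
  under further sums.\<close>

lemma sweedler_coassoc:
  assumes C: "k_coalgebra K C" and X: "module K X"
    and l1: "\<And>v w. \<lbrakk>v \<in> carrier C; w \<in> carrier C\<rbrakk> \<Longrightarrow> k_linear K C X (\<lambda>u. f u v w)"
    and l2: "\<And>u w. \<lbrakk>u \<in> carrier C; w \<in> carrier C\<rbrakk> \<Longrightarrow> k_linear K C X (\<lambda>v. f u v w)"
    and l3: "\<And>u v. \<lbrakk>u \<in> carrier C; v \<in> carrier C\<rbrakk> \<Longrightarrow> k_linear K C X (f u v)"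
  shows "sweedler K C X (\<lambda>x z. sweedler K C X (\<lambda>u v. f u v z) x) h
    = sweedler K C X (\<lambda>u y. sweedler K C X (f u) y) h"
proof (cases "h \<in> carrier C")
  case h: True
  note M = k_coalgebra_module[OF C]
  note MM = tensor_module[OF M M]
  note MMM = tensor_module[OF M MM]
  let ?B = "\<lambda>u t. tlift K X (f u) t"
  have fb: "k_bilinear K C C X (f u)" if "u \<in> carrier C" for u
    using that l2 l3 by (intro k_bilinearI) auto
  have B: "k_bilinear K C (tensor K C C) X ?B"
    using tlift_linear[OF M M X fb] k_linear_tlift_inner[OF M M X M _ l1]
    by (intro k_bilinearI) auto
  have B': "k_bilinear K C (tensor K C C) X (\<lambda>u. tlift K X (f u))" using B by simp
  note d = comult_closed[OF C]
  note p = pure_closed[OF M MM]  pure_closed[OF M M]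
  have a: "tlift K X ?B (pure K C (tensor K C C) u t) = tlift K X (f u) t"
    if "u \<in> carrier C" "t \<in> carrier (tensor K C C)" for u t
    using tlift_pure[OF M MM X B that] .
  have b: "tlift K X (f u) (pure K C C v w) = f u v w"
    if "u \<in> carrier C" "v \<in> carrier C" "w \<in> carrier C" for u v w
    using tlift_pure[OF M M X fb] that by simp
  have "tlift K X ?B (tlift K (tensor K C (tensor K C C))
        (\<lambda>y z. tlift K (tensor K C (tensor K C C))
          (\<lambda>u v. pure K C (tensor K C C) u (pure K C C v z)) (comult C y)) (comult C h))
    = tlift K X (\<lambda>y z. tlift K X ?B (tlift K (tensor K C (tensor K C C))
          (\<lambda>u v. pure K C (tensor K C C) u (pure K C C v z)) (comult C y))) (comult C h)"
    by (intro tlift_tlift[OF M M M MM X d[OF h] B] tlift_closed[OF M M MMM] d p)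
  also have "\<dots> = tlift K X (\<lambda>y z. tlift K X (\<lambda>u v. f u v z) (comult C y)) (comult C h)"
  proof (rule tlift_cong[OF M M d[OF h]])
    fix y z assume yz: "y \<in> carrier C" "z \<in> carrier C"
    have "tlift K X ?B (tlift K (tensor K C (tensor K C C))
          (\<lambda>u v. pure K C (tensor K C C) u (pure K C C v z)) (comult C y))
      = tlift K X (\<lambda>u v. tlift K X ?B (pure K C (tensor K C C) u (pure K C C v z))) (comult C y)"
      using yz by (intro tlift_tlift[OF M M M MM X d B] p)
    also have "\<dots> = tlift K X (\<lambda>u v. f u v z) (comult C y)"
      using yz by (intro tlift_cong[OF M M d]) (simp_all add: a b p)
    finally show "tlift K X ?B (tlift K (tensor K C (tensor K C C))
          (\<lambda>u v. pure K C (tensor K C C) u (pure K C C v z)) (comult C y))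
      = tlift K X (\<lambda>u v. f u v z) (comult C y)" .
  qed
  finally have 1: "tlift K X ?B (tlift K (tensor K C (tensor K C C))
        (\<lambda>y z. pure K C (tensor K C C) y (comult C z)) (comult C h))
    = tlift K X (\<lambda>y z. tlift K X (\<lambda>u v. f u v z) (comult C y)) (comult C h)"
    using k_coalgebra.coassoc[OF C h] by simp
  have "tlift K X ?B (tlift K (tensor K C (tensor K C C))
        (\<lambda>y z. pure K C (tensor K C C) y (comult C z)) (comult C h))
    = tlift K X (\<lambda>y z. tlift K X ?B (pure K C (tensor K C C) y (comult C z))) (comult C h)"
    by (intro tlift_tlift[OF M M M MM X d[OF h] B] p d)
  also have "\<dots> = tlift K X (\<lambda>y z. tlift K X (f y) (comult C z)) (comult C h)"
    by (intro tlift_cong[OF M M d[OF h]]) (simp add: a d)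
  finally show ?thesis using 1 h by (simp add: sweedler_eq[OF C])
qed (simp add: sweedler_def)

lemma sweedler_counit_left:
  assumes C: "k_coalgebra K C" and X: "module K X" and g: "k_linear K C X g" and h: "h \<in> carrier C"
  shows "sweedler K C X (\<lambda>x y. counit C x \<odot>\<^bsub>X\<^esub> g y) h = g h"
proof -
  interpret k_coalgebra K C by fact
  note e = k_linear_closed[OF counit_linear, unfolded scalars_def, simplified]
  have "g (sweedler K C C (\<lambda>x y. counit C x \<odot>\<^bsub>C\<^esub> y) h)
    = sweedler K C X (\<lambda>x y. g (counit C x \<odot>\<^bsub>C\<^esub> y)) h"
    using sweedler_commute[OF g C k_coalgebra_module[OF C] X h] e by simp
  then show ?thesis using counit_left[OF h] e k_linear_smult[OF g] h by (simp add: sweedler_eq[OF C h])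
qed

lemma sweedler_counit_right:
  assumes C: "k_coalgebra K C" and X: "module K X" and g: "k_linear K C X g" and h: "h \<in> carrier C"
  shows "sweedler K C X (\<lambda>x y. counit C y \<odot>\<^bsub>X\<^esub> g x) h = g h"
proof -
  interpret k_coalgebra K C by fact
  note e = k_linear_closed[OF counit_linear, unfolded scalars_def, simplified]
  have "g (sweedler K C C (\<lambda>x y. counit C y \<odot>\<^bsub>C\<^esub> x) h)
    = sweedler K C X (\<lambda>x y. g (counit C y \<odot>\<^bsub>C\<^esub> x)) h"
    using sweedler_commute[OF g C k_coalgebra_module[OF C] X h] e by simp
  then show ?thesis using counit_right[OF h] e k_linear_smult[OF g] h by (simp add: sweedler_eq[OF C h])
qed

lemma tlift_sweedler:
  assumes "k_coalgebra K C" "module K V" "module K W" "module K X" "k_bilinear K V W X b" "h \<in> carrier C"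
    "\<And>x y. \<lbrakk>x \<in> carrier C; y \<in> carrier C\<rbrakk> \<Longrightarrow> d x y \<in> carrier (tensor K V W)"
  shows "tlift K X b (sweedler K C (tensor K V W) d h) = sweedler K C X (\<lambda>x y. tlift K X b (d x y)) h"
  by (rule sweedler_commute[OF tlift_linear[OF assms(2-5)] assms(1) tensor_module[OF assms(2,3)] assms(4,6,7)])

lemma tlift_sweedler_pure:
  assumes "k_coalgebra K C" "module K V" "module K W" "module K X" "k_bilinear K V W X b" "h \<in> carrier C"
    "\<And>x y. \<lbrakk>x \<in> carrier C; y \<in> carrier C\<rbrakk> \<Longrightarrow> p x y \<in> carrier V"
    "\<And>x y. \<lbrakk>x \<in> carrier C; y \<in> carrier C\<rbrakk> \<Longrightarrow> q x y \<in> carrier W"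
  shows "tlift K X b (sweedler K C (tensor K V W) (\<lambda>x y. pure K V W (p x y) (q x y)) h)
    = sweedler K C X (\<lambda>x y. b (p x y) (q x y)) h"
  by (subst tlift_sweedler[OF assms(1-6)])
    (simp_all add: pure_closed[OF assms(2,3)] tlift_pure[OF assms(2-5)] assms(7,8))

text \<open>Change of the index coalgebra: it suffices to know the coproduct of \<open>c\<close> as
  a sum over the coproduct of \<open>h\<close>. This serves for the projection \<open>p\<close> and
  for the antipode, where the two legs change places.\<close>

lemma sweedler_transfer:
  assumes "k_coalgebra K C" "k_coalgebra K D" "module K X" "c \<in> carrier C" "h \<in> carrier D"
    and "comult C c = sweedler K D (tensor K C C) (\<lambda>x y. pure K C C (p x y) (q x y)) h"
    and "\<And>x. x \<in> carrier C \<Longrightarrow> k_linear K C X (b x)"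
    and "\<And>y. y \<in> carrier C \<Longrightarrow> k_linear K C X (\<lambda>x. b x y)"
    and "\<And>x y. \<lbrakk>x \<in> carrier D; y \<in> carrier D\<rbrakk> \<Longrightarrow> p x y \<in> carrier C"
    and "\<And>x y. \<lbrakk>x \<in> carrier D; y \<in> carrier D\<rbrakk> \<Longrightarrow> q x y \<in> carrier C"
  shows "sweedler K C X b c = sweedler K D X (\<lambda>x y. b (p x y) (q x y)) h"
  using tlift_sweedler_pure[OF assms(2) k_coalgebra_module k_coalgebra_module assms(3) k_bilinearI assms(5),
      OF assms(1,1) assms(7-10)] assms(1,4,6) by (simp add: sweedler_eq)

lemma comult3_eq:
  assumes C: "k_coalgebra K C" and h: "h \<in> carrier C"
  shows "comult3 K C X f h = sweedler K C X (\<lambda>x h3. sweedler K C X (\<lambda>h1 h2. f h1 h2 h3) x) h"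
proof -
  have "sweedler K C X (\<lambda>x h3. sweedler K C X (\<lambda>h1 h2. f h1 h2 h3) x) h
    = sweedler K C X (\<lambda>x h3. tlift K X (\<lambda>h1 h2. f h1 h2 h3) (comult C x)) h"
    by (rule sweedler_cong[THEN fun_cong]) (simp add: sweedler_eq[OF C])
  then show ?thesis using h by (simp add: comult3_def sweedler_eq[OF C])
qed

section \<open>Convolution of linear maps from a coalgebra to an algebra\<close>

definition convolution ::
    "('k, 'l) ring_scheme \<Rightarrow> ('k, 'c, 'm) bialg_scheme \<Rightarrow> ('k, 'x, 'n) module_scheme \<Rightarrow>
     ('c \<Rightarrow> 'x) \<Rightarrow> ('c \<Rightarrow> 'x) \<Rightarrow> 'c \<Rightarrow> 'x"
  where "convolution K C B f g h = sweedler K C B (\<lambda>x y. f x \<otimes>\<^bsub>B\<^esub> g y) h"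

definition conv_unit ::
    "('k, 'c, 'm) bialg_scheme \<Rightarrow> ('k, 'x, 'n) module_scheme \<Rightarrow> 'c \<Rightarrow> 'x"
  where "conv_unit C B h = counit C h \<odot>\<^bsub>B\<^esub> \<one>\<^bsub>B\<^esub>"

lemma convolution_cong [cong]:
  assumes "\<And>x. x \<in> carrier C \<Longrightarrow> f x = f' x" "\<And>x. x \<in> carrier C \<Longrightarrow> g x = g' x"
  shows "convolution K C B f g = convolution K C B f' g'"
  using assms by (intro ext) (simp add: convolution_def)

lemma convolution_linear:
  assumes "k_coalgebra K C" "k_algebra K B" "k_linear K C B f" "k_linear K C B g"
  shows "k_linear K C B (convolution K C B f g)"
  unfolding convolution_def[abs_def]
  by (rule k_linear_sweedler_outer[OF assms(1) k_algebra_module k_coalgebra_module k_linear_id])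
    (auto intro: k_linear_mult_left k_linear_mult_right assms k_linear_closed)

lemma conv_unit_linear:
  assumes "k_coalgebra K C" "k_algebra K B" shows "k_linear K C B (conv_unit C B)"
proof -
  interpret C: k_coalgebra K C by fact
  interpret B: k_algebra K B by fact
  show ?thesis unfolding conv_unit_def[abs_def]
    by (rule k_linear_scalar_smult) (auto intro: C.counit_linear B.module_axioms)
qed

lemma convolution_assoc:
  assumes C: "k_coalgebra K C" and B: "k_algebra K B"
    and l: "k_linear K C B f" "k_linear K C B g" "k_linear K C B k"
  shows "convolution K C B (convolution K C B f g) k = convolution K C B f (convolution K C B g k)"
proof
  fix h
  interpret B: k_algebra K B by fact
  note M = k_algebra_module[OF B]
  note c = k_linear_closed[OF l(1)] k_linear_closed[OF l(2)] k_linear_closed[OF l(3)]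
  note lin = k_linear_mult_left[OF B] k_linear_mult_right[OF B] k_linear_id
  have "convolution K C B (convolution K C B f g) k h
    = sweedler K C B (\<lambda>x z. sweedler K C B (\<lambda>u v. f u \<otimes>\<^bsub>B\<^esub> g v \<otimes>\<^bsub>B\<^esub> k z) x) h"
    unfolding convolution_def
    by (intro sweedler_cong[THEN fun_cong] sweedler_commute[OF _ C M M])
      (simp_all add: c lin)
  also have "\<dots> = sweedler K C B (\<lambda>u y. sweedler K C B (\<lambda>v z. f u \<otimes>\<^bsub>B\<^esub> g v \<otimes>\<^bsub>B\<^esub> k z) y) h"
    by (rule sweedler_coassoc[OF C M]) (simp_all add: c lin l)
  also have "\<dots> = sweedler K C B (\<lambda>u y. sweedler K C B (\<lambda>v z. f u \<otimes>\<^bsub>B\<^esub> (g v \<otimes>\<^bsub>B\<^esub> k z)) y) h"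
    by (simp add: c B.m_assoc)
  also have "\<dots> = convolution K C B f (convolution K C B g k) h"
    unfolding convolution_def
    by (intro sweedler_cong[THEN fun_cong] sweedler_commute[OF _ C M M, symmetric])
      (simp_all add: c lin)
  finally show "convolution K C B (convolution K C B f g) k h
    = convolution K C B f (convolution K C B g k) h" .
qed

lemma conv_unit_left:
  assumes "k_coalgebra K C" "k_algebra K B" "k_linear K C B g" "h \<in> carrier C"
  shows "convolution K C B (conv_unit C B) g h = g h"
proof -
  interpret C: k_coalgebra K C by fact
  interpret B: k_algebra K B by fact
  note e = k_linear_closed[OF C.counit_linear, unfolded scalars_def, simplified]
  show ?thesis
    using sweedler_counit_left[OF assms(1) B.module_axioms assms(3,4)] k_linear_closed[OF assms(3)] e
    by (simp add: convolution_def conv_unit_def B.smult_mult_left)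
qed

lemma conv_unit_right:
  assumes "k_coalgebra K C" "k_algebra K B" "k_linear K C B g" "h \<in> carrier C"
  shows "convolution K C B g (conv_unit C B) h = g h"
proof -
  interpret C: k_coalgebra K C by fact
  interpret B: k_algebra K B by fact
  note e = k_linear_closed[OF C.counit_linear, unfolded scalars_def, simplified]
  show ?thesis
    using sweedler_counit_right[OF assms(1) B.module_axioms assms(3,4)] k_linear_closed[OF assms(3)] e
    by (simp add: convolution_def conv_unit_def B.smult_mult_right)
qed

lemma convolution_closed:
  assumes "k_coalgebra K C" "k_algebra K B" "k_linear K C B f" "k_linear K C B g" "h \<in> carrier C"
  shows "convolution K C B f g h \<in> carrier B"
  by (rule k_linear_closed[OF convolution_linear[OF assms(1-4)] assms(5)])

text \<open>Associativity moves \<open>p\<close> next to its right inverse \<open>q\<close>. Most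
  later identities are brought to this form, \<open>p\<close> and \<open>q\<close> being an algebra
  map and its composite with an antipode in one order or the other, so that iterated Sweedler sums
  rarely have to be written out.\<close>

lemma convolution_cancel_left:
  assumes C: "k_coalgebra K C" and B: "k_algebra K B"
    and l: "k_linear K C B p" "k_linear K C B q" "k_linear K C B g"
    and e: "\<And>x. x \<in> carrier C \<Longrightarrow> convolution K C B p q x = conv_unit C B x"
    and h: "h \<in> carrier C"
  shows "convolution K C B p (convolution K C B q g) h = g h"
proof -
  have "convolution K C B p (convolution K C B q g) h = convolution K C B (convolution K C B p q) g h"
    using convolution_assoc[OF C B l] by simp
  also have "\<dots> = convolution K C B (conv_unit C B) g h" by (simp add: e cong: convolution_cong)
  finally show ?thesis using conv_unit_left[OF C B l(3) h] by simp
qed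

text \<open>In a monoid a left inverse and a right inverse of the same element agree; here the
  monoid is that of linear maps under convolution.\<close>

lemma convolution_inverse_unique:
  assumes C: "k_coalgebra K C" and B: "k_algebra K B"
    and l: "k_linear K C B p" "k_linear K C B q" "k_linear K C B g"
    and e: "\<And>x. x \<in> carrier C \<Longrightarrow> convolution K C B p q x = conv_unit C B x"
    and e': "\<And>x. x \<in> carrier C \<Longrightarrow> convolution K C B q g x = conv_unit C B x"
    and h: "h \<in> carrier C"
  shows "p h = g h"
proof -
  have "g h = convolution K C B p (convolution K C B q g) h"
    using convolution_cancel_left[OF C B l e h] by simp
  also have "\<dots> = convolution K C B p (conv_unit C B) h" by (simp add: e' cong: convolution_cong)
  finally show ?thesis using conv_unit_right[OF C B l(1) h] by simp
qed

definition algebra_hom ::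
    "('k, 'l) ring_scheme \<Rightarrow> ('k, 'a, 'm) module_scheme \<Rightarrow> ('k, 'b, 'n) module_scheme \<Rightarrow> ('a \<Rightarrow> 'b) \<Rightarrow> bool"
  where "algebra_hom K A B f \<longleftrightarrow> k_linear K A B f
    \<and> (\<forall>x \<in> carrier A. \<forall>y \<in> carrier A. f (x \<otimes>\<^bsub>A\<^esub> y) = f x \<otimes>\<^bsub>B\<^esub> f y) \<and> f \<one>\<^bsub>A\<^esub> = \<one>\<^bsub>B\<^esub>"

lemma algebra_homD:
  assumes "algebra_hom K A B f"
  shows "k_linear K A B f" "x \<in> carrier A \<Longrightarrow> f x \<in> carrier B"
    "\<lbrakk>x \<in> carrier A; y \<in> carrier A\<rbrakk> \<Longrightarrow> f (x \<otimes>\<^bsub>A\<^esub> y) = f x \<otimes>\<^bsub>B\<^esub> f y" "f \<one>\<^bsub>A\<^esub> = \<one>\<^bsub>B\<^esub>"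
  using assms k_linear_closed[of K A B f x] by (simp_all add: algebra_hom_def)

lemma algebra_hom_comp:
  assumes f: "algebra_hom K B D f" and g: "algebra_hom K A B g"
  shows "algebra_hom K A D (\<lambda>x. f (g x))"
  using k_linear_comp[OF algebra_homD(1)[OF f] algebra_homD(1)[OF g]] algebra_homD(2-)[OF f]
    algebra_homD(2-)[OF g] by (simp add: algebra_hom_def)

lemma algebra_hom_convolution:
  assumes "algebra_hom K B D \<phi>" "k_algebra K B" "k_algebra K D" "k_coalgebra K C"
    "k_linear K C B f" "k_linear K C B g" "h \<in> carrier C"
  shows "\<phi> (convolution K C B f g h) = convolution K C D (\<lambda>x. \<phi> (f x)) (\<lambda>x. \<phi> (g x)) h"
proof -
  interpret B: k_algebra K B by fact
  note c = k_linear_closed[OF assms(5)] k_linear_closed[OF assms(6)]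
  have "\<phi> (sweedler K C B (\<lambda>x y. f x \<otimes>\<^bsub>B\<^esub> g y) h) = sweedler K C D (\<lambda>x y. \<phi> (f x \<otimes>\<^bsub>B\<^esub> g y)) h"
    by (rule sweedler_commute[OF algebra_homD(1)[OF assms(1)] assms(4) k_algebra_module
        k_algebra_module assms(7), OF assms(2,3)]) (simp add: c)
  then show ?thesis by (simp add: convolution_def c algebra_homD(3)[OF assms(1)])
qed

section \<open>The tensor product of two algebras\<close>

text \<open>\<open>tensor\<close> leaves the fields \<open>mult\<close> and \<open>one\<close>
  without meaning. Overwriting just these two keeps carrier, addition and scalars, so linearity and
  \<open>tlift\<close> for the algebra are literally those of the tensor product.\<close>

definition tensor_algebra ::
    "('k, 'l) ring_scheme \<Rightarrow> ('k, 'a, 'm) module_scheme \<Rightarrow> ('k, 'b, 'n) module_scheme \<Rightarrow>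
     ('k, ('a \<times> 'b \<Rightarrow> 'k) set) module"
  where "tensor_algebra K A B = (tensor K A B)\<lparr>mult := tensor_mult K A B, one := pure K A B \<one>\<^bsub>A\<^esub> \<one>\<^bsub>B\<^esub>\<rparr>"

lemma tensor_algebra_sel:
  "carrier (tensor_algebra K A B) = carrier (tensor K A B)"
  "add (tensor_algebra K A B) = add (tensor K A B)"
  "zero (tensor_algebra K A B) = zero (tensor K A B)"
  "smult (tensor_algebra K A B) = smult (tensor K A B)"
  "mult (tensor_algebra K A B) = tensor_mult K A B"
  "one (tensor_algebra K A B) = pure K A B \<one>\<^bsub>A\<^esub> \<one>\<^bsub>B\<^esub>"
  by (simp_all add: tensor_algebra_def)

lemma tlift_target_cong:
  assumes "carrier X = carrier Y" "add X = add Y" "zero X = zero Y" "smult X = smult Y"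
  shows "tlift K X = tlift K Y"
  unfolding tlift_def finsum_def finprod_def Let_def using assms by (intro ext) (simp add: comp_def)

lemma tlift_tensor_algebra: "tlift K (tensor_algebra K A B) = tlift K (tensor K A B)"
  by (rule tlift_target_cong) (simp_all add: tensor_algebra_sel)

lemma sweedler_tensor_algebra: "sweedler K C (tensor_algebra K A B) = sweedler K C (tensor K A B)"
  by (intro ext) (simp add: sweedler_def tlift_tensor_algebra)

lemma k_linear_tensor_algebra:
  "k_linear K V (tensor_algebra K A B) = k_linear K V (tensor K A B)"
  "k_linear K (tensor_algebra K A B) W = k_linear K (tensor K A B) W"
  by (intro ext; simp add: k_linear_def tensor_algebra_sel)+

lemma tensor_mult_bilinear:
  assumes A: "k_algebra K A" and B: "k_algebra K B"
  shows "k_bilinear K (tensor K A B) (tensor K A B) (tensor K A B) (tensor_mult K A B)"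
proof -
  interpret A: k_algebra K A by fact
  interpret B: k_algebra K B by fact
  note M = k_algebra_module[OF A] k_algebra_module[OF B]
  note T = tensor_module[OF M]
  note lin = k_linear_mult_left[OF A] k_linear_mult_right[OF A] k_linear_mult_left[OF B]
    k_linear_mult_right[OF B] k_linear_pure_left[OF M] k_linear_pure_right[OF M] k_linear_id
  have b1: "k_bilinear K A B (tensor K A B) (\<lambda>a' b'. pure K A B (a \<otimes>\<^bsub>A\<^esub> a') (b \<otimes>\<^bsub>B\<^esub> b'))"
    if "a \<in> carrier A" "b \<in> carrier B" for a b
    using that by (auto intro!: k_bilinearI lin)
  have b2: "k_bilinear K A B (tensor K A B)
      (\<lambda>a b. tlift K (tensor K A B) (\<lambda>a' b'. pure K A B (a \<otimes>\<^bsub>A\<^esub> a') (b \<otimes>\<^bsub>B\<^esub> b')) Y)"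
    if "Y \<in> carrier (tensor K A B)" for Y
    using that by (auto intro!: k_bilinearI k_linear_tlift_inner[OF M T] lin M)
  show ?thesis
  proof (rule k_bilinearI)
    fix X assume X: "X \<in> carrier (tensor K A B)"
    show "k_linear K (tensor K A B) (tensor K A B) (tensor_mult K A B X)"
      unfolding tensor_mult_def[abs_def]
      by (rule k_linear_tlift_inner[OF M T T X]) (rule k_linear_tlift_outer[OF M T b1 k_linear_id])
  next
    fix Y assume Y: "Y \<in> carrier (tensor K A B)"
    show "k_linear K (tensor K A B) (tensor K A B) (\<lambda>X. tensor_mult K A B X Y)"
      unfolding tensor_mult_def by (rule k_linear_tlift_outer[OF M T b2[OF Y] k_linear_id])
  qed
qed

lemma tensor_mult_pure:
  assumes A: "k_algebra K A" and B: "k_algebra K B"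
    and c: "a \<in> carrier A" "b \<in> carrier B" "a' \<in> carrier A" "b' \<in> carrier B"
  shows "tensor_mult K A B (pure K A B a b) (pure K A B a' b') = pure K A B (a \<otimes>\<^bsub>A\<^esub> a') (b \<otimes>\<^bsub>B\<^esub> b')"
proof -
  interpret A: k_algebra K A by fact
  interpret B: k_algebra K B by fact
  note M = k_algebra_module[OF A] k_algebra_module[OF B]
  note T = tensor_module[OF M]
  note lin = k_linear_mult_left[OF A] k_linear_mult_right[OF A] k_linear_mult_left[OF B]
    k_linear_mult_right[OF B] k_linear_pure_left[OF M] k_linear_pure_right[OF M] k_linear_id
  have b1: "k_bilinear K A B (tensor K A B) (\<lambda>a' b'. pure K A B (a \<otimes>\<^bsub>A\<^esub> a') (b \<otimes>\<^bsub>B\<^esub> b'))"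
    if "a \<in> carrier A" "b \<in> carrier B" for a b
    using that by (auto intro!: k_bilinearI lin)
  have b2: "k_bilinear K A B (tensor K A B)
      (\<lambda>a b. tlift K (tensor K A B) (\<lambda>a' b'. pure K A B (a \<otimes>\<^bsub>A\<^esub> a') (b \<otimes>\<^bsub>B\<^esub> b')) Y)"
    if "Y \<in> carrier (tensor K A B)" for Y
    using that by (auto intro!: k_bilinearI k_linear_tlift_inner[OF M T] lin M)
  show ?thesis unfolding tensor_mult_def
    by (subst tlift_pure[OF M T b2]) (simp_all add: c pure_closed[OF M] tlift_pure[OF M T b1])
qed

text \<open>Associativity is trilinear, so it is checked on pure tensors by extending one argument
  at a time; each unit law takes a single such extension.\<close>

lemma tensor_algebra_algebra:
  assumes A: "k_algebra K A" and B: "k_algebra K B"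
  shows "k_algebra K (tensor_algebra K A B)"
proof -
  interpret A: k_algebra K A by fact
  interpret B: k_algebra K B by fact
  note M = k_algebra_module[OF A] k_algebra_module[OF B]
  note T = tensor_module[OF M]
  interpret T: module K "tensor K A B" by (rule T)
  let ?T = "tensor K A B" and ?m = "tensor_mult K A B" and ?p = "pure K A B"
  note bil = tensor_mult_bilinear[OF A B]
  have ml: "k_linear K V ?T (\<lambda>v. ?m (f v) t)" if "k_linear K V ?T f" "t \<in> carrier ?T"
    for V :: "('a, 'v, 'w) module_scheme" and f t
    using k_linear_comp[OF _ that(1), of ?T "\<lambda>u. ?m u t"] bil that(2) by (simp add: k_bilinear_def)
  have mr: "k_linear K V ?T (\<lambda>v. ?m t (f v))" if "k_linear K V ?T f" "t \<in> carrier ?T"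
    for V :: "('a, 'v, 'w) module_scheme" and f t
    using k_linear_comp[OF _ that(1), of ?T "?m t"] bil that(2) by (simp add: k_bilinear_def)
  note mc = k_bilinear_closed[OF bil]
  note mp = tensor_mult_pure[OF A B] and pc = pure_closed[OF M]
  have assoc: "?m (?m X Y) Z = ?m X (?m Y Z)"
    if X: "X \<in> carrier ?T" and Y: "Y \<in> carrier ?T" and Z: "Z \<in> carrier ?T" for X Y Z
  proof (rule tensor_ext[OF M T X])
    show "k_linear K ?T ?T (\<lambda>X. ?m (?m X Y) Z)" "k_linear K ?T ?T (\<lambda>X. ?m X (?m Y Z))"
      using Y Z by (simp_all add: ml k_linear_id mc)
    fix a b assume ab: "a \<in> carrier A" "b \<in> carrier B"
    show "?m (?m (?p a b) Y) Z = ?m (?p a b) (?m Y Z)"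
    proof (rule tensor_ext[OF M T Y])
      show "k_linear K ?T ?T (\<lambda>Y. ?m (?m (?p a b) Y) Z)" "k_linear K ?T ?T (\<lambda>Y. ?m (?p a b) (?m Y Z))"
        using ab Z by (simp_all add: ml mr k_linear_id mc pc)
      fix a' b' assume ab': "a' \<in> carrier A" "b' \<in> carrier B"
      show "?m (?m (?p a b) (?p a' b')) Z = ?m (?p a b) (?m (?p a' b') Z)"
      proof (rule tensor_ext[OF M T Z])
        show "k_linear K ?T ?T (?m (?m (?p a b) (?p a' b')))"
          "k_linear K ?T ?T (\<lambda>Y. ?m (?p a b) (?m (?p a' b') Y))"
          using ab ab' mr[OF k_linear_id, of "?m (?p a b) (?p a' b')"] by (simp_all add: mr k_linear_id mc pc)
      qed (use ab ab' in \<open>simp add: mp A.m_assoc B.m_assoc\<close>)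
    qed
  qed
  have one: "?m (?p \<one>\<^bsub>A\<^esub> \<one>\<^bsub>B\<^esub>) X = X" "?m X (?p \<one>\<^bsub>A\<^esub> \<one>\<^bsub>B\<^esub>) = X" if X: "X \<in> carrier ?T" for X
  proof -
    show "?m (?p \<one>\<^bsub>A\<^esub> \<one>\<^bsub>B\<^esub>) X = X"
      by (rule tensor_ext[OF M T X mr[OF k_linear_id] k_linear_id]) (simp_all add: mp pc)
    show "?m X (?p \<one>\<^bsub>A\<^esub> \<one>\<^bsub>B\<^esub>) = X"
      by (rule tensor_ext[OF M T X ml[OF k_linear_id] k_linear_id]) (simp_all add: mp pc)
  qed
  let ?A = "tensor_algebra K A B"
  have AT: "module K ?A"
  proof (rule moduleI)
    show "abelian_group ?A"
    proof (rule abelian_groupI)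
      fix x assume "x \<in> carrier ?A"
      then show "\<exists>y\<in>carrier ?A. y \<oplus>\<^bsub>?A\<^esub> x = \<zero>\<^bsub>?A\<^esub>"
        by (intro bexI[of _ "\<ominus>\<^bsub>?T\<^esub> x"]) (auto simp: tensor_algebra_sel T.l_neg)
    qed (auto simp: tensor_algebra_sel T.a_ac)
  qed (auto simp: tensor_algebra_sel T.smult_l_distr T.smult_r_distr T.smult_assoc1 A.is_cring)
  interpret AT: module K ?A by (rule AT)
  show ?thesis
  proof (rule k_algebra.intro[OF A.field_axioms AT _ k_algebra_axioms.intro])
    show "ring ?A"
    proof (rule ringI)
      show "monoid ?A" by (rule monoidI) (auto simp: tensor_algebra_sel mc pc assoc one)
    qed (auto simp: tensor_algebra_sel k_linear_add[OF ml[OF k_linear_id]] k_linear_add[OF mr[OF k_linear_id]]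
        intro: AT.abelian_group_axioms)
  qed (simp_all add: tensor_algebra_sel k_linear_smult[OF ml[OF k_linear_id]] k_linear_smult[OF mr[OF k_linear_id]])
qed

lemma algebra_hom_pure_left:
  assumes A: "k_algebra K A" and B: "k_algebra K B"
  shows "algebra_hom K A (tensor_algebra K A B) (\<lambda>a. pure K A B a \<one>\<^bsub>B\<^esub>)"
proof -
  interpret A: k_algebra K A by fact
  interpret B: k_algebra K B by fact
  note M = k_algebra_module[OF A] k_algebra_module[OF B]
  show ?thesis unfolding algebra_hom_def
    by (auto simp: tensor_algebra_sel k_linear_tensor_algebra tensor_mult_pure[OF A B]
        intro!: k_linear_pure_left[OF M] k_linear_id)
qed

lemma algebra_hom_pure_right:
  assumes A: "k_algebra K A" and B: "k_algebra K B"
  shows "algebra_hom K B (tensor_algebra K A B) (\<lambda>b. pure K A B \<one>\<^bsub>A\<^esub> b)"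
proof -
  interpret A: k_algebra K A by fact
  interpret B: k_algebra K B by fact
  note M = k_algebra_module[OF A] k_algebra_module[OF B]
  have l: "k_linear K B (tensor K A B) (pure K A B \<one>\<^bsub>A\<^esub>)"
    using k_linear_pure_right[OF M k_linear_id, of "\<one>\<^bsub>A\<^esub>"] by simp
  show ?thesis unfolding algebra_hom_def
    by (auto simp: tensor_algebra_sel k_linear_tensor_algebra tensor_mult_pure[OF A B] l)
qed

section \<open>Bialgebras and antipodes\<close>

lemma bialgebra_coalgebra: "bialgebra K A \<Longrightarrow> k_coalgebra K A"
  and bialgebra_algebra: "bialgebra K A \<Longrightarrow> k_algebra K A"
  by (simp_all add: bialgebra_def)

lemma comult_algebra_hom:
  assumes "bialgebra K A" shows "algebra_hom K A (tensor_algebra K A A) (comult A)"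
proof -
  interpret bialgebra K A by fact
  show ?thesis unfolding algebra_hom_def
    by (auto simp: tensor_algebra_sel k_linear_tensor_algebra comult_linear comult_mult comult_one)
qed

text \<open>The tensor a1 \<otimes> a2 is the product of a1 \<otimes> 1 and 1 \<otimes> a2. In this
  form \<Delta> takes part in cancellations against convolution inverses.\<close>

lemma comult_convolution:
  assumes "bialgebra K A" and h: "h \<in> carrier A"
  shows "comult A h = convolution K A (tensor_algebra K A A)
    (\<lambda>a. pure K A A a \<one>\<^bsub>A\<^esub>) (\<lambda>b. pure K A A \<one>\<^bsub>A\<^esub> b) h"
proof -
  interpret bialgebra K A by fact
  note A = bialgebra_algebra[OF assms(1)] and C = bialgebra_coalgebra[OF assms(1)]
  note M = k_algebra_module[OF A]
  have "convolution K A (tensor_algebra K A A) (\<lambda>a. pure K A A a \<one>\<^bsub>A\<^esub>) (\<lambda>b. pure K A A \<one>\<^bsub>A\<^esub> b) h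
    = sweedler K A (tensor K A A) (pure K A A) h"
    by (simp add: convolution_def tensor_algebra_sel sweedler_tensor_algebra tensor_mult_pure[OF A A]
        cong: sweedler_cong)
  also have "\<dots> = comult A h"
    using tensor_expand[OF M M comult_closed[OF C h]] by (simp add: sweedler_eq[OF C h])
  finally show ?thesis by simp
qed

lemma sweedler_mult:
  assumes "bialgebra K A" "module K X" "x \<in> carrier A" "y \<in> carrier A"
    and b1: "\<And>x. x \<in> carrier A \<Longrightarrow> k_linear K A X (b x)"
    and b2: "\<And>y. y \<in> carrier A \<Longrightarrow> k_linear K A X (\<lambda>x. b x y)"
  shows "sweedler K A X b (x \<otimes>\<^bsub>A\<^esub> y)
    = sweedler K A X (\<lambda>x1 x2. sweedler K A X (\<lambda>y1 y2. b (x1 \<otimes>\<^bsub>A\<^esub> y1) (x2 \<otimes>\<^bsub>A\<^esub> y2)) y) x"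
proof -
  interpret bialgebra K A by fact
  note A = bialgebra_algebra[OF assms(1)] and C = bialgebra_coalgebra[OF assms(1)]
  note M = k_algebra_module[OF A]
  have b: "k_bilinear K A A X b" using b1 b2 by (rule k_bilinearI)
  have e: "comult A (x \<otimes>\<^bsub>A\<^esub> y) = sweedler K A (tensor K A A) (\<lambda>x1 x2.
      sweedler K A (tensor K A A) (\<lambda>y1 y2. pure K A A (x1 \<otimes>\<^bsub>A\<^esub> y1) (x2 \<otimes>\<^bsub>A\<^esub> y2)) y) x"
    using assms by (simp add: comult_mult tensor_mult_def sweedler_eq[OF C])
  have "sweedler K A X b (x \<otimes>\<^bsub>A\<^esub> y) = tlift K X b (comult A (x \<otimes>\<^bsub>A\<^esub> y))"
    using assms by (simp add: sweedler_eq[OF C])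
  also have "\<dots> = sweedler K A X (\<lambda>x1 x2. tlift K X b
      (sweedler K A (tensor K A A) (\<lambda>y1 y2. pure K A A (x1 \<otimes>\<^bsub>A\<^esub> y1) (x2 \<otimes>\<^bsub>A\<^esub> y2)) y)) x"
    unfolding e using assms
    by (intro tlift_sweedler[OF C M M _ b] sweedler_closed[OF C tensor_module[OF M M]] pure_closed[OF M M]) auto
  also have "\<dots> = sweedler K A X (\<lambda>x1 x2. sweedler K A X (\<lambda>y1 y2. b (x1 \<otimes>\<^bsub>A\<^esub> y1) (x2 \<otimes>\<^bsub>A\<^esub> y2)) y) x"
    using assms
    by (intro sweedler_cong[THEN fun_cong] tlift_sweedler_pure[OF C M M _ b]) auto
  finally show ?thesis .
qed

lemma sweedler_one:
  assumes "bialgebra K A" "module K X"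
    and b1: "\<And>x. x \<in> carrier A \<Longrightarrow> k_linear K A X (b x)"
    and b2: "\<And>y. y \<in> carrier A \<Longrightarrow> k_linear K A X (\<lambda>x. b x y)"
  shows "sweedler K A X b \<one>\<^bsub>A\<^esub> = b \<one>\<^bsub>A\<^esub> \<one>\<^bsub>A\<^esub>"
proof -
  interpret bialgebra K A by fact
  note A = bialgebra_algebra[OF assms(1)] and C = bialgebra_coalgebra[OF assms(1)]
  note M = k_algebra_module[OF A]
  show ?thesis
    using tlift_pure[OF M M assms(2) k_bilinearI[OF b1 b2]] by (simp add: sweedler_eq[OF C] comult_one)
qed

context hopf_algebra
begin

lemma bialg: "bialgebra K H" and alg: "k_algebra K H" and coalg: "k_coalgebra K H"
  and modH: "module K H"
  by (simp_all add: bialgebra_axioms k_algebra_axioms k_coalgebra_axioms module_axioms)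

lemma S_closed: "x \<in> carrier H \<Longrightarrow> S x \<in> carrier H"
  by (rule k_linear_closed[OF antipode_linear])

lemma counit_closed: "x \<in> carrier H \<Longrightarrow> counit H x \<in> carrier K"
  using k_linear_closed[OF counit_linear] by (simp add: scalars_def)

lemma antipode_conv_left:
  assumes "algebra_hom K H B \<phi>" "k_algebra K B" "h \<in> carrier H"
  shows "convolution K H B (\<lambda>x. \<phi> (S x)) \<phi> h = conv_unit H B h"
proof -
  have "convolution K H H S (\<lambda>x. x) h = counit H h \<odot>\<^bsub>H\<^esub> \<one>\<^bsub>H\<^esub>"
    using antipode_left[OF assms(3)] assms(3) by (simp add: convolution_def sweedler_eq[OF coalg])
  then show ?thesis
    using algebra_hom_convolution[OF assms(1) alg assms(2) coalg antipode_linear k_linear_id assms(3)]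
      algebra_homD[OF assms(1)] k_linear_smult[OF algebra_homD(1)[OF assms(1)]] assms(3)
    by (simp add: conv_unit_def counit_closed)
qed

lemma antipode_conv_right:
  assumes "algebra_hom K H B \<phi>" "k_algebra K B" "h \<in> carrier H"
  shows "convolution K H B \<phi> (\<lambda>x. \<phi> (S x)) h = conv_unit H B h"
proof -
  have "convolution K H H (\<lambda>x. x) S h = counit H h \<odot>\<^bsub>H\<^esub> \<one>\<^bsub>H\<^esub>"
    using antipode_right[OF assms(3)] assms(3) by (simp add: convolution_def sweedler_eq[OF coalg])
  then show ?thesis
    using algebra_hom_convolution[OF assms(1) alg assms(2) coalg k_linear_id antipode_linear assms(3)]
      algebra_homD[OF assms(1)] k_linear_smult[OF algebra_homD(1)[OF assms(1)]] assms(3)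
    by (simp add: conv_unit_def counit_closed)
qed

lemma antipode_one: "S \<one>\<^bsub>H\<^esub> = \<one>\<^bsub>H\<^esub>"
proof -
  have "sweedler K H H (\<lambda>y z. S y \<otimes>\<^bsub>H\<^esub> z) \<one>\<^bsub>H\<^esub> = S \<one>\<^bsub>H\<^esub> \<otimes>\<^bsub>H\<^esub> \<one>\<^bsub>H\<^esub>"
    by (rule sweedler_one[OF bialg modH])
      (auto intro: k_linear_mult_left[OF alg] k_linear_mult_right[OF alg] antipode_linear k_linear_id S_closed)
  then show ?thesis using antipode_left[of "\<one>\<^bsub>H\<^esub>"] S_closed
    by (simp add: sweedler_eq[OF coalg] counit_one)
qed

lemma counit_antipode:
  assumes h: "h \<in> carrier H" shows "counit H (S h) = counit H h"
proof -
  note s = module_scalars[OF K.is_cring]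
  have "counit H (sweedler K H H (\<lambda>y z. S y \<otimes>\<^bsub>H\<^esub> z) h)
    = sweedler K H (scalars K) (\<lambda>y z. counit H (S y \<otimes>\<^bsub>H\<^esub> z)) h"
    by (rule sweedler_commute[OF counit_linear coalg modH s h]) (simp add: S_closed)
  also have "\<dots> = sweedler K H (scalars K) (\<lambda>y z. counit H z \<odot>\<^bsub>scalars K\<^esub> counit H (S y)) h"
    by (simp add: counit_mult S_closed scalars_def K.m_comm counit_closed)
  also have "\<dots> = counit H (S h)"
    by (rule sweedler_counit_right[OF coalg s k_linear_comp[OF counit_linear antipode_linear] h])
  finally have "counit H (S h) = counit H (counit H h \<odot>\<^bsub>H\<^esub> \<one>\<^bsub>H\<^esub>)"
    using antipode_left[OF h] h by (simp add: sweedler_eq[OF coalg])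
  also have "\<dots> = counit H h"
    using k_linear_smult[OF counit_linear] h by (simp add: counit_one scalars_def counit_closed)
  finally show ?thesis .
qed

text \<open>Both sides are convolution inverses of \<open>comult H\<close> among linear maps from
  \<open>H\<close> to H \<otimes> H: the left one since \<open>comult H\<close> is an algebra map,
  the right one since \<Delta> is the convolution of \<open>?i\<close> and \<open>?j\<close>,
  inverted factor by factor in reverse order. The product of 1 \<otimes> S(x) and S(y) \<otimes> 1
  produces the flip.\<close>

lemma comult_antipode:
  assumes h: "h \<in> carrier H"
  shows "comult H (S h) = sweedler K H (tensor K H H) (\<lambda>x y. pure K H H (S y) (S x)) h"
proof -
  let ?T = "tensor_algebra K H H"
  note T = tensor_algebra_algebra[OF alg alg]
  interpret T: k_algebra K ?T by (rule T)
  let ?i = "\<lambda>a. pure K H H a \<one>\<^bsub>H\<^esub>" and ?j = "\<lambda>b. pure K H H \<one>\<^bsub>H\<^esub> b"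
  have i: "algebra_hom K H ?T ?i" by (rule algebra_hom_pure_left[OF alg alg])
  have j: "algebra_hom K H ?T ?j" by (rule algebra_hom_pure_right[OF alg alg])
  let ?Q = "convolution K H ?T (\<lambda>x. ?j (S x)) (\<lambda>x. ?i (S x))"
  have D: "algebra_hom K H ?T (comult H)" by (rule comult_algebra_hom[OF bialg])
  note li = algebra_homD(1)[OF i] and lj = algebra_homD(1)[OF j]
  note liS = k_linear_comp[OF li antipode_linear] and ljS = k_linear_comp[OF lj antipode_linear]
  note cl = convolution_linear[OF coalg T]
  have right: "convolution K H ?T (comult H) ?Q x = conv_unit H ?T x" if x: "x \<in> carrier H" for x
  proof -
    have "convolution K H ?T (comult H) ?Q x = convolution K H ?T (convolution K H ?T ?i ?j) ?Q x"
      by (simp add: comult_convolution[OF bialg])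
    also have "\<dots> = convolution K H ?T ?i (convolution K H ?T ?j ?Q) x"
      by (rule fun_cong[OF convolution_assoc[OF coalg T li lj cl[OF ljS liS]]])
    also have "\<dots> = convolution K H ?T ?i (\<lambda>x. ?i (S x)) x"
      by (rule fun_cong[OF convolution_cong[OF refl]])
        (rule convolution_cancel_left[OF coalg T lj ljS liS antipode_conv_right[OF j T]])
    finally show ?thesis using antipode_conv_right[OF i T x] by simp
  qed
  have "comult H (S h) = ?Q h"
    by (rule convolution_inverse_unique[OF coalg T
          k_linear_comp[OF algebra_homD(1)[OF D] antipode_linear] algebra_homD(1)[OF D]
          cl[OF ljS liS] antipode_conv_left[OF D T] right h])
  also have "\<dots> = sweedler K H (tensor K H H) (\<lambda>x y. pure K H H (S y) (S x)) h"
    by (simp add: convolution_def tensor_algebra_sel sweedler_tensor_algebra tensor_mult_pure[OF alg alg]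
        S_closed)
  finally show ?thesis .
qed

lemma sweedler_antipode:
  assumes "module K X" "h \<in> carrier H"
    and b1: "\<And>x. x \<in> carrier H \<Longrightarrow> k_linear K H X (b x)"
    and b2: "\<And>y. y \<in> carrier H \<Longrightarrow> k_linear K H X (\<lambda>x. b x y)"
  shows "sweedler K H X b (S h) = sweedler K H X (\<lambda>x y. b (S y) (S x)) h"
  by (rule sweedler_transfer[OF coalg coalg assms(1) S_closed[OF assms(2)] assms(2)
        comult_antipode[OF assms(2)] b1 b2]) (simp_all add: S_closed)

end

lemma convolution_cancel_right:
  assumes C: "k_coalgebra K C" and B: "k_algebra K B"
    and l: "k_linear K C B g" "k_linear K C B p" "k_linear K C B q"
    and e: "\<And>x. x \<in> carrier C \<Longrightarrow> convolution K C B p q x = conv_unit C B x"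
    and h: "h \<in> carrier C"
  shows "convolution K C B (convolution K C B g p) q h = g h"
proof -
  have "convolution K C B (convolution K C B g p) q h = convolution K C B g (convolution K C B p q) h"
    using convolution_assoc[OF C B l] by simp
  also have "\<dots> = convolution K C B g (conv_unit C B) h" by (simp add: e cong: convolution_cong)
  finally show ?thesis using conv_unit_right[OF C B l(1) h] by simp
qed

text \<open>Multiplicativity comes down to exchanging f(y1) and g(x2), hence the commutation
  hypothesis. It makes the coactions \<open>lc\<close> and \<open>rc\<close> and the map
  \<open>lam\<close> algebra maps.\<close>

lemma convolution_commuting_hom:
  assumes A: "bialgebra K A" and B: "k_algebra K B"
    and f: "algebra_hom K A B f" and g: "algebra_hom K A B g"
    and comm: "\<And>x y. \<lbrakk>x \<in> carrier A; y \<in> carrier A\<rbrakk> \<Longrightarrow> f x \<otimes>\<^bsub>B\<^esub> g y = g y \<otimes>\<^bsub>B\<^esub> f x"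
  shows "algebra_hom K A B (convolution K A B f g)"
proof -
  interpret A: bialgebra K A by fact
  interpret B: k_algebra K B by fact
  note C = bialgebra_coalgebra[OF A] and M = k_algebra_module[OF B]
  note f' = algebra_homD(2,3)[OF f] and g' = algebra_homD(2,3)[OF g]
  note lin = k_linear_mult_left[OF B] k_linear_mult_right[OF B] algebra_homD(1)[OF f] algebra_homD(1)[OF g]
    k_linear_id
  have cl: "convolution K A B f g x \<in> carrier B" if "x \<in> carrier A" for x
    by (rule convolution_closed[OF C B algebra_homD(1)[OF f] algebra_homD(1)[OF g] that])
  have "convolution K A B f g (x \<otimes>\<^bsub>A\<^esub> y) = convolution K A B f g x \<otimes>\<^bsub>B\<^esub> convolution K A B f g y"
    if x: "x \<in> carrier A" and y: "y \<in> carrier A" for x y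
  proof -
    have "convolution K A B f g (x \<otimes>\<^bsub>A\<^esub> y) = sweedler K A B (\<lambda>x1 x2. sweedler K A B
        (\<lambda>y1 y2. f (x1 \<otimes>\<^bsub>A\<^esub> y1) \<otimes>\<^bsub>B\<^esub> g (x2 \<otimes>\<^bsub>A\<^esub> y2)) y) x"
      unfolding convolution_def by (rule sweedler_mult[OF A M x y]) (simp_all add: lin f' g')
    also have "\<dots> = sweedler K A B (\<lambda>x1 x2. sweedler K A B
        (\<lambda>y1 y2. (f x1 \<otimes>\<^bsub>B\<^esub> g x2) \<otimes>\<^bsub>B\<^esub> (f y1 \<otimes>\<^bsub>B\<^esub> g y2)) y) x"
    proof (intro sweedler_cong[THEN fun_cong])
      fix x1 x2 y1 y2 assume c: "x1 \<in> carrier A" "x2 \<in> carrier A" "y1 \<in> carrier A" "y2 \<in> carrier A"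
      have "f (x1 \<otimes>\<^bsub>A\<^esub> y1) \<otimes>\<^bsub>B\<^esub> g (x2 \<otimes>\<^bsub>A\<^esub> y2) = f x1 \<otimes>\<^bsub>B\<^esub> (f y1 \<otimes>\<^bsub>B\<^esub> g x2) \<otimes>\<^bsub>B\<^esub> g y2"
        using c by (simp add: f' g' B.m_assoc)
      then show "f (x1 \<otimes>\<^bsub>A\<^esub> y1) \<otimes>\<^bsub>B\<^esub> g (x2 \<otimes>\<^bsub>A\<^esub> y2)
          = (f x1 \<otimes>\<^bsub>B\<^esub> g x2) \<otimes>\<^bsub>B\<^esub> (f y1 \<otimes>\<^bsub>B\<^esub> g y2)"
        using c comm[of y1 x2] by (simp add: f' g' B.m_assoc)
    qed
    also have "\<dots> = sweedler K A B (\<lambda>x1 x2. (f x1 \<otimes>\<^bsub>B\<^esub> g x2) \<otimes>\<^bsub>B\<^esub> convolution K A B f g y) x"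
      unfolding convolution_def using y
      by (intro sweedler_cong[THEN fun_cong] sweedler_commute[OF _ C M M, symmetric]) (simp_all add: lin f' g')
    also have "\<dots> = convolution K A B f g x \<otimes>\<^bsub>B\<^esub> convolution K A B f g y"
      unfolding convolution_def[of _ _ _ _ _ x] using x y
      by (intro sweedler_commute[where g="\<lambda>z. z \<otimes>\<^bsub>B\<^esub> convolution K A B f g y", OF _ C M M, symmetric])
        (simp_all add: lin f' g' cl)
    finally show ?thesis .
  qed
  moreover have "convolution K A B f g \<one>\<^bsub>A\<^esub> = \<one>\<^bsub>B\<^esub>"
    unfolding convolution_def
    by (subst sweedler_one[OF A M]) (simp_all add: lin f' g' algebra_homD(4)[OF f] algebra_homD(4)[OF g])
  ultimately show ?thesis unfolding algebra_hom_def
    using convolution_linear[OF C B algebra_homD(1)[OF f] algebra_homD(1)[OF g]] by simp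
qed

context hopf_algebra
begin

text \<open>Convolution inverses are taken in one variable at a time, which avoids a coalgebra
  structure on H \<otimes> H: in \<open>k\<close> with \<open>h\<close> fixed, and then in
  \<open>h\<close> with \<open>k\<close> fixed.\<close>

lemma antipode_mult:
  assumes h: "h \<in> carrier H" and k: "k \<in> carrier H"
  shows "S (h \<otimes>\<^bsub>H\<^esub> k) = S k \<otimes>\<^bsub>H\<^esub> S h"
proof -
  note lin = k_linear_mult_left[OF alg] k_linear_mult_right[OF alg] k_linear_id
    k_linear_comp[OF antipode_linear] antipode_linear
  note ih = antipode_conv_right[of H "\<lambda>x. x", OF _ alg]
  have hid: "algebra_hom K H H (\<lambda>x. x)" by (simp add: algebra_hom_def k_linear_id)
  let ?c = "convolution K H H"
  \<comment> \<open>As a function of \<open>k\<close>, the left side convolved with the identity is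
    \<Sum> S(h1 k1) h2 k2 = \<epsilon>(h) \<epsilon>(k). Convolving with \<open>S\<close> on the
    right isolates it.\<close>
  have G: "sweedler K H H (\<lambda>x y. S (x \<otimes>\<^bsub>H\<^esub> k) \<otimes>\<^bsub>H\<^esub> y) h = counit H h \<odot>\<^bsub>H\<^esub> S k"
    if h: "h \<in> carrier H" and k: "k \<in> carrier H" for h k
  proof -
    let ?G = "\<lambda>k. sweedler K H H (\<lambda>x y. S (x \<otimes>\<^bsub>H\<^esub> k) \<otimes>\<^bsub>H\<^esub> y) h"
    have Gl: "k_linear K H H ?G"
      using h by (intro k_linear_sweedler_inner[OF coalg modH modH h]) (simp add: lin)
    have GI: "?c ?G (\<lambda>x. x) k = counit H h \<odot>\<^bsub>H\<^esub> conv_unit H H k" if k: "k \<in> carrier H" for k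
    proof -
      have "?c ?G (\<lambda>x. x) k = sweedler K H H (\<lambda>u v. sweedler K H H
          (\<lambda>x y. S (x \<otimes>\<^bsub>H\<^esub> u) \<otimes>\<^bsub>H\<^esub> y \<otimes>\<^bsub>H\<^esub> v) h) k"
        unfolding convolution_def using h
        by (intro sweedler_cong[THEN fun_cong] sweedler_commute[where g="\<lambda>z. z \<otimes>\<^bsub>H\<^esub> _", OF _ coalg modH modH])
          (simp_all add: lin S_closed)
      also have "\<dots> = sweedler K H H (\<lambda>u v. sweedler K H H
          (\<lambda>x y. S (x \<otimes>\<^bsub>H\<^esub> u) \<otimes>\<^bsub>H\<^esub> (y \<otimes>\<^bsub>H\<^esub> v)) h) k"
        by (simp add: m_assoc S_closed)
      also have "\<dots> = sweedler K H H (\<lambda>x y. sweedler K H H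
          (\<lambda>u v. S (x \<otimes>\<^bsub>H\<^esub> u) \<otimes>\<^bsub>H\<^esub> (y \<otimes>\<^bsub>H\<^esub> v)) k) h"
        using h k by (intro sweedler_swap[OF coalg coalg modH]) (simp_all add: S_closed)
      also have "\<dots> = sweedler K H H (\<lambda>x y. S x \<otimes>\<^bsub>H\<^esub> y) (h \<otimes>\<^bsub>H\<^esub> k)"
        by (rule sweedler_mult[OF bialg modH h k, symmetric]) (simp_all add: lin S_closed)
      also have "\<dots> = counit H (h \<otimes>\<^bsub>H\<^esub> k) \<odot>\<^bsub>H\<^esub> \<one>\<^bsub>H\<^esub>"
        using antipode_left h k by (simp add: sweedler_eq[OF coalg])
      finally show ?thesis using h k
        by (simp add: conv_unit_def counit_mult smult_assoc1 counit_closed)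
    qed
    have "?G k = ?c (?c ?G (\<lambda>x. x)) S k"
      by (rule convolution_cancel_right[OF coalg alg Gl k_linear_id antipode_linear
            antipode_conv_right[OF hid alg] k, symmetric])
    also have "\<dots> = ?c (\<lambda>x. counit H h \<odot>\<^bsub>H\<^esub> conv_unit H H x) S k" by (simp add: GI)
    also have "\<dots> = sweedler K H H (\<lambda>x y. counit H h \<odot>\<^bsub>H\<^esub> (conv_unit H H x \<otimes>\<^bsub>H\<^esub> S y)) k"
      using h by (simp add: convolution_def smult_mult_left conv_unit_def counit_closed S_closed)
    also have "\<dots> = counit H h \<odot>\<^bsub>H\<^esub> ?c (conv_unit H H) S k"
      unfolding convolution_def using h k
      by (intro sweedler_commute[symmetric, OF _ coalg modH modH] k_linear_smult_right[OF modH])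
        (simp_all add: lin S_closed counit_closed conv_unit_def)
    finally show ?thesis by (simp add: conv_unit_left[OF coalg alg antipode_linear k])
  qed
  let ?F = "\<lambda>h. S (h \<otimes>\<^bsub>H\<^esub> k)"
  have Fl: "k_linear K H H ?F" using k by (simp add: lin)
  have "?F h = ?c (?c ?F (\<lambda>x. x)) S h"
    by (rule convolution_cancel_right[OF coalg alg Fl k_linear_id antipode_linear
          antipode_conv_right[OF hid alg] h, symmetric])
  also have "\<dots> = sweedler K H H (\<lambda>x y. counit H x \<odot>\<^bsub>H\<^esub> (S k \<otimes>\<^bsub>H\<^esub> S y)) h"
    using k by (simp add: convolution_def G smult_mult_left counit_closed S_closed)
  also have "\<dots> = S k \<otimes>\<^bsub>H\<^esub> S h"
    using k by (intro sweedler_counit_left[OF coalg modH _ h]) (simp add: lin S_closed)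
  finally show ?thesis .
qed

end

text \<open>A tensor product depends only on carriers, additions and scalar actions. Records that
  differ in other fields, such as \<open>quot_module\<close> and \<open>quot_bialgebra\<close>, or a
  tensor product and the bosonization built on it, therefore have equal tensor products, not merely
  isomorphic ones.\<close>

lemma tensor_cong:
  assumes "carrier V = carrier V'" "add V = add V'" "smult V = smult V'"
    and "carrier W = carrier W'" "add W = add W'" "smult W = smult W'"
  shows "tensor K V W = tensor K V' W'" "pure K V W = pure K V' W'"
proof -
  have r: "tensor_relators K V W = tensor_relators K V' W'"
    unfolding tensor_relators_def by (simp add: assms)
  then have n: "tensor_null K V W = tensor_null K V' W'"
    by (simp add: tensor_null_def assms)
  then show "tensor K V W = tensor K V' W'" by (simp add: tensor_def assms)
  show "pure K V W = pure K V' W'" by (intro ext) (simp add: pure_def n assms)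
qed

section \<open>Bialgebras projecting onto a Hopf algebra\<close>

locale bialgebra_projection =
  fixes K :: "('k, 'l) ring_scheme" and A :: "('k, 'a, 'm) bialg_scheme"
    and H :: "('k, 'h, 'p) bialg_scheme" and S :: "'h \<Rightarrow> 'h" and p :: "'a \<Rightarrow> 'h"
  assumes bialgA: "bialgebra K A" and hopfH: "hopf_algebra K H S"
    and p_hom: "algebra_hom K A H p"
    and p_comult: "a \<in> carrier A \<Longrightarrow>
      comult H (p a) = sweedler K A (tensor K H H) (\<lambda>x y. pure K H H (p x) (p y)) a"
    and p_counit: "a \<in> carrier A \<Longrightarrow> counit H (p a) = counit A a"
begin

sublocale H: hopf_algebra K H S by (rule hopfH)
sublocale A: bialgebra K A by (rule bialgA)

lemma algA [simp]: "k_algebra K A" and algH [simp]: "k_algebra K H"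
  and coA [simp]: "k_coalgebra K A" and coH [simp]: "k_coalgebra K H"
  and modA [simp]: "module K A" and modH [simp]: "module K H" and bialgH: "bialgebra K H"
  using bialgA H.bialg by (simp_all add: bialgebra_algebra bialgebra_coalgebra k_algebra_module)

declare tensor_module [simp] tensor_algebra_algebra [simp] k_algebra_module [simp]
  pure_closed [simp]

lemmas p_closed [simp] = algebra_homD(2)[OF p_hom]
lemmas p_mult = algebra_homD(3)[OF p_hom]
lemmas p_one = algebra_homD(4)[OF p_hom]
lemmas S_closed [simp] = H.S_closed

lemma counitA_closed [simp]: "a \<in> carrier A \<Longrightarrow> counit A a \<in> carrier K"
  using k_linear_closed[OF A.counit_linear] by (simp add: scalars_def)

lemmas counitH_closed [simp] = H.counit_closed

lemmas p_lin = algebra_homD(1)[OF p_hom]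
lemmas S_lin = H.antipode_linear

lemmas lin [simp] = k_linear_id p_lin S_lin
  k_linear_comp[OF p_lin] k_linear_comp[OF S_lin]
  k_linear_comp[OF A.counit_linear] k_linear_comp[OF H.counit_linear] A.counit_linear H.counit_linear
  k_linear_mult_left k_linear_mult_right k_linear_pure_left k_linear_pure_right
  k_linear_smult_right k_linear_scalar_smult k_linear_plus
  k_linear_sweedler_inner k_linear_sweedler_outer convolution_linear

lemmas closed [simp] = sweedler_closed convolution_closed

lemma sweedler_p:
  assumes "module K X" "a \<in> carrier A"
    and "\<And>x. x \<in> carrier H \<Longrightarrow> k_linear K H X (b x)"
    and "\<And>y. y \<in> carrier H \<Longrightarrow> k_linear K H X (\<lambda>x. b x y)"
  shows "sweedler K H X b (p a) = sweedler K A X (\<lambda>x y. b (p x) (p y)) a"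
  by (rule sweedler_transfer[OF coH coA assms(1) _ assms(2) p_comult[OF assms(2)] assms(3,4)])
    (simp_all add: assms(2))

section \<open>The left and right coactions of \<open>H\<close> on \<open>A\<close> as algebra
  maps\<close>

definition k1 :: "'h \<Rightarrow> ('h \<times> 'a \<Rightarrow> 'k) set" where "k1 h = pure K H A h \<one>\<^bsub>A\<^esub>"
definition k2 :: "'a \<Rightarrow> ('h \<times> 'a \<Rightarrow> 'k) set" where "k2 a = pure K H A \<one>\<^bsub>H\<^esub> a"

abbreviation "U \<equiv> tensor_algebra K H A"

lemma algU [simp]: "k_algebra K U" by simp
lemma modU [simp]: "module K U" by simp

sublocale U: k_algebra K U by (rule algU)

lemma k1_hom: "algebra_hom K H U k1"
  using algebra_hom_pure_left[OF algH algA] by (simp add: k1_def[abs_def])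

lemma k2_hom: "algebra_hom K A U k2"
  using algebra_hom_pure_right[OF algH algA] by (simp add: k2_def[abs_def])

lemmas k_closed [simp] = algebra_homD(2)[OF k1_hom] algebra_homD(2)[OF k2_hom]
lemmas k_lin [simp] = algebra_homD(1)[OF k1_hom] algebra_homD(1)[OF k2_hom]
  k_linear_comp[OF algebra_homD(1)[OF k1_hom]] k_linear_comp[OF algebra_homD(1)[OF k2_hom]]

lemma k1_k2: "\<lbrakk>h \<in> carrier H; a \<in> carrier A\<rbrakk> \<Longrightarrow> k1 h \<otimes>\<^bsub>U\<^esub> k2 a = pure K H A h a"
  "\<lbrakk>h \<in> carrier H; a \<in> carrier A\<rbrakk> \<Longrightarrow> k2 a \<otimes>\<^bsub>U\<^esub> k1 h = pure K H A h a"
  by (simp_all add: k1_def k2_def tensor_algebra_sel tensor_mult_pure)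

lemma pure_U [simp]: "\<lbrakk>h \<in> carrier H; a \<in> carrier A\<rbrakk> \<Longrightarrow> pure K H A h a \<in> carrier U"
  by (simp add: tensor_algebra_sel)

lemma pure_mult_U: "\<lbrakk>h \<in> carrier H; a \<in> carrier A; g \<in> carrier H; b \<in> carrier A\<rbrakk>
    \<Longrightarrow> pure K H A h a \<otimes>\<^bsub>U\<^esub> pure K H A g b = pure K H A (h \<otimes>\<^bsub>H\<^esub> g) (a \<otimes>\<^bsub>A\<^esub> b)"
  by (simp add: tensor_algebra_sel tensor_mult_pure)

text \<open>The coaction (p \<otimes> id)\<Delta>, presented as a convolution of two algebra maps
  with commuting images; this presentation yields its multiplicativity. \<open>rc\<close> is its
  mirror image.\<close>

definition lc :: "'a \<Rightarrow> ('h \<times> 'a \<Rightarrow> 'k) set"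
  where "lc = convolution K A U (\<lambda>x. k1 (p x)) k2"

lemma lc_eq: "lc a = sweedler K A U (\<lambda>x y. pure K H A (p x) y) a"
  by (simp add: lc_def convolution_def k1_k2)

lemma lc_hom: "algebra_hom K A U lc"
  unfolding lc_def
  by (rule convolution_commuting_hom[OF bialgA algU algebra_hom_comp[OF k1_hom p_hom] k2_hom])
    (simp add: k1_k2)

lemmas lc_closed [simp] = algebra_homD(2)[OF lc_hom]
lemmas lc_lin [simp] = algebra_homD(1)[OF lc_hom] k_linear_comp[OF algebra_homD(1)[OF lc_hom]]
lemmas lc_mult = algebra_homD(3)[OF lc_hom]

definition rc :: "'a \<Rightarrow> ('a \<times> 'h \<Rightarrow> 'k) set"
  where "rc = convolution K A (tensor_algebra K A H)
    (\<lambda>a. pure K A H a \<one>\<^bsub>H\<^esub>) (\<lambda>a. pure K A H \<one>\<^bsub>A\<^esub> (p a))"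

lemma rc_eq: "rc a = sweedler K A (tensor_algebra K A H) (\<lambda>x y. pure K A H x (p y)) a"
  by (simp add: rc_def convolution_def tensor_algebra_sel tensor_mult_pure)

lemma rc_hom: "algebra_hom K A (tensor_algebra K A H) rc"
  unfolding rc_def
  by (rule convolution_commuting_hom[OF bialgA _ algebra_hom_pure_left
        algebra_hom_comp[OF algebra_hom_pure_right p_hom]])
    (simp_all add: tensor_algebra_sel tensor_mult_pure)

definition bicolinear_section :: "('h \<Rightarrow> 'a) \<Rightarrow> bool"
  where "bicolinear_section f \<longleftrightarrow> k_linear K H A f \<and> (\<forall>h \<in> carrier H. p (f h) = h
    \<and> sweedler K A (tensor K H A) (\<lambda>x y. pure K H A (p x) y) (f h)
      = sweedler K H (tensor K H A) (\<lambda>x y. pure K H A x (f y)) h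
    \<and> sweedler K A (tensor K A H) (\<lambda>x y. pure K A H x (p y)) (f h)
      = sweedler K H (tensor K A H) (\<lambda>x y. pure K A H (f x) y) h)"

end

section \<open>Bialgebras with a split projection onto a Hopf algebra\<close>

locale split_bialgebra = bialgebra_projection K A H S p
  for K :: "('k, 'l) ring_scheme" and A :: "('k, 'a, 'm) bialg_scheme"
    and H :: "('k, 'h, 'p) bialg_scheme" and S :: "'h \<Rightarrow> 'h" and p :: "'a \<Rightarrow> 'h" +
  fixes s :: "'h \<Rightarrow> 'a"
  assumes s_hom: "algebra_hom K H A s" and s_section: "bicolinear_section s"
begin

lemma p_s: "h \<in> carrier H \<Longrightarrow> p (s h) = h"
  and s_left: "h \<in> carrier H \<Longrightarrow>
      sweedler K A (tensor K H A) (\<lambda>x y. pure K H A (p x) y) (s h)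
      = sweedler K H (tensor K H A) (\<lambda>x y. pure K H A x (s y)) h"
  and s_right: "h \<in> carrier H \<Longrightarrow>
      sweedler K A (tensor K A H) (\<lambda>x y. pure K A H x (p y)) (s h)
      = sweedler K H (tensor K A H) (\<lambda>x y. pure K A H (s x) y) h"
  using s_section by (simp_all add: bicolinear_section_def)

lemmas s_closed [simp] = algebra_homD(2)[OF s_hom]
lemmas s_mult = algebra_homD(3)[OF s_hom]
lemmas s_one = algebra_homD(4)[OF s_hom]
lemmas s_lin [simp] = algebra_homD(1)[OF s_hom]
lemmas s_lin' [simp] = k_linear_comp[OF s_lin]

text \<open>Right colinearity of \<open>s\<close> as a substitution rule, obtained by applying the
  linear map induced by \<open>b\<close> to the defining identity in A \<otimes> H. It applies to
  sums that see the second leg of \<Delta>(s(h)) only through \<open>p\<close>.\<close>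

lemma sweedler_s_right:
  assumes X: "module K X" and h: "h \<in> carrier H"
    and l: "\<And>x. x \<in> carrier A \<Longrightarrow> k_linear K H X (b x)"
      "\<And>y. y \<in> carrier H \<Longrightarrow> k_linear K A X (\<lambda>x. b x y)"
  shows "sweedler K A X (\<lambda>x y. b x (p y)) (s h) = sweedler K H X (\<lambda>x y. b (s x) y) h"
proof -
  note b = k_bilinearI[of A K H X b, OF l]
  have "sweedler K A X (\<lambda>x y. b x (p y)) (s h)
      = tlift K X b (sweedler K A (tensor K A H) (\<lambda>x y. pure K A H x (p y)) (s h))"
    by (rule tlift_sweedler_pure[OF coA modA modH X b, symmetric]) (simp_all add: h)
  also have "\<dots> = sweedler K H X (\<lambda>x y. b (s x) y) h"
    unfolding s_right[OF h] by (rule tlift_sweedler_pure[OF coH modA modH X b h]) simp_all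
  finally show ?thesis .
qed

lemma sweedler_s_left:
  assumes X: "module K X" and h: "h \<in> carrier H"
    and l: "\<And>x. x \<in> carrier H \<Longrightarrow> k_linear K A X (b x)"
      "\<And>y. y \<in> carrier A \<Longrightarrow> k_linear K H X (\<lambda>x. b x y)"
  shows "sweedler K A X (\<lambda>x y. b (p x) y) (s h) = sweedler K H X (\<lambda>x y. b x (s y)) h"
proof -
  note b = k_bilinearI[of H K A X b, OF l]
  have "sweedler K A X (\<lambda>x y. b (p x) y) (s h)
      = tlift K X b (sweedler K A (tensor K H A) (\<lambda>x y. pure K H A (p x) y) (s h))"
    by (rule tlift_sweedler_pure[OF coA modH modA X b, symmetric]) (simp_all add: h)
  also have "\<dots> = sweedler K H X (\<lambda>x y. b x (s y)) h"
    unfolding s_left[OF h] by (rule tlift_sweedler_pure[OF coH modH modA X b h]) simp_all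
  finally show ?thesis .
qed

section \<open>Right coinvariants and the projection onto them\<close>

definition coinv :: "'a set"
  where "coinv = {r \<in> carrier A.
    sweedler K A (tensor K A H) (\<lambda>x y. pure K A H x (p y)) r = pure K A H r \<one>\<^bsub>H\<^esub>}"

lemma coinv_closed [simp]: "r \<in> coinv \<Longrightarrow> r \<in> carrier A" by (simp add: coinv_def)

lemma sweedler_coinv:
  assumes X: "module K X" and r: "r \<in> coinv"
    and l: "\<And>x. x \<in> carrier A \<Longrightarrow> k_linear K H X (b x)"
      "\<And>y. y \<in> carrier H \<Longrightarrow> k_linear K A X (\<lambda>x. b x y)"
  shows "sweedler K A X (\<lambda>x y. b x (p y)) r = b r \<one>\<^bsub>H\<^esub>"
proof -
  note b = k_bilinearI[of A K H X b, OF l]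
  have "sweedler K A X (\<lambda>x y. b x (p y)) r
      = tlift K X b (sweedler K A (tensor K A H) (\<lambda>x y. pure K A H x (p y)) r)"
    by (rule tlift_sweedler_pure[OF coA modA modH X b, symmetric]) (simp_all add: r)
  also have "\<dots> = tlift K X b (pure K A H r \<one>\<^bsub>H\<^esub>)" using r by (simp add: coinv_def del: coinv_closed)
  also have "\<dots> = b r \<one>\<^bsub>H\<^esub>" by (rule tlift_pure[OF modA modH X b]) (simp_all add: r)
  finally show ?thesis .
qed

text \<open>The right coaction is multiplicative; \<open>r\<close> contributes the leg 1 and s(h)
  contributes h2, so the coaction of r s(h) is carried by \<open>h\<close> alone.\<close>

lemma sweedler_coinv_s:
  assumes X: "module K X" and r: "r \<in> coinv" and h: "h \<in> carrier H"
    and l: "\<And>x. x \<in> carrier A \<Longrightarrow> k_linear K H X (b x)"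
      "\<And>y. y \<in> carrier H \<Longrightarrow> k_linear K A X (\<lambda>x. b x y)"
  shows "sweedler K A X (\<lambda>x y. b x (p y)) (r \<otimes>\<^bsub>A\<^esub> s h) = sweedler K H X (\<lambda>x y. b (r \<otimes>\<^bsub>A\<^esub> s x) y) h"
proof -
  have L1: "k_linear K U X (\<lambda>u. b x (f u))" if "x \<in> carrier A" "k_linear K U H f"
    for U :: "('k, 'u, 'v) module_scheme" and x f
    using k_linear_comp[OF l(1)] that by blast
  have L2: "k_linear K U X (\<lambda>u. b (f u) y)" if "y \<in> carrier H" "k_linear K U A f"
    for U :: "('k, 'u, 'v) module_scheme" and y f
    using k_linear_comp[OF l(2)] that by blast
  have "sweedler K A X (\<lambda>x y. b x (p y)) (r \<otimes>\<^bsub>A\<^esub> s h) = sweedler K A X (\<lambda>x1 x2. sweedler K A X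
      (\<lambda>y1 y2. b (x1 \<otimes>\<^bsub>A\<^esub> y1) (p (x2 \<otimes>\<^bsub>A\<^esub> y2))) (s h)) r"
    by (rule sweedler_mult[OF bialgA X]) (simp_all add: L1 L2 r h l)
  also have "\<dots> = sweedler K A X (\<lambda>x1 x2. sweedler K A X
      (\<lambda>y1 y2. b (x1 \<otimes>\<^bsub>A\<^esub> y1) (p x2 \<otimes>\<^bsub>H\<^esub> p y2)) (s h)) r"
    by (simp add: p_mult)
  also have "\<dots> = sweedler K A X (\<lambda>x1 x2. sweedler K H X
      (\<lambda>y1 y2. b (x1 \<otimes>\<^bsub>A\<^esub> s y1) (p x2 \<otimes>\<^bsub>H\<^esub> y2)) h) r"
    by (intro sweedler_cong[THEN fun_cong] sweedler_s_right[OF X h, where b="\<lambda>y1 y2. b (_ \<otimes>\<^bsub>A\<^esub> y1) (_ \<otimes>\<^bsub>H\<^esub> y2)"])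
      (simp_all add: L1 L2 l)
  also have "\<dots> = sweedler K H X (\<lambda>y1 y2. b (r \<otimes>\<^bsub>A\<^esub> s y1) (\<one>\<^bsub>H\<^esub> \<otimes>\<^bsub>H\<^esub> y2)) h"
    by (rule sweedler_coinv[OF X r, where b="\<lambda>x1 x2. sweedler K H X
      (\<lambda>y1 y2. b (x1 \<otimes>\<^bsub>A\<^esub> s y1) (x2 \<otimes>\<^bsub>H\<^esub> y2)) h"]) (simp_all add: L1 L2 l h X)
  finally show ?thesis by simp
qed

lemma fieldK: "field K" using algA by (simp add: k_algebra_def)

lemma cringK: "cring K" by (rule module.axioms(1)[OF modA])

lemma id_hom: "algebra_hom K V V (\<lambda>x. x)" by (simp add: algebra_hom_def)

lemma convolution_p:
  assumes B: "k_algebra K B" and a: "a \<in> carrier A" and f: "k_linear K H B f" and g: "k_linear K H B g"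
  shows "convolution K A B (\<lambda>x. f (p x)) (\<lambda>x. g (p x)) a = convolution K H B f g (p a)"
  unfolding convolution_def
  by (rule sweedler_p[OF _ a, symmetric])
    (simp_all add: B f g k_linear_closed[OF f] k_linear_closed[OF g])

text \<open>The Hopf-theoretic inverse of \<phi> on \<open>H\<close> is pulled back along the
  coalgebra map \<open>p\<close>. The cancellations over \<open>A\<close> use it for \<phi> equal to
  \<open>s\<close> or to composites of \<open>s\<close> with algebra maps into a tensor
  product.\<close>

lemma conv_inv_right:
  assumes \<phi>: "algebra_hom K H B \<phi>" and B: "k_algebra K B" and a: "a \<in> carrier A"
  shows "convolution K A B (\<lambda>x. \<phi> (p x)) (\<lambda>x. \<phi> (S (p x))) a = conv_unit A B a"
  using convolution_p[OF B a algebra_homD(1)[OF \<phi>] k_linear_comp[OF algebra_homD(1)[OF \<phi>] S_lin]]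
    H.antipode_conv_right[OF \<phi> B, of "p a"] a by (simp add: conv_unit_def p_counit)

lemma conv_inv_left:
  assumes \<phi>: "algebra_hom K H B \<phi>" and B: "k_algebra K B" and a: "a \<in> carrier A"
  shows "convolution K A B (\<lambda>x. \<phi> (S (p x))) (\<lambda>x. \<phi> (p x)) a = conv_unit A B a"
  using convolution_p[OF B a k_linear_comp[OF algebra_homD(1)[OF \<phi>] S_lin] algebra_homD(1)[OF \<phi>]]
    H.antipode_conv_left[OF \<phi> B, of "p a"] a by (simp add: conv_unit_def p_counit)

definition tau :: "'a \<Rightarrow> 'a"
  where "tau = convolution K A A (\<lambda>x. x) (\<lambda>x. s (S (p x)))"

lemma tau_lin: "k_linear K A A tau"
  unfolding tau_def by simp

lemma tau_closed [simp]: "a \<in> carrier A \<Longrightarrow> tau a \<in> carrier A"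
  by (rule k_linear_closed[OF tau_lin])

lemma tau_coinv [simp]:
  assumes a: "a \<in> carrier A" shows "tau a \<in> coinv"
proof -
  let ?T = "tensor_algebra K A H" and ?i = "\<lambda>a. pure K A H a \<one>\<^bsub>H\<^esub>" and ?j = "\<lambda>h. pure K A H \<one>\<^bsub>A\<^esub> h"
  note T = tensor_algebra_algebra[OF algA algH]
  have i: "algebra_hom K A ?T ?i" by (rule algebra_hom_pure_left) simp_all
  have j: "algebra_hom K H ?T ?j" by (rule algebra_hom_pure_right) simp_all
  have jp: "algebra_hom K A ?T (\<lambda>a. ?j (p a))" by (rule algebra_hom_comp[OF j p_hom])
  have q_def: "rc = convolution K A ?T ?i (\<lambda>a. ?j (p a))" by (simp add: rc_def)
  have qe: "rc x = sweedler K A (tensor K A H) (\<lambda>x y. pure K A H x (p y)) x" for x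
    by (simp only: rc_eq sweedler_tensor_algebra)
  note q = rc_hom
  note qs = algebra_hom_comp[OF q s_hom]
  note l = algebra_homD(1)[OF i] algebra_homD(1)[OF jp] algebra_homD(1)[OF q]
  note lt = k_linear_comp[OF l(1) tau_lin]
  note l' = k_linear_comp[OF k_linear_comp[OF k_linear_comp[OF l(3) s_lin] S_lin] p_lin]
    k_linear_comp[OF k_linear_comp[OF l(3) s_lin] p_lin]
    k_linear_comp[OF k_linear_comp[OF k_linear_comp[OF l(1) s_lin] S_lin] p_lin]
    k_linear_comp[OF k_linear_comp[OF l(1) s_lin] p_lin]
  note si = algebra_hom_comp[OF i s_hom]
  have it: "?i (tau x) = convolution K A ?T ?i (\<lambda>x. ?i (s (S (p x)))) x" if "x \<in> carrier A" for x
    unfolding tau_def using that by (intro algebra_hom_convolution[OF i algA T coA]) simp_all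
  have qsp: "rc (s (p x)) = convolution K A ?T (\<lambda>x. ?i (s (p x))) (\<lambda>x. ?j (p x)) x"
    if x: "x \<in> carrier A" for x
  proof -
    have "rc (s (p x)) = sweedler K H (tensor K A H) (\<lambda>x y. pure K A H (s x) y) (p x)"
      using s_right[of "p x"] x by (simp add: qe)
    also have "\<dots> = sweedler K A (tensor K A H) (\<lambda>x y. pure K A H (s (p x)) (p y)) x"
      by (rule sweedler_p) (simp_all add: x)
    finally show ?thesis
      by (simp add: convolution_def tensor_algebra_sel sweedler_tensor_algebra tensor_mult_pure)
  qed
  have "convolution K A ?T (\<lambda>x. ?i (tau x)) (\<lambda>x. rc (s (p x))) x = rc x" if x: "x \<in> carrier A" for x
  proof -
    have "convolution K A ?T (\<lambda>x. ?i (tau x)) (\<lambda>x. rc (s (p x))) x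
      = convolution K A ?T (convolution K A ?T ?i (\<lambda>x. ?i (s (S (p x)))))
          (convolution K A ?T (\<lambda>x. ?i (s (p x))) (\<lambda>x. ?j (p x))) x"
      by (simp add: it qsp)
    also have "\<dots> = convolution K A ?T ?i (convolution K A ?T (\<lambda>x. ?i (s (S (p x))))
        (convolution K A ?T (\<lambda>x. ?i (s (p x))) (\<lambda>x. ?j (p x)))) x"
      by (rule fun_cong[OF convolution_assoc[OF coA T l(1) l'(3) convolution_linear[OF coA T l'(4) l(2)]]])
    also have "\<dots> = convolution K A ?T ?i (\<lambda>x. ?j (p x)) x"
      by (rule fun_cong[OF convolution_cong[OF refl]])
        (rule convolution_cancel_left[OF coA T l'(3,4) l(2) conv_inv_left[OF si T]])
    finally show ?thesis by (simp add: q_def)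
  qed
  note main = this
  have "rc (tau a) = convolution K A ?T rc (\<lambda>x. rc (s (S (p x)))) a"
    unfolding tau_def using a by (intro algebra_hom_convolution[OF q algA T coA]) simp_all
  also have "\<dots> = convolution K A ?T (convolution K A ?T (\<lambda>x. ?i (tau x)) (\<lambda>x. rc (s (p x))))
      (\<lambda>x. rc (s (S (p x)))) a"
    by (simp add: main)
  also have "\<dots> = ?i (tau a)"
    by (rule convolution_cancel_right[OF coA T lt l'(2,1) conv_inv_right[OF qs T] a])
  finally show ?thesis using a by (simp add: coinv_def qe del: coinv_closed)
qed

text \<open>The antipode reverses products, so s(h1) and s(S(h2)) become neighbours between a1 and
  s(S(p(a2))) and collapse to \<epsilon>(h).\<close>

lemma tau_s_mult:
  assumes a: "a \<in> carrier A" and h: "h \<in> carrier H"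
  shows "tau (a \<otimes>\<^bsub>A\<^esub> s h) = counit H h \<odot>\<^bsub>A\<^esub> tau a"
proof -
  have "tau (a \<otimes>\<^bsub>A\<^esub> s h) = sweedler K A A (\<lambda>a1 a2. sweedler K A A
      (\<lambda>y1 y2. a1 \<otimes>\<^bsub>A\<^esub> y1 \<otimes>\<^bsub>A\<^esub> s (S (p (a2 \<otimes>\<^bsub>A\<^esub> y2)))) (s h)) a"
    unfolding tau_def convolution_def by (rule sweedler_mult[OF bialgA]) (simp_all add: a h)
  also have "\<dots> = sweedler K A A (\<lambda>a1 a2. sweedler K A A
      (\<lambda>y1 y2. a1 \<otimes>\<^bsub>A\<^esub> y1 \<otimes>\<^bsub>A\<^esub> s (S (p a2 \<otimes>\<^bsub>H\<^esub> p y2))) (s h)) a"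
    by (simp add: p_mult)
  also have "\<dots> = sweedler K A A (\<lambda>a1 a2. sweedler K H A
      (\<lambda>y1 y2. a1 \<otimes>\<^bsub>A\<^esub> s y1 \<otimes>\<^bsub>A\<^esub> s (S (p a2 \<otimes>\<^bsub>H\<^esub> y2))) h) a"
    by (intro sweedler_cong[THEN fun_cong] sweedler_s_right[OF _ h, where
      b="\<lambda>y1 y2. _ \<otimes>\<^bsub>A\<^esub> y1 \<otimes>\<^bsub>A\<^esub> s (S (p _ \<otimes>\<^bsub>H\<^esub> y2))"]) simp_all
  also have "\<dots> = sweedler K A A (\<lambda>a1 a2. sweedler K H A
      (\<lambda>y1 y2. a1 \<otimes>\<^bsub>A\<^esub> (s y1 \<otimes>\<^bsub>A\<^esub> s (S y2)) \<otimes>\<^bsub>A\<^esub> s (S (p a2))) h) a"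
    by (simp add: H.antipode_mult s_mult A.m_assoc)
  also have "\<dots> = sweedler K A A (\<lambda>a1 a2. a1 \<otimes>\<^bsub>A\<^esub> conv_unit H A h \<otimes>\<^bsub>A\<^esub> s (S (p a2))) a"
  proof (intro sweedler_cong[THEN fun_cong])
    fix x y assume xy: "x \<in> carrier A" "y \<in> carrier A"
    have "sweedler K H A (\<lambda>y1 y2. x \<otimes>\<^bsub>A\<^esub> (s y1 \<otimes>\<^bsub>A\<^esub> s (S y2)) \<otimes>\<^bsub>A\<^esub> s (S (p y))) h
      = x \<otimes>\<^bsub>A\<^esub> sweedler K H A (\<lambda>y1 y2. s y1 \<otimes>\<^bsub>A\<^esub> s (S y2)) h \<otimes>\<^bsub>A\<^esub> s (S (p y))"
      using xy h
      by (intro sweedler_commute[where g="\<lambda>z. x \<otimes>\<^bsub>A\<^esub> z \<otimes>\<^bsub>A\<^esub> s (S (p y))", symmetric]) simp_all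
    then show "sweedler K H A (\<lambda>y1 y2. x \<otimes>\<^bsub>A\<^esub> (s y1 \<otimes>\<^bsub>A\<^esub> s (S y2)) \<otimes>\<^bsub>A\<^esub> s (S (p y))) h
      = x \<otimes>\<^bsub>A\<^esub> conv_unit H A h \<otimes>\<^bsub>A\<^esub> s (S (p y))"
      using H.antipode_conv_right[OF s_hom algA h] by (simp add: convolution_def)
  qed
  also have "\<dots> = sweedler K A A (\<lambda>a1 a2. counit H h \<odot>\<^bsub>A\<^esub> (a1 \<otimes>\<^bsub>A\<^esub> s (S (p a2)))) a"
    using h by (simp add: conv_unit_def A.smult_mult_left A.smult_mult_right)
  also have "\<dots> = counit H h \<odot>\<^bsub>A\<^esub> tau a"
    unfolding tau_def convolution_def using a h
    by (intro sweedler_commute[where g="\<lambda>z. counit H h \<odot>\<^bsub>A\<^esub> z", symmetric]) simp_all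
  finally show ?thesis .
qed

lemma tau_id: assumes r: "r \<in> coinv" shows "tau r = r"
proof -
  have "tau r = r \<otimes>\<^bsub>A\<^esub> s (S \<one>\<^bsub>H\<^esub>)"
    unfolding tau_def convolution_def
    by (rule sweedler_coinv[OF _ r, where b="\<lambda>x y. x \<otimes>\<^bsub>A\<^esub> s (S y)"]) simp_all
  then show ?thesis using r by (simp add: H.antipode_one s_one)
qed

lemma counit_s: "h \<in> carrier H \<Longrightarrow> counit A (s h) = counit H h"
  using p_counit[of "s h"] p_s by simp

lemma tau_one: "tau \<one>\<^bsub>A\<^esub> = \<one>\<^bsub>A\<^esub>"
proof -
  have "tau \<one>\<^bsub>A\<^esub> = \<one>\<^bsub>A\<^esub> \<otimes>\<^bsub>A\<^esub> s (S (p \<one>\<^bsub>A\<^esub>))"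
    unfolding tau_def convolution_def by (rule sweedler_one[OF bialgA]) simp_all
  then show ?thesis by (simp add: p_one s_one H.antipode_one)
qed

lemma tau_s: "h \<in> carrier H \<Longrightarrow> tau (s h) = counit H h \<odot>\<^bsub>A\<^esub> \<one>\<^bsub>A\<^esub>"
  using tau_s_mult[of "\<one>\<^bsub>A\<^esub>" h] by (simp add: tau_one)

lemma coinv_one [simp]: "\<one>\<^bsub>A\<^esub> \<in> coinv"
  using tau_coinv[of "\<one>\<^bsub>A\<^esub>"] by (simp add: tau_one)

text \<open>The coinvariants are exactly the fixed points of \<open>tau\<close>, by
  \<open>tau_id\<close> and \<open>tau_coinv\<close>. Closure under an operation is therefore proved
  by computing \<open>tau\<close> of the result, here and for the linear operations.\<close>

lemma coinv_mult [simp]: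
  assumes r: "r \<in> coinv" and q: "q \<in> coinv" shows "r \<otimes>\<^bsub>A\<^esub> q \<in> coinv"
proof -
  have "tau (r \<otimes>\<^bsub>A\<^esub> q) = sweedler K A A (\<lambda>x1 x2. sweedler K A A
      (\<lambda>y1 y2. x1 \<otimes>\<^bsub>A\<^esub> y1 \<otimes>\<^bsub>A\<^esub> s (S (p (x2 \<otimes>\<^bsub>A\<^esub> y2)))) q) r"
    unfolding tau_def convolution_def by (rule sweedler_mult[OF bialgA]) (simp_all add: r q)
  also have "\<dots> = sweedler K A A (\<lambda>x1 x2. sweedler K A A
      (\<lambda>y1 y2. x1 \<otimes>\<^bsub>A\<^esub> y1 \<otimes>\<^bsub>A\<^esub> s (S (p x2 \<otimes>\<^bsub>H\<^esub> p y2))) q) r"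
    by (simp add: p_mult)
  also have "\<dots> = sweedler K A A (\<lambda>x1 x2. x1 \<otimes>\<^bsub>A\<^esub> q \<otimes>\<^bsub>A\<^esub> s (S (p x2 \<otimes>\<^bsub>H\<^esub> \<one>\<^bsub>H\<^esub>))) r"
    by (intro sweedler_cong[THEN fun_cong] sweedler_coinv[OF _ q, where
      b="\<lambda>y1 y2. _ \<otimes>\<^bsub>A\<^esub> y1 \<otimes>\<^bsub>A\<^esub> s (S (p _ \<otimes>\<^bsub>H\<^esub> y2))"]) simp_all
  also have "\<dots> = r \<otimes>\<^bsub>A\<^esub> q \<otimes>\<^bsub>A\<^esub> s (S (\<one>\<^bsub>H\<^esub> \<otimes>\<^bsub>H\<^esub> \<one>\<^bsub>H\<^esub>))"
    by (rule sweedler_coinv[OF _ r, where b="\<lambda>y1 y2. y1 \<otimes>\<^bsub>A\<^esub> q \<otimes>\<^bsub>A\<^esub> s (S (y2 \<otimes>\<^bsub>H\<^esub> \<one>\<^bsub>H\<^esub>))"])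
      (simp_all add: q)
  finally have "tau (r \<otimes>\<^bsub>A\<^esub> q) = r \<otimes>\<^bsub>A\<^esub> q" using r q by (simp add: H.antipode_one s_one)
  then show ?thesis using tau_coinv[of "r \<otimes>\<^bsub>A\<^esub> q"] r q by simp
qed

lemma coinv_add [simp]: "\<lbrakk>r \<in> coinv; q \<in> coinv\<rbrakk> \<Longrightarrow> r \<oplus>\<^bsub>A\<^esub> q \<in> coinv"
  using tau_coinv[of "r \<oplus>\<^bsub>A\<^esub> q"] by (simp add: k_linear_add[OF tau_lin] tau_id)

lemma coinv_smult [simp]: "\<lbrakk>c \<in> carrier K; r \<in> coinv\<rbrakk> \<Longrightarrow> c \<odot>\<^bsub>A\<^esub> r \<in> coinv"
  using tau_coinv[of "c \<odot>\<^bsub>A\<^esub> r"] by (simp add: k_linear_smult[OF tau_lin] tau_id)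

lemma coinv_uminus [simp]: "r \<in> coinv \<Longrightarrow> \<ominus>\<^bsub>A\<^esub> r \<in> coinv"
  using tau_coinv[of "\<ominus>\<^bsub>A\<^esub> r"] by (simp add: k_linear_uminus[OF modA modA tau_lin] tau_id)

lemma coinv_zero [simp]: "\<zero>\<^bsub>A\<^esub> \<in> coinv"
  using tau_coinv[of "\<zero>\<^bsub>A\<^esub>"] by (simp add: k_linear_zero[OF modA modA tau_lin])

text \<open>Applying \<open>tau\<close> to a factor that already lies in \<open>coinv\<close> changes nothing, while it lands in
  \<open>coinv\<close> without a proof obligation; hence all structure maps below are defined with \<open>tau\<close>.\<close>

definition coinv_module :: "('k, 'a) module"
  where "coinv_module = \<lparr>carrier = coinv, mult = mult A, one = \<one>\<^bsub>A\<^esub>, zero = \<zero>\<^bsub>A\<^esub>, add = add A, smult = smult A\<rparr>"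

definition tdelta :: "'a \<Rightarrow> ('a \<times> 'a \<Rightarrow> 'k) set"
  where "tdelta a = sweedler K A (tensor K coinv_module coinv_module)
    (\<lambda>x y. pure K coinv_module coinv_module (tau x) (tau y)) a"

definition adj :: "'h \<Rightarrow> 'a \<Rightarrow> 'a"
  where "adj h r = sweedler K H A (\<lambda>x y. s x \<otimes>\<^bsub>A\<^esub> r \<otimes>\<^bsub>A\<^esub> s (S y)) h"

definition lcoact :: "'a \<Rightarrow> ('h \<times> 'a \<Rightarrow> 'k) set"
  where "lcoact a = sweedler K A (tensor K H coinv_module) (\<lambda>x y. pure K H coinv_module (p x) (tau y)) a"

definition R :: "('k, 'h, 'a) yd_quad"
  where "R = \<lparr>carrier = coinv, mult = mult A, one = \<one>\<^bsub>A\<^esub>, zero = \<zero>\<^bsub>A\<^esub>, add = add A, smult = smult A,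
    comult = tdelta, counit = counit A, act = adj, coact = lcoact, cocyc = (\<lambda>h. tdelta (s h))\<rparr>"

lemma R_sel:
  "carrier R = coinv" "mult R = mult A" "one R = \<one>\<^bsub>A\<^esub>" "zero R = \<zero>\<^bsub>A\<^esub>" "add R = add A"
  "smult R = smult A" "comult R = tdelta" "counit R = counit A" "act R = adj" "coact R = lcoact"
  "cocyc R h = tdelta (s h)"
  by (simp_all add: R_def)

lemma algR [simp]: "k_algebra K R"
proof (rule k_algebra.intro[OF fieldK _ _ k_algebra_axioms.intro])
  show ag: "module K R"
  proof (rule moduleI)
    show "abelian_group R"
    proof (rule abelian_groupI)
      fix x assume "x \<in> carrier R"
      then show "\<exists>y\<in>carrier R. y \<oplus>\<^bsub>R\<^esub> x = \<zero>\<^bsub>R\<^esub>"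
        by (intro bexI[of _ "\<ominus>\<^bsub>A\<^esub> x"]) (auto simp: R_sel A.l_neg)
    qed (auto simp: R_sel A.a_ac)
  qed (auto simp: R_sel A.smult_l_distr A.smult_r_distr A.smult_assoc1 cringK)
  interpret module K R by (rule ag)
  show "ring R"
  proof (rule ringI)
    show "monoid R" by (rule monoidI) (auto simp: R_sel A.m_assoc)
  qed (auto simp: R_sel A.l_distr A.r_distr intro: abelian_group_axioms)
qed (auto simp: R_sel A.smult_mult_left A.smult_mult_right)

lemma modR [simp]: "module K R" by (rule k_algebra_module) simp

text \<open>The coproduct and the coaction are fields of \<open>R\<close> with values in tensor
  products over \<open>R\<close> itself. The bare module \<open>coinv_module\<close> breaks this
  circle in their definitions and is replaced by \<open>R\<close> afterwards, the tensor products
  being equal.\<close>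

lemma tensor_R:
  "tensor K coinv_module coinv_module = tensor K R R" "pure K coinv_module coinv_module = pure K R R"
  "tensor K H coinv_module = tensor K H R" "pure K H coinv_module = pure K H R"
  by (intro tensor_cong; simp add: coinv_module_def R_sel)+

lemma tdelta_eq: "tdelta a = sweedler K A (tensor K R R) (\<lambda>x y. pure K R R (tau x) (tau y)) a"
  unfolding tdelta_def tensor_R ..

lemma lcoact_eq: "lcoact a = sweedler K A (tensor K H R) (\<lambda>x y. pure K H R (p x) (tau y)) a"
  unfolding lcoact_def tensor_R ..

lemma R_carrier [simp]: "carrier R = coinv" by (simp add: R_sel)

lemma sweedler_R: "k_coalgebra K C \<Longrightarrow> h \<in> carrier C \<Longrightarrow>
    (\<And>x y. x \<in> carrier C \<Longrightarrow> y \<in> carrier C \<Longrightarrow> b x y \<in> coinv) \<Longrightarrow> sweedler K C R b h = sweedler K C A b h"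
  using sweedler_commute[of K R A "\<lambda>x. x" C h b] by (simp add: k_linear_def R_sel)

lemma tau_lin_R: "k_linear K A R tau"
  using tau_lin by (simp add: k_linear_def R_sel)

lemma R_lin_A: "k_linear K R A (\<lambda>x. x)"
  by (simp add: k_linear_def R_sel)

lemma k_linear_R: "k_linear K A X f \<Longrightarrow> k_linear K R X f"
  by (simp add: k_linear_def R_sel Pi_iff)

lemmas tau_lin' [simp] = tau_lin_R k_linear_comp[OF tau_lin_R] tau_lin k_linear_comp[OF tau_lin] R_lin_A

lemma tdelta_lin [simp]: "k_linear K A (tensor K R R) tdelta"
  unfolding tdelta_eq[abs_def] by simp

lemmas tdelta_lin' [simp] = k_linear_comp[OF tdelta_lin]

lemma tdelta_closed [simp]: "a \<in> carrier A \<Longrightarrow> tdelta a \<in> carrier (tensor K R R)"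
  by (rule k_linear_closed[OF tdelta_lin])

lemma lcoact_lin [simp]: "k_linear K A (tensor K H R) lcoact"
  unfolding lcoact_eq[abs_def] by simp

lemmas lcoact_lin' [simp] = k_linear_comp[OF lcoact_lin]

lemma lcoact_closed [simp]: "a \<in> carrier A \<Longrightarrow> lcoact a \<in> carrier (tensor K H R)"
  by (rule k_linear_closed[OF lcoact_lin])

lemma adj_lin_left: "r \<in> carrier A \<Longrightarrow> k_linear K V H f \<Longrightarrow> module K V \<Longrightarrow> k_linear K V A (\<lambda>v. adj (f v) r)"
  unfolding adj_def by simp

lemma adj_lin_right: "h \<in> carrier H \<Longrightarrow> k_linear K V A f \<Longrightarrow> module K V \<Longrightarrow> k_linear K V A (\<lambda>v. adj h (f v))"
  unfolding adj_def by simp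

lemma adj_closed [simp]: "h \<in> carrier H \<Longrightarrow> r \<in> carrier A \<Longrightarrow> adj h r \<in> carrier A"
  unfolding adj_def by simp

text \<open>Two evaluations of \<open>tau\<close> meet: the trailing factor s(S(h2)) is swallowed,
  leaving tau(s(h) r); and as \<open>r\<close> is coinvariant, expanding tau(s(h) r) reproduces the
  adjoint action. So the result is fixed by \<open>tau\<close>.\<close>

lemma adj_coinv [simp]:
  assumes h: "h \<in> carrier H" and r: "r \<in> coinv" shows "adj h r \<in> coinv"
proof -
  have "tau (adj h r) = sweedler K H A (\<lambda>x y. tau (s x \<otimes>\<^bsub>A\<^esub> r \<otimes>\<^bsub>A\<^esub> s (S y))) h"
    unfolding adj_def using h r by (intro sweedler_commute) simp_all
  also have "\<dots> = sweedler K H A (\<lambda>x y. counit H y \<odot>\<^bsub>A\<^esub> tau (s x \<otimes>\<^bsub>A\<^esub> r)) h"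
    using r by (simp add: tau_s_mult H.counit_antipode)
  also have "\<dots> = tau (s h \<otimes>\<^bsub>A\<^esub> r)"
    by (rule sweedler_counit_right) (use h r in simp_all)
  also have "\<dots> = sweedler K A A (\<lambda>x1 x2. sweedler K A A
      (\<lambda>y1 y2. x1 \<otimes>\<^bsub>A\<^esub> y1 \<otimes>\<^bsub>A\<^esub> s (S (p (x2 \<otimes>\<^bsub>A\<^esub> y2)))) r) (s h)"
    unfolding tau_def convolution_def by (rule sweedler_mult[OF bialgA]) (simp_all add: r h)
  also have "\<dots> = sweedler K A A (\<lambda>x1 x2. sweedler K A A
      (\<lambda>y1 y2. x1 \<otimes>\<^bsub>A\<^esub> y1 \<otimes>\<^bsub>A\<^esub> s (S (p x2 \<otimes>\<^bsub>H\<^esub> p y2))) r) (s h)"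
    by (simp add: p_mult)
  also have "\<dots> = sweedler K A A (\<lambda>x1 x2. x1 \<otimes>\<^bsub>A\<^esub> r \<otimes>\<^bsub>A\<^esub> s (S (p x2 \<otimes>\<^bsub>H\<^esub> \<one>\<^bsub>H\<^esub>))) (s h)"
    by (intro sweedler_cong[THEN fun_cong] sweedler_coinv[OF _ r, where
      b="\<lambda>y1 y2. _ \<otimes>\<^bsub>A\<^esub> y1 \<otimes>\<^bsub>A\<^esub> s (S (p _ \<otimes>\<^bsub>H\<^esub> y2))"]) simp_all
  also have "\<dots> = sweedler K H A (\<lambda>x1 x2. s x1 \<otimes>\<^bsub>A\<^esub> r \<otimes>\<^bsub>A\<^esub> s (S (x2 \<otimes>\<^bsub>H\<^esub> \<one>\<^bsub>H\<^esub>))) h"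
    by (rule sweedler_s_right[OF _ h, where b="\<lambda>y1 y2. y1 \<otimes>\<^bsub>A\<^esub> r \<otimes>\<^bsub>A\<^esub> s (S (y2 \<otimes>\<^bsub>H\<^esub> \<one>\<^bsub>H\<^esub>))"])
      (simp_all add: r)
  finally have "tau (adj h r) = adj h r" by (simp add: adj_def)
  then show ?thesis using tau_coinv[of "adj h r"] h r by simp
qed

section \<open>Embedding the braided tensor square into the tensor square\<close>

abbreviation "T \<equiv> tensor_algebra K A A"
abbreviation "RR \<equiv> tensor K R R"

lemma algT [simp]: "k_algebra K T" by simp

lemma modT [simp]: "module K T" by simp

sublocale T: k_algebra K T by (rule algT)

definition i1 :: "'a \<Rightarrow> ('a \<times> 'a \<Rightarrow> 'k) set" where "i1 a = pure K A A a \<one>\<^bsub>A\<^esub>"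
definition i2 :: "'a \<Rightarrow> ('a \<times> 'a \<Rightarrow> 'k) set" where "i2 a = pure K A A \<one>\<^bsub>A\<^esub> a"

lemma i1_hom: "algebra_hom K A T i1"
  using algebra_hom_pure_left[OF algA algA] by (simp add: i1_def[abs_def])

lemma i2_hom: "algebra_hom K A T i2"
  using algebra_hom_pure_right[OF algA algA] by (simp add: i2_def[abs_def])

lemmas i1_closed [simp] = algebra_homD(2)[OF i1_hom]
lemmas i2_closed [simp] = algebra_homD(2)[OF i2_hom]
lemmas i_lin [simp] = algebra_homD(1)[OF i1_hom] algebra_homD(1)[OF i2_hom]
  k_linear_comp[OF algebra_homD(1)[OF i1_hom]] k_linear_comp[OF algebra_homD(1)[OF i2_hom]]
lemmas i_mult = algebra_homD(3)[OF i1_hom] algebra_homD(3)[OF i2_hom]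

lemma i1_i2: "\<lbrakk>a \<in> carrier A; b \<in> carrier A\<rbrakk> \<Longrightarrow> i1 a \<otimes>\<^bsub>T\<^esub> i2 b = pure K A A a b"
  by (simp add: i1_def i2_def tensor_algebra_sel tensor_mult_pure)

lemma i2_i1: "\<lbrakk>a \<in> carrier A; b \<in> carrier A\<rbrakk> \<Longrightarrow> i2 b \<otimes>\<^bsub>T\<^esub> i1 a = i1 a \<otimes>\<^bsub>T\<^esub> i2 b"
  by (simp add: i1_def i2_def tensor_algebra_sel tensor_mult_pure)

lemma pure_mult: "\<lbrakk>a \<in> carrier A; b \<in> carrier A; c \<in> carrier A; d \<in> carrier A\<rbrakk>
    \<Longrightarrow> pure K A A a b \<otimes>\<^bsub>T\<^esub> pure K A A c d = pure K A A (a \<otimes>\<^bsub>A\<^esub> c) (b \<otimes>\<^bsub>A\<^esub> d)"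
  by (simp add: tensor_algebra_sel tensor_mult_pure)

lemma i1_pure: "\<lbrakk>a \<in> carrier A; b \<in> carrier A; c \<in> carrier A\<rbrakk>
    \<Longrightarrow> i1 a \<otimes>\<^bsub>T\<^esub> pure K A A b c = pure K A A (a \<otimes>\<^bsub>A\<^esub> b) c"
  by (simp add: i1_def tensor_algebra_sel tensor_mult_pure)

lemma pure_T [simp]: "\<lbrakk>a \<in> carrier A; b \<in> carrier A\<rbrakk> \<Longrightarrow> pure K A A a b \<in> carrier T"
  by (simp add: tensor_algebra_sel)

lemma Delta_hom: "algebra_hom K A T (comult A)" by (rule comult_algebra_hom[OF bialgA])

lemmas Delta_closed [simp] = algebra_homD(2)[OF Delta_hom]
lemmas Delta_lin [simp] = algebra_homD(1)[OF Delta_hom] k_linear_comp[OF algebra_homD(1)[OF Delta_hom]]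
lemmas Delta_mult = algebra_homD(3)[OF Delta_hom]

lemma Delta_conv: "a \<in> carrier A \<Longrightarrow> comult A a = convolution K A T i1 i2 a"
  using comult_convolution[OF bialgA] by (simp add: i1_def[abs_def] i2_def[abs_def])

text \<open>The left coaction with its leg pushed into \<open>A\<close>: a goes to \<Sum> s(p(a1))
  \<otimes> a2. Its restriction \<open>gam\<close> along \<open>s\<close> is (s \<otimes> s)\<Delta>
  by left colinearity, which is what \<Delta>(s(h)) would be if \<open>s\<close> were a coalgebra
  map.\<close>

definition lam :: "'a \<Rightarrow> ('a \<times> 'a \<Rightarrow> 'k) set"
  where "lam = convolution K A T (\<lambda>x. i1 (s (p x))) i2"

definition gam :: "'h \<Rightarrow> ('a \<times> 'a \<Rightarrow> 'k) set"
  where "gam h = lam (s h)"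

lemma lam_hom: "algebra_hom K A T lam"
  unfolding lam_def
  by (rule convolution_commuting_hom[OF bialgA algT algebra_hom_comp[OF i1_hom algebra_hom_comp[OF s_hom p_hom]] i2_hom])
    (simp add: i2_i1)

lemma gam_hom: "algebra_hom K H T gam"
  unfolding gam_def[abs_def] by (rule algebra_hom_comp[OF lam_hom s_hom])

lemmas lam_closed [simp] = algebra_homD(2)[OF lam_hom]
lemmas lam_lin [simp] = algebra_homD(1)[OF lam_hom] k_linear_comp[OF algebra_homD(1)[OF lam_hom]]
lemmas lam_mult = algebra_homD(3)[OF lam_hom]
lemmas gam_closed [simp] = algebra_homD(2)[OF gam_hom]
lemmas gam_lin [simp] = algebra_homD(1)[OF gam_hom] k_linear_comp[OF algebra_homD(1)[OF gam_hom]]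
lemmas gam_mult = algebra_homD(3)[OF gam_hom]

lemma gam_conv: "h \<in> carrier H \<Longrightarrow> gam h = convolution K H T (\<lambda>x. i1 (s x)) (\<lambda>x. i2 (s x)) h"
  unfolding gam_def lam_def convolution_def
  by (rule sweedler_s_left[where b="\<lambda>x y. i1 (s x) \<otimes>\<^bsub>T\<^esub> i2 y"]) simp_all

lemma gam_antipode_left: "h \<in> carrier H \<Longrightarrow> convolution K H T (\<lambda>x. gam (S x)) gam h = conv_unit H T h"
  by (rule H.antipode_conv_left[OF gam_hom algT])

lemmas s_i1 = algebra_hom_comp[OF i1_hom s_hom]

lemma k_linear_R_iff:
  "(\<And>v. v \<in> carrier V \<Longrightarrow> f v \<in> coinv) \<Longrightarrow> k_linear K V A f \<Longrightarrow> k_linear K V R f"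
  by (simp add: k_linear_def R_sel Pi_iff)

lemma R_mult_lin [simp]:
  "k_linear K V R f \<Longrightarrow> r \<in> coinv \<Longrightarrow> k_linear K V R (\<lambda>v. f v \<otimes>\<^bsub>A\<^esub> r)"
  "k_linear K V R f \<Longrightarrow> r \<in> coinv \<Longrightarrow> k_linear K V R (\<lambda>v. r \<otimes>\<^bsub>A\<^esub> f v)"
  using k_linear_mult_left[OF algR, of V f r] k_linear_mult_right[OF algR, of V f r] by (simp_all add: R_sel)

lemma R_adj_lin [simp]:
  "r \<in> coinv \<Longrightarrow> k_linear K V H f \<Longrightarrow> module K V \<Longrightarrow> k_linear K V R (\<lambda>v. adj (f v) r)"
  using k_linear_R_iff[of V "\<lambda>v. adj (f v) r"] adj_lin_left[of r V f] k_linear_closed[of K V H f] by auto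

lemma R_adj_lin' [simp]:
  "h \<in> carrier H \<Longrightarrow> k_linear K V R f \<Longrightarrow> module K V \<Longrightarrow> k_linear K V R (\<lambda>v. adj h (f v))"
  using k_linear_R_iff[of V "\<lambda>v. adj h (f v)"] adj_lin_right[of h V f] k_linear_closed[of K V R f]
    k_linear_comp[OF R_lin_A, of V f] by auto

lemma k_linear_from_R [simp]: "k_linear K V R f \<Longrightarrow> k_linear K V A f"
  using k_linear_comp[OF R_lin_A] .

lemma tlift_tdelta:
  assumes "module K X" "k_bilinear K R R X b" "a \<in> carrier A"
  shows "tlift K X b (tdelta a) = sweedler K A X (\<lambda>x y. b (tau x) (tau y)) a"
  unfolding tdelta_eq by (rule tlift_sweedler_pure[OF coA modR modR assms]) simp_all

lemma tlift_lcoact: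
  assumes "module K X" "k_bilinear K H R X b" "a \<in> carrier A"
  shows "tlift K X b (lcoact a) = sweedler K A X (\<lambda>x y. b (p x) (tau y)) a"
  unfolding lcoact_eq by (rule tlift_sweedler_pure[OF coA modH modR assms]) simp_all

lemma pure_smult:
  assumes "c \<in> carrier K" "r \<in> coinv"
  shows "q \<in> coinv \<Longrightarrow> pure K R R (c \<odot>\<^bsub>A\<^esub> r) q = c \<odot>\<^bsub>RR\<^esub> pure K R R r q"
    "q \<in> coinv \<Longrightarrow> pure K R R q (c \<odot>\<^bsub>A\<^esub> r) = c \<odot>\<^bsub>RR\<^esub> pure K R R q r"
    "h \<in> carrier H \<Longrightarrow> pure K H R h (c \<odot>\<^bsub>A\<^esub> r) = c \<odot>\<^bsub>tensor K H R\<^esub> pure K H R h r"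
    "h \<in> carrier H \<Longrightarrow> pure K R H (c \<odot>\<^bsub>A\<^esub> r) h = c \<odot>\<^bsub>tensor K R H\<^esub> pure K R H r h"
  using assms k_linear_smult[OF k_linear_pure_left[OF modR modR k_linear_id], of q c r]
    k_linear_smult[OF k_linear_pure_right[OF modR modR k_linear_id], of q c r]
    k_linear_smult[OF k_linear_pure_right[OF modH modR k_linear_id], of h c r]
    k_linear_smult[OF k_linear_pure_left[OF modR modH k_linear_id], of h c r]
  by (simp_all add: R_sel)

text \<open>\<Delta> sends coinvariants into A \<otimes> R: replacing r2 by tau(r2) inserts
  s(S(p(r3))) on its right, and after coassociativity the leg p(r3) is that of the right coaction of
  \<open>r\<close>, which is 1.\<close>

lemma sweedler_coinv_tau:
  assumes X: "module K X" and r: "r \<in> coinv"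
    and l: "\<And>x. x \<in> carrier A \<Longrightarrow> k_linear K A X (b x)"
      "\<And>y. y \<in> carrier A \<Longrightarrow> k_linear K A X (\<lambda>x. b x y)"
  shows "sweedler K A X (\<lambda>x y. b x (tau y)) r = sweedler K A X b r"
proof -
  have L1: "k_linear K U X (\<lambda>u. b x (f u))" if "x \<in> carrier A" "k_linear K U A f"
    for U :: "('k, 'u, 'v) module_scheme" and x f
    using k_linear_comp[OF l(1)] that by blast
  have L2: "k_linear K U X (\<lambda>u. b (f u) y)" if "y \<in> carrier A" "k_linear K U A f"
    for U :: "('k, 'u, 'v) module_scheme" and y f
    using k_linear_comp[OF l(2)] that by blast
  have bc: "b x y \<in> carrier X" if "x \<in> carrier A" "y \<in> carrier A" for x y
    using k_linear_closed[OF l(1)] that by blast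
  have "sweedler K A X (\<lambda>x y. b x (tau y)) r
    = sweedler K A X (\<lambda>x y. sweedler K A X (\<lambda>u v. b x (u \<otimes>\<^bsub>A\<^esub> s (S (p v)))) y) r"
    unfolding tau_def convolution_def using X
    by (intro sweedler_cong[THEN fun_cong] sweedler_commute) (simp_all add: l bc)
  also have "\<dots> = sweedler K A X (\<lambda>z v. sweedler K A X (\<lambda>x u. b x (u \<otimes>\<^bsub>A\<^esub> s (S (p v)))) z) r"
    by (rule sweedler_coassoc[symmetric]) (simp_all add: X L1 L2 l)
  also have "\<dots> = sweedler K A X (\<lambda>x u. b x (u \<otimes>\<^bsub>A\<^esub> s (S \<one>\<^bsub>H\<^esub>))) r"
    by (rule sweedler_coinv[OF X r, where b="\<lambda>z v. sweedler K A X (\<lambda>x u. b x (u \<otimes>\<^bsub>A\<^esub> s (S v))) z"])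
      (simp_all add: X L1 L2 l)
  finally show ?thesis by (simp add: H.antipode_one s_one)
qed

text \<open>\<open>Psi(r \<otimes> q) = \<Sum> r s(q\<^sub>(\<^sub>-\<^sub>1\<^sub>)) \<otimes> q\<^sub>(\<^sub>0\<^sub>)\<close> is multiplicative from the braided tensor square of \<open>R\<close> to
  \<open>A \<otimes> A\<close>, with left inverse \<open>Theta\<close>.\<close>

definition Psi :: "('a \<times> 'a \<Rightarrow> 'k) set \<Rightarrow> ('a \<times> 'a \<Rightarrow> 'k) set"
  where "Psi X = tlift K T (\<lambda>r q. i1 r \<otimes>\<^bsub>T\<^esub> lam q) X"

definition Theta :: "('a \<times> 'a \<Rightarrow> 'k) set \<Rightarrow> ('a \<times> 'a \<Rightarrow> 'k) set"
  where "Theta X = tlift K RR (\<lambda>a b. pure K R R (tau a) (tau b)) X"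

lemma Psi_bil: "k_bilinear K R R T (\<lambda>r q. i1 r \<otimes>\<^bsub>T\<^esub> lam q)"
  by (rule k_bilinearI) simp_all

lemma Psi_lin0: "k_linear K RR T Psi"
  unfolding Psi_def[abs_def] by (rule tlift_linear[OF modR modR modT Psi_bil])

lemmas Psi_lin [simp] = Psi_lin0 k_linear_comp[OF Psi_lin0]
lemmas Psi_closed [simp] = k_linear_closed[OF Psi_lin0]

lemma Psi_pure: "\<lbrakk>r \<in> coinv; q \<in> coinv\<rbrakk> \<Longrightarrow> Psi (pure K R R r q) = i1 r \<otimes>\<^bsub>T\<^esub> lam q"
  unfolding Psi_def by (rule tlift_pure[OF modR modR modT Psi_bil]) simp_all

lemma Theta_bil: "k_bilinear K A A RR (\<lambda>a b. pure K R R (tau a) (tau b))"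
  by (rule k_bilinearI) simp_all

lemma Theta_lin0: "k_linear K T RR Theta"
  unfolding k_linear_tensor_algebra Theta_def[abs_def]
  by (rule tlift_linear[OF modA modA _ Theta_bil]) simp

lemmas Theta_lin [simp] = Theta_lin0 k_linear_comp[OF Theta_lin0]

lemma Theta_pure: "\<lbrakk>a \<in> carrier A; b \<in> carrier A\<rbrakk> \<Longrightarrow> Theta (pure K A A a b) = pure K R R (tau a) (tau b)"
  unfolding Theta_def by (rule tlift_pure[OF modA modA _ Theta_bil]) simp_all

lemma T_ext:
  assumes "X \<in> carrier T" "module K Y" "k_linear K T Y f" "k_linear K T Y g"
    "\<And>x y. \<lbrakk>x \<in> carrier A; y \<in> carrier A\<rbrakk> \<Longrightarrow> f (pure K A A x y) = g (pure K A A x y)"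
  shows "f X = g X"
  by (rule tensor_ext[OF modA modA assms(2), of X f g])
    (use assms in \<open>simp_all add: tensor_algebra_sel k_linear_tensor_algebra\<close>)

text \<open>Under \<open>tau\<close> the factor s(p(x)) in the first leg of Psi(r \<otimes> q)
  shrinks to \<epsilon>(x), and the counit law restores \<open>q\<close>. Injectivity of
  \<open>Psi\<close> follows, through which equations in R \<otimes> R are proved.\<close>

lemma Theta_Psi:
  assumes X: "X \<in> carrier RR" shows "Theta (Psi X) = X"
proof (rule tensor_ext[OF modR modR _ X, where X=RR and f="\<lambda>X. Theta (Psi X)"])
  fix r q assume "r \<in> carrier R" "q \<in> carrier R"
  then have rq: "r \<in> coinv" "q \<in> coinv" by simp_all
  have "Psi (pure K R R r q) = sweedler K A T (\<lambda>x y. i1 r \<otimes>\<^bsub>T\<^esub> (i1 (s (p x)) \<otimes>\<^bsub>T\<^esub> i2 y)) q"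
    unfolding Psi_pure[OF rq] lam_def convolution_def using rq by (intro sweedler_commute) simp_all
  also have "\<dots> = sweedler K A T (\<lambda>x y. pure K A A (r \<otimes>\<^bsub>A\<^esub> s (p x)) y) q"
    using rq by (simp add: i1_i2 i1_pure)
  finally have "Theta (Psi (pure K R R r q))
      = Theta (sweedler K A T (\<lambda>x y. pure K A A (r \<otimes>\<^bsub>A\<^esub> s (p x)) y) q)" by simp
  also have "\<dots> = sweedler K A RR (\<lambda>x y. Theta (pure K A A (r \<otimes>\<^bsub>A\<^esub> s (p x)) y)) q"
    using rq by (intro sweedler_commute) simp_all
  also have "\<dots> = sweedler K A RR (\<lambda>x y. counit A x \<odot>\<^bsub>RR\<^esub> pure K R R (tau r) (tau y)) q"
    using rq by (simp add: Theta_pure tau_s_mult p_counit pure_smult)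
  also have "\<dots> = pure K R R (tau r) (tau q)"
    using rq by (intro sweedler_counit_left) simp_all
  finally show "Theta (Psi (pure K R R r q)) = pure K R R r q" using rq by (simp add: tau_id)
qed simp_all

lemma Psi_inj: "\<lbrakk>X \<in> carrier RR; Y \<in> carrier RR; Psi X = Psi Y\<rbrakk> \<Longrightarrow> X = Y"
  using Theta_Psi by metis

text \<open>The key formula for \<delta> and \<omega> at once. The map \<open>i1\<close> after
  \<open>tau\<close> is \<open>i1\<close> convolved with i1(s(S(p(x)))), and \<open>lam\<close>
  after \<open>tau\<close> is \<open>lam\<close> convolved with gam(S(p(x))). The inner factor
  i1(s(S(p(x)))) cancels the first factor of \<open>lam\<close>, and what remains of it,
  \<open>i2\<close>, combines with \<open>i1\<close> to \<Delta>.\<close>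

lemma Psi_tdelta:
  assumes a: "a \<in> carrier A"
  shows "Psi (tdelta a) = convolution K A T (comult A) (\<lambda>x. gam (S (p x))) a"
proof -
  let ?c = "convolution K A T"
  have t1: "i1 (tau x) = ?c i1 (\<lambda>x. i1 (s (S (p x)))) x" if "x \<in> carrier A" for x
    unfolding tau_def using that by (intro algebra_hom_convolution[OF i1_hom algA algT coA]) simp_all
  have t2: "lam (tau x) = ?c lam (\<lambda>x. gam (S (p x))) x" if "x \<in> carrier A" for x
    unfolding tau_def gam_def using that by (intro algebra_hom_convolution[OF lam_hom algA algT coA]) simp_all
  have "Psi (tdelta a) = ?c (\<lambda>x. i1 (tau x)) (\<lambda>x. lam (tau x)) a"
    unfolding Psi_def convolution_def by (rule tlift_tdelta[OF modT Psi_bil a])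
  also have "\<dots> = ?c (?c i1 (\<lambda>x. i1 (s (S (p x))))) (?c lam (\<lambda>x. gam (S (p x)))) a"
    by (simp add: t1 t2)
  also have "\<dots> = ?c i1 (?c (\<lambda>x. i1 (s (S (p x)))) (?c lam (\<lambda>x. gam (S (p x))))) a"
    by (subst convolution_assoc) simp_all
  also have "\<dots> = ?c i1 (?c (\<lambda>x. i1 (s (S (p x)))) (?c (\<lambda>x. i1 (s (p x))) (?c i2 (\<lambda>x. gam (S (p x)))))) a"
    unfolding lam_def by (subst convolution_assoc) simp_all
  also have "\<dots> = ?c i1 (?c i2 (\<lambda>x. gam (S (p x)))) a"
    by (rule fun_cong[OF convolution_cong[OF refl]], rule convolution_cancel_left)
      (simp_all add: conv_inv_left[OF s_i1 algT])
  also have "\<dots> = ?c (?c i1 i2) (\<lambda>x. gam (S (p x))) a"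
    by (subst convolution_assoc) simp_all
  also have "\<dots> = ?c (comult A) (\<lambda>x. gam (S (p x))) a" by (simp add: Delta_conv)
  finally show ?thesis .
qed

text \<open>For coinvariant \<open>r\<close> the leg p(r2) in \<open>Psi_tdelta\<close> is 1, so the
  twisting factor is gam(S(1)) = 1.\<close>

lemma Psi_delta:
  assumes r: "r \<in> coinv" shows "Psi (tdelta r) = comult A r"
proof -
  have "Psi (tdelta r) = comult A r \<otimes>\<^bsub>T\<^esub> gam (S \<one>\<^bsub>H\<^esub>)"
    unfolding Psi_tdelta[OF coinv_closed[OF r]] convolution_def
    by (rule sweedler_coinv[OF modT r, where b="\<lambda>x y. comult A x \<otimes>\<^bsub>T\<^esub> gam (S y)"]) simp_all
  then show ?thesis using r by (simp add: H.antipode_one algebra_homD(4)[OF gam_hom])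
qed

lemma Psi_omega:
  assumes h: "h \<in> carrier H"
  shows "Psi (tdelta (s h)) = convolution K H T (\<lambda>x. comult A (s x)) (\<lambda>x. gam (S x)) h"
  unfolding Psi_tdelta[OF s_closed[OF h]] convolution_def
  by (rule sweedler_s_right[OF modT h, where b="\<lambda>x y. comult A x \<otimes>\<^bsub>T\<^esub> gam (S y)"]) simp_all

text \<open>Convolving \<open>Psi_omega\<close> with \<open>gam\<close> cancels its factor
  gam(S(x)). Thus \<omega> is the convolution quotient of \<Delta>(s(h)) by gam(h), and is trivial
  when \<open>s\<close> is a coalgebra map.\<close>

lemma Psi_omega_gam:
  assumes h: "h \<in> carrier H"
  shows "convolution K H T (\<lambda>x. Psi (tdelta (s x))) gam h = comult A (s h)"
proof -
  have "convolution K H T (\<lambda>x. Psi (tdelta (s x))) gam h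
    = convolution K H T (convolution K H T (\<lambda>x. comult A (s x)) (\<lambda>x. gam (S x))) gam h"
    by (simp add: Psi_omega)
  also have "\<dots> = comult A (s h)"
    by (rule convolution_cancel_right) (simp_all add: h gam_antipode_left)
  finally show ?thesis .
qed

lemma Psi_tdelta_coinv_s:
  assumes r: "r \<in> coinv" and h: "h \<in> carrier H"
  shows "Psi (tdelta (r \<otimes>\<^bsub>A\<^esub> s h)) = comult A r \<otimes>\<^bsub>T\<^esub> Psi (tdelta (s h))"
proof -
  have rs: "r \<otimes>\<^bsub>A\<^esub> s h \<in> carrier A" using r h by simp
  have "Psi (tdelta (r \<otimes>\<^bsub>A\<^esub> s h)) = sweedler K H T (\<lambda>x y. comult A (r \<otimes>\<^bsub>A\<^esub> s x) \<otimes>\<^bsub>T\<^esub> gam (S y)) h"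
    unfolding Psi_tdelta[OF rs] convolution_def
    by (rule sweedler_coinv_s[OF modT r h, where b="\<lambda>x y. comult A x \<otimes>\<^bsub>T\<^esub> gam (S y)"]) simp_all
  also have "\<dots> = sweedler K H T (\<lambda>x y. comult A r \<otimes>\<^bsub>T\<^esub> (comult A (s x) \<otimes>\<^bsub>T\<^esub> gam (S y))) h"
    using r by (simp add: Delta_mult T.m_assoc)
  also have "\<dots> = comult A r \<otimes>\<^bsub>T\<^esub> Psi (tdelta (s h))"
    unfolding Psi_omega[OF h] convolution_def using r h
    by (intro sweedler_commute[symmetric]) simp_all
  finally show ?thesis .
qed

lemma i1_adj:
  assumes t: "t \<in> carrier A" and h: "h \<in> carrier H"
  shows "i1 (adj h t) = convolution K H T (\<lambda>x. i1 (s x) \<otimes>\<^bsub>T\<^esub> i1 t) (\<lambda>x. i1 (s (S x))) h"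
proof -
  have "i1 (adj h t) = sweedler K H T (\<lambda>x y. i1 (s x \<otimes>\<^bsub>A\<^esub> t \<otimes>\<^bsub>A\<^esub> s (S y))) h"
    unfolding adj_def using t h by (intro sweedler_commute) simp_all
  then show ?thesis using t by (simp add: i_mult convolution_def)
qed

lemma lam_adj:
  assumes t: "t \<in> carrier A" and h: "h \<in> carrier H"
  shows "lam (adj h t) = convolution K H T (\<lambda>x. gam x \<otimes>\<^bsub>T\<^esub> lam t) (\<lambda>x. gam (S x)) h"
proof -
  have "lam (adj h t) = sweedler K H T (\<lambda>x y. lam (s x \<otimes>\<^bsub>A\<^esub> t \<otimes>\<^bsub>A\<^esub> s (S y))) h"
    unfolding adj_def using t h by (intro sweedler_commute) simp_all
  then show ?thesis using t by (simp add: lam_mult convolution_def gam_def)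
qed

text \<open>The braiding realized in A \<otimes> A: pulling i1(t) to the left of lam(q) lets the
  coaction leg of \<open>q\<close> act on \<open>t\<close>. The factor i1(s(S(p(x)))) of the adjoint
  action cancels the first factor of \<open>lam\<close>, after which \<open>i1\<close> and
  \<open>i2\<close> commute.\<close>

lemma lam_i1:
  assumes t: "t \<in> carrier A" and q: "q \<in> carrier A"
  shows "sweedler K A T (\<lambda>x y. i1 (adj (p x) t) \<otimes>\<^bsub>T\<^esub> lam y) q = lam q \<otimes>\<^bsub>T\<^esub> i1 t"
proof -
  let ?c = "convolution K A T"
  have e: "i1 (adj (p x) t) = ?c (\<lambda>x. i1 (s (p x)) \<otimes>\<^bsub>T\<^esub> i1 t) (\<lambda>x. i1 (s (S (p x)))) x"
    if "x \<in> carrier A" for x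
    using that t
    by (subst convolution_p[where f="\<lambda>x. i1 (s x) \<otimes>\<^bsub>T\<^esub> i1 t" and g="\<lambda>x. i1 (s (S x))"]) (simp_all add: i1_adj)
  have "sweedler K A T (\<lambda>x y. i1 (adj (p x) t) \<otimes>\<^bsub>T\<^esub> lam y) q
    = ?c (\<lambda>x. i1 (adj (p x) t)) lam q" by (simp add: convolution_def)
  also have "\<dots> = ?c (?c (\<lambda>x. i1 (s (p x)) \<otimes>\<^bsub>T\<^esub> i1 t) (\<lambda>x. i1 (s (S (p x))))) lam q"
    by (simp add: e)
  also have "\<dots> = ?c (\<lambda>x. i1 (s (p x)) \<otimes>\<^bsub>T\<^esub> i1 t) (?c (\<lambda>x. i1 (s (S (p x)))) lam) q"
    using t by (subst convolution_assoc) simp_all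
  also have "\<dots> = ?c (\<lambda>x. i1 (s (p x)) \<otimes>\<^bsub>T\<^esub> i1 t) i2 q"
    unfolding lam_def
    by (rule fun_cong[OF convolution_cong[OF refl]], rule convolution_cancel_left)
      (simp_all add: conv_inv_left[OF s_i1 algT])
  also have "\<dots> = sweedler K A T (\<lambda>x y. i1 (s (p x)) \<otimes>\<^bsub>T\<^esub> i2 y \<otimes>\<^bsub>T\<^esub> i1 t) q"
    using t by (simp add: convolution_def T.m_assoc i2_i1)
  also have "\<dots> = lam q \<otimes>\<^bsub>T\<^esub> i1 t"
    unfolding lam_def convolution_def using t q
    by (intro sweedler_commute[where g="\<lambda>z. z \<otimes>\<^bsub>T\<^esub> i1 t", symmetric]) simp_all
  finally show ?thesis .
qed

section \<open>The braided product under the embedding\<close>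

definition br :: "'a \<Rightarrow> 'a \<Rightarrow> 'a \<Rightarrow> 'a \<Rightarrow> ('a \<times> 'a \<Rightarrow> 'k) set"
  where "br r q t v = sweedler K A RR (\<lambda>x y. pure K R R (r \<otimes>\<^bsub>A\<^esub> adj (p x) t) (tau y \<otimes>\<^bsub>A\<^esub> v)) q"

lemma braided_mult_br:
  "braided_mult K R X Y = tlift K RR (\<lambda>r q. tlift K RR (br r q) Y) X"
  if X: "X \<in> carrier RR" and Y: "Y \<in> carrier RR"
  unfolding braided_mult_def
proof (intro tlift_cong[OF modR modR X] tlift_cong[OF modR modR Y])
  fix r q t v assume c: "r \<in> carrier R" "q \<in> carrier R" "t \<in> carrier R" "v \<in> carrier R"
  have b: "k_bilinear K H R RR (\<lambda>g s0. pure K R R (r \<otimes>\<^bsub>R\<^esub> act R g t) (s0 \<otimes>\<^bsub>R\<^esub> v))"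
    using c by (intro k_bilinearI) (simp_all add: R_sel(2,9))
  show "tlift K RR (\<lambda>g s0. pure K R R (r \<otimes>\<^bsub>R\<^esub> act R g t) (s0 \<otimes>\<^bsub>R\<^esub> v)) (coact R q) = br r q t v"
    using tlift_lcoact[OF _ b, of q] c by (simp add: R_sel(2,9,10) br_def)
qed

lemma br_bil: "\<lbrakk>r \<in> coinv; q \<in> coinv\<rbrakk> \<Longrightarrow> k_bilinear K R R RR (br r q)"
  unfolding br_def[abs_def] by (rule k_bilinearI) simp_all

lemma br_lin1: "\<lbrakk>q \<in> coinv; t \<in> coinv; v \<in> coinv\<rbrakk> \<Longrightarrow> k_linear K R RR (\<lambda>r. br r q t v)"
  unfolding br_def[abs_def] by simp

lemma br_lin2: "\<lbrakk>r \<in> coinv; t \<in> coinv; v \<in> coinv\<rbrakk> \<Longrightarrow> k_linear K R RR (\<lambda>q. br r q t v)"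
  unfolding br_def[abs_def] by simp

lemma br_bil2: "Y \<in> carrier RR \<Longrightarrow> k_bilinear K R R RR (\<lambda>r q. tlift K RR (br r q) Y)"
  by (rule k_bilinearI; rule k_linear_tlift_inner[OF modR modR]) (simp_all add: br_lin1 br_lin2)

lemma braided_closed [simp]:
  "\<lbrakk>X \<in> carrier RR; Y \<in> carrier RR\<rbrakk> \<Longrightarrow> braided_mult K R X Y \<in> carrier RR"
  unfolding braided_mult_br
  by (intro tlift_closed[OF modR modR]) (simp_all add: k_bilinear_closed[OF br_bil])

text \<open>By linearity both tensors may be taken pure, r \<otimes> q and t \<otimes> v. As
  \<open>i1\<close> and \<open>lam\<close> are multiplicative, what remains is the exchange of
  lam(q) with i1(t), given by \<open>lam_i1\<close>.\<close>

lemma Psi_mult: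
  assumes X: "X \<in> carrier RR" and Y: "Y \<in> carrier RR"
  shows "Psi (braided_mult K R X Y) = Psi X \<otimes>\<^bsub>T\<^esub> Psi Y"
  unfolding braided_mult_br[OF X Y]
proof (rule tensor_ext[OF modR modR _ X, where f="\<lambda>X. Psi (tlift K RR (\<lambda>r q. tlift K RR (br r q) Y) X)"])
  show "k_linear K RR T (\<lambda>X. Psi (tlift K RR (\<lambda>r q. tlift K RR (br r q) Y) X))"
    by (rule k_linear_comp[OF Psi_lin0 tlift_linear[OF modR modR _ br_bil2[OF Y]]]) simp
  fix r q assume "r \<in> carrier R" "q \<in> carrier R"
  then have rq: "r \<in> coinv" "q \<in> coinv" by simp_all
  have "Psi (tlift K RR (br r q) Y) = i1 r \<otimes>\<^bsub>T\<^esub> lam q \<otimes>\<^bsub>T\<^esub> Psi Y"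
  proof (rule tensor_ext[OF modR modR _ Y, where f="\<lambda>Y. Psi (tlift K RR (br r q) Y)"])
    show "k_linear K RR T (\<lambda>Y. Psi (tlift K RR (br r q) Y))"
      by (rule k_linear_comp[OF Psi_lin0 tlift_linear[OF modR modR _ br_bil[OF rq]]]) simp
    fix t v assume "t \<in> carrier R" "v \<in> carrier R"
    then have tv: "t \<in> coinv" "v \<in> coinv" by simp_all
    have "Psi (tlift K RR (br r q) (pure K R R t v)) = Psi (br r q t v)"
      using tlift_pure[OF modR modR _ br_bil[OF rq], of t v] tv by simp
    also have "\<dots> = sweedler K A T (\<lambda>x y. Psi (pure K R R (r \<otimes>\<^bsub>A\<^esub> adj (p x) t) (tau y \<otimes>\<^bsub>A\<^esub> v))) q"
      unfolding br_def using rq tv by (intro sweedler_commute) simp_all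
    also have "\<dots> = sweedler K A T (\<lambda>x y. i1 r \<otimes>\<^bsub>T\<^esub> (i1 (adj (p x) t) \<otimes>\<^bsub>T\<^esub> lam (tau y)) \<otimes>\<^bsub>T\<^esub> lam v) q"
      using rq tv by (simp add: Psi_pure i_mult lam_mult T.m_assoc)
    \<comment> \<open>The projection \<open>tau\<close> built into the coaction of \<open>R\<close>
      acts as the identity here, because the coproduct of the coinvariant \<open>q\<close> already
      lies in A \<otimes> R.\<close>
    also have "\<dots> = sweedler K A T (\<lambda>x y. i1 r \<otimes>\<^bsub>T\<^esub> (i1 (adj (p x) t) \<otimes>\<^bsub>T\<^esub> lam y) \<otimes>\<^bsub>T\<^esub> lam v) q"
      using rq tv by (intro sweedler_coinv_tau[where
        b="\<lambda>x y. i1 r \<otimes>\<^bsub>T\<^esub> (i1 (adj (p x) t) \<otimes>\<^bsub>T\<^esub> lam y) \<otimes>\<^bsub>T\<^esub> lam v"]) (simp_all add: adj_lin_left)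
    also have "\<dots> = i1 r \<otimes>\<^bsub>T\<^esub> sweedler K A T (\<lambda>x y. i1 (adj (p x) t) \<otimes>\<^bsub>T\<^esub> lam y) q \<otimes>\<^bsub>T\<^esub> lam v"
      using rq tv by (intro sweedler_commute[where g="\<lambda>z. i1 r \<otimes>\<^bsub>T\<^esub> z \<otimes>\<^bsub>T\<^esub> lam v", symmetric]) simp_all
    also have "\<dots> = i1 r \<otimes>\<^bsub>T\<^esub> lam q \<otimes>\<^bsub>T\<^esub> Psi (pure K R R t v)"
      using rq tv by (simp add: lam_i1 Psi_pure T.m_assoc)
    finally show "Psi (tlift K RR (br r q) (pure K R R t v)) = i1 r \<otimes>\<^bsub>T\<^esub> lam q \<otimes>\<^bsub>T\<^esub> Psi (pure K R R t v)" .
  qed (use rq in simp_all)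
  then show "Psi (tlift K RR (\<lambda>r q. tlift K RR (br r q) Y) (pure K R R r q)) = Psi (pure K R R r q) \<otimes>\<^bsub>T\<^esub> Psi Y"
    using tlift_pure[OF modR modR _ br_bil2[OF Y], of r q] rq by (simp add: Psi_pure)
qed (use Y in simp_all)

text \<open>Under \<open>Psi\<close> both sides are \<Delta>(r) Psi(\<omega>(h)). So the product
  \<delta>(r)\<omega>(h), from which the coproduct of the bosonization is built, is
  \<open>tdelta\<close> of r s(h), the element of \<open>A\<close> for which r # h stands.\<close>

lemma braided_tdelta:
  assumes r: "r \<in> coinv" and h: "h \<in> carrier H"
  shows "braided_mult K R (tdelta r) (tdelta (s h)) = tdelta (r \<otimes>\<^bsub>A\<^esub> s h)"
  using r h by (rule_tac Psi_inj) (simp_all add: Psi_mult Psi_tdelta_coinv_s Psi_delta)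

section \<open>The coinvariants as a Yetter-Drinfeld algebra\<close>

lemma adj_one: "v \<in> carrier A \<Longrightarrow> adj \<one>\<^bsub>H\<^esub> v = v"
  unfolding adj_def
  by (subst sweedler_one[OF bialgH modA]) (simp_all add: s_one H.antipode_one)

lemma adj_mult:
  assumes h: "h \<in> carrier H" and k: "k \<in> carrier H" and v: "v \<in> carrier A"
  shows "adj (h \<otimes>\<^bsub>H\<^esub> k) v = adj h (adj k v)"
proof -
  have "adj (h \<otimes>\<^bsub>H\<^esub> k) v = sweedler K H A (\<lambda>x1 x2. sweedler K H A
      (\<lambda>y1 y2. s (x1 \<otimes>\<^bsub>H\<^esub> y1) \<otimes>\<^bsub>A\<^esub> v \<otimes>\<^bsub>A\<^esub> s (S (x2 \<otimes>\<^bsub>H\<^esub> y2))) k) h"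
    unfolding adj_def by (rule sweedler_mult[OF bialgH modA h k]) (simp_all add: v)
  also have "\<dots> = sweedler K H A (\<lambda>x1 x2. sweedler K H A
      (\<lambda>y1 y2. s x1 \<otimes>\<^bsub>A\<^esub> (s y1 \<otimes>\<^bsub>A\<^esub> v \<otimes>\<^bsub>A\<^esub> s (S y2)) \<otimes>\<^bsub>A\<^esub> s (S x2)) k) h"
    using v by (simp add: s_mult H.antipode_mult A.m_assoc)
  also have "\<dots> = sweedler K H A (\<lambda>x1 x2. s x1 \<otimes>\<^bsub>A\<^esub> adj k v \<otimes>\<^bsub>A\<^esub> s (S x2)) h"
    unfolding adj_def using k v
    by (intro sweedler_cong[THEN fun_cong]
        sweedler_commute[where g="\<lambda>z. s _ \<otimes>\<^bsub>A\<^esub> z \<otimes>\<^bsub>A\<^esub> s (S _)", symmetric]) simp_all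
  finally show ?thesis by (simp add: adj_def)
qed

lemma adj_conv:
  assumes "h \<in> carrier H" "r \<in> carrier A"
  shows "adj h r = convolution K H A (\<lambda>x. s x \<otimes>\<^bsub>A\<^esub> r) (\<lambda>x. s (S x)) h"
    "adj h r = convolution K H A s (\<lambda>x. r \<otimes>\<^bsub>A\<^esub> s (S x)) h"
  using assms by (simp_all add: adj_def convolution_def A.m_assoc)

text \<open>The two presentations in \<open>adj_conv\<close> place s(S(h2)) and s(h3) next to each
  other between \<open>r\<close> and \<open>q\<close>, where they cancel.\<close>

lemma adj_prod:
  assumes h: "h \<in> carrier H" and r: "r \<in> carrier A" and q: "q \<in> carrier A"
  shows "adj h (r \<otimes>\<^bsub>A\<^esub> q) = sweedler K H A (\<lambda>x y. adj x r \<otimes>\<^bsub>A\<^esub> adj y q) h"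
proof -
  let ?c = "convolution K H A"
  have "sweedler K H A (\<lambda>x y. adj x r \<otimes>\<^bsub>A\<^esub> adj y q) h = ?c (\<lambda>x. adj x r) (\<lambda>y. adj y q) h"
    by (simp add: convolution_def)
  also have "\<dots> = ?c (?c (\<lambda>x. s x \<otimes>\<^bsub>A\<^esub> r) (\<lambda>x. s (S x))) (?c s (\<lambda>x. q \<otimes>\<^bsub>A\<^esub> s (S x))) h"
    using r q by (simp add: adj_conv(1)[of _ r] adj_conv(2)[of _ q])
  also have "\<dots> = ?c (\<lambda>x. s x \<otimes>\<^bsub>A\<^esub> r) (?c (\<lambda>x. s (S x)) (?c s (\<lambda>x. q \<otimes>\<^bsub>A\<^esub> s (S x)))) h"
    using r q by (subst convolution_assoc) simp_all
  also have "\<dots> = ?c (\<lambda>x. s x \<otimes>\<^bsub>A\<^esub> r) (\<lambda>x. q \<otimes>\<^bsub>A\<^esub> s (S x)) h"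
    by (rule fun_cong[OF convolution_cong[OF refl]], rule convolution_cancel_left)
      (simp_all add: q H.antipode_conv_left[OF s_hom algA])
  also have "\<dots> = adj h (r \<otimes>\<^bsub>A\<^esub> q)" using r q by (simp add: convolution_def adj_def A.m_assoc)
  finally show ?thesis by simp
qed

lemma adj_unit: "h \<in> carrier H \<Longrightarrow> adj h \<one>\<^bsub>A\<^esub> = counit H h \<odot>\<^bsub>A\<^esub> \<one>\<^bsub>A\<^esub>"
  using H.antipode_conv_right[OF s_hom algA, of h] by (simp add: adj_def convolution_def conv_unit_def)

lemma lcoact_tau:
  assumes r: "r \<in> coinv" and X: "module K X" and b: "k_bilinear K H A X b"
  shows "tlift K X b (lcoact r) = sweedler K A X (\<lambda>x y. b (p x) y) r"
proof -
  have l: "k_linear K U X (\<lambda>u. b x (f u))" if "x \<in> carrier H" "k_linear K U A f"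
    for U :: "('k, 'u, 'v) module_scheme" and x f
    using k_linear_comp[of K A X "b x"] that b by (auto simp: k_bilinear_def)
  have l': "k_linear K U X (\<lambda>u. b (f u) y)" if "y \<in> carrier A" "k_linear K U H f"
    for U :: "('k, 'u, 'v) module_scheme" and y f
    using k_linear_comp[of K H X "\<lambda>h. b h y"] that b by (auto simp: k_bilinear_def)
  have b': "k_bilinear K H R X b" using b by (auto simp: k_bilinear_def k_linear_R)
  have "tlift K X b (lcoact r) = sweedler K A X (\<lambda>x y. b (p x) (tau y)) r"
    by (rule tlift_lcoact[OF X b']) (simp add: r)
  also have "\<dots> = sweedler K A X (\<lambda>x y. b (p x) y) r"
    by (rule sweedler_coinv_tau[OF X r, where b="\<lambda>x y. b (p x) y"]) (simp_all add: l l' l[OF _ k_linear_id])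
  finally show ?thesis .
qed

lemma left_comodule_R: "left_comodule K H R lcoact"
proof (intro left_comodule.intro left_comodule_axioms.intro)
  show "k_linear K R (tensor K H R) lcoact" by (simp add: k_linear_R)
  fix m assume "m \<in> carrier R"
  then have m: "m \<in> coinv" by simp
  let ?X = "tensor K H (tensor K H R)"
  have "tlift K ?X (\<lambda>h x. tlift K ?X (\<lambda>h1 h2. pure K H (tensor K H R) h1 (pure K H R h2 x)) (comult H h)) (lcoact m)
    = tlift K ?X (\<lambda>h x. sweedler K H ?X (\<lambda>h1 h2. pure K H (tensor K H R) h1 (pure K H R h2 x)) h) (lcoact m)"
    using m by (intro tlift_cong[OF modH modR]) (simp_all add: sweedler_eq)
  also have "\<dots> = sweedler K A ?X (\<lambda>x y. sweedler K H ?X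
      (\<lambda>h1 h2. pure K H (tensor K H R) h1 (pure K H R h2 (tau y))) (p x)) m"
    using m by (intro tlift_lcoact k_bilinearI) simp_all
  also have "\<dots> = sweedler K A ?X (\<lambda>x y. sweedler K A ?X
      (\<lambda>u v. pure K H (tensor K H R) (p u) (pure K H R (p v) (tau y))) x) m"
    by (intro sweedler_cong[THEN fun_cong] sweedler_p) simp_all
  also have "\<dots> = sweedler K A ?X (\<lambda>u z. sweedler K A ?X
      (\<lambda>v y. pure K H (tensor K H R) (p u) (pure K H R (p v) (tau y))) z) m"
    by (rule sweedler_coassoc) simp_all
  also have "\<dots> = sweedler K A ?X (\<lambda>u z. pure K H (tensor K H R) (p u) (lcoact z)) m"
    unfolding lcoact_eq by (intro sweedler_cong[THEN fun_cong] sweedler_commute[symmetric]) simp_all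
  \<comment> \<open>Inserting \<open>tau\<close> changes nothing because \<open>m\<close> is
    coinvariant; it moves the argument of the inner coaction into \<open>R\<close>, so that the sum
    can be read as one over the coaction of \<open>m\<close>.\<close>
  also have "\<dots> = sweedler K A ?X (\<lambda>u z. pure K H (tensor K H R) (p u) (lcoact (tau z))) m"
    by (rule sweedler_coinv_tau[symmetric, OF _ m]) simp_all
  also have "\<dots> = tlift K ?X (\<lambda>h x. pure K H (tensor K H R) h (lcoact x)) (lcoact m)"
    using m by (intro tlift_lcoact[symmetric] k_bilinearI) (simp_all add: k_linear_R)
  finally show "tlift K ?X (\<lambda>h x. tlift K ?X
      (\<lambda>h1 h2. pure K H (tensor K H R) h1 (pure K H R h2 x)) (comult H h)) (lcoact m)
    = tlift K ?X (\<lambda>h x. pure K H (tensor K H R) h (lcoact x)) (lcoact m)" .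
  have "tlift K R (\<lambda>h x. counit H h \<odot>\<^bsub>R\<^esub> x) (lcoact m) = sweedler K A R (\<lambda>x y. counit A x \<odot>\<^bsub>R\<^esub> tau y) m"
    using m by (subst tlift_lcoact[OF _ k_bilinearI]) (simp_all add: p_counit)
  also have "\<dots> = tau m" using m by (intro sweedler_counit_left) simp_all
  finally show "tlift K R (\<lambda>h x. counit H h \<odot>\<^bsub>R\<^esub> x) (lcoact m) = m" using m by (simp add: tau_id)
qed (simp_all)

lemma adj_bilinear: "k_bilinear K H R R adj"
  by (rule k_bilinearI) (use R_adj_lin'[OF _ k_linear_id[of K R]] in simp_all)

section \<open>The Yetter-Drinfeld condition for the adjoint action\<close>

abbreviation "HR \<equiv> tensor K H R"

lemma lc_s: "h \<in> carrier H \<Longrightarrow> lc (s h) = convolution K H U k1 (\<lambda>x. k2 (s x)) h"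
  unfolding lc_def convolution_def
  by (rule sweedler_s_left[where b="\<lambda>x y. k1 x \<otimes>\<^bsub>U\<^esub> k2 y"]) simp_all

text \<open>Both sides are convolution inverses of lc(s(h)): the left one since this is an algebra
  map, the right one since left colinearity factors it as k1(h1) k2(s(h2)), and factors are inverted
  in reverse order.\<close>

lemma lc_s_antipode:
  assumes h: "h \<in> carrier H"
  shows "lc (s (S h)) = convolution K H U (\<lambda>x. k2 (s (S x))) (\<lambda>x. k1 (S x)) h"
proof (rule convolution_inverse_unique[OF coH algU, where q="\<lambda>x. lc (s x)"])
  let ?c = "convolution K H U"
  fix x assume x: "x \<in> carrier H"
  show "?c (\<lambda>x. lc (s (S x))) (\<lambda>x. lc (s x)) x = conv_unit H U x"
    by (rule H.antipode_conv_left[OF algebra_hom_comp[OF lc_hom s_hom] algU x])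
  have "?c (\<lambda>x. lc (s x)) (?c (\<lambda>x. k2 (s (S x))) (\<lambda>x. k1 (S x))) x
    = ?c (?c k1 (\<lambda>x. k2 (s x))) (?c (\<lambda>x. k2 (s (S x))) (\<lambda>x. k1 (S x))) x" by (simp add: lc_s)
  also have "\<dots> = ?c k1 (?c (\<lambda>x. k2 (s x)) (?c (\<lambda>x. k2 (s (S x))) (\<lambda>x. k1 (S x)))) x"
    by (subst convolution_assoc) simp_all
  also have "\<dots> = ?c k1 (\<lambda>x. k1 (S x)) x"
    by (rule fun_cong[OF convolution_cong[OF refl]], rule convolution_cancel_left)
      (simp_all add: H.antipode_conv_right[OF algebra_hom_comp[OF k2_hom s_hom] algU])
  also have "\<dots> = conv_unit H U x" by (rule H.antipode_conv_right[OF k1_hom algU x])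
  finally show "?c (\<lambda>x. lc (s x)) (?c (\<lambda>x. k2 (s (S x))) (\<lambda>x. k1 (S x))) x = conv_unit H U x" .
qed (use h in simp_all)

text \<open>The Yetter-Drinfeld identity is computed in the algebra H \<otimes> A, where
  \<open>lc\<close> is multiplicative, and carried to H \<otimes> R at the end by this map.\<close>

definition Pi_R :: "('h \<times> 'a \<Rightarrow> 'k) set \<Rightarrow> ('h \<times> 'a \<Rightarrow> 'k) set"
  where "Pi_R X = tlift K HR (\<lambda>h a. pure K H R h (tau a)) X"

lemma Pi_R_bil: "k_bilinear K H A HR (\<lambda>h a. pure K H R h (tau a))"
  by (rule k_bilinearI) simp_all

lemma Pi_R_lin: "k_linear K U HR Pi_R"
  unfolding k_linear_tensor_algebra Pi_R_def[abs_def]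
  by (rule tlift_linear[OF modH modA _ Pi_R_bil]) simp

lemma Pi_R_pure: "\<lbrakk>h \<in> carrier H; a \<in> carrier A\<rbrakk> \<Longrightarrow> Pi_R (pure K H A h a) = pure K H R h (tau a)"
  unfolding Pi_R_def by (rule tlift_pure[OF modH modA _ Pi_R_bil]) simp_all

lemma Pi_R_lc: "a \<in> carrier A \<Longrightarrow> Pi_R (lc a) = lcoact a"
  unfolding lc_eq lcoact_eq
  by (subst sweedler_commute[OF Pi_R_lin]) (simp_all add: Pi_R_pure)

text \<open>\<open>lc\<close> is applied factor by factor to s(x) v s(S(y)). Left colinearity splits
  lc(s(x)) into x1 \<otimes> s(x2), \<open>lc_s_antipode\<close> does the same on the right, and the
  two inner legs conjugate the second leg of lc(v) into the adjoint action.\<close>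

lemma lcoact_adj:
  assumes h: "h \<in> carrier H" and v: "v \<in> coinv"
  shows "lcoact (adj h v) = comult3 K H HR (\<lambda>h1 h2 h3. tlift K HR
    (\<lambda>g w. pure K H R (h1 \<otimes>\<^bsub>H\<^esub> g \<otimes>\<^bsub>H\<^esub> S h3) (adj h2 w)) (lcoact v)) h"
proof -
  let ?c = "convolution K H U"
  have v': "v \<in> carrier A" using v by simp
  \<comment> \<open>Conjugation takes place in the \<open>A\<close>-leg alone: the
    \<open>H\<close>-leg p(x) commutes with the image of \<open>k2\<close>.\<close>
  have ad: "?c (\<lambda>x. k2 (s x) \<otimes>\<^bsub>U\<^esub> lc v) (\<lambda>x. k2 (s (S x))) g
      = sweedler K A U (\<lambda>x y. pure K H A (p x) (adj g y)) v" if g: "g \<in> carrier H" for g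
  proof -
    have "?c (\<lambda>x. k2 (s x) \<otimes>\<^bsub>U\<^esub> lc v) (\<lambda>x. k2 (s (S x))) g = sweedler K H U (\<lambda>u w.
        sweedler K A U (\<lambda>x y. k2 (s u) \<otimes>\<^bsub>U\<^esub> pure K H A (p x) y \<otimes>\<^bsub>U\<^esub> k2 (s (S w))) v) g"
      unfolding convolution_def lc_eq
      by (intro sweedler_cong[THEN fun_cong]
          sweedler_commute[where g="\<lambda>z. k2 (s _) \<otimes>\<^bsub>U\<^esub> z \<otimes>\<^bsub>U\<^esub> k2 (s (S _))"]) (simp_all add: v')
    also have "\<dots> = sweedler K A U (\<lambda>x y. sweedler K H U (\<lambda>u w.
        k2 (s u) \<otimes>\<^bsub>U\<^esub> pure K H A (p x) y \<otimes>\<^bsub>U\<^esub> k2 (s (S w))) g) v"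
      by (rule sweedler_swap) (simp_all add: v' g)
    also have "\<dots> = sweedler K A U (\<lambda>x y. sweedler K H U (\<lambda>u w.
        k1 (p x) \<otimes>\<^bsub>U\<^esub> k2 (s u \<otimes>\<^bsub>A\<^esub> y \<otimes>\<^bsub>A\<^esub> s (S w))) g) v"
      using v' by (simp add: k1_def k2_def pure_mult_U)
    also have "\<dots> = sweedler K A U (\<lambda>x y. k1 (p x) \<otimes>\<^bsub>U\<^esub> k2 (adj g y)) v"
      unfolding adj_def
      by (intro sweedler_cong[THEN fun_cong] sweedler_commute[where g="\<lambda>z. k1 _ \<otimes>\<^bsub>U\<^esub> k2 z", symmetric])
        (simp_all add: g)
    finally show ?thesis using g by (simp add: k1_k2)
  qed
  have "lc (adj h v) = ?c (\<lambda>x. lc (s x) \<otimes>\<^bsub>U\<^esub> lc v) (\<lambda>x. lc (s (S x))) h"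
    unfolding adj_conv(1)[OF h v'] using h v'
    by (subst algebra_hom_convolution[OF lc_hom]) (simp_all add: lc_mult)
  also have "\<dots> = ?c (\<lambda>x. ?c k1 (\<lambda>x. k2 (s x)) x \<otimes>\<^bsub>U\<^esub> lc v) (?c (\<lambda>x. k2 (s (S x))) (\<lambda>x. k1 (S x))) h"
    by (rule fun_cong[OF convolution_cong]) (simp add: lc_s, simp add: lc_s_antipode)
  also have "\<dots> = ?c (?c k1 (\<lambda>x. k2 (s x) \<otimes>\<^bsub>U\<^esub> lc v)) (?c (\<lambda>x. k2 (s (S x))) (\<lambda>x. k1 (S x))) h"
  proof -
    have "?c k1 (\<lambda>x. k2 (s x)) x \<otimes>\<^bsub>U\<^esub> lc v = ?c k1 (\<lambda>x. k2 (s x) \<otimes>\<^bsub>U\<^esub> lc v) x"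
      if x: "x \<in> carrier H" for x
      unfolding convolution_def using x v'
      by (subst sweedler_commute[where g="\<lambda>z. z \<otimes>\<^bsub>U\<^esub> lc v"]) (simp_all add: U.m_assoc)
    then show ?thesis by simp
  qed
  also have "\<dots> = ?c (?c k1 (?c (\<lambda>x. k2 (s x) \<otimes>\<^bsub>U\<^esub> lc v) (\<lambda>x. k2 (s (S x))))) (\<lambda>x. k1 (S x)) h"
    using v' by (simp add: convolution_assoc)
  also have "\<dots> = ?c (?c k1 (\<lambda>g. sweedler K A U (\<lambda>x y. pure K H A (p x) (adj g y)) v)) (\<lambda>x. k1 (S x)) h"
    by (simp add: ad)
  also have "\<dots> = sweedler K H U (\<lambda>z h3. sweedler K H U (\<lambda>h1 h2.
      sweedler K A U (\<lambda>x y. k1 h1 \<otimes>\<^bsub>U\<^esub> pure K H A (p x) (adj h2 y) \<otimes>\<^bsub>U\<^esub> k1 (S h3)) v) z) h"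
  proof -
    let ?F = "\<lambda>h2. sweedler K A U (\<lambda>x y. pure K H A (p x) (adj h2 y)) v"
    have Fc: "?F h2 \<in> carrier U" if "h2 \<in> carrier H" for h2 using that v' by simp
    have "sweedler K H U (\<lambda>h1 h2. k1 h1 \<otimes>\<^bsub>U\<^esub> ?F h2) z \<otimes>\<^bsub>U\<^esub> k1 (S h3)
      = sweedler K H U (\<lambda>h1 h2. k1 h1 \<otimes>\<^bsub>U\<^esub> ?F h2 \<otimes>\<^bsub>U\<^esub> k1 (S h3)) z"
      if "z \<in> carrier H" "h3 \<in> carrier H" for z h3
      using that Fc by (intro sweedler_commute[where g="\<lambda>t. t \<otimes>\<^bsub>U\<^esub> k1 (S h3)"]) simp_all
    moreover have "k1 h1 \<otimes>\<^bsub>U\<^esub> ?F h2 \<otimes>\<^bsub>U\<^esub> k1 (S h3)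
      = sweedler K A U (\<lambda>x y. k1 h1 \<otimes>\<^bsub>U\<^esub> pure K H A (p x) (adj h2 y) \<otimes>\<^bsub>U\<^esub> k1 (S h3)) v"
      if "h1 \<in> carrier H" "h2 \<in> carrier H" "h3 \<in> carrier H" for h1 h2 h3
      using that v' by (intro sweedler_commute[where g="\<lambda>t. k1 h1 \<otimes>\<^bsub>U\<^esub> t \<otimes>\<^bsub>U\<^esub> k1 (S h3)"]) simp_all
    ultimately show ?thesis by (simp add: convolution_def)
  qed
  also have "\<dots> = sweedler K H U (\<lambda>z h3. sweedler K H U (\<lambda>h1 h2.
      sweedler K A U (\<lambda>x y. pure K H A (h1 \<otimes>\<^bsub>H\<^esub> p x \<otimes>\<^bsub>H\<^esub> S h3) (adj h2 y)) v) z) h"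
    by (simp add: k1_def pure_mult_U)
  finally have "lcoact (adj h v) = Pi_R \<dots>" using h v' by (simp add: Pi_R_lc[symmetric])
  also have "\<dots> = sweedler K H HR (\<lambda>z h3. Pi_R (sweedler K H U (\<lambda>h1 h2.
      sweedler K A U (\<lambda>x y. pure K H A (h1 \<otimes>\<^bsub>H\<^esub> p x \<otimes>\<^bsub>H\<^esub> S h3) (adj h2 y)) v) z)) h"
    using h v' by (intro sweedler_commute[OF Pi_R_lin]) simp_all
  also have "\<dots> = sweedler K H HR (\<lambda>z h3. sweedler K H HR (\<lambda>h1 h2.
      Pi_R (sweedler K A U (\<lambda>x y. pure K H A (h1 \<otimes>\<^bsub>H\<^esub> p x \<otimes>\<^bsub>H\<^esub> S h3) (adj h2 y)) v)) z) h"
    using v' by (intro sweedler_cong[THEN fun_cong] sweedler_commute[OF Pi_R_lin]) simp_all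
  also have "\<dots> = sweedler K H HR (\<lambda>z h3. sweedler K H HR (\<lambda>h1 h2.
      sweedler K A HR (\<lambda>x y. Pi_R (pure K H A (h1 \<otimes>\<^bsub>H\<^esub> p x \<otimes>\<^bsub>H\<^esub> S h3) (adj h2 y))) v) z) h"
    using v' by (intro sweedler_cong[THEN fun_cong] sweedler_commute[OF Pi_R_lin]) simp_all
  also have "\<dots> = sweedler K H HR (\<lambda>z h3. sweedler K H HR (\<lambda>h1 h2. tlift K HR
    (\<lambda>g w. pure K H R (h1 \<otimes>\<^bsub>H\<^esub> g \<otimes>\<^bsub>H\<^esub> S h3) (adj h2 w)) (lcoact v)) z) h"
  proof (intro sweedler_cong[THEN fun_cong])
    fix z h3 h1 h2 assume c: "z \<in> carrier H" "h3 \<in> carrier H" "h1 \<in> carrier H" "h2 \<in> carrier H"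
    have bl: "k_bilinear K H R HR (\<lambda>g w. pure K H R (h1 \<otimes>\<^bsub>H\<^esub> g \<otimes>\<^bsub>H\<^esub> S h3) (adj h2 w))"
      using c by (intro k_bilinearI) simp_all
    have "tlift K HR (\<lambda>g w. pure K H R (h1 \<otimes>\<^bsub>H\<^esub> g \<otimes>\<^bsub>H\<^esub> S h3) (adj h2 w)) (lcoact v)
      = sweedler K A HR (\<lambda>x y. pure K H R (h1 \<otimes>\<^bsub>H\<^esub> p x \<otimes>\<^bsub>H\<^esub> S h3) (tau (adj h2 (tau y)))) v"
      using c v' by (subst tlift_lcoact[OF _ bl]) (simp_all add: tau_id)
    also have "\<dots> = sweedler K A HR (\<lambda>x y. pure K H R (h1 \<otimes>\<^bsub>H\<^esub> p x \<otimes>\<^bsub>H\<^esub> S h3) (tau (adj h2 y))) v"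
      using c by (intro sweedler_coinv_tau[OF _ v, where
        b="\<lambda>x y. pure K H R (h1 \<otimes>\<^bsub>H\<^esub> p x \<otimes>\<^bsub>H\<^esub> S h3) (tau (adj h2 y))"]) (simp_all add: adj_lin_right)
    finally show "sweedler K A HR (\<lambda>x y. Pi_R (pure K H A (h1 \<otimes>\<^bsub>H\<^esub> p x \<otimes>\<^bsub>H\<^esub> S h3) (adj h2 y))) v
      = tlift K HR (\<lambda>g w. pure K H R (h1 \<otimes>\<^bsub>H\<^esub> g \<otimes>\<^bsub>H\<^esub> S h3) (adj h2 w)) (lcoact v)"
      using c by (simp add: Pi_R_pure)
  qed
  also have "\<dots> = comult3 K H HR (\<lambda>h1 h2 h3. tlift K HR
    (\<lambda>g w. pure K H R (h1 \<otimes>\<^bsub>H\<^esub> g \<otimes>\<^bsub>H\<^esub> S h3) (adj h2 w)) (lcoact v)) h"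
    by (rule comult3_eq[OF coH h, symmetric])
  finally show ?thesis .
qed

lemma yd_module: "yetter_drinfeld_module K H S R adj lcoact"
proof (intro yetter_drinfeld_module.intro yetter_drinfeld_module_axioms.intro)
  show "adj (h \<otimes>\<^bsub>H\<^esub> k) v = adj h (adj k v)" if "h \<in> carrier H" "k \<in> carrier H" "v \<in> carrier R" for h k v
    using that adj_mult by simp
qed (simp_all add: hopfH left_comodule_R adj_bilinear adj_one lcoact_adj)

lemma lcoact_mult:
  assumes r: "r \<in> coinv" and q: "q \<in> coinv"
  shows "lcoact (r \<otimes>\<^bsub>A\<^esub> q) = tensor_mult K H R (lcoact r) (lcoact q)"
proof -
  let ?m = "tensor_mult K H R"
  note bil = tensor_mult_bilinear[OF algH algR]
  have l1: "k_linear K HR HR (\<lambda>X. ?m X Y)" if "Y \<in> carrier HR" for Y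
    using bil that by (simp add: k_bilinear_def)
  have l2: "k_linear K HR HR (?m X)" if "X \<in> carrier HR" for X
    using bil that by (simp add: k_bilinear_def)
  have "lcoact (r \<otimes>\<^bsub>A\<^esub> q) = sweedler K A HR (\<lambda>x1 x2. sweedler K A HR
      (\<lambda>y1 y2. pure K H R (p (x1 \<otimes>\<^bsub>A\<^esub> y1)) (tau (x2 \<otimes>\<^bsub>A\<^esub> y2))) q) r"
    unfolding lcoact_eq by (rule sweedler_mult[OF bialgA]) (simp_all add: r q)
  also have "\<dots> = sweedler K A HR (\<lambda>x1 x2. sweedler K A HR
      (\<lambda>y1 y2. pure K H R (p (x1 \<otimes>\<^bsub>A\<^esub> y1)) (tau (x2 \<otimes>\<^bsub>A\<^esub> tau y2))) q) r"
    by (intro sweedler_cong[THEN fun_cong] sweedler_coinv_tau[symmetric, OF _ q, where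
      b="\<lambda>y1 y2. pure K H R (p (_ \<otimes>\<^bsub>A\<^esub> y1)) (tau (_ \<otimes>\<^bsub>A\<^esub> y2))"]) simp_all
  also have "\<dots> = sweedler K A HR (\<lambda>x1 x2. sweedler K A HR
      (\<lambda>y1 y2. pure K H R (p (x1 \<otimes>\<^bsub>A\<^esub> y1)) (tau (tau x2 \<otimes>\<^bsub>A\<^esub> tau y2))) q) r"
    by (rule sweedler_coinv_tau[symmetric, OF _ r, where b="\<lambda>x1 x2. sweedler K A HR
      (\<lambda>y1 y2. pure K H R (p (x1 \<otimes>\<^bsub>A\<^esub> y1)) (tau (x2 \<otimes>\<^bsub>A\<^esub> tau y2))) q"]) (simp_all add: q)
  also have "\<dots> = sweedler K A HR (\<lambda>x1 x2. sweedler K A HR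
      (\<lambda>y1 y2. ?m (pure K H R (p x1) (tau x2)) (pure K H R (p y1) (tau y2))) q) r"
    using tensor_mult_pure[OF algH algR] by (simp add: p_mult tau_id R_sel(2))
  also have "\<dots> = sweedler K A HR (\<lambda>x1 x2. ?m (pure K H R (p x1) (tau x2)) (lcoact q)) r"
    unfolding lcoact_eq using q
    by (intro sweedler_cong[THEN fun_cong] sweedler_commute[OF l2, symmetric]) simp_all
  also have "\<dots> = ?m (lcoact r) (lcoact q)"
    unfolding lcoact_eq[of r] using r q by (intro sweedler_commute[OF l1, symmetric]) simp_all
  finally show ?thesis .
qed

lemma lcoact_one: "lcoact \<one>\<^bsub>A\<^esub> = pure K H R \<one>\<^bsub>H\<^esub> \<one>\<^bsub>A\<^esub>"
  unfolding lcoact_eq by (subst sweedler_one[OF bialgA]) (simp_all add: p_one tau_one)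

lemma yd_algebra: "yetter_drinfeld_algebra K H S R"
proof (intro yetter_drinfeld_algebra.intro yetter_drinfeld_algebra_axioms.intro)
  show "yetter_drinfeld_module K H S R (act R) (coact R)" using yd_module by (simp add: R_sel)
  fix h r q assume h: "h \<in> carrier H" and rq: "r \<in> carrier R" "q \<in> carrier R"
  show "act R h (r \<otimes>\<^bsub>R\<^esub> q) = tlift K R (\<lambda>h1 h2. act R h1 r \<otimes>\<^bsub>R\<^esub> act R h2 q) (comult H h)"
    using h rq adj_prod[of h r q] sweedler_R[OF coH h, of "\<lambda>x y. adj x r \<otimes>\<^bsub>A\<^esub> adj y q"]
    by (simp add: R_sel sweedler_eq)
next
  fix r q assume "r \<in> carrier R" "q \<in> carrier R"
  then show "coact R (r \<otimes>\<^bsub>R\<^esub> q) = tensor_mult K H R (coact R r) (coact R q)"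
    using lcoact_mult[of r q] by (simp add: R_sel)
qed (simp_all add: R_sel adj_unit lcoact_one)

section \<open>Compatibility of the action and the coaction with the coproduct\<close>

lemma counit_tau: "a \<in> carrier A \<Longrightarrow> counit A (tau a) = counit A a"
proof -
  assume a: "a \<in> carrier A"
  note s = module_scalars[OF cringK]
  have "counit A (tau a) = sweedler K A (scalars K) (\<lambda>x y. counit A (x \<otimes>\<^bsub>A\<^esub> s (S (p y)))) a"
    unfolding tau_def convolution_def using a by (intro sweedler_commute s) simp_all
  also have "\<dots> = sweedler K A (scalars K) (\<lambda>x y. counit A y \<odot>\<^bsub>scalars K\<^esub> counit A x) a"
    by (simp add: A.counit_mult counit_s H.counit_antipode p_counit scalars_def cring.cring_simprules(14)[OF cringK])
  also have "\<dots> = counit A a" by (intro sweedler_counit_right s) (simp_all add: a)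
  finally show ?thesis .
qed

text \<open>Apply \<epsilon> \<otimes> id to the coinvariance equation: one side becomes p(r), the
  other a multiple of 1.\<close>

lemma p_coinv:
  assumes r: "r \<in> coinv" shows "p r = counit A r \<odot>\<^bsub>H\<^esub> \<one>\<^bsub>H\<^esub>"
proof -
  have "p r = sweedler K A H (\<lambda>x y. counit A x \<odot>\<^bsub>H\<^esub> p y) r"
    by (rule sweedler_counit_left[symmetric]) (simp_all add: r)
  also have "\<dots> = counit A r \<odot>\<^bsub>H\<^esub> \<one>\<^bsub>H\<^esub>"
    by (rule sweedler_coinv[OF _ r, where b="\<lambda>x y. counit A x \<odot>\<^bsub>H\<^esub> y"]) simp_all
  finally show ?thesis .
qed

lemma counit_adj:
  assumes h: "h \<in> carrier H" and r: "r \<in> carrier A"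
  shows "counit A (adj h r) = counit A r \<otimes>\<^bsub>K\<^esub> counit H h"
proof -
  note s = module_scalars[OF cringK]
  have "counit A (adj h r) = sweedler K H (scalars K) (\<lambda>x y. counit A (s x \<otimes>\<^bsub>A\<^esub> r \<otimes>\<^bsub>A\<^esub> s (S y))) h"
    unfolding adj_def using h r by (intro sweedler_commute s) simp_all
  also have "\<dots> = sweedler K H (scalars K) (\<lambda>x y. counit H x \<odot>\<^bsub>scalars K\<^esub> (counit A r \<odot>\<^bsub>scalars K\<^esub> counit H y)) h"
    using r by (simp add: A.counit_mult counit_s H.counit_antipode scalars_def H.K.m_assoc)
  also have "\<dots> = counit A r \<odot>\<^bsub>scalars K\<^esub> counit H h"
    using h r s by (intro sweedler_counit_left s k_linear_smult_right) simp_all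
  finally show ?thesis by (simp add: scalars_def)
qed

lemma tdelta_one: "tdelta \<one>\<^bsub>A\<^esub> = pure K R R \<one>\<^bsub>A\<^esub> \<one>\<^bsub>A\<^esub>"
  unfolding tdelta_eq by (subst sweedler_one[OF bialgA]) (simp_all add: tau_one)

lemma tdelta_mult:
  "\<lbrakk>r \<in> coinv; q \<in> coinv\<rbrakk> \<Longrightarrow> tdelta (r \<otimes>\<^bsub>A\<^esub> q) = braided_mult K R (tdelta r) (tdelta q)"
  by (rule Psi_inj) (simp_all add: Psi_mult Psi_delta Delta_mult)

lemma tdelta_counit_left:
  assumes a: "a \<in> carrier A"
  shows "tlift K R (\<lambda>x y. counit A x \<odot>\<^bsub>R\<^esub> y) (tdelta a) = tau a"
proof -
  have "tlift K R (\<lambda>x y. counit A x \<odot>\<^bsub>R\<^esub> y) (tdelta a) = sweedler K A R (\<lambda>x y. counit A x \<odot>\<^bsub>R\<^esub> tau y) a"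
    by (subst tlift_tdelta[OF modR k_bilinearI a]) (simp_all add: counit_tau k_linear_R)
  also have "\<dots> = tau a" by (intro sweedler_counit_left) (simp_all add: a)
  finally show ?thesis .
qed

lemma tdelta_counit_right:
  assumes a: "a \<in> carrier A"
  shows "tlift K R (\<lambda>x y. counit A y \<odot>\<^bsub>R\<^esub> x) (tdelta a) = tau a"
proof -
  have "tlift K R (\<lambda>x y. counit A y \<odot>\<^bsub>R\<^esub> x) (tdelta a) = sweedler K A R (\<lambda>x y. counit A y \<odot>\<^bsub>R\<^esub> tau x) a"
    by (subst tlift_tdelta[OF modR k_bilinearI a]) (simp_all add: counit_tau k_linear_R)
  also have "\<dots> = tau a" by (intro sweedler_counit_right) (simp_all add: a)
  finally show ?thesis .
qed

lemma lcoact_counit_right: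
  assumes r: "r \<in> coinv"
  shows "tlift K H (\<lambda>g q. counit A q \<odot>\<^bsub>H\<^esub> g) (lcoact r) = counit A r \<odot>\<^bsub>H\<^esub> \<one>\<^bsub>H\<^esub>"
proof -
  have "tlift K H (\<lambda>g q. counit A q \<odot>\<^bsub>H\<^esub> g) (lcoact r) = sweedler K A H (\<lambda>x y. counit A y \<odot>\<^bsub>H\<^esub> p x) r"
    by (subst tlift_lcoact[OF modH k_bilinearI]) (simp_all add: counit_tau k_linear_R r)
  also have "\<dots> = p r" by (intro sweedler_counit_right) (simp_all add: r)
  finally show ?thesis using r by (simp add: p_coinv)
qed

section \<open>The diagonal action, multiplicativity of \<omega>, and the action against
  \<delta>\<close>

definition da :: "'h \<Rightarrow> 'h \<Rightarrow> ('a \<times> 'a \<Rightarrow> 'k) set \<Rightarrow> ('a \<times> 'a \<Rightarrow> 'k) set"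
  where "da h k X = tlift K RR (\<lambda>r q. pure K R R (adj h r) (adj k q)) X"

lemma da_bil: "\<lbrakk>h \<in> carrier H; k \<in> carrier H\<rbrakk> \<Longrightarrow> k_bilinear K R R RR (\<lambda>r q. pure K R R (adj h r) (adj k q))"
  by (rule k_bilinearI) simp_all

lemma da_lin: "\<lbrakk>h \<in> carrier H; k \<in> carrier H\<rbrakk> \<Longrightarrow> k_linear K RR RR (da h k)"
  unfolding da_def[abs_def] by (intro tlift_linear da_bil) simp_all

lemma da_pure: "\<lbrakk>h \<in> carrier H; k \<in> carrier H; r \<in> coinv; q \<in> coinv\<rbrakk>
    \<Longrightarrow> da h k (pure K R R r q) = pure K R R (adj h r) (adj k q)"
  unfolding da_def using tlift_pure[OF modR modR _ da_bil] by simp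

lemma da_closed [simp]: "\<lbrakk>h \<in> carrier H; k \<in> carrier H; X \<in> carrier RR\<rbrakk> \<Longrightarrow> da h k X \<in> carrier RR"
  using k_linear_closed[OF da_lin] .

lemma diag_act_eq: "h \<in> carrier H \<Longrightarrow> diag_act K H R h X = sweedler K H RR (\<lambda>x y. da x y X) h"
  by (simp add: diag_act_def da_def R_sel sweedler_eq)

lemma diag_act_closed [simp]: "\<lbrakk>h \<in> carrier H; X \<in> carrier RR\<rbrakk> \<Longrightarrow> diag_act K H R h X \<in> carrier RR"
  by (simp add: diag_act_eq)

text \<open>Under \<open>Psi\<close> the diagonal action becomes conjugation by \<open>gam\<close>.
  For r \<otimes> q the factor i1(s(S(x))) that ends the first conjugate cancels the first factor of
  the \<open>gam\<close> that opens the second, and i2(s(x)) then commutes past i1(r).\<close>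

lemma Psi_act:
  assumes X: "X \<in> carrier RR" and h: "h \<in> carrier H"
  shows "Psi (diag_act K H R h X) = convolution K H T (\<lambda>x. gam x \<otimes>\<^bsub>T\<^esub> Psi X) (\<lambda>x. gam (S x)) h"
  unfolding diag_act_eq[OF h] convolution_def
proof (rule tensor_ext[OF modR modR _ X, where X=T and f="\<lambda>X. Psi (sweedler K H RR (\<lambda>x y. da x y X) h)"])
  let ?c = "convolution K H T"
  have "k_linear K RR RR (\<lambda>X. sweedler K H RR (\<lambda>x y. da x y X) h)"
    using da_lin h by (intro k_linear_sweedler_inner) simp_all
  then show "k_linear K RR T (\<lambda>X. Psi (sweedler K H RR (\<lambda>x y. da x y X) h))"
    by (rule k_linear_comp[OF Psi_lin0])
  fix r q assume "r \<in> carrier R" "q \<in> carrier R"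
  then have rq: "r \<in> coinv" "q \<in> coinv" by simp_all
  have "Psi (sweedler K H RR (\<lambda>x y. da x y (pure K R R r q)) h)
    = sweedler K H T (\<lambda>x y. Psi (pure K R R (adj x r) (adj y q))) h"
    using rq h by (subst sweedler_commute[OF Psi_lin0]) (simp_all add: da_pure)
  also have "\<dots> = ?c (\<lambda>x. i1 (adj x r)) (\<lambda>x. lam (adj x q)) h"
    using rq by (simp add: Psi_pure convolution_def)
  also have "\<dots> = ?c (?c (\<lambda>x. i1 (s x) \<otimes>\<^bsub>T\<^esub> i1 r) (\<lambda>x. i1 (s (S x))))
      (?c (\<lambda>x. gam x \<otimes>\<^bsub>T\<^esub> lam q) (\<lambda>x. gam (S x))) h"
    using rq by (simp add: i1_adj lam_adj)
  also have "\<dots> = ?c (?c (\<lambda>x. i1 (s x) \<otimes>\<^bsub>T\<^esub> i1 r) (\<lambda>x. i1 (s (S x))))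
      (?c (?c (\<lambda>x. i1 (s x)) (\<lambda>x. i2 (s x) \<otimes>\<^bsub>T\<^esub> lam q)) (\<lambda>x. gam (S x))) h"
  proof -
    have "gam x \<otimes>\<^bsub>T\<^esub> lam q = ?c (\<lambda>x. i1 (s x)) (\<lambda>x. i2 (s x) \<otimes>\<^bsub>T\<^esub> lam q) x" if x: "x \<in> carrier H" for x
      unfolding gam_conv[OF x] convolution_def using rq x
      by (subst sweedler_commute[where g="\<lambda>z. z \<otimes>\<^bsub>T\<^esub> lam q"]) (simp_all add: T.m_assoc)
    then show ?thesis by simp
  qed
  also have "\<dots> = ?c (\<lambda>x. i1 (s x) \<otimes>\<^bsub>T\<^esub> i1 r) (?c (\<lambda>x. i1 (s (S x)))
      (?c (\<lambda>x. i1 (s x)) (?c (\<lambda>x. i2 (s x) \<otimes>\<^bsub>T\<^esub> lam q) (\<lambda>x. gam (S x))))) h"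
    using rq by (simp add: convolution_assoc)
  also have "\<dots> = ?c (\<lambda>x. i1 (s x) \<otimes>\<^bsub>T\<^esub> i1 r) (?c (\<lambda>x. i2 (s x) \<otimes>\<^bsub>T\<^esub> lam q) (\<lambda>x. gam (S x))) h"
    by (rule fun_cong[OF convolution_cong[OF refl]], rule convolution_cancel_left)
      (simp_all add: rq H.antipode_conv_left[OF s_i1 algT])
  also have "\<dots> = ?c (?c (\<lambda>x. i1 (s x) \<otimes>\<^bsub>T\<^esub> i1 r) (\<lambda>x. i2 (s x) \<otimes>\<^bsub>T\<^esub> lam q)) (\<lambda>x. gam (S x)) h"
    using rq by (simp add: convolution_assoc)
  also have "\<dots> = ?c (\<lambda>x. gam x \<otimes>\<^bsub>T\<^esub> Psi (pure K R R r q)) (\<lambda>x. gam (S x)) h"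
  proof -
    have "?c (\<lambda>x. i1 (s x) \<otimes>\<^bsub>T\<^esub> i1 r) (\<lambda>x. i2 (s x) \<otimes>\<^bsub>T\<^esub> lam q) x = gam x \<otimes>\<^bsub>T\<^esub> Psi (pure K R R r q)"
      if x: "x \<in> carrier H" for x
    proof -
      have "i1 (s x) \<otimes>\<^bsub>T\<^esub> i1 r \<otimes>\<^bsub>T\<^esub> (i2 (s y) \<otimes>\<^bsub>T\<^esub> lam q) = i1 (s x) \<otimes>\<^bsub>T\<^esub> i2 (s y) \<otimes>\<^bsub>T\<^esub> (i1 r \<otimes>\<^bsub>T\<^esub> lam q)"
        if "x \<in> carrier H" "y \<in> carrier H" for x y
        using that rq i2_i1[of r "s y"] by (simp add: T.m_assoc) (simp add: T.m_assoc[symmetric])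
      then have "?c (\<lambda>x. i1 (s x) \<otimes>\<^bsub>T\<^esub> i1 r) (\<lambda>x. i2 (s x) \<otimes>\<^bsub>T\<^esub> lam q) x
        = sweedler K H T (\<lambda>x y. i1 (s x) \<otimes>\<^bsub>T\<^esub> i2 (s y) \<otimes>\<^bsub>T\<^esub> (i1 r \<otimes>\<^bsub>T\<^esub> lam q)) x"
        by (simp add: convolution_def)
      also have "\<dots> = gam x \<otimes>\<^bsub>T\<^esub> (i1 r \<otimes>\<^bsub>T\<^esub> lam q)"
        unfolding gam_conv[OF x] convolution_def using rq x
        by (intro sweedler_commute[where g="\<lambda>z. z \<otimes>\<^bsub>T\<^esub> (i1 r \<otimes>\<^bsub>T\<^esub> lam q)", symmetric]) simp_all
      finally show ?thesis using rq by (simp add: Psi_pure)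
    qed
    then show ?thesis by simp
  qed
  finally show "Psi (sweedler K H RR (\<lambda>x y. da x y (pure K R R r q)) h)
    = sweedler K H T (\<lambda>x y. gam x \<otimes>\<^bsub>T\<^esub> Psi (pure K R R r q) \<otimes>\<^bsub>T\<^esub> gam (S y)) h"
    by (simp add: convolution_def)
qed (simp_all add: h)

text \<open>The common form of the right sides of the two axioms that contain the diagonal action.
  Since \<Sum> Psi(\<omega>(h1)) gam(h2) = \<Delta>(s(h)), the left half of the conjugation by
  \<open>gam\<close> is absorbed and \<Delta>(s(h1)) takes its place.\<close>

lemma Psi_twisted:
  assumes X: "X \<in> carrier RR" and h: "h \<in> carrier H"
  shows "Psi (tlift K RR (\<lambda>h1 h2. braided_mult K R (tdelta (s h1)) (diag_act K H R h2 X)) (comult H h))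
    = sweedler K H T (\<lambda>x y. comult A (s x) \<otimes>\<^bsub>T\<^esub> Psi X \<otimes>\<^bsub>T\<^esub> gam (S y)) h"
proof -
  let ?c = "convolution K H T"
  have e: "?c (\<lambda>x. Psi (tdelta (s x))) (\<lambda>x. gam x \<otimes>\<^bsub>T\<^esub> Psi X) x = comult A (s x) \<otimes>\<^bsub>T\<^esub> Psi X"
    if x: "x \<in> carrier H" for x
  proof -
    have "comult A (s x) \<otimes>\<^bsub>T\<^esub> Psi X = ?c (\<lambda>x. Psi (tdelta (s x))) gam x \<otimes>\<^bsub>T\<^esub> Psi X"
      using Psi_omega_gam[OF x] by simp
    also have "\<dots> = ?c (\<lambda>x. Psi (tdelta (s x))) (\<lambda>x. gam x \<otimes>\<^bsub>T\<^esub> Psi X) x"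
      unfolding convolution_def using X x
      by (subst sweedler_commute[where g="\<lambda>z. z \<otimes>\<^bsub>T\<^esub> Psi X"]) (simp_all add: T.m_assoc)
    finally show ?thesis by simp
  qed
  have "Psi (tlift K RR (\<lambda>h1 h2. braided_mult K R (tdelta (s h1)) (diag_act K H R h2 X)) (comult H h))
    = Psi (sweedler K H RR (\<lambda>h1 h2. braided_mult K R (tdelta (s h1)) (diag_act K H R h2 X)) h)"
    using h by (simp add: sweedler_eq)
  also have "\<dots> = sweedler K H T (\<lambda>h1 h2. Psi (tdelta (s h1)) \<otimes>\<^bsub>T\<^esub> Psi (diag_act K H R h2 X)) h"
    using X h by (subst sweedler_commute[OF Psi_lin0]) (simp_all add: Psi_mult)
  also have "\<dots> = ?c (\<lambda>x. Psi (tdelta (s x))) (?c (\<lambda>x. gam x \<otimes>\<^bsub>T\<^esub> Psi X) (\<lambda>x. gam (S x))) h"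
    using X by (simp add: convolution_def[of K H T "\<lambda>x. Psi (tdelta (s x))"] Psi_act)
  also have "\<dots> = ?c (?c (\<lambda>x. Psi (tdelta (s x))) (\<lambda>x. gam x \<otimes>\<^bsub>T\<^esub> Psi X)) (\<lambda>x. gam (S x)) h"
    using X by (subst convolution_assoc) simp_all
  also have "\<dots> = ?c (\<lambda>x. comult A (s x) \<otimes>\<^bsub>T\<^esub> Psi X) (\<lambda>x. gam (S x)) h" by (simp add: e)
  finally show ?thesis by (simp add: convolution_def)
qed

text \<open>Both images are \<Sum> \<Delta>(s(h1)) Psi(\<omega>(k)) gam(S(h2)): on the left because
  \<open>s\<close>, \<Delta> and \<open>gam\<close> are multiplicative and \<open>S\<close> reverses
  products, on the right by \<open>Psi_twisted\<close>.\<close>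

lemma omega_mult:
  assumes h: "h \<in> carrier H" and k: "k \<in> carrier H"
  shows "tdelta (s (h \<otimes>\<^bsub>H\<^esub> k)) = tlift K RR
    (\<lambda>h1 h2. braided_mult K R (tdelta (s h1)) (diag_act K H R h2 (tdelta (s k)))) (comult H h)"
proof (rule Psi_inj)
  have "Psi (tdelta (s (h \<otimes>\<^bsub>H\<^esub> k))) = sweedler K H T (\<lambda>x y. comult A (s x) \<otimes>\<^bsub>T\<^esub> gam (S y)) (h \<otimes>\<^bsub>H\<^esub> k)"
    using h k by (simp add: Psi_omega convolution_def)
  also have "\<dots> = sweedler K H T (\<lambda>x1 x2. sweedler K H T
      (\<lambda>y1 y2. comult A (s (x1 \<otimes>\<^bsub>H\<^esub> y1)) \<otimes>\<^bsub>T\<^esub> gam (S (x2 \<otimes>\<^bsub>H\<^esub> y2))) k) h"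
    by (rule sweedler_mult[OF bialgH modT h k]) simp_all
  also have "\<dots> = sweedler K H T (\<lambda>x1 x2. sweedler K H T
      (\<lambda>y1 y2. comult A (s x1) \<otimes>\<^bsub>T\<^esub> (comult A (s y1) \<otimes>\<^bsub>T\<^esub> gam (S y2)) \<otimes>\<^bsub>T\<^esub> gam (S x2)) k) h"
    by (simp add: s_mult Delta_mult H.antipode_mult gam_mult T.m_assoc)
  also have "\<dots> = sweedler K H T (\<lambda>x y. comult A (s x) \<otimes>\<^bsub>T\<^esub> Psi (tdelta (s k)) \<otimes>\<^bsub>T\<^esub> gam (S y)) h"
    unfolding Psi_omega[OF k] convolution_def using k
    by (intro sweedler_cong[THEN fun_cong]
        sweedler_commute[where g="\<lambda>z. comult A (s _) \<otimes>\<^bsub>T\<^esub> z \<otimes>\<^bsub>T\<^esub> gam (S _)", symmetric]) simp_all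
  finally show "Psi (tdelta (s (h \<otimes>\<^bsub>H\<^esub> k))) = Psi (tlift K RR
    (\<lambda>h1 h2. braided_mult K R (tdelta (s h1)) (diag_act K H R h2 (tdelta (s k)))) (comult H h))"
    using h k by (simp add: Psi_twisted)
  have "sweedler K H RR (\<lambda>h1 h2. braided_mult K R (tdelta (s h1)) (diag_act K H R h2 (tdelta (s k)))) h \<in> carrier RR"
    using h k by simp
  then show "tlift K RR (\<lambda>h1 h2. braided_mult K R (tdelta (s h1)) (diag_act K H R h2 (tdelta (s k)))) (comult H h)
    \<in> carrier RR" using h by (simp add: sweedler_eq)
qed (use h k in simp)

text \<open>Both images are \<Sum> \<Delta>(s(h1)) \<Delta>(r) gam(S(h2)); on the left,
  \<Delta>(s(S(h2))) from the adjoint action cancels \<Delta>(s(h3)) from \<omega>.\<close>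

lemma delta_act:
  assumes h: "h \<in> carrier H" and r: "r \<in> coinv"
  shows "tlift K RR (\<lambda>h1 h2. braided_mult K R (tdelta (adj h1 r)) (tdelta (s h2))) (comult H h)
    = tlift K RR (\<lambda>h1 h2. braided_mult K R (tdelta (s h1)) (diag_act K H R h2 (tdelta r))) (comult H h)"
proof (rule Psi_inj)
  let ?c = "convolution K H T"
  have r': "r \<in> carrier A" using r by simp
  have e: "comult A (adj x r) = ?c (\<lambda>x. comult A (s x) \<otimes>\<^bsub>T\<^esub> comult A r) (\<lambda>x. comult A (s (S x))) x"
    if x: "x \<in> carrier H" for x
    unfolding adj_conv(1)[OF x r'] using x r'
    by (subst algebra_hom_convolution[OF Delta_hom]) (simp_all add: Delta_mult)
  have "Psi (tlift K RR (\<lambda>h1 h2. braided_mult K R (tdelta (adj h1 r)) (tdelta (s h2))) (comult H h))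
    = Psi (sweedler K H RR (\<lambda>h1 h2. braided_mult K R (tdelta (adj h1 r)) (tdelta (s h2))) h)"
    using h by (simp add: sweedler_eq)
  also have "\<dots> = ?c (\<lambda>x. comult A (adj x r)) (\<lambda>x. Psi (tdelta (s x))) h"
    using h r by (subst sweedler_commute[OF Psi_lin0]) (simp_all add: Psi_mult Psi_delta convolution_def)
  also have "\<dots> = ?c (?c (\<lambda>x. comult A (s x) \<otimes>\<^bsub>T\<^esub> comult A r) (\<lambda>x. comult A (s (S x))))
      (?c (\<lambda>x. comult A (s x)) (\<lambda>x. gam (S x))) h"
    by (simp add: e Psi_omega)
  also have "\<dots> = ?c (\<lambda>x. comult A (s x) \<otimes>\<^bsub>T\<^esub> comult A r) (?c (\<lambda>x. comult A (s (S x)))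
      (?c (\<lambda>x. comult A (s x)) (\<lambda>x. gam (S x)))) h"
    using r by (subst convolution_assoc) simp_all
  also have "\<dots> = ?c (\<lambda>x. comult A (s x) \<otimes>\<^bsub>T\<^esub> comult A r) (\<lambda>x. gam (S x)) h"
    by (rule fun_cong[OF convolution_cong[OF refl]], rule convolution_cancel_left)
      (simp_all add: H.antipode_conv_left[OF algebra_hom_comp[OF Delta_hom s_hom] algT])
  also have "\<dots> = Psi (tlift K RR (\<lambda>h1 h2. braided_mult K R (tdelta (s h1)) (diag_act K H R h2 (tdelta r))) (comult H h))"
    using h r by (simp add: Psi_twisted Psi_delta convolution_def)
  finally show "Psi (tlift K RR (\<lambda>h1 h2. braided_mult K R (tdelta (adj h1 r)) (tdelta (s h2))) (comult H h))
    = Psi (tlift K RR (\<lambda>h1 h2. braided_mult K R (tdelta (s h1)) (diag_act K H R h2 (tdelta r))) (comult H h))" .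
  have "sweedler K H RR (\<lambda>h1 h2. braided_mult K R (tdelta (adj h1 r)) (tdelta (s h2))) h \<in> carrier RR"
    "sweedler K H RR (\<lambda>h1 h2. braided_mult K R (tdelta (s h1)) (diag_act K H R h2 (tdelta r))) h \<in> carrier RR"
    using h r by simp_all
  then show "tlift K RR (\<lambda>h1 h2. braided_mult K R (tdelta (adj h1 r)) (tdelta (s h2))) (comult H h) \<in> carrier RR"
    "tlift K RR (\<lambda>h1 h2. braided_mult K R (tdelta (s h1)) (diag_act K H R h2 (tdelta r))) (comult H h) \<in> carrier RR"
    using h by (simp_all add: sweedler_eq)
qed

section \<open>The diagonal coaction on R \<otimes> R\<close>

abbreviation "Y \<equiv> tensor K H RR"

text \<open>Left colinearity turns the coproduct of s(h) into h1 \<otimes> s(h2); \<open>tau\<close>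
  reduces the right factor s(h2) to \<epsilon>(h2), so only the multiplication of the
  \<open>H\<close>-leg by \<open>h\<close> survives.\<close>

lemma sweedler_left_s_mult:
  assumes X: "module K X" and a: "a \<in> carrier A" and h: "h \<in> carrier H"
    and b: "k_bilinear K H R X b"
  shows "sweedler K A X (\<lambda>x y. b (p x) (tau y)) (a \<otimes>\<^bsub>A\<^esub> s h)
    = sweedler K A X (\<lambda>x y. b (p x \<otimes>\<^bsub>H\<^esub> h) (tau y)) a"
proof -
  have l: "k_linear K V X (\<lambda>u. b x (f u))" if "x \<in> carrier H" "k_linear K V R f"
    for V :: "('k, 'u, 'v) module_scheme" and x f
    using k_linear_comp[of K R X "b x"] that b by (auto simp: k_bilinear_def)
  have l': "k_linear K V X (\<lambda>u. b (f u) y)" if "y \<in> coinv" "k_linear K V H f"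
    for V :: "('k, 'u, 'v) module_scheme" and y f
    using k_linear_comp[of K H X "\<lambda>h. b h y"] that b by (auto simp: k_bilinear_def)
  have sm: "b x (c \<odot>\<^bsub>A\<^esub> y) = c \<odot>\<^bsub>X\<^esub> b x y" if "x \<in> carrier H" "c \<in> carrier K" "y \<in> coinv" for x c y
    using k_linear_smult[of K R X "b x" c y] b that by (simp add: k_bilinear_def R_sel)
  have "sweedler K A X (\<lambda>x y. b (p x) (tau y)) (a \<otimes>\<^bsub>A\<^esub> s h) = sweedler K A X (\<lambda>x1 x2. sweedler K A X
      (\<lambda>y1 y2. b (p (x1 \<otimes>\<^bsub>A\<^esub> y1)) (tau (x2 \<otimes>\<^bsub>A\<^esub> y2))) (s h)) a"
    by (rule sweedler_mult[OF bialgA X]) (simp_all add: a h l l')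
  also have "\<dots> = sweedler K A X (\<lambda>x1 x2. sweedler K A X
      (\<lambda>y1 y2. b (p x1 \<otimes>\<^bsub>H\<^esub> p y1) (tau (x2 \<otimes>\<^bsub>A\<^esub> y2))) (s h)) a"
    by (simp add: p_mult)
  also have "\<dots> = sweedler K A X (\<lambda>x1 x2. sweedler K H X
      (\<lambda>y1 y2. b (p x1 \<otimes>\<^bsub>H\<^esub> y1) (tau (x2 \<otimes>\<^bsub>A\<^esub> s y2))) h) a"
    by (intro sweedler_cong[THEN fun_cong] sweedler_s_left[OF X h, where
      b="\<lambda>y1 y2. b (p _ \<otimes>\<^bsub>H\<^esub> y1) (tau (_ \<otimes>\<^bsub>A\<^esub> y2))"]) (simp_all add: l l')
  also have "\<dots> = sweedler K A X (\<lambda>x1 x2. sweedler K H X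
      (\<lambda>y1 y2. counit H y2 \<odot>\<^bsub>X\<^esub> b (p x1 \<otimes>\<^bsub>H\<^esub> y1) (tau x2)) h) a"
    by (simp add: tau_s_mult sm)
  also have "\<dots> = sweedler K A X (\<lambda>x y. b (p x \<otimes>\<^bsub>H\<^esub> h) (tau y)) a"
    by (intro sweedler_cong[THEN fun_cong] sweedler_counit_right) (simp_all add: h X l')
  finally show ?thesis .
qed

text \<open>\<open>Psi\<close> stores the coaction leg of the second tensorand in the first factor.
  Hence the left coaction of the first factor alone, followed by \<open>tau\<close> on the remaining
  legs, reads off the diagonal coaction; this is \<open>diag_coact_Psi\<close>.\<close>

definition Fl :: "('a \<times> 'a \<Rightarrow> 'k) set \<Rightarrow> ('h \<times> ('a \<times> 'a \<Rightarrow> 'k) set \<Rightarrow> 'k) set"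
  where "Fl X = tlift K Y (\<lambda>P Q. sweedler K A Y (\<lambda>x y. pure K H RR (p x) (pure K R R (tau y) (tau Q))) P) X"

lemma Fl_bil: "k_bilinear K A A Y (\<lambda>P Q. sweedler K A Y (\<lambda>x y. pure K H RR (p x) (pure K R R (tau y) (tau Q))) P)"
  by (rule k_bilinearI) simp_all

lemma Fl_lin: "k_linear K T Y Fl"
  unfolding k_linear_tensor_algebra Fl_def[abs_def] by (rule tlift_linear[OF modA modA _ Fl_bil]) simp

lemma Fl_pure: "\<lbrakk>P \<in> carrier A; Q \<in> carrier A\<rbrakk> \<Longrightarrow>
    Fl (pure K A A P Q) = sweedler K A Y (\<lambda>x y. pure K H RR (p x) (pure K R R (tau y) (tau Q))) P"
  unfolding Fl_def by (rule tlift_pure[OF modA modA _ Fl_bil]) simp_all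

lemma Psi_pure_sweedler:
  assumes rq: "r \<in> coinv" "q \<in> coinv"
  shows "Psi (pure K R R r q) = sweedler K A T (\<lambda>x y. pure K A A (r \<otimes>\<^bsub>A\<^esub> s (p x)) y) q"
proof -
  have "Psi (pure K R R r q) = sweedler K A T (\<lambda>x y. i1 r \<otimes>\<^bsub>T\<^esub> (i1 (s (p x)) \<otimes>\<^bsub>T\<^esub> i2 y)) q"
    unfolding Psi_pure[OF rq] lam_def convolution_def using rq by (intro sweedler_commute) simp_all
  also have "\<dots> = sweedler K A T (\<lambda>x y. pure K A A (r \<otimes>\<^bsub>A\<^esub> s (p x)) y) q"
    using rq by (simp add: i1_i2 i1_pure)
  finally show ?thesis .
qed

lemma diag_coact_Psi:
  assumes X: "X \<in> carrier RR" shows "diag_coact K H R X = Fl (Psi X)"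
  unfolding diag_coact_def Let_def
proof (rule tensor_ext[OF modR modR _ X, where X=Y and f="\<lambda>X. tlift K Y (\<lambda>r s.
      tlift K Y (\<lambda>g r0. tlift K Y (\<lambda>g' s0. pure K H RR (g \<otimes>\<^bsub>H\<^esub> g') (pure K R R r0 s0)) (coact R s)) (coact R r)) X"])
  let ?d = "\<lambda>r q. tlift K Y (\<lambda>g r0. tlift K Y (\<lambda>g' s0. pure K H RR (g \<otimes>\<^bsub>H\<^esub> g') (pure K R R r0 s0)) (lcoact q)) (lcoact r)"
  have b1: "k_bilinear K H R Y (\<lambda>g' s0. pure K H RR (g \<otimes>\<^bsub>H\<^esub> g') (pure K R R r0 s0))"
    if "g \<in> carrier H" "r0 \<in> coinv" for g r0
    using that by (intro k_bilinearI) simp_all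
  have b2: "k_bilinear K H R Y (\<lambda>g r0. tlift K Y (\<lambda>g' s0. pure K H RR (g \<otimes>\<^bsub>H\<^esub> g') (pure K R R r0 s0)) (lcoact q))"
    if "q \<in> carrier A" for q
    using that by (intro k_bilinearI k_linear_tlift_inner[OF modH modR]) simp_all
  have d: "?d r q = sweedler K A Y (\<lambda>x y. sweedler K A Y
      (\<lambda>u v. pure K H RR (p x \<otimes>\<^bsub>H\<^esub> p u) (pure K R R (tau y) (tau v))) q) r"
    if "r \<in> carrier A" "q \<in> carrier A" for r q
    using that by (simp add: tlift_lcoact[OF _ b2] tlift_lcoact[OF _ b1])
  have db: "k_bilinear K R R Y ?d"
  proof -
    have "k_bilinear K R R Y (\<lambda>r q. sweedler K A Y (\<lambda>x y. sweedler K A Y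
      (\<lambda>u v. pure K H RR (p x \<otimes>\<^bsub>H\<^esub> p u) (pure K R R (tau y) (tau v))) q) r)"
      by (rule k_bilinearI) simp_all
    then show ?thesis
      unfolding k_bilinear_def using k_linear_cong[OF modR, of _ _ Y] d by (smt (verit) R_carrier coinv_closed)
  qed
  show "k_linear K RR Y (tlift K Y (\<lambda>r s. tlift K Y (\<lambda>g r0. tlift K Y
      (\<lambda>g' s0. pure K H RR (g \<otimes>\<^bsub>H\<^esub> g') (pure K R R r0 s0)) (coact R s)) (coact R r)))"
    unfolding R_sel(10) by (rule tlift_linear[OF modR modR _ db]) simp
  show "k_linear K RR Y (\<lambda>X. Fl (Psi X))" by (rule k_linear_comp[OF Fl_lin Psi_lin0])
  fix r q assume "r \<in> carrier R" "q \<in> carrier R"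
  then have rq: "r \<in> coinv" "q \<in> coinv" by simp_all
  have "tlift K Y (\<lambda>r s. tlift K Y (\<lambda>g r0. tlift K Y
      (\<lambda>g' s0. pure K H RR (g \<otimes>\<^bsub>H\<^esub> g') (pure K R R r0 s0)) (coact R s)) (coact R r)) (pure K R R r q) = ?d r q"
    unfolding R_sel(10) by (rule tlift_pure[OF modR modR _ db]) (simp_all add: rq)
  also have "\<dots> = sweedler K A Y (\<lambda>u v. sweedler K A Y
      (\<lambda>x y. pure K H RR (p x \<otimes>\<^bsub>H\<^esub> p u) (pure K R R (tau y) (tau v))) r) q"
    unfolding d[OF coinv_closed[OF rq(1)] coinv_closed[OF rq(2)]]
    by (rule sweedler_swap) (use rq in simp_all)
  \<comment> \<open>The leg p(u) coming from \<open>q\<close> re-enters the first factor as s(p(u)),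
    by \<open>sweedler_left_s_mult\<close> read backwards.\<close>
  also have "\<dots> = sweedler K A Y (\<lambda>u v. Fl (pure K A A (r \<otimes>\<^bsub>A\<^esub> s (p u)) v)) q"
  proof (rule sweedler_cong[THEN fun_cong])
    fix u v assume uv: "u \<in> carrier A" "v \<in> carrier A"
    have "sweedler K A Y (\<lambda>x y. pure K H RR (p x) (pure K R R (tau y) (tau v))) (r \<otimes>\<^bsub>A\<^esub> s (p u))
      = sweedler K A Y (\<lambda>x y. pure K H RR (p x \<otimes>\<^bsub>H\<^esub> p u) (pure K R R (tau y) (tau v))) r"
      by (rule sweedler_left_s_mult[where b="\<lambda>x y. pure K H RR x (pure K R R y (tau v))", OF _ _ _ k_bilinearI])
        (use rq uv in simp_all)
    then show "sweedler K A Y (\<lambda>x y. pure K H RR (p x \<otimes>\<^bsub>H\<^esub> p u) (pure K R R (tau y) (tau v))) r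
      = Fl (pure K A A (r \<otimes>\<^bsub>A\<^esub> s (p u)) v)" using rq uv by (simp add: Fl_pure)
  qed
  also have "\<dots> = Fl (Psi (pure K R R r q))"
    unfolding Psi_pure_sweedler[OF rq] using rq by (intro sweedler_commute[OF Fl_lin, symmetric]) simp_all
  finally show "tlift K Y (\<lambda>r s. tlift K Y (\<lambda>g r0. tlift K Y
      (\<lambda>g' s0. pure K H RR (g \<otimes>\<^bsub>H\<^esub> g') (pure K R R r0 s0)) (coact R s)) (coact R r)) (pure K R R r q)
    = Fl (Psi (pure K R R r q))" .
qed simp

lemma Fl_Delta:
  assumes a: "a \<in> carrier A"
  shows "Fl (comult A a) = sweedler K A Y (\<lambda>x z. pure K H RR (p x) (tdelta z)) a"
proof -
  have "Fl (comult A a) = sweedler K A Y (\<lambda>P Q. sweedler K A Y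
      (\<lambda>x y. pure K H RR (p x) (pure K R R (tau y) (tau Q))) P) a"
    unfolding Fl_def sweedler_eq[OF coA a] ..
  also have "\<dots> = sweedler K A Y (\<lambda>x z. sweedler K A Y
      (\<lambda>y Q. pure K H RR (p x) (pure K R R (tau y) (tau Q))) z) a"
    by (rule sweedler_coassoc) simp_all
  also have "\<dots> = sweedler K A Y (\<lambda>x z. pure K H RR (p x) (tdelta z)) a"
    unfolding tdelta_eq by (intro sweedler_cong[THEN fun_cong] sweedler_commute[symmetric]) simp_all
  finally show ?thesis .
qed

lemma delta_coact:
  assumes r: "r \<in> coinv"
  shows "diag_coact K H R (tdelta r) = tlift K Y (\<lambda>g q. pure K H RR g (tdelta q)) (lcoact r)"
proof -
  have "tlift K Y (\<lambda>g q. pure K H RR g (tdelta q)) (lcoact r)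
    = sweedler K A Y (\<lambda>x z. pure K H RR (p x) (tdelta z)) r"
    by (rule lcoact_tau[OF r _ k_bilinearI]) simp_all
  then show ?thesis using r by (simp add: diag_coact_Psi Psi_delta Fl_Delta)
qed

definition rk :: "'h \<Rightarrow> ('h \<times> ('a \<times> 'a \<Rightarrow> 'k) set \<Rightarrow> 'k) set \<Rightarrow> ('h \<times> ('a \<times> 'a \<Rightarrow> 'k) set \<Rightarrow> 'k) set"
  where "rk k X = tlift K Y (\<lambda>g Z. pure K H RR (g \<otimes>\<^bsub>H\<^esub> k) Z) X"

lemma rk_bil: "k \<in> carrier H \<Longrightarrow> k_bilinear K H RR Y (\<lambda>g Z. pure K H RR (g \<otimes>\<^bsub>H\<^esub> k) Z)"
  using k_linear_pure_right[OF modH _ k_linear_id, of RR] by (intro k_bilinearI) simp_all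

lemma rk_lin: "k \<in> carrier H \<Longrightarrow> k_linear K Y Y (rk k)"
  unfolding rk_def[abs_def] by (rule tlift_linear[OF modH _ _ rk_bil]) simp_all

lemma rk_pure: "\<lbrakk>k \<in> carrier H; g \<in> carrier H; Z \<in> carrier RR\<rbrakk> \<Longrightarrow>
    rk k (pure K H RR g Z) = pure K H RR (g \<otimes>\<^bsub>H\<^esub> k) Z"
  unfolding rk_def by (rule tlift_pure[OF modH _ _ rk_bil]) simp_all

text \<open>gam(k) is \<Sum> s(k1) \<otimes> s(k2). The factor s(k1) multiplies the
  \<open>H\<close>-leg by k1, while \<open>tau\<close> reduces s(k2) in the second factor to
  \<epsilon>(k2); together this is right multiplication of the \<open>H\<close>-leg by
  \<open>k\<close>.\<close>

lemma Fl_gam: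
  assumes X: "X \<in> carrier T" and k: "k \<in> carrier H"
  shows "Fl (X \<otimes>\<^bsub>T\<^esub> gam k) = rk k (Fl X)"
proof (rule T_ext[OF X, where Y=Y and f="\<lambda>X. Fl (X \<otimes>\<^bsub>T\<^esub> gam k)"])
  show "k_linear K T Y (\<lambda>X. Fl (X \<otimes>\<^bsub>T\<^esub> gam k))" using k by (intro k_linear_comp[OF Fl_lin]) simp
  show "k_linear K T Y (\<lambda>X. rk k (Fl X))" by (rule k_linear_comp[OF rk_lin[OF k] Fl_lin])
  fix P Q assume PQ: "P \<in> carrier A" "Q \<in> carrier A"
  have sm: "pure K H RR x (pure K R R y (c \<odot>\<^bsub>A\<^esub> z)) = c \<odot>\<^bsub>Y\<^esub> pure K H RR x (pure K R R y z)"
    if "x \<in> carrier H" "y \<in> coinv" "c \<in> carrier K" "z \<in> coinv" for x y z c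
    using that k_linear_smult[OF k_linear_pure_right[OF modH _ k_linear_id, of RR x], of c "pure K R R y z"]
    by (simp add: pure_smult)
  have "pure K A A P Q \<otimes>\<^bsub>T\<^esub> gam k
    = sweedler K H T (\<lambda>x y. pure K A A P Q \<otimes>\<^bsub>T\<^esub> (i1 (s x) \<otimes>\<^bsub>T\<^esub> i2 (s y))) k"
    unfolding gam_conv[OF k] convolution_def using PQ k by (intro sweedler_commute) simp_all
  also have "\<dots> = sweedler K H T (\<lambda>x y. pure K A A (P \<otimes>\<^bsub>A\<^esub> s x) (Q \<otimes>\<^bsub>A\<^esub> s y)) k"
    using PQ by (simp add: i1_i2 pure_mult)
  finally have "Fl (pure K A A P Q \<otimes>\<^bsub>T\<^esub> gam k)
      = Fl (sweedler K H T (\<lambda>x y. pure K A A (P \<otimes>\<^bsub>A\<^esub> s x) (Q \<otimes>\<^bsub>A\<^esub> s y)) k)" by simp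
  also have "\<dots> = sweedler K H Y (\<lambda>x y. Fl (pure K A A (P \<otimes>\<^bsub>A\<^esub> s x) (Q \<otimes>\<^bsub>A\<^esub> s y))) k"
    using PQ k by (intro sweedler_commute[OF Fl_lin]) simp_all
  also have "\<dots> = sweedler K H Y (\<lambda>x y. sweedler K A Y
      (\<lambda>u v. pure K H RR (p u \<otimes>\<^bsub>H\<^esub> x) (pure K R R (tau v) (tau (Q \<otimes>\<^bsub>A\<^esub> s y)))) P) k"
  proof (rule sweedler_cong[THEN fun_cong])
    fix x y assume xy: "x \<in> carrier H" "y \<in> carrier H"
    have "sweedler K A Y (\<lambda>u v. pure K H RR (p u) (pure K R R (tau v) (tau (Q \<otimes>\<^bsub>A\<^esub> s y)))) (P \<otimes>\<^bsub>A\<^esub> s x)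
      = sweedler K A Y (\<lambda>u v. pure K H RR (p u \<otimes>\<^bsub>H\<^esub> x) (pure K R R (tau v) (tau (Q \<otimes>\<^bsub>A\<^esub> s y)))) P"
      by (rule sweedler_left_s_mult[where b="\<lambda>u v. pure K H RR u (pure K R R v (tau (Q \<otimes>\<^bsub>A\<^esub> s y)))", OF _ _ _ k_bilinearI])
        (use PQ xy in simp_all)
    then show "Fl (pure K A A (P \<otimes>\<^bsub>A\<^esub> s x) (Q \<otimes>\<^bsub>A\<^esub> s y)) = sweedler K A Y
      (\<lambda>u v. pure K H RR (p u \<otimes>\<^bsub>H\<^esub> x) (pure K R R (tau v) (tau (Q \<otimes>\<^bsub>A\<^esub> s y)))) P"
      using PQ xy by (simp add: Fl_pure)
  qed
  also have "\<dots> = sweedler K H Y (\<lambda>x y. counit H y \<odot>\<^bsub>Y\<^esub> sweedler K A Y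
      (\<lambda>u v. pure K H RR (p u \<otimes>\<^bsub>H\<^esub> x) (pure K R R (tau v) (tau Q))) P) k"
  proof (rule sweedler_cong[THEN fun_cong])
    fix x y assume xy: "x \<in> carrier H" "y \<in> carrier H"
    have "sweedler K A Y (\<lambda>u v. pure K H RR (p u \<otimes>\<^bsub>H\<^esub> x) (pure K R R (tau v) (tau (Q \<otimes>\<^bsub>A\<^esub> s y)))) P
      = sweedler K A Y (\<lambda>u v. counit H y \<odot>\<^bsub>Y\<^esub> pure K H RR (p u \<otimes>\<^bsub>H\<^esub> x) (pure K R R (tau v) (tau Q))) P"
      using PQ xy by (simp add: tau_s_mult sm)
    also have "\<dots> = counit H y \<odot>\<^bsub>Y\<^esub> sweedler K A Y
      (\<lambda>u v. pure K H RR (p u \<otimes>\<^bsub>H\<^esub> x) (pure K R R (tau v) (tau Q))) P"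
      using PQ xy by (intro sweedler_commute[where g="\<lambda>z. counit H y \<odot>\<^bsub>Y\<^esub> z", symmetric]) simp_all
    finally show "sweedler K A Y (\<lambda>u v. pure K H RR (p u \<otimes>\<^bsub>H\<^esub> x) (pure K R R (tau v) (tau (Q \<otimes>\<^bsub>A\<^esub> s y)))) P
      = counit H y \<odot>\<^bsub>Y\<^esub> sweedler K A Y (\<lambda>u v. pure K H RR (p u \<otimes>\<^bsub>H\<^esub> x) (pure K R R (tau v) (tau Q))) P" .
  qed
  also have "\<dots> = sweedler K A Y (\<lambda>u v. pure K H RR (p u \<otimes>\<^bsub>H\<^esub> k) (pure K R R (tau v) (tau Q))) P"
    using PQ k by (intro sweedler_counit_right) simp_all
  also have "\<dots> = sweedler K A Y (\<lambda>u v. rk k (pure K H RR (p u) (pure K R R (tau v) (tau Q)))) P"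
    using PQ k by (simp add: rk_pure)
  also have "\<dots> = rk k (Fl (pure K A A P Q))"
    unfolding Fl_pure[OF PQ] using PQ by (intro sweedler_commute[OF rk_lin[OF k], symmetric]) simp_all
  finally show "Fl (pure K A A P Q \<otimes>\<^bsub>T\<^esub> gam k) = rk k (Fl (pure K A A P Q))" .
qed simp

text \<open>Psi(\<omega>(h)) is \<Sum> \<Delta>(s(x)) gam(S(y)) over the coproduct of
  \<open>h\<close>. Left colinearity of \<open>s\<close> splits the first factor into the leg x1 and
  \<omega>(x2), and \<open>Fl_gam\<close> multiplies S(y) onto the leg.\<close>

lemma omega_coact:
  assumes h: "h \<in> carrier H"
  shows "diag_coact K H R (tdelta (s h)) = comult3 K H Y
    (\<lambda>h1 h2 h3. pure K H RR (h1 \<otimes>\<^bsub>H\<^esub> S h3) (tdelta (s h2))) h"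
proof -
  have Fs: "Fl (comult A (s x)) = sweedler K H Y (\<lambda>u v. pure K H RR u (tdelta (s v))) x" if x: "x \<in> carrier H" for x
    using x by (subst Fl_Delta) (simp_all add: sweedler_s_left[where b="\<lambda>u v. pure K H RR u (tdelta v)"])
  have "diag_coact K H R (tdelta (s h)) = Fl (sweedler K H T (\<lambda>x y. comult A (s x) \<otimes>\<^bsub>T\<^esub> gam (S y)) h)"
    using h by (simp add: diag_coact_Psi Psi_omega convolution_def)
  also have "\<dots> = sweedler K H Y (\<lambda>x y. Fl (comult A (s x) \<otimes>\<^bsub>T\<^esub> gam (S y))) h"
    using h by (intro sweedler_commute[OF Fl_lin]) simp_all
  also have "\<dots> = sweedler K H Y (\<lambda>x y. rk (S y) (sweedler K H Y (\<lambda>u v. pure K H RR u (tdelta (s v))) x)) h"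
    by (simp add: Fl_gam Fs)
  also have "\<dots> = sweedler K H Y (\<lambda>x y. sweedler K H Y (\<lambda>u v. rk (S y) (pure K H RR u (tdelta (s v)))) x) h"
    by (intro sweedler_cong[THEN fun_cong] sweedler_commute[OF rk_lin]) simp_all
  also have "\<dots> = comult3 K H Y (\<lambda>h1 h2 h3. pure K H RR (h1 \<otimes>\<^bsub>H\<^esub> S h3) (tdelta (s h2))) h"
    by (simp add: comult3_eq[OF coH h] rk_pure)
  finally show ?thesis .
qed

section \<open>The quadruple of a split bialgebra\<close>

abbreviation "Y3 \<equiv> tensor K R RR"

definition e3 :: "'a \<Rightarrow> 'a \<Rightarrow> ('a \<times> ('a \<times> 'a \<Rightarrow> 'k) set \<Rightarrow> 'k) set"
  where "e3 a c = sweedler K A Y3 (\<lambda>x y. pure K R RR (tau x) (pure K R R (tau y) c)) a"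

lemma e3_lin_left: "\<lbrakk>c \<in> coinv; module K V; k_linear K V A g\<rbrakk> \<Longrightarrow> k_linear K V Y3 (\<lambda>v. e3 (g v) c)"
  unfolding e3_def by simp

lemma e3_lin_right: "\<lbrakk>a \<in> carrier A; module K V; k_linear K V R g\<rbrakk> \<Longrightarrow> k_linear K V Y3 (\<lambda>v. e3 a (g v))"
  unfolding e3_def by simp

lemma e3_smult: "\<lbrakk>a \<in> carrier A; c \<in> coinv; k \<in> carrier K\<rbrakk> \<Longrightarrow> e3 a (k \<odot>\<^bsub>A\<^esub> c) = k \<odot>\<^bsub>Y3\<^esub> e3 a c"
  using k_linear_smult[OF e3_lin_right[of a R "\<lambda>c. c"], of k c] by (simp add: R_sel(6))

lemma reassoc_tdelta: "\<lbrakk>a \<in> carrier A; z \<in> coinv\<rbrakk> \<Longrightarrow> reassoc K R (tdelta a) z = e3 a z"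
  unfolding reassoc_def e3_def by (rule tlift_tdelta[OF _ k_bilinearI]) simp_all

text \<open>The map that applies \<open>tdelta\<close> to the first factor and \<open>tau\<close> to
  the second, with brackets moved to the right. Both sides of the coassociativity axiom are its
  value at \<Delta>(r), both sides of the cocycle axiom its value at \<Delta>(s(h)).\<close>

definition E3 :: "('a \<times> 'a \<Rightarrow> 'k) set \<Rightarrow> ('a \<times> ('a \<times> 'a \<Rightarrow> 'k) set \<Rightarrow> 'k) set"
  where "E3 X = tlift K Y3 (\<lambda>a b. e3 a (tau b)) X"

lemma E3_bil: "k_bilinear K A A Y3 (\<lambda>a b. e3 a (tau b))"
  by (rule k_bilinearI) (simp_all add: e3_lin_left e3_lin_right)

lemma E3_lin: "k_linear K T Y3 E3"
  unfolding k_linear_tensor_algebra E3_def[abs_def] by (rule tlift_linear[OF modA modA _ E3_bil]) simp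

lemma E3_pure: "\<lbrakk>a \<in> carrier A; b \<in> carrier A\<rbrakk> \<Longrightarrow> E3 (pure K A A a b) = e3 a (tau b)"
  unfolding E3_def by (rule tlift_pure[OF modA modA _ E3_bil]) simp_all

lemma E3_Delta:
  assumes c: "c \<in> carrier A"
  shows "E3 (comult A c) = sweedler K A Y3 (\<lambda>x y. pure K R RR (tau x) (tdelta y)) c"
proof -
  have "E3 (comult A c) = sweedler K A Y3 (\<lambda>a b. sweedler K A Y3
      (\<lambda>x y. pure K R RR (tau x) (pure K R R (tau y) (tau b))) a) c"
    unfolding E3_def e3_def sweedler_eq[OF coA c] ..
  also have "\<dots> = sweedler K A Y3 (\<lambda>x z. sweedler K A Y3
      (\<lambda>y b. pure K R RR (tau x) (pure K R R (tau y) (tau b))) z) c"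
    by (rule sweedler_coassoc) simp_all
  also have "\<dots> = sweedler K A Y3 (\<lambda>x z. pure K R RR (tau x) (tdelta z)) c"
    unfolding tdelta_eq by (intro sweedler_cong[THEN fun_cong] sweedler_commute[symmetric]) simp_all
  finally show ?thesis .
qed

text \<open>Only the factor s(k1) of gam(k) is seen by \<open>E3\<close>: s(k2) multiplies the
  second factor from the right and is reduced by \<open>tau\<close> to \<epsilon>(k2).\<close>

lemma E3_gam:
  assumes X: "X \<in> carrier T" and k: "k \<in> carrier H"
  shows "E3 (X \<otimes>\<^bsub>T\<^esub> gam k) = E3 (X \<otimes>\<^bsub>T\<^esub> i1 (s k))"
proof (rule T_ext[OF X, where Y=Y3 and f="\<lambda>X. E3 (X \<otimes>\<^bsub>T\<^esub> gam k)"])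
  show "k_linear K T Y3 (\<lambda>X. E3 (X \<otimes>\<^bsub>T\<^esub> gam k))" "k_linear K T Y3 (\<lambda>X. E3 (X \<otimes>\<^bsub>T\<^esub> i1 (s k)))"
    using k by (simp_all add: k_linear_comp[OF E3_lin])
  fix a b assume ab: "a \<in> carrier A" "b \<in> carrier A"
  have "pure K A A a b \<otimes>\<^bsub>T\<^esub> gam k
    = sweedler K H T (\<lambda>x y. pure K A A a b \<otimes>\<^bsub>T\<^esub> (i1 (s x) \<otimes>\<^bsub>T\<^esub> i2 (s y))) k"
    unfolding gam_conv[OF k] convolution_def using ab k by (intro sweedler_commute) simp_all
  also have "\<dots> = sweedler K H T (\<lambda>x y. pure K A A (a \<otimes>\<^bsub>A\<^esub> s x) (b \<otimes>\<^bsub>A\<^esub> s y)) k"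
    using ab by (simp add: i1_i2 pure_mult)
  finally have "E3 (pure K A A a b \<otimes>\<^bsub>T\<^esub> gam k)
      = E3 (sweedler K H T (\<lambda>x y. pure K A A (a \<otimes>\<^bsub>A\<^esub> s x) (b \<otimes>\<^bsub>A\<^esub> s y)) k)" by simp
  also have "\<dots> = sweedler K H Y3 (\<lambda>x y. E3 (pure K A A (a \<otimes>\<^bsub>A\<^esub> s x) (b \<otimes>\<^bsub>A\<^esub> s y))) k"
    using ab k by (intro sweedler_commute[OF E3_lin]) simp_all
  also have "\<dots> = sweedler K H Y3 (\<lambda>x y. counit H y \<odot>\<^bsub>Y3\<^esub> e3 (a \<otimes>\<^bsub>A\<^esub> s x) (tau b)) k"
    using ab by (simp add: E3_pure tau_s_mult e3_smult)
  also have "\<dots> = e3 (a \<otimes>\<^bsub>A\<^esub> s k) (tau b)"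
    using ab k by (intro sweedler_counit_right) (simp_all add: e3_lin_left)
  also have "\<dots> = E3 (pure K A A a b \<otimes>\<^bsub>T\<^esub> i1 (s k))"
    using ab k by (simp add: i1_def pure_mult E3_pure)
  finally show "E3 (pure K A A a b \<otimes>\<^bsub>T\<^esub> gam k) = E3 (pure K A A a b \<otimes>\<^bsub>T\<^esub> i1 (s k))" .
qed simp

text \<open>Covers the right sides of two axioms: coassociativity takes \<open>f\<close> the
  identity and k = 1, the cocycle axiom takes f(g) = g h2. In both, \<delta>(r)\<omega>(f(g)) is
  \<open>tdelta\<close> of r s(g) s(k), and summing over the coaction of \<open>q\<close>
  reassembles Psi(r \<otimes> q).\<close>

lemma reassoc_twisted:
  assumes X: "X \<in> carrier RR" and f: "k_linear K H H f" and k: "k \<in> carrier H"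
    and fk: "\<And>g. g \<in> carrier H \<Longrightarrow> f g = g \<otimes>\<^bsub>H\<^esub> k"
  shows "tlift K Y3 (\<lambda>r q. tlift K Y3
      (\<lambda>g w. reassoc K R (braided_mult K R (tdelta r) (tdelta (s (f g)))) w) (lcoact q)) X
    = E3 (Psi X \<otimes>\<^bsub>T\<^esub> i1 (s k))"
proof -
  note fc = k_linear_closed[OF f]
  note E3c = k_linear_closed[OF E3_lin]
  have "tlift K Y3 (\<lambda>r q. tlift K Y3
      (\<lambda>g w. reassoc K R (braided_mult K R (tdelta r) (tdelta (s (f g)))) w) (lcoact q)) X
    = tlift K Y3 (\<lambda>r q. E3 (i1 r \<otimes>\<^bsub>T\<^esub> lam q \<otimes>\<^bsub>T\<^esub> i1 (s k))) X"
  proof (rule tlift_cong[OF modR modR X])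
    fix r q assume "r \<in> carrier R" "q \<in> carrier R"
    then have rq: "r \<in> coinv" "q \<in> coinv" by simp_all
    have "tlift K Y3 (\<lambda>g w. reassoc K R (braided_mult K R (tdelta r) (tdelta (s (f g)))) w) (lcoact q)
      = tlift K Y3 (\<lambda>g w. e3 (r \<otimes>\<^bsub>A\<^esub> s (f g)) w) (lcoact q)"
      using rq by (intro tlift_cong[OF modH modR]) (simp_all add: braided_tdelta reassoc_tdelta fc)
    also have "\<dots> = sweedler K A Y3 (\<lambda>u v. e3 (r \<otimes>\<^bsub>A\<^esub> s (f (p u))) (tau v)) q"
      using rq by (intro tlift_lcoact k_bilinearI e3_lin_left e3_lin_right[where g="\<lambda>c. c"])
        (simp_all add: fc f)
    also have "\<dots> = sweedler K A Y3 (\<lambda>u v. E3 (pure K A A (r \<otimes>\<^bsub>A\<^esub> s (p u)) v \<otimes>\<^bsub>T\<^esub> i1 (s k))) q"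
      using rq k by (simp add: fk s_mult E3_pure i1_def pure_mult A.m_assoc)
    also have "\<dots> = E3 (sweedler K A T (\<lambda>u v. pure K A A (r \<otimes>\<^bsub>A\<^esub> s (p u)) v) q \<otimes>\<^bsub>T\<^esub> i1 (s k))"
      using rq k by (intro sweedler_commute[where g="\<lambda>z. E3 (z \<otimes>\<^bsub>T\<^esub> i1 (s k))", symmetric])
        (simp_all add: k_linear_comp[OF E3_lin])
    finally show "tlift K Y3 (\<lambda>g w. reassoc K R (braided_mult K R (tdelta r) (tdelta (s (f g)))) w) (lcoact q)
      = E3 (i1 r \<otimes>\<^bsub>T\<^esub> lam q \<otimes>\<^bsub>T\<^esub> i1 (s k))"
      using rq by (simp add: Psi_pure_sweedler[symmetric] Psi_pure)
  qed
  also have "\<dots> = E3 (Psi X \<otimes>\<^bsub>T\<^esub> i1 (s k))"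
    unfolding Psi_def using X k
    by (intro tlift_commute[OF modR modR, where g="\<lambda>z. E3 (z \<otimes>\<^bsub>T\<^esub> i1 (s k))", symmetric])
      (simp_all add: k_linear_comp[OF E3_lin])
  finally show ?thesis .
qed

lemma delta_coassoc:
  assumes r: "r \<in> coinv"
  shows "tlift K Y3 (\<lambda>r1 r2. pure K R RR r1 (tdelta r2)) (tdelta r)
    = tlift K Y3 (\<lambda>r1 r2. tlift K Y3
        (\<lambda>g w. reassoc K R (braided_mult K R (tdelta r1) (tdelta (s g))) w) (lcoact r2)) (tdelta r)"
proof -
  have "tlift K Y3 (\<lambda>r1 r2. pure K R RR r1 (tdelta r2)) (tdelta r)
    = sweedler K A Y3 (\<lambda>x y. pure K R RR (tau x) (tdelta (tau y))) r"
    using r by (intro tlift_tdelta k_bilinearI) (simp_all add: k_linear_R)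
  also have "\<dots> = sweedler K A Y3 (\<lambda>x y. pure K R RR (tau x) (tdelta y)) r"
    by (rule sweedler_coinv_tau[OF _ r, where b="\<lambda>x y. pure K R RR (tau x) (tdelta y)"]) simp_all
  also have "\<dots> = E3 (comult A r)" using r by (simp add: E3_Delta)
  also have "\<dots> = E3 (Psi (tdelta r) \<otimes>\<^bsub>T\<^esub> i1 (s \<one>\<^bsub>H\<^esub>))"
    using r by (simp add: Psi_delta s_one algebra_homD(4)[OF i1_hom])
  also have "\<dots> = tlift K Y3 (\<lambda>r1 r2. tlift K Y3
        (\<lambda>g w. reassoc K R (braided_mult K R (tdelta r1) (tdelta (s g))) w) (lcoact r2)) (tdelta r)"
    using r by (intro reassoc_twisted[symmetric, where f="\<lambda>g. g"]) simp_all
  finally show ?thesis .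
qed

text \<open>The factor s(S(p(x))) of \<open>tau\<close> cancels. This already recovers an element
  from its components tau(a1) and p(a2), and is used again to invert \<open>iso\<close>.\<close>

lemma tau_conv_s: "a \<in> carrier A \<Longrightarrow> convolution K A A tau (\<lambda>x. s (p x)) a = a"
  unfolding tau_def
  by (rule convolution_cancel_right) (simp_all add: conv_inv_left[OF s_hom algA])

lemma omega_cocycle:
  assumes h: "h \<in> carrier H"
  shows "tlift K Y3 (\<lambda>h1 h2. tlift K Y3
      (\<lambda>x y. pure K R RR x (braided_mult K R (tdelta y) (tdelta (s h2)))) (tdelta (s h1))) (comult H h)
    = tlift K Y3 (\<lambda>h1 h2. tlift K Y3 (\<lambda>x y. tlift K Y3
        (\<lambda>g w. reassoc K R (braided_mult K R (tdelta x) (tdelta (s (g \<otimes>\<^bsub>H\<^esub> h2)))) w)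
        (lcoact y)) (tdelta (s h1))) (comult H h)"
proof -
  note hd = comult_closed[OF coH h]
  have "tlift K Y3 (\<lambda>h1 h2. tlift K Y3
      (\<lambda>x y. pure K R RR x (braided_mult K R (tdelta y) (tdelta (s h2)))) (tdelta (s h1))) (comult H h)
    = tlift K Y3 (\<lambda>h1 h2. sweedler K A Y3 (\<lambda>a b. pure K R RR (tau a) (tdelta (tau b \<otimes>\<^bsub>A\<^esub> s h2))) (s h1)) (comult H h)"
  proof (rule tlift_cong[OF modH modH hd])
    fix h1 h2 assume c: "h1 \<in> carrier H" "h2 \<in> carrier H"
    have "tlift K Y3 (\<lambda>x y. pure K R RR x (braided_mult K R (tdelta y) (tdelta (s h2)))) (tdelta (s h1))
      = tlift K Y3 (\<lambda>x y. pure K R RR x (tdelta (y \<otimes>\<^bsub>A\<^esub> s h2))) (tdelta (s h1))"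
      using c by (intro tlift_cong[OF modR modR]) (simp_all add: braided_tdelta)
    also have "\<dots> = sweedler K A Y3 (\<lambda>a b. pure K R RR (tau a) (tdelta (tau b \<otimes>\<^bsub>A\<^esub> s h2))) (s h1)"
      using c by (intro tlift_tdelta k_bilinearI) simp_all
    finally show "tlift K Y3 (\<lambda>x y. pure K R RR x (braided_mult K R (tdelta y) (tdelta (s h2)))) (tdelta (s h1))
      = sweedler K A Y3 (\<lambda>a b. pure K R RR (tau a) (tdelta (tau b \<otimes>\<^bsub>A\<^esub> s h2))) (s h1)" .
  qed
  also have "\<dots> = sweedler K H Y3 (\<lambda>h1 h2. sweedler K A Y3
      (\<lambda>a b. pure K R RR (tau a) (tdelta (tau b \<otimes>\<^bsub>A\<^esub> s h2))) (s h1)) h"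
    using h by (rule sweedler_eq[OF coH, symmetric])
  \<comment> \<open>Right colinearity turns the sum over \<Delta>(h) into one over \<Delta>(s(h)),
    with h2 = p(c2). After coassociativity the last two legs combine to \<Sum> tau(d1) s(p(d2)) = d,
    and the inner \<open>tau\<close> disappears.\<close>
  also have "\<dots> = sweedler K A Y3 (\<lambda>c1 c2. sweedler K A Y3
      (\<lambda>a b. pure K R RR (tau a) (tdelta (tau b \<otimes>\<^bsub>A\<^esub> s (p c2)))) c1) (s h)"
    by (rule sweedler_s_right[OF _ h, symmetric, where b="\<lambda>c1 c2. sweedler K A Y3
      (\<lambda>a b. pure K R RR (tau a) (tdelta (tau b \<otimes>\<^bsub>A\<^esub> s c2))) c1"]) simp_all
  also have "\<dots> = sweedler K A Y3 (\<lambda>a d. sweedler K A Y3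
      (\<lambda>b c. pure K R RR (tau a) (tdelta (tau b \<otimes>\<^bsub>A\<^esub> s (p c)))) d) (s h)"
    by (rule sweedler_coassoc) simp_all
  also have "\<dots> = sweedler K A Y3 (\<lambda>a d. pure K R RR (tau a) (tdelta (convolution K A A tau (\<lambda>x. s (p x)) d))) (s h)"
    unfolding convolution_def
    by (intro sweedler_cong[THEN fun_cong]
        sweedler_commute[where g="\<lambda>z. pure K R RR (tau _) (tdelta z)", symmetric]) simp_all
  also have "\<dots> = E3 (comult A (s h))" using h by (simp add: tau_conv_s E3_Delta)
  also have "\<dots> = E3 (convolution K H T (\<lambda>x. Psi (tdelta (s x))) gam h)" using h by (simp add: Psi_omega_gam)
  also have "\<dots> = sweedler K H Y3 (\<lambda>x y. E3 (Psi (tdelta (s x)) \<otimes>\<^bsub>T\<^esub> gam y)) h"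
    unfolding convolution_def using h by (intro sweedler_commute[OF E3_lin]) simp_all
  also have "\<dots> = sweedler K H Y3 (\<lambda>x y. E3 (Psi (tdelta (s x)) \<otimes>\<^bsub>T\<^esub> i1 (s y))) h"
    by (simp add: E3_gam)
  also have "\<dots> = sweedler K H Y3 (\<lambda>h1 h2. tlift K Y3 (\<lambda>x y. tlift K Y3
        (\<lambda>g w. reassoc K R (braided_mult K R (tdelta x) (tdelta (s (g \<otimes>\<^bsub>H\<^esub> h2)))) w)
        (lcoact y)) (tdelta (s h1))) h"
    by (intro sweedler_cong[THEN fun_cong] reassoc_twisted[symmetric]) simp_all
  finally show ?thesis unfolding sweedler_eq[OF coH h] .
qed

lemma yd_quadruple: "yetter_drinfeld_quadruple K H S R"
proof (intro yetter_drinfeld_quadruple.intro yetter_drinfeld_quadruple_axioms.intro)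
  have cocyc: "cocyc R = (\<lambda>h. tdelta (s h))" by (rule ext) (simp add: R_sel)
  show "yetter_drinfeld_algebra K H S R" by (rule yd_algebra)
  show "k_linear K R (scalars K) (counit R)" "k_linear K R RR (comult R)"
    by (simp_all add: R_sel(7,8) k_linear_R)
  show "k_linear K H RR (cocyc R)" unfolding cocyc by simp
  note sel = R_sel(2,3,6-11)
  show "counit R (act R h r) = counit R r \<otimes>\<^bsub>K\<^esub> counit H h"
    if "h \<in> carrier H" "r \<in> carrier R" for h r
    using that by (simp add: sel counit_adj)
  show "tlift K H (\<lambda>g s. counit R s \<odot>\<^bsub>H\<^esub> g) (coact R r) = counit R r \<odot>\<^bsub>H\<^esub> \<one>\<^bsub>H\<^esub>"
    if "r \<in> carrier R" for r
    unfolding sel using that by (simp add: lcoact_counit_right)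
  show "counit R (r \<otimes>\<^bsub>R\<^esub> q) = counit R r \<otimes>\<^bsub>K\<^esub> counit R q"
    if "r \<in> carrier R" "q \<in> carrier R" for r q
    using that by (simp add: sel A.counit_mult)
  show "diag_coact K H R (comult R r) = tlift K Y (\<lambda>g s. pure K H RR g (comult R s)) (coact R r)"
    if "r \<in> carrier R" for r
    unfolding sel by (rule delta_coact) (use that in simp)
  show "diag_coact K H R (cocyc R h) = comult3 K H Y
      (\<lambda>h1 h2 h3. pure K H RR (h1 \<otimes>\<^bsub>H\<^esub> S h3) (cocyc R h2)) h"
    if "h \<in> carrier H" for h
    unfolding sel by (rule omega_coact[OF that])
  show "comult R (r \<otimes>\<^bsub>R\<^esub> q) = braided_mult K R (comult R r) (comult R q)"
    if "r \<in> carrier R" "q \<in> carrier R" for r q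
    unfolding sel by (rule tdelta_mult) (use that in simp_all)
  show "cocyc R (h \<otimes>\<^bsub>H\<^esub> k) = tlift K RR
      (\<lambda>h1 h2. braided_mult K R (cocyc R h1) (diag_act K H R h2 (cocyc R k))) (comult H h)"
    if "h \<in> carrier H" "k \<in> carrier H" for h k
    unfolding sel by (rule omega_mult[OF that])
  show "tlift K RR (\<lambda>h1 h2. braided_mult K R (comult R (act R h1 r)) (cocyc R h2)) (comult H h)
    = tlift K RR (\<lambda>h1 h2. braided_mult K R (cocyc R h1) (diag_act K H R h2 (comult R r))) (comult H h)"
    if "h \<in> carrier H" "r \<in> carrier R" for h r
    unfolding sel by (rule delta_act) (use that in simp_all)
  show "tlift K Y3 (\<lambda>r1 r2. pure K R RR r1 (comult R r2)) (comult R r)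
    = tlift K Y3 (\<lambda>r1 r2. tlift K Y3
        (\<lambda>g s. reassoc K R (braided_mult K R (comult R r1) (cocyc R g)) s) (coact R r2)) (comult R r)"
    if "r \<in> carrier R" for r
    unfolding sel by (rule delta_coassoc) (use that in simp)
  show "tlift K Y3 (\<lambda>h1 h2. tlift K Y3
      (\<lambda>x y. pure K R RR x (braided_mult K R (comult R y) (cocyc R h2))) (cocyc R h1)) (comult H h)
    = tlift K Y3 (\<lambda>h1 h2. tlift K Y3 (\<lambda>x y. tlift K Y3
        (\<lambda>g s. reassoc K R (braided_mult K R (comult R x) (cocyc R (g \<otimes>\<^bsub>H\<^esub> h2))) s)
        (coact R y)) (cocyc R h1)) (comult H h)"
    if "h \<in> carrier H" for h
    unfolding sel by (rule omega_cocycle[OF that])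
  show "tlift K R (\<lambda>r1 r2. counit R r1 \<odot>\<^bsub>R\<^esub> r2) (comult R r) = r"
    "tlift K R (\<lambda>r1 r2. counit R r2 \<odot>\<^bsub>R\<^esub> r1) (comult R r) = r" if "r \<in> carrier R" for r
    unfolding R_sel(7,8) using tdelta_counit_left[of r] tdelta_counit_right[of r] that
    by (simp_all add: tau_id)
  show "tlift K R (\<lambda>x y. counit R x \<odot>\<^bsub>R\<^esub> y) (cocyc R h) = counit H h \<odot>\<^bsub>R\<^esub> \<one>\<^bsub>R\<^esub>"
    "tlift K R (\<lambda>x y. counit R y \<odot>\<^bsub>R\<^esub> x) (cocyc R h) = counit H h \<odot>\<^bsub>R\<^esub> \<one>\<^bsub>R\<^esub>"
    if "h \<in> carrier H" for h
    unfolding R_sel(8,11) using tdelta_counit_left[of "s h"] tdelta_counit_right[of "s h"] that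
    by (simp_all add: tau_s R_sel(3,6))
qed (simp_all add: R_sel(3,7,8,11) s_one tdelta_one A.counit_one)

end

section \<open>Transport of structure\<close>

text \<open>The bialgebra laws of the bosonization are carried over from \<open>A\<close> instead of
  being derived from the axioms of the quadruple. Both mutually inverse linear maps are given, so
  that products and coproducts on \<open>B\<close> can be rewritten as images of those on
  \<open>A\<close>.\<close>

lemma bialgebra_transport:
  fixes K :: "('k, 'l) ring_scheme" and A :: "('k, 'a, 'm) bialg_scheme" and B :: "('k, 'b, 'n) bialg_scheme"
  assumes A: "bialgebra K A" and B: "module K B"
    and f: "k_linear K A B f" and g: "k_linear K B A g"
    and fg: "\<And>y. y \<in> carrier B \<Longrightarrow> f (g y) = y" and gf: "\<And>x. x \<in> carrier A \<Longrightarrow> g (f x) = x"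
    and mult: "\<And>x y. \<lbrakk>x \<in> carrier A; y \<in> carrier A\<rbrakk> \<Longrightarrow> f (x \<otimes>\<^bsub>A\<^esub> y) = f x \<otimes>\<^bsub>B\<^esub> f y"
    and one: "f \<one>\<^bsub>A\<^esub> = \<one>\<^bsub>B\<^esub>"
    and comult: "\<And>x. x \<in> carrier A \<Longrightarrow> comult B (f x)
      = sweedler K A (tensor K B B) (\<lambda>y z. pure K B B (f y) (f z)) x"
    and counit: "\<And>x. x \<in> carrier A \<Longrightarrow> counit B (f x) = counit A x"
  shows "bialgebra K B"
proof -
  interpret A: bialgebra K A by fact
  interpret B: module K B by fact
  note C = bialgebra_coalgebra[OF A] and M = bialgebra_algebra[OF A, THEN k_algebra_module]
  note fc [simp] = k_linear_closed[OF f] and gc [simp] = k_linear_closed[OF g]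
  note pc = pure_closed[OF B B] and TB = tensor_module[OF B B]
  have m: "x \<otimes>\<^bsub>B\<^esub> y = f (g x \<otimes>\<^bsub>A\<^esub> g y)" if "x \<in> carrier B" "y \<in> carrier B" for x y
    using that by (simp add: mult fg)
  have ring: "ring B"
  proof (rule ringI)
    show "abelian_group B" by (rule B.abelian_group_axioms)
    show "monoid B"
      by (rule monoidI) (simp_all add: m one[symmetric] gf fg A.m_assoc)
    fix x y z assume c: "x \<in> carrier B" "y \<in> carrier B" "z \<in> carrier B"
    show "(x \<oplus>\<^bsub>B\<^esub> y) \<otimes>\<^bsub>B\<^esub> z = x \<otimes>\<^bsub>B\<^esub> z \<oplus>\<^bsub>B\<^esub> y \<otimes>\<^bsub>B\<^esub> z"
      "z \<otimes>\<^bsub>B\<^esub> (x \<oplus>\<^bsub>B\<^esub> y) = z \<otimes>\<^bsub>B\<^esub> x \<oplus>\<^bsub>B\<^esub> z \<otimes>\<^bsub>B\<^esub> y"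
      using c by (simp_all add: m k_linear_add[OF g] k_linear_add[OF f] A.l_distr A.r_distr)
  qed
  have alg: "k_algebra K B"
    by (rule k_algebra.intro[OF _ B ring k_algebra_axioms.intro])
      (use bialgebra_algebra[OF A] in \<open>simp_all add: k_algebra_def m k_linear_smult[OF g] k_linear_smult[OF f]
        A.smult_mult_left A.smult_mult_right\<close>)
  \<comment> \<open>Sweedler sums over \<open>B\<close> are pulled back to sums over
    \<open>A\<close>, where the coalgebra laws are known.\<close>
  have L: "tlift K X b (comult B y) = sweedler K A X (\<lambda>u v. b (f u) (f v)) (g y)"
    if X: "module K X" and b: "k_bilinear K B B X b" and y: "y \<in> carrier B"
    for X :: "('k, 'x, 'y) module_scheme" and b y
    using comult[of "g y"] y
    by (simp add: fg tlift_sweedler_pure[OF C B B X b, where p="\<lambda>u v. f u" and q="\<lambda>u v. f v"])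
  have Lc: "comult B y = sweedler K A (tensor K B B) (\<lambda>u v. pure K B B (f u) (f v)) (g y)"
    if "y \<in> carrier B" for y using comult[of "g y"] that by (simp add: fg)
  have plin: "k_linear K V (tensor K B B) (\<lambda>v. pure K B B (f (h v)) (f z))"
    "k_linear K V (tensor K B B) (\<lambda>v. pure K B B (f z) (f (h v)))"
    if "k_linear K V A h" "z \<in> carrier A" for V :: "('k, 'v, 'w) module_scheme" and h z
    using that by (auto intro!: k_linear_pure_left[OF B B] k_linear_pure_right[OF B B] k_linear_comp[OF f])
  have cl: "k_linear K B (tensor K B B) (comult B)"
  proof -
    have "k_linear K B (tensor K B B) (\<lambda>y. sweedler K A (tensor K B B) (\<lambda>u v. pure K B B (f u) (f v)) (g y))"
      by (rule k_linear_sweedler_outer[OF C TB B g]) (simp_all add: plin k_linear_id)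
    moreover have "k_linear K B (tensor K B B) (comult B) = k_linear K B (tensor K B B)
        (\<lambda>y. sweedler K A (tensor K B B) (\<lambda>u v. pure K B B (f u) (f v)) (g y))"
      by (rule k_linear_cong[OF B Lc])
    ultimately show ?thesis by simp
  qed
  have ce: "counit B y = counit A (g y)" if "y \<in> carrier B" for y
    using counit[of "g y"] that by (simp add: fg)
  have cul: "k_linear K B (scalars K) (counit B)"
    by (rule k_linear_cong[OF B ce, THEN iffD2]) (simp_all add: k_linear_comp[OF A.counit_linear g])
  have cuc: "counit B y \<in> carrier K" if "y \<in> carrier B" for y
    using k_linear_closed[OF cul that] by (simp add: scalars_def)
  have coalg: "k_coalgebra K B"
  proof (intro k_coalgebra.intro k_coalgebra_axioms.intro)
    show "field K" using alg by (simp add: k_algebra_def)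
    fix x assume x: "x \<in> carrier B"
    let ?X = "tensor K B (tensor K B B)" and ?p = "\<lambda>u v z. pure K B (tensor K B B) u (pure K B B v z)"
    note X = tensor_module[OF B TB]
    have pb: "k_bilinear K B B ?X (\<lambda>u v. ?p u v z)" "k_bilinear K B B ?X (?p z)" if "z \<in> carrier B" for z
      using that pc
      by (auto intro!: k_bilinearI k_linear_pure_left[OF B TB] k_linear_pure_right[OF B TB]
          k_linear_pure_left[OF B B] k_linear_pure_right[OF B B] k_linear_id)
    have o1: "k_bilinear K B B ?X (\<lambda>y z. tlift K ?X (\<lambda>u v. ?p u v z) (comult B y))"
    proof (rule k_bilinearI)
      fix y assume y: "y \<in> carrier B"
      show "k_linear K B ?X (\<lambda>z. tlift K ?X (\<lambda>u v. ?p u v z) (comult B y))"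
        by (rule k_linear_tlift_inner[OF B B X B k_linear_closed[OF cl y]])
          (auto intro!: k_linear_pure_right[OF B TB] k_linear_pure_right[OF B B] k_linear_id)
    next
      fix z assume z: "z \<in> carrier B"
      show "k_linear K B ?X (\<lambda>y. tlift K ?X (\<lambda>u v. ?p u v z) (comult B y))"
        by (rule k_linear_tlift_outer[OF B B X pb(1)[OF z] cl])
    qed
    have o2: "k_bilinear K B B ?X (\<lambda>y z. pure K B (tensor K B B) y (comult B z))"
      by (auto intro!: k_bilinearI k_linear_pure_left[OF B TB] k_linear_pure_right[OF B TB] cl k_linear_id
          k_linear_closed[OF cl])
    have "tlift K ?X (\<lambda>y z. tlift K ?X (\<lambda>u v. ?p u v z) (comult B y)) (comult B x)
      = sweedler K A ?X (\<lambda>y z. sweedler K A ?X (\<lambda>u v. ?p (f u) (f v) (f z)) y) (g x)"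
      by (simp add: L[OF X o1 x] L[OF X pb(1)] gf)
    also have "\<dots> = sweedler K A ?X (\<lambda>u w. sweedler K A ?X (\<lambda>v z. ?p (f u) (f v) (f z)) w) (g x)"
      by (rule sweedler_coassoc[OF C X])
        (auto intro!: k_linear_pure_left[OF B TB] k_linear_pure_right[OF B TB] k_linear_pure_left[OF B B]
          k_linear_pure_right[OF B B] f pc)
    also have "\<dots> = sweedler K A ?X (\<lambda>u w. pure K B (tensor K B B) (f u) (comult B (f w))) (g x)"
      by (intro sweedler_cong[THEN fun_cong])
        (simp add: comult sweedler_commute[OF k_linear_pure_right[OF B TB k_linear_id] C TB X] pc)
    also have "\<dots> = tlift K ?X (\<lambda>y z. pure K B (tensor K B B) y (comult B z)) (comult B x)"
      by (rule L[OF X o2 x, symmetric])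
    finally show "tlift K ?X (\<lambda>y z. tlift K ?X (\<lambda>u v. ?p u v z) (comult B y)) (comult B x)
      = tlift K ?X (\<lambda>y z. pure K B (tensor K B B) y (comult B z)) (comult B x)" .
    have b1: "k_bilinear K B B B (\<lambda>y z. counit B y \<odot>\<^bsub>B\<^esub> z)" "k_bilinear K B B B (\<lambda>y z. counit B z \<odot>\<^bsub>B\<^esub> y)"
      by (auto intro!: k_bilinearI k_linear_scalar_smult[OF B cul] k_linear_smult_right[OF B] k_linear_id cuc)
    show "tlift K B (\<lambda>y z. counit B y \<odot>\<^bsub>B\<^esub> z) (comult B x) = x"
      unfolding L[OF B b1(1) x] using x
      by (simp add: counit sweedler_counit_left[OF C B f] fg)
    show "tlift K B (\<lambda>y z. counit B z \<odot>\<^bsub>B\<^esub> y) (comult B x) = x"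
      unfolding L[OF B b1(2) x] using x
      by (simp add: counit sweedler_counit_right[OF C B f] fg)
  qed (fact B cl cul)+
  show ?thesis
  proof (intro bialgebra.intro alg coalg bialgebra_axioms.intro)
    fix x y assume xy: "x \<in> carrier B" "y \<in> carrier B"
    let ?m = "tensor_mult K B B"
    note bil = tensor_mult_bilinear[OF alg alg]
    have l1: "k_linear K (tensor K B B) (tensor K B B) (\<lambda>X. ?m X Y)" if "Y \<in> carrier (tensor K B B)" for Y
      using bil that by (simp add: k_bilinear_def)
    have l2: "k_linear K (tensor K B B) (tensor K B B) (?m X)" if "X \<in> carrier (tensor K B B)" for X
      using bil that by (simp add: k_bilinear_def)
    have c: "comult B z \<in> carrier (tensor K B B)" if "z \<in> carrier B" for z using k_linear_closed[OF cl that] .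
    have "comult B (x \<otimes>\<^bsub>B\<^esub> y) = sweedler K A (tensor K B B) (\<lambda>u v. pure K B B (f u) (f v)) (g x \<otimes>\<^bsub>A\<^esub> g y)"
      using xy by (simp add: m comult)
    also have "\<dots> = sweedler K A (tensor K B B) (\<lambda>u1 u2. sweedler K A (tensor K B B)
        (\<lambda>v1 v2. pure K B B (f (u1 \<otimes>\<^bsub>A\<^esub> v1)) (f (u2 \<otimes>\<^bsub>A\<^esub> v2))) (g y)) (g x)"
      using xy by (intro sweedler_mult[OF A TB]) (simp_all add: plin k_linear_id)
    also have "\<dots> = sweedler K A (tensor K B B) (\<lambda>u1 u2. sweedler K A (tensor K B B)
        (\<lambda>v1 v2. ?m (pure K B B (f u1) (f u2)) (pure K B B (f v1) (f v2))) (g y)) (g x)"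
      by (simp add: mult tensor_mult_pure[OF alg alg])
    also have "\<dots> = sweedler K A (tensor K B B) (\<lambda>u1 u2. ?m (pure K B B (f u1) (f u2)) (comult B y)) (g x)"
      unfolding Lc[OF xy(2)] using xy
      by (intro sweedler_cong[THEN fun_cong] sweedler_commute[OF l2 C TB TB, symmetric]) (simp_all add: pc)
    also have "\<dots> = ?m (comult B x) (comult B y)"
      unfolding Lc[OF xy(1)] using xy c
      by (intro sweedler_commute[OF l1 C TB TB, symmetric]) (simp_all add: pc)
    finally show "comult B (x \<otimes>\<^bsub>B\<^esub> y) = ?m (comult B x) (comult B y)" .
    show "counit B (x \<otimes>\<^bsub>B\<^esub> y) = counit B x \<otimes>\<^bsub>K\<^esub> counit B y"
      using xy by (simp add: m ce gf A.counit_mult)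
  next
    have "comult B \<one>\<^bsub>B\<^esub> = sweedler K A (tensor K B B) (\<lambda>u v. pure K B B (f u) (f v)) \<one>\<^bsub>A\<^esub>"
      using comult[of "\<one>\<^bsub>A\<^esub>"] by (simp add: one)
    also have "\<dots> = pure K B B \<one>\<^bsub>B\<^esub> \<one>\<^bsub>B\<^esub>"
      by (subst sweedler_one[OF A TB]) (simp_all add: plin k_linear_id one)
    finally show "comult B \<one>\<^bsub>B\<^esub> = pure K B B \<one>\<^bsub>B\<^esub> \<one>\<^bsub>B\<^esub>" .
    show "counit B \<one>\<^bsub>B\<^esub> = \<one>\<^bsub>K\<^esub>" using counit[of "\<one>\<^bsub>A\<^esub>"] by (simp add: one A.counit_one)
  qed
qed

lemma hopf_algebra_transport:
  fixes K :: "('k, 'l) ring_scheme" and A :: "('k, 'a, 'm) bialg_scheme" and B :: "('k, 'b, 'n) bialg_scheme"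
  assumes A: "hopf_algebra K A S" and Bb: "bialgebra K B"
    and f: "k_linear K A B f" and g: "k_linear K B A g"
    and fg: "\<And>y. y \<in> carrier B \<Longrightarrow> f (g y) = y" and gf: "\<And>x. x \<in> carrier A \<Longrightarrow> g (f x) = x"
    and mult: "\<And>x y. \<lbrakk>x \<in> carrier A; y \<in> carrier A\<rbrakk> \<Longrightarrow> f (x \<otimes>\<^bsub>A\<^esub> y) = f x \<otimes>\<^bsub>B\<^esub> f y"
    and one: "f \<one>\<^bsub>A\<^esub> = \<one>\<^bsub>B\<^esub>"
    and comult: "\<And>x. x \<in> carrier A \<Longrightarrow> comult B (f x)
      = sweedler K A (tensor K B B) (\<lambda>y z. pure K B B (f y) (f z)) x"
    and counit: "\<And>x. x \<in> carrier A \<Longrightarrow> counit B (f x) = counit A x"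
  shows "hopf_algebra K B (\<lambda>y. f (S (g y)))"
proof (intro hopf_algebra.intro Bb hopf_algebra_axioms.intro)
  interpret A: hopf_algebra K A S by fact
  note C = A.coalg and M = A.modH
  note alg = bialgebra_algebra[OF Bb] and B = k_algebra_module[OF bialgebra_algebra[OF Bb]]
  note fc [simp] = k_linear_closed[OF f] and gc [simp] = k_linear_closed[OF g]
  note Sc = A.S_closed
  show Sl: "k_linear K B B (\<lambda>y. f (S (g y)))"
    by (intro k_linear_comp[OF f] k_linear_comp[OF A.antipode_linear] g)
  fix x assume x: "x \<in> carrier B"
  have L: "tlift K B b (comult B x) = sweedler K A B (\<lambda>u v. b (f u) (f v)) (g x)"
    if b: "k_bilinear K B B B b" for b
    using comult[of "g x"] x
    by (simp add: fg tlift_sweedler_pure[OF C B B B b, where p="\<lambda>u v. f u" and q="\<lambda>u v. f v"])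
  have b: "k_bilinear K B B B (\<lambda>y z. f (S (g y)) \<otimes>\<^bsub>B\<^esub> z)" "k_bilinear K B B B (\<lambda>y z. y \<otimes>\<^bsub>B\<^esub> f (S (g z)))"
    using Sl Sc by (auto intro!: k_bilinearI k_linear_mult_left[OF alg] k_linear_mult_right[OF alg] k_linear_id)
  have e: "f (counit A (g x) \<odot>\<^bsub>A\<^esub> \<one>\<^bsub>A\<^esub>) = counit B x \<odot>\<^bsub>B\<^esub> \<one>\<^bsub>B\<^esub>"
    using x counit[of "g x"] by (simp add: k_linear_smult[OF f] A.counit_closed one fg)
  have "tlift K B (\<lambda>y z. f (S (g y)) \<otimes>\<^bsub>B\<^esub> z) (comult B x) = sweedler K A B (\<lambda>u v. f (S u \<otimes>\<^bsub>A\<^esub> v)) (g x)"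
    unfolding L[OF b(1)] by (simp add: gf mult Sc)
  also have "\<dots> = f (sweedler K A A (\<lambda>u v. S u \<otimes>\<^bsub>A\<^esub> v) (g x))"
    using x by (intro sweedler_commute[OF f C M B, symmetric]) (simp_all add: Sc)
  finally show "tlift K B (\<lambda>y z. f (S (g y)) \<otimes>\<^bsub>B\<^esub> z) (comult B x) = counit B x \<odot>\<^bsub>B\<^esub> \<one>\<^bsub>B\<^esub>"
    using A.antipode_left[of "g x"] x e by (simp add: sweedler_eq[OF C])
  have "tlift K B (\<lambda>y z. y \<otimes>\<^bsub>B\<^esub> f (S (g z))) (comult B x) = sweedler K A B (\<lambda>u v. f (u \<otimes>\<^bsub>A\<^esub> S v)) (g x)"
    unfolding L[OF b(2)] by (simp add: gf mult Sc)
  also have "\<dots> = f (sweedler K A A (\<lambda>u v. u \<otimes>\<^bsub>A\<^esub> S v) (g x))"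
    using x by (intro sweedler_commute[OF f C M B, symmetric]) (simp_all add: Sc)
  finally show "tlift K B (\<lambda>y z. y \<otimes>\<^bsub>B\<^esub> f (S (g z))) (comult B x) = counit B x \<odot>\<^bsub>B\<^esub> \<one>\<^bsub>B\<^esub>"
    using A.antipode_right[of "g x"] x e by (simp add: sweedler_eq[OF C])
qed

section \<open>The isomorphism with the bosonization\<close>

context split_bialgebra
begin

abbreviation "RH \<equiv> tensor K R H"
abbreviation "BB \<equiv> tensor K RH RH"

definition iso :: "'a \<Rightarrow> ('a \<times> 'h \<Rightarrow> 'k) set"
  where "iso a = sweedler K A RH (\<lambda>x y. pure K R H (tau x) (p y)) a"

definition iso_inv :: "('a \<times> 'h \<Rightarrow> 'k) set \<Rightarrow> 'a"
  where "iso_inv X = tlift K A (\<lambda>r h. r \<otimes>\<^bsub>A\<^esub> s h) X"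

lemma iso_inv_bil: "k_bilinear K R H A (\<lambda>r h. r \<otimes>\<^bsub>A\<^esub> s h)"
  by (rule k_bilinearI) simp_all

lemma iso_lin0: "k_linear K A RH iso"
  unfolding iso_def[abs_def] by simp

lemmas iso_lin [simp] = iso_lin0 k_linear_comp[OF iso_lin0]
lemmas iso_closed [simp] = k_linear_closed[OF iso_lin0]

lemma iso_inv_lin0: "k_linear K RH A iso_inv"
  unfolding iso_inv_def[abs_def] by (rule tlift_linear[OF modR modH modA iso_inv_bil])

lemmas iso_inv_lin [simp] = iso_inv_lin0 k_linear_comp[OF iso_inv_lin0]
lemmas iso_inv_closed [simp] = k_linear_closed[OF iso_inv_lin0]

lemma iso_inv_pure: "\<lbrakk>r \<in> coinv; h \<in> carrier H\<rbrakk> \<Longrightarrow> iso_inv (pure K R H r h) = r \<otimes>\<^bsub>A\<^esub> s h"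
  unfolding iso_inv_def by (rule tlift_pure[OF modR modH modA iso_inv_bil]) simp_all

lemma iso_pure:
  assumes r: "r \<in> coinv" and h: "h \<in> carrier H" shows "iso (r \<otimes>\<^bsub>A\<^esub> s h) = pure K R H r h"
proof -
  have "iso (r \<otimes>\<^bsub>A\<^esub> s h) = sweedler K H RH (\<lambda>x y. pure K R H (tau (r \<otimes>\<^bsub>A\<^esub> s x)) y) h"
    unfolding iso_def by (rule sweedler_coinv_s[OF _ r h, where b="\<lambda>x y. pure K R H (tau x) y"]) simp_all
  also have "\<dots> = sweedler K H RH (\<lambda>x y. counit H x \<odot>\<^bsub>RH\<^esub> pure K R H r y) h"
    using r by (simp add: tau_s_mult tau_id pure_smult)
  also have "\<dots> = pure K R H r h"
    by (rule sweedler_counit_left) (use r h k_linear_pure_right[OF modR modH k_linear_id] in simp_all)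
  finally show ?thesis .
qed

lemma iso_inv_iso: "a \<in> carrier A \<Longrightarrow> iso_inv (iso a) = a"
  unfolding iso_inv_def iso_def
  by (subst tlift_sweedler_pure[OF coA modR modH modA iso_inv_bil])
    (simp_all add: tau_conv_s[unfolded convolution_def])

lemma iso_iso_inv: "X \<in> carrier RH \<Longrightarrow> iso (iso_inv X) = X"
  by (rule tensor_ext[OF modR modH, where X=RH and f="\<lambda>X. iso (iso_inv X)"])
    (simp_all add: iso_inv_pure iso_pure)

section \<open>The isomorphism and the products\<close>

definition sm :: "'a \<Rightarrow> 'h \<Rightarrow> 'a \<Rightarrow> 'h \<Rightarrow> ('a \<times> 'h \<Rightarrow> 'k) set"
  where "sm r h q k = sweedler K H RH (\<lambda>x y. pure K R H (r \<otimes>\<^bsub>A\<^esub> adj x q) (y \<otimes>\<^bsub>H\<^esub> k)) h"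

text \<open>The smash relation holds in \<open>A\<close>: the sum of adj(h1) q times s(h2) is s(h)
  q, since s(S(h2)) s(h3) cancels. Hence r # h to r s(h) respects products.\<close>

lemma iso_inv_sm:
  assumes c: "r \<in> coinv" "h \<in> carrier H" "q \<in> coinv" "k \<in> carrier H"
  shows "iso_inv (sm r h q k) = r \<otimes>\<^bsub>A\<^esub> s h \<otimes>\<^bsub>A\<^esub> (q \<otimes>\<^bsub>A\<^esub> s k)"
proof -
  have q': "q \<in> carrier A" using c by simp
  have e: "convolution K H A (\<lambda>x. adj x q) s h = s h \<otimes>\<^bsub>A\<^esub> q"
  proof -
    have "convolution K H A (\<lambda>x. adj x q) s h
      = convolution K H A (convolution K H A (\<lambda>x. s x \<otimes>\<^bsub>A\<^esub> q) (\<lambda>x. s (S x))) s h"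
      by (simp add: adj_conv(1)[OF _ q'])
    also have "\<dots> = s h \<otimes>\<^bsub>A\<^esub> q"
      by (rule convolution_cancel_right) (use c in \<open>simp_all add: H.antipode_conv_left[OF s_hom algA]\<close>)
    finally show ?thesis .
  qed
  have "iso_inv (sm r h q k) = sweedler K H A (\<lambda>x y. r \<otimes>\<^bsub>A\<^esub> (adj x q \<otimes>\<^bsub>A\<^esub> s y) \<otimes>\<^bsub>A\<^esub> s k) h"
    unfolding sm_def using c
    by (subst sweedler_commute[OF iso_inv_lin0]) (simp_all add: iso_inv_pure s_mult A.m_assoc)
  also have "\<dots> = r \<otimes>\<^bsub>A\<^esub> convolution K H A (\<lambda>x. adj x q) s h \<otimes>\<^bsub>A\<^esub> s k"
    unfolding convolution_def using c
    by (intro sweedler_commute[where g="\<lambda>z. r \<otimes>\<^bsub>A\<^esub> z \<otimes>\<^bsub>A\<^esub> s k", symmetric]) simp_all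
  finally show ?thesis using c by (simp add: e A.m_assoc)
qed

lemma iso_mult:
  assumes a: "a \<in> carrier A" and b: "b \<in> carrier A"
  shows "iso (a \<otimes>\<^bsub>A\<^esub> b) = smash_mult K R H (iso a) (iso b)"
proof -
  have "smash_mult K R H (iso a) (iso b)
    = tlift K RH (\<lambda>r h. tlift K RH (\<lambda>q k. iso (r \<otimes>\<^bsub>A\<^esub> s h \<otimes>\<^bsub>A\<^esub> (q \<otimes>\<^bsub>A\<^esub> s k))) (iso b)) (iso a)"
    unfolding smash_mult_def
  proof (intro tlift_cong[OF modR modH iso_closed[OF a]] tlift_cong[OF modR modH iso_closed[OF b]])
    fix r h q k assume c: "r \<in> carrier R" "h \<in> carrier H" "q \<in> carrier R" "k \<in> carrier H"
    have "tlift K RH (\<lambda>h1 h2. pure K R H (r \<otimes>\<^bsub>R\<^esub> act R h1 q) (h2 \<otimes>\<^bsub>H\<^esub> k)) (comult H h) = sm r h q k"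
      using c by (simp add: sm_def R_sel(2,9) sweedler_eq)
    also have "\<dots> = iso (iso_inv (sm r h q k))"
      by (rule iso_iso_inv[symmetric]) (use c in \<open>simp add: sm_def\<close>)
    finally show "tlift K RH (\<lambda>h1 h2. pure K R H (r \<otimes>\<^bsub>R\<^esub> act R h1 q) (h2 \<otimes>\<^bsub>H\<^esub> k)) (comult H h)
      = iso (r \<otimes>\<^bsub>A\<^esub> s h \<otimes>\<^bsub>A\<^esub> (q \<otimes>\<^bsub>A\<^esub> s k))" using c by (simp add: iso_inv_sm)
  qed
  also have "\<dots> = tlift K RH (\<lambda>r h. iso (r \<otimes>\<^bsub>A\<^esub> s h \<otimes>\<^bsub>A\<^esub> b)) (iso a)"
  proof (rule tlift_cong[OF modR modH iso_closed[OF a]])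
    fix r h assume c: "r \<in> carrier R" "h \<in> carrier H"
    have "tlift K RH (\<lambda>q k. iso (r \<otimes>\<^bsub>A\<^esub> s h \<otimes>\<^bsub>A\<^esub> (q \<otimes>\<^bsub>A\<^esub> s k))) (iso b)
      = iso (r \<otimes>\<^bsub>A\<^esub> s h \<otimes>\<^bsub>A\<^esub> iso_inv (iso b))"
      unfolding iso_inv_def using c b
      by (intro tlift_commute[OF modR modH, where g="\<lambda>z. iso (r \<otimes>\<^bsub>A\<^esub> s h \<otimes>\<^bsub>A\<^esub> z)", symmetric]) simp_all
    then show "tlift K RH (\<lambda>q k. iso (r \<otimes>\<^bsub>A\<^esub> s h \<otimes>\<^bsub>A\<^esub> (q \<otimes>\<^bsub>A\<^esub> s k))) (iso b) = iso (r \<otimes>\<^bsub>A\<^esub> s h \<otimes>\<^bsub>A\<^esub> b)"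
      using b by (simp add: iso_inv_iso)
  qed
  also have "\<dots> = iso (iso_inv (iso a) \<otimes>\<^bsub>A\<^esub> b)"
    unfolding iso_inv_def using a b
    by (intro tlift_commute[OF modR modH, where g="\<lambda>z. iso (z \<otimes>\<^bsub>A\<^esub> b)", symmetric]) simp_all
  finally show ?thesis using a by (simp add: iso_inv_iso)
qed

lemma iso_one: "iso \<one>\<^bsub>A\<^esub> = pure K R H \<one>\<^bsub>A\<^esub> \<one>\<^bsub>H\<^esub>"
  using iso_pure[of "\<one>\<^bsub>A\<^esub>" "\<one>\<^bsub>H\<^esub>"] by (simp add: s_one)

section \<open>The isomorphism and the coproducts\<close>

definition FF :: "('a \<times> 'a \<Rightarrow> 'k) set \<Rightarrow> (('a \<times> 'h \<Rightarrow> 'k) set \<times> ('a \<times> 'h \<Rightarrow> 'k) set \<Rightarrow> 'k) set"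
  where "FF X = tlift K BB (\<lambda>a b. pure K RH RH (iso a) (iso b)) X"

lemma FF_bil: "k_bilinear K A A BB (\<lambda>a b. pure K RH RH (iso a) (iso b))"
  by (rule k_bilinearI) simp_all

lemma FF_lin0: "k_linear K T BB FF"
  unfolding k_linear_tensor_algebra FF_def[abs_def] by (rule tlift_linear[OF modA modA _ FF_bil]) simp

lemmas FF_lin [simp] = FF_lin0 k_linear_comp[OF FF_lin0]

lemma FF_pure: "\<lbrakk>a \<in> carrier A; b \<in> carrier A\<rbrakk> \<Longrightarrow> FF (pure K A A a b) = pure K RH RH (iso a) (iso b)"
  unfolding FF_def by (rule tlift_pure[OF modA modA _ FF_bil]) simp_all

text \<open>The inner sum of the bosonization coproduct, pulled back to A \<otimes> A. The leg g h2
  corresponds to s(g) s(h2), where s(g) is already part of \<open>Psi\<close>; so h2 and h3 amount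
  to multiplying Psi(X) on the right by s(h2) \<otimes> s(h3).\<close>

lemma boson_comult_aux:
  assumes X: "X \<in> carrier RR" and h2: "h2 \<in> carrier H" and h3: "h3 \<in> carrier H"
  shows "tlift K BB (\<lambda>d1 d2. tlift K BB (\<lambda>g d0. pure K RH RH (pure K R H d1 (g \<otimes>\<^bsub>H\<^esub> h2)) (pure K R H d0 h3))
      (lcoact d2)) X = FF (Psi X \<otimes>\<^bsub>T\<^esub> (i1 (s h2) \<otimes>\<^bsub>T\<^esub> i2 (s h3)))"
proof -
  let ?Z = "i1 (s h2) \<otimes>\<^bsub>T\<^esub> i2 (s h3)"
  have Z: "?Z \<in> carrier T" "?Z = pure K A A (s h2) (s h3)" using h2 h3 by (simp_all add: i1_i2)
  have "tlift K BB (\<lambda>d1 d2. tlift K BB (\<lambda>g d0. pure K RH RH (pure K R H d1 (g \<otimes>\<^bsub>H\<^esub> h2)) (pure K R H d0 h3))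
      (lcoact d2)) X = tlift K BB (\<lambda>d1 d2. FF (i1 d1 \<otimes>\<^bsub>T\<^esub> lam d2 \<otimes>\<^bsub>T\<^esub> ?Z)) X"
  proof (rule tlift_cong[OF modR modR X])
    fix d1 d2 assume "d1 \<in> carrier R" "d2 \<in> carrier R"
    then have d: "d1 \<in> coinv" "d2 \<in> coinv" by simp_all
    have "tlift K BB (\<lambda>g d0. pure K RH RH (pure K R H d1 (g \<otimes>\<^bsub>H\<^esub> h2)) (pure K R H d0 h3)) (lcoact d2)
      = sweedler K A BB (\<lambda>u v. pure K RH RH (pure K R H d1 (p u \<otimes>\<^bsub>H\<^esub> h2)) (pure K R H (tau v) h3)) d2"
      using d h2 h3 by (intro tlift_lcoact k_bilinearI) simp_all
    also have "\<dots> = sweedler K A BB (\<lambda>u v. FF (pure K A A (d1 \<otimes>\<^bsub>A\<^esub> s (p u)) (tau v) \<otimes>\<^bsub>T\<^esub> ?Z)) d2"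
      using d h2 h3 by (simp add: Z(2) pure_mult FF_pure A.m_assoc s_mult[symmetric] iso_pure)
    also have "\<dots> = sweedler K A BB (\<lambda>u v. FF (pure K A A (d1 \<otimes>\<^bsub>A\<^esub> s (p u)) v \<otimes>\<^bsub>T\<^esub> ?Z)) d2"
    proof (rule sweedler_coinv_tau[OF _ d(2), where b="\<lambda>u v. FF (pure K A A (d1 \<otimes>\<^bsub>A\<^esub> s (p u)) v \<otimes>\<^bsub>T\<^esub> ?Z)"])
      have "k_linear K A T (\<lambda>v. pure K A A a v)" "k_linear K A T (\<lambda>v. pure K A A (d1 \<otimes>\<^bsub>A\<^esub> s (p v)) a)"
        if "a \<in> carrier A" for a
        using that d k_linear_pure_right[OF modA modA k_linear_id[of K A]]
        unfolding k_linear_tensor_algebra by simp_all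
      then show "k_linear K A BB (\<lambda>v. FF (pure K A A (d1 \<otimes>\<^bsub>A\<^esub> s (p x)) v \<otimes>\<^bsub>T\<^esub> ?Z))"
        "k_linear K A BB (\<lambda>u. FF (pure K A A (d1 \<otimes>\<^bsub>A\<^esub> s (p u)) x \<otimes>\<^bsub>T\<^esub> ?Z))" if "x \<in> carrier A" for x
        using that d Z(1) by simp_all
    qed simp
    also have "\<dots> = FF (sweedler K A T (\<lambda>u v. pure K A A (d1 \<otimes>\<^bsub>A\<^esub> s (p u)) v) d2 \<otimes>\<^bsub>T\<^esub> ?Z)"
      using d Z(1) by (intro sweedler_commute[where g="\<lambda>z. FF (z \<otimes>\<^bsub>T\<^esub> ?Z)", symmetric]) simp_all
    finally show "tlift K BB (\<lambda>g d0. pure K RH RH (pure K R H d1 (g \<otimes>\<^bsub>H\<^esub> h2)) (pure K R H d0 h3)) (lcoact d2)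
      = FF (i1 d1 \<otimes>\<^bsub>T\<^esub> lam d2 \<otimes>\<^bsub>T\<^esub> ?Z)" using d by (simp add: Psi_pure_sweedler[symmetric] Psi_pure)
  qed
  also have "\<dots> = FF (Psi X \<otimes>\<^bsub>T\<^esub> ?Z)"
    unfolding Psi_def using X Z(1)
    by (intro tlift_commute[OF modR modR, where g="\<lambda>z. FF (z \<otimes>\<^bsub>T\<^esub> ?Z)", symmetric]) simp_all
  finally show ?thesis .
qed

lemma iso_comult:
  assumes a: "a \<in> carrier A"
  shows "boson_comult K R H (iso a) = FF (comult A a)"
proof -
  have "boson_comult K R H (iso a) = tlift K BB (\<lambda>r h. FF (comult A (r \<otimes>\<^bsub>A\<^esub> s h))) (iso a)"
    unfolding boson_comult_def Let_def
  proof (rule tlift_cong[OF modR modH iso_closed[OF a]])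
    fix r h assume "r \<in> carrier R" and h: "h \<in> carrier H"
    then have r: "r \<in> coinv" by simp
    let ?P = "\<lambda>x. Psi (tdelta (r \<otimes>\<^bsub>A\<^esub> s x))"
    have "comult3 K H BB (\<lambda>h1 h2 h3. tlift K BB (\<lambda>d1 d2. tlift K BB
        (\<lambda>g d0. pure K RH RH (pure K R H d1 (g \<otimes>\<^bsub>H\<^esub> h2)) (pure K R H d0 h3)) (coact R d2))
        (braided_mult K R (comult R r) (cocyc R h1))) h
      = sweedler K H BB (\<lambda>x h3. sweedler K H BB (\<lambda>h1 h2. FF (?P h1 \<otimes>\<^bsub>T\<^esub> (i1 (s h2) \<otimes>\<^bsub>T\<^esub> i2 (s h3)))) x) h"
      using r h by (simp add: comult3_eq[OF coH] R_sel(7,10,11) boson_comult_aux braided_tdelta)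
    also have "\<dots> = sweedler K H BB (\<lambda>h1 y. sweedler K H BB (\<lambda>h2 h3. FF (?P h1 \<otimes>\<^bsub>T\<^esub> (i1 (s h2) \<otimes>\<^bsub>T\<^esub> i2 (s h3)))) y) h"
      by (rule sweedler_coassoc) (use r in simp_all)
    \<comment> \<open>The factors s(h2) \<otimes> s(h3) add up to gam(y). Convolved with
      Psi(\<omega>(h1)) this gives \<Delta>(s(h)), and with the factor \<Delta>(r) the whole becomes
      \<Delta>(r s(h)).\<close>
    also have "\<dots> = sweedler K H BB (\<lambda>h1 y. FF (?P h1 \<otimes>\<^bsub>T\<^esub> gam y)) h"
    proof (rule sweedler_cong[THEN fun_cong])
      fix x y assume "x \<in> carrier H" "y \<in> carrier H"
      then show "sweedler K H BB (\<lambda>h2 h3. FF (?P x \<otimes>\<^bsub>T\<^esub> (i1 (s h2) \<otimes>\<^bsub>T\<^esub> i2 (s h3)))) y = FF (?P x \<otimes>\<^bsub>T\<^esub> gam y)"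
        unfolding gam_conv[OF \<open>y \<in> carrier H\<close>] convolution_def using r
        by (intro sweedler_commute[where g="\<lambda>z. FF (?P x \<otimes>\<^bsub>T\<^esub> z)", symmetric]) simp_all
    qed
    also have "\<dots> = sweedler K H BB (\<lambda>x y. FF (comult A r \<otimes>\<^bsub>T\<^esub> (Psi (tdelta (s x)) \<otimes>\<^bsub>T\<^esub> gam y))) h"
      using r by (simp add: Psi_tdelta_coinv_s T.m_assoc)
    also have "\<dots> = FF (comult A r \<otimes>\<^bsub>T\<^esub> convolution K H T (\<lambda>x. Psi (tdelta (s x))) gam h)"
      unfolding convolution_def using r h
      by (intro sweedler_commute[where g="\<lambda>z. FF (comult A r \<otimes>\<^bsub>T\<^esub> z)", symmetric]) simp_all
    also have "\<dots> = FF (comult A (r \<otimes>\<^bsub>A\<^esub> s h))" using r h by (simp add: Psi_omega_gam Delta_mult)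
    finally show "comult3 K H BB (\<lambda>h1 h2 h3. tlift K BB (\<lambda>d1 d2. tlift K BB
        (\<lambda>g d0. pure K RH RH (pure K R H d1 (g \<otimes>\<^bsub>H\<^esub> h2)) (pure K R H d0 h3)) (coact R d2))
        (braided_mult K R (comult R r) (cocyc R h1))) h = FF (comult A (r \<otimes>\<^bsub>A\<^esub> s h))" .
  qed
  also have "\<dots> = FF (comult A (iso_inv (iso a)))"
    unfolding iso_inv_def using a
    by (intro tlift_commute[OF modR modH, where g="\<lambda>z. FF (comult A z)", symmetric]) simp_all
  finally show ?thesis using a by (simp add: iso_inv_iso)
qed

lemma iso_counit:
  assumes a: "a \<in> carrier A"
  shows "tlift K (scalars K) (\<lambda>r h. counit R r \<otimes>\<^bsub>K\<^esub> counit H h) (iso a) = counit A a"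
proof -
  note s = module_scalars[OF cringK]
  have sm: "x \<otimes>\<^bsub>K\<^esub> y = x \<odot>\<^bsub>scalars K\<^esub> y" for x y by (simp add: scalars_def)
  have "k_bilinear K R H (scalars K) (\<lambda>r h. counit A r \<odot>\<^bsub>scalars K\<^esub> counit H h)"
  proof (rule k_bilinearI)
    show "k_linear K R (scalars K) (\<lambda>r. counit A r \<odot>\<^bsub>scalars K\<^esub> counit H h)" if "h \<in> carrier H" for h
      by (rule k_linear_scalar_smult[OF s k_linear_R]) (use that in \<open>simp, simp add: scalars_def\<close>)
  qed (simp add: s)
  then have "tlift K (scalars K) (\<lambda>r h. counit R r \<otimes>\<^bsub>K\<^esub> counit H h) (iso a)
    = sweedler K A (scalars K) (\<lambda>x y. counit A (tau x) \<odot>\<^bsub>scalars K\<^esub> counit H (p y)) a"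
    unfolding iso_def R_sel(8) sm by (rule tlift_sweedler_pure[OF coA modR modH s _ a]) simp_all
  also have "\<dots> = sweedler K A (scalars K) (\<lambda>x y. counit A x \<odot>\<^bsub>scalars K\<^esub> counit A y) a"
    by (simp add: counit_tau p_counit)
  also have "\<dots> = counit A a" by (rule sweedler_counit_left[OF coA s A.counit_linear a])
  finally show ?thesis .
qed

section \<open>The bosonization as a bialgebra isomorphic to \<open>A\<close>\<close>

abbreviation "Bos \<equiv> bosonization K R H"

lemma Bos_tensor: "tensor K Bos Bos = BB" "pure K Bos Bos = pure K RH RH"
  by (intro tensor_cong; simp add: bosonization_def)+

lemma Bos_linear: "k_linear K A Bos iso" "k_linear K Bos A iso_inv"
  using iso_lin0 iso_inv_lin0 by (simp_all add: k_linear_def bosonization_def)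

lemma Bos_module: "module K Bos"
proof -
  interpret RH: module K RH by simp
  show ?thesis
  proof (rule moduleI)
    show "abelian_group Bos"
    proof (rule abelian_groupI)
      fix x assume "x \<in> carrier Bos"
      then show "\<exists>y\<in>carrier Bos. y \<oplus>\<^bsub>Bos\<^esub> x = \<zero>\<^bsub>Bos\<^esub>"
        by (intro bexI[of _ "\<ominus>\<^bsub>RH\<^esub> x"]) (auto simp: bosonization_def RH.l_neg)
    qed (auto simp: bosonization_def RH.a_ac)
  qed (auto simp: bosonization_def RH.smult_l_distr RH.smult_r_distr RH.smult_assoc1 cringK)
qed

lemma Bos_facts:
  "y \<in> carrier Bos \<Longrightarrow> iso (iso_inv y) = y" "x \<in> carrier A \<Longrightarrow> iso_inv (iso x) = x"
  "\<lbrakk>x \<in> carrier A; x' \<in> carrier A\<rbrakk> \<Longrightarrow> iso (x \<otimes>\<^bsub>A\<^esub> x') = iso x \<otimes>\<^bsub>Bos\<^esub> iso x'"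
  "iso \<one>\<^bsub>A\<^esub> = \<one>\<^bsub>Bos\<^esub>"
  "x \<in> carrier A \<Longrightarrow> counit Bos (iso x) = counit A x"
  by (simp_all add: iso_iso_inv iso_inv_iso iso_mult iso_one iso_counit bosonization_def R_sel(3))

lemma Bos_comult: "x \<in> carrier A \<Longrightarrow> comult Bos (iso x)
    = sweedler K A (tensor K Bos Bos) (\<lambda>y z. pure K Bos Bos (iso y) (iso z)) x"
  unfolding Bos_tensor by (simp add: iso_comult FF_def sweedler_eq bosonization_def)

lemma Bos_bialgebra: "bialgebra K Bos"
  by (rule bialgebra_transport[OF bialgA Bos_module Bos_linear Bos_facts(1-4) Bos_comult Bos_facts(5)])

lemma Bos_iso: "bialgebra_iso K A Bos iso"
  unfolding bialgebra_iso_def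
proof (intro conjI ballI)
  show "iso \<in> ring_hom A Bos"
    by (rule ring_hom_memI)
      (simp_all add: Bos_facts(3,4) k_linear_closed[OF Bos_linear(1)] k_linear_add[OF Bos_linear(1)])
  show "bij_betw iso (carrier A) (carrier Bos)"
    by (rule bij_betwI[where g=iso_inv])
      (auto simp: Bos_facts(1,2) k_linear_closed[OF Bos_linear(1)] k_linear_closed[OF Bos_linear(2)])
  show "comult Bos (iso x) = tlift K (tensor K Bos Bos) (\<lambda>y z. pure K Bos Bos (iso y) (iso z)) (comult A x)"
    if "x \<in> carrier A" for x using Bos_comult[OF that] that by (simp add: sweedler_eq)
qed (simp_all add: bialgA Bos_bialgebra Bos_linear(1) Bos_facts(5))

lemma Bos_hopf:
  "hopf_algebra K A SA \<Longrightarrow> hopf_algebra K Bos (\<lambda>y. iso (SA (iso_inv y)))"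
  by (rule hopf_algebra_transport[OF _ Bos_bialgebra Bos_linear Bos_facts(1-4) Bos_comult Bos_facts(5)])

end

section \<open>Nilpotent kernels: the antipode\<close>

lemma tlift_mem:
  fixes K :: "('k, 'l) ring_scheme" and V :: "('k, 'v, 'm) module_scheme"
    and W :: "('k, 'w, 'n) module_scheme" and X :: "('k, 'x, 'o) module_scheme"
  assumes X: "module K X" and N: "submodule N K X" and T: "T \<in> carrier (tensor K V W)"
    and V: "module K V" and W: "module K W"
    and b: "\<And>x y. \<lbrakk>x \<in> carrier V; y \<in> carrier W\<rbrakk> \<Longrightarrow> b x y \<in> N"
  shows "tlift K X b T \<in> N"
proof -
  interpret X: module K X by fact
  interpret N: submodule N K X by fact
  let ?f = "SOME f. f \<in> T"
  have f: "?f \<in> carrier (free_module K (carrier V \<times> carrier W))"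
    using tensor_some_rep(1)[OF V W T] .
  have bc: "?f p \<odot>\<^bsub>X\<^esub> b (fst p) (snd p) \<in> N" if "?f p \<noteq> \<zero>\<^bsub>K\<^esub>" for p
  proof (rule N.smult_closed)
    show "?f p \<in> carrier K" using f unfolding free_module_simps by blast
    have "p \<in> carrier V \<times> carrier W" using f that unfolding free_module_simps by blast
    then show "b (fst p) (snd p) \<in> N" using b by (cases p) simp
  qed
  have Nc: "N \<subseteq> carrier X" using N.subset by simp
  have zero: "\<zero>\<^bsub>X\<^esub> \<in> N" and add: "\<And>x y. x \<in> N \<Longrightarrow> y \<in> N \<Longrightarrow> x \<oplus>\<^bsub>X\<^esub> y \<in> N"
    using N.one_closed N.m_closed by simp_all
  have fin: "finsum X g I \<in> N" if "g \<in> I \<rightarrow> N" for g :: "'v \<times> 'w \<Rightarrow> 'x" and I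
    using that
  proof (induction I rule: infinite_finite_induct)
    case (insert i I)
    then show ?case using Nc by (subst X.finsum_insert) (auto intro!: add)
  qed (simp_all add: zero)
  show ?thesis unfolding tlift_def Let_def by (intro fin funcsetI) (simp add: bc)
qed

lemma ideal_submodule:
  assumes "k_algebra K A" "ideal I A" shows "submodule I K A"
proof -
  interpret A: k_algebra K A by fact
  interpret I: ideal I A by fact
  show ?thesis
  proof (rule A.submoduleI)
    show "I \<subseteq> carrier A" by (rule I.a_subset)
    show "\<ominus>\<^bsub>A\<^esub> a \<in> I" if "a \<in> I" for a using that by (rule I.a_inv_closed)
    show "c \<odot>\<^bsub>A\<^esub> x \<in> I" if "c \<in> carrier K" "x \<in> I" for c x
      using I.I_l_closed[OF that(2), of "c \<odot>\<^bsub>A\<^esub> \<one>\<^bsub>A\<^esub>"] that I.a_Hcarr by (simp add: A.smult_mult_left)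
  qed auto
qed

lemma ideal_power_ideal:
  assumes "ring A" "ideal J A" shows "ideal (ideal_power A J n) A"
proof (induction n)
  case 0
  interpret ring A by fact
  show ?case by (simp add: oneideal)
next
  case (Suc n)
  interpret ring A by fact
  show ?case using ideal_prod_is_ideal[OF assms(2) Suc] by simp
qed

lemma ideal_power_mult:
  assumes "x \<in> J" "y \<in> ideal_power A J n"
  shows "x \<otimes>\<^bsub>A\<^esub> y \<in> ideal_power A J (Suc n)"
  using ideal_prod.prod[OF assms] by simp

lemma ideal_power_one:
  assumes "ring A" "ideal J A" shows "ideal_power A J (Suc 0) = J"
proof -
  interpret ring A by fact
  interpret J: ideal J A by fact
  have "J \<subseteq> ideal_prod A J (carrier A)"
  proof
    fix x assume x: "x \<in> J"
    show "x \<in> ideal_prod A J (carrier A)"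
      using ideal_prod.prod[OF x one_closed, of A] J.a_Hcarr[OF x] by simp
  qed
  moreover have "ideal_prod A J (carrier A) \<subseteq> J"
    using ideal_prod_inter[OF assms(2) oneideal] by blast
  ultimately show ?thesis by auto
qed

lemma ideal_power_Suc_subset:
  assumes "ring A" "ideal J A" shows "ideal_power A J (Suc n) \<subseteq> J" "ideal_power A J (Suc n) \<subseteq> ideal_power A J n"
  using ring.ideal_prod_inter[OF assms ideal_power_ideal[OF assms, of n]] by auto

lemma k_linear_zero_map: "module K V \<Longrightarrow> module K W \<Longrightarrow> k_linear K V W (\<lambda>_. \<zero>\<^bsub>W\<^esub>)"
proof -
  assume "module K V" "module K W"
  then interpret W: module K W by simp
  show ?thesis by (simp add: k_linear_def)
qed

lemma sweedler_diff:
  assumes C: "k_coalgebra K C" and X: "module K X" and h: "h \<in> carrier C"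
    and b: "\<And>x y. \<lbrakk>x \<in> carrier C; y \<in> carrier C\<rbrakk> \<Longrightarrow> b x y \<in> carrier X"
    and b': "\<And>x y. \<lbrakk>x \<in> carrier C; y \<in> carrier C\<rbrakk> \<Longrightarrow> b' x y \<in> carrier X"
  shows "sweedler K C X (\<lambda>x y. b x y \<ominus>\<^bsub>X\<^esub> b' x y) h = sweedler K C X b h \<ominus>\<^bsub>X\<^esub> sweedler K C X b' h"
proof -
  interpret X: module K X by fact
  have "sweedler K C X (\<lambda>x y. b x y \<ominus>\<^bsub>X\<^esub> b' x y) h
    = sweedler K C X b h \<oplus>\<^bsub>X\<^esub> sweedler K C X (\<lambda>x y. \<ominus>\<^bsub>X\<^esub> b' x y) h"
    unfolding a_minus_def by (rule sweedler_add[OF C X h b]) (simp_all add: b')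
  also have "sweedler K C X (\<lambda>x y. \<ominus>\<^bsub>X\<^esub> b' x y) h = \<ominus>\<^bsub>X\<^esub> sweedler K C X b' h"
    by (rule sweedler_commute[symmetric, OF k_linear_neg[OF X k_linear_id] C X X h b'])
  finally show ?thesis by (simp add: a_minus_def)
qed

lemma convolution_add_left:
  assumes C: "k_coalgebra K C" and B: "k_algebra K B"
    and l: "k_linear K C B f" "k_linear K C B f'" "k_linear K C B g" and h: "h \<in> carrier C"
  shows "convolution K C B (\<lambda>x. f x \<oplus>\<^bsub>B\<^esub> f' x) g h = convolution K C B f g h \<oplus>\<^bsub>B\<^esub> convolution K C B f' g h"
proof -
  interpret B: k_algebra K B by fact
  note c = k_linear_closed[OF l(1)] k_linear_closed[OF l(2)] k_linear_closed[OF l(3)]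
  have "convolution K C B (\<lambda>x. f x \<oplus>\<^bsub>B\<^esub> f' x) g h
    = sweedler K C B (\<lambda>x y. f x \<otimes>\<^bsub>B\<^esub> g y \<oplus>\<^bsub>B\<^esub> f' x \<otimes>\<^bsub>B\<^esub> g y) h"
    by (simp add: convolution_def c B.l_distr)
  also have "\<dots> = convolution K C B f g h \<oplus>\<^bsub>B\<^esub> convolution K C B f' g h"
    unfolding convolution_def by (rule sweedler_add[OF C k_algebra_module[OF B] h]) (simp_all add: c)
  finally show ?thesis .
qed

lemma convolution_add_right:
  assumes C: "k_coalgebra K C" and B: "k_algebra K B"
    and l: "k_linear K C B f" "k_linear K C B f'" "k_linear K C B g" and h: "h \<in> carrier C"
  shows "convolution K C B g (\<lambda>x. f x \<oplus>\<^bsub>B\<^esub> f' x) h = convolution K C B g f h \<oplus>\<^bsub>B\<^esub> convolution K C B g f' h"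
proof -
  interpret B: k_algebra K B by fact
  note c = k_linear_closed[OF l(1)] k_linear_closed[OF l(2)] k_linear_closed[OF l(3)]
  have "convolution K C B g (\<lambda>x. f x \<oplus>\<^bsub>B\<^esub> f' x) h
    = sweedler K C B (\<lambda>x y. g x \<otimes>\<^bsub>B\<^esub> f y \<oplus>\<^bsub>B\<^esub> g x \<otimes>\<^bsub>B\<^esub> f' y) h"
    by (simp add: convolution_def c B.r_distr)
  also have "\<dots> = convolution K C B g f h \<oplus>\<^bsub>B\<^esub> convolution K C B g f' h"
    unfolding convolution_def by (rule sweedler_add[OF C k_algebra_module[OF B] h]) (simp_all add: c)
  finally show ?thesis .
qed

text \<open>The Neumann series \<open>\<Sum> e\<^sup>i\<close> of \<open>e = conv_unit - u\<close>; its partial sums are \<open>G\<close>, its powers \<open>E\<close>.\<close>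

lemma convolution_unipotent_inverse:
  fixes K :: "('k, 'l) ring_scheme" and A :: "('k, 'a, 'm) bialg_scheme" and B :: "('k, 'b, 'n) module_scheme"
  assumes C: "k_coalgebra K A" and B: "k_algebra K B" and J: "ideal J B"
    and nil: "ideal_power B J n = {\<zero>\<^bsub>B\<^esub>}"
    and u: "k_linear K A B u" and uJ: "\<And>a. a \<in> carrier A \<Longrightarrow> conv_unit A B a \<ominus>\<^bsub>B\<^esub> u a \<in> J"
  shows "\<exists>G. k_linear K A B G
    \<and> (\<forall>a \<in> carrier A. convolution K A B G u a = conv_unit A B a)
    \<and> (\<forall>a \<in> carrier A. convolution K A B u G a = conv_unit A B a)"
proof -
  interpret B: k_algebra K B by fact
  interpret A: k_coalgebra K A by fact
  note M = k_algebra_module[OF B] and MA = k_coalgebra_module[OF C]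
  note cu = conv_unit_linear[OF C B]
  let ?c = "convolution K A B"
  define e where "e = (\<lambda>a. conv_unit A B a \<ominus>\<^bsub>B\<^esub> u a)"
  have el: "k_linear K A B e" unfolding e_def by (rule k_linear_diff[OF M cu u])
  define G where "G = rec_nat (\<lambda>_. \<zero>\<^bsub>B\<^esub>) (\<lambda>_ g a. conv_unit A B a \<oplus>\<^bsub>B\<^esub> ?c e g a)"
  define E where "E = rec_nat (conv_unit A B) (\<lambda>_ g. ?c e g)"
  have G0: "G 0 = (\<lambda>_. \<zero>\<^bsub>B\<^esub>)" and GS: "G (Suc m) = (\<lambda>a. conv_unit A B a \<oplus>\<^bsub>B\<^esub> ?c e (G m) a)" for m
    by (simp_all add: G_def)
  have E0: "E 0 = conv_unit A B" and ES: "E (Suc m) = ?c e (E m)" for m by (simp_all add: E_def)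
  have Gl: "k_linear K A B (G m)" for m
    by (induction m) (simp_all add: G0 GS k_linear_zero_map[OF MA M] k_linear_plus[OF M] cu
        convolution_linear[OF C B el])
  have El: "k_linear K A B (E m)" for m
    by (induction m) (simp_all add: E0 ES cu convolution_linear[OF C B el])
  have EJ: "E m a \<in> ideal_power B J m" if "a \<in> carrier A" for m a
    using that
  proof (induction m arbitrary: a)
    case 0
    then show ?case using k_linear_closed[OF cu] by (simp add: E0)
  next
    case (Suc m)
    have sub: "submodule (ideal_power B J (Suc m)) K B"
      by (rule ideal_submodule[OF B ideal_power_ideal[OF B.ring_axioms J]])
    show ?case
      unfolding ES convolution_def sweedler_eq[OF C Suc.prems]
      by (rule tlift_mem[OF M sub comult_closed[OF C Suc.prems] MA MA])
        (simp add: e_def ideal_prod.prod uJ Suc.IH)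
  qed
  note c = k_linear_closed[OF cu] k_linear_closed[OF u] k_linear_closed[OF el] k_linear_closed[OF Gl]
    k_linear_closed[OF El]
  have ue: "conv_unit A B a = u a \<oplus>\<^bsub>B\<^esub> e a" if "a \<in> carrier A" for a
    using c(1,2)[OF that] by (simp add: e_def a_minus_def B.a_lcomm[of "u a"] B.r_neg)
  \<comment> \<open>\<open>u\<close> and \<open>e\<close> add up to the unit, so convolving u + e
    with \<open>e\<close> from either side gives \<open>e\<close>; removing the common term, the
    square of \<open>e\<close>, leaves the claim. It lets one series invert \<open>u\<close> on both
    sides.\<close>
  have comm: "?c u e = ?c e u"
  proof
    fix a show "?c u e a = ?c e u a"
    proof (cases "a \<in> carrier A")
      case True
      have "?c u e a \<oplus>\<^bsub>B\<^esub> ?c e e a = ?c (\<lambda>x. u x \<oplus>\<^bsub>B\<^esub> e x) e a"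
        by (rule convolution_add_left[OF C B u el el True, symmetric])
      also have "\<dots> = ?c (conv_unit A B) e a" by (simp add: ue[symmetric])
      also have "\<dots> = ?c e (conv_unit A B) a"
        using conv_unit_left[OF C B el True] conv_unit_right[OF C B el True] by simp
      also have "\<dots> = ?c e (\<lambda>x. u x \<oplus>\<^bsub>B\<^esub> e x) a" by (simp add: ue[symmetric])
      also have "\<dots> = ?c e u a \<oplus>\<^bsub>B\<^esub> ?c e e a" by (rule convolution_add_right[OF C B u el el True])
      finally show ?thesis
        using convolution_closed[OF C B u el True] convolution_closed[OF C B el u True]
          convolution_closed[OF C B el el True] by simp
    qed (simp add: convolution_def sweedler_def)
  qed
  \<comment> \<open>The partial sums invert \<open>u\<close> up to the remainder \<open>E m\<close>,
    which takes values in the m-th power of \<open>J\<close> and hence vanishes at m = n.\<close>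
  have key: "?c (G m) u a \<oplus>\<^bsub>B\<^esub> E m a = conv_unit A B a \<and> ?c u (G m) a \<oplus>\<^bsub>B\<^esub> E m a = conv_unit A B a"
    if "a \<in> carrier A" for m a
    using that
  proof (induction m arbitrary: a)
    case 0
    have "?c (\<lambda>_. \<zero>\<^bsub>B\<^esub>) u a = \<zero>\<^bsub>B\<^esub>" "?c u (\<lambda>_. \<zero>\<^bsub>B\<^esub>) a = \<zero>\<^bsub>B\<^esub>"
      using tlift_zero[OF MA MA M comult_closed[OF C 0]] by (simp_all add: convolution_def c sweedler_eq[OF C 0])
    then show ?case using c(1)[OF 0] by (simp add: G0 E0)
  next
    case (Suc m)
    note a = Suc.prems
    have eu: "?c e (conv_unit A B) x = e x" if "x \<in> carrier A" for x by (rule conv_unit_right[OF C B el that])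
    note cl = convolution_linear[OF C B]
    have "?c (G (Suc m)) u a = ?c (conv_unit A B) u a \<oplus>\<^bsub>B\<^esub> ?c (?c e (G m)) u a"
      unfolding GS by (rule convolution_add_left[OF C B cu cl[OF el Gl] u a])
    also have "\<dots> = u a \<oplus>\<^bsub>B\<^esub> ?c e (?c (G m) u) a"
      using conv_unit_left[OF C B u a] convolution_assoc[OF C B el Gl u] by simp
    finally have 1: "?c (G (Suc m)) u a = u a \<oplus>\<^bsub>B\<^esub> ?c e (?c (G m) u) a" .
    have "?c u (G (Suc m)) a = ?c u (conv_unit A B) a \<oplus>\<^bsub>B\<^esub> ?c u (?c e (G m)) a"
      unfolding GS by (rule convolution_add_right[OF C B cu cl[OF el Gl] u a])
    also have "\<dots> = u a \<oplus>\<^bsub>B\<^esub> ?c e (?c u (G m)) a"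
      using conv_unit_right[OF C B u a] convolution_assoc[OF C B u el Gl, of m, symmetric]
        convolution_assoc[OF C B el u Gl, of m] comm by simp
    finally have 2: "?c u (G (Suc m)) a = u a \<oplus>\<^bsub>B\<^esub> ?c e (?c u (G m)) a" .
    have fin: "u a \<oplus>\<^bsub>B\<^esub> ?c e F a \<oplus>\<^bsub>B\<^esub> E (Suc m) a = conv_unit A B a"
      if F: "k_linear K A B F" and FE: "\<And>x. x \<in> carrier A \<Longrightarrow> F x \<oplus>\<^bsub>B\<^esub> E m x = conv_unit A B x" for F
    proof -
      have "?c e F a \<oplus>\<^bsub>B\<^esub> ?c e (E m) a = ?c e (\<lambda>x. F x \<oplus>\<^bsub>B\<^esub> E m x) a"
        by (rule convolution_add_right[OF C B F El el a, symmetric])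
      also have "\<dots> = e a" using eu[OF a] by (simp add: FE)
      finally show ?thesis
        using ue[OF a] c(2)[OF a] convolution_closed[OF C B el F a] convolution_closed[OF C B el El a]
        by (simp add: ES B.a_assoc)
    qed
    show ?case unfolding 1 2 using fin[OF cl[OF Gl u]] fin[OF cl[OF u Gl]] Suc.IH by simp
  qed
  have "?c (G n) u a = conv_unit A B a" "?c u (G n) a = conv_unit A B a" if a: "a \<in> carrier A" for a
    using key[OF a, of n] EJ[OF a, of n] nil convolution_closed[OF C B Gl u a] convolution_closed[OF C B u Gl a]
    by simp_all
  then show ?thesis using Gl by blast
qed

context split_bialgebra
begin

text \<open>After composition with \<open>p\<close>, the map \<open>?T\<close> becomes S(p(x)), the
  inverse of \<open>p\<close>; so both convolutions of \<open>?T\<close> with the identity are the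
  unit modulo \<open>J\<close>, hence invertible. One yields a left inverse of the identity, the
  other a right inverse, and these agree.\<close>

lemma antipode_exists:
  assumes J: "ideal J A" and ker: "\<And>a. \<lbrakk>a \<in> carrier A; p a = \<zero>\<^bsub>H\<^esub>\<rbrakk> \<Longrightarrow> a \<in> J"
    and nil: "ideal_power A J n = {\<zero>\<^bsub>A\<^esub>}"
  shows "\<exists>SA. hopf_algebra K A SA"
proof -
  let ?c = "convolution K A A" and ?T = "\<lambda>x. s (S (p x))" and ?I = "\<lambda>x::'a. x"
  note cl = convolution_linear[OF coA algA]
  have cu: "k_linear K A A (conv_unit A A)" by (simp add: conv_unit_linear)
  have pu: "p (conv_unit A A a) = conv_unit A H a" if "a \<in> carrier A" for a
    using that by (simp add: conv_unit_def k_linear_smult[OF p_lin] p_one)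
  have uJ: "conv_unit A A a \<ominus>\<^bsub>A\<^esub> u a \<in> J"
    if "u \<in> {?c ?T ?I, ?c ?I ?T}" and a: "a \<in> carrier A" for u a
  proof (rule ker)
    have ul: "k_linear K A A u" using that by auto
    note uc = k_linear_closed[OF ul a] k_linear_closed[OF cu a]
    show "conv_unit A A a \<ominus>\<^bsub>A\<^esub> u a \<in> carrier A" using uc by simp
    have "p (?c ?T ?I a) = convolution K A H (\<lambda>x. S (p x)) p a"
      by (subst algebra_hom_convolution[OF p_hom algA algH coA]) (simp_all add: a p_s)
    also have "\<dots> = conv_unit A H a" by (rule conv_inv_left[OF id_hom algH a])
    finally have 1: "p (?c ?T ?I a) = conv_unit A H a" .
    have "p (?c ?I ?T a) = convolution K A H p (\<lambda>x. S (p x)) a"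
      by (subst algebra_hom_convolution[OF p_hom algA algH coA]) (simp_all add: a p_s)
    also have "\<dots> = conv_unit A H a" by (rule conv_inv_right[OF id_hom algH a])
    finally have "p (u a) = conv_unit A H a" using that 1 by auto
    then show "p (conv_unit A A a \<ominus>\<^bsub>A\<^esub> u a) = \<zero>\<^bsub>H\<^esub>"
      using uc pu[OF a] p_closed[OF uc(2)]
      by (simp add: a_minus_def k_linear_add[OF p_lin] k_linear_uminus[OF modA modH p_lin] H.r_neg)
  qed
  have Tl: "k_linear K A A ?T" and Il: "k_linear K A A ?I" by simp_all
  have uJ1: "conv_unit A A a \<ominus>\<^bsub>A\<^esub> ?c ?T ?I a \<in> J" "conv_unit A A a \<ominus>\<^bsub>A\<^esub> ?c ?I ?T a \<in> J"
    if "a \<in> carrier A" for a by (rule uJ[OF _ that], simp)+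
  obtain G where G: "k_linear K A A G" "\<And>a. a \<in> carrier A \<Longrightarrow> ?c G (?c ?T ?I) a = conv_unit A A a"
    using convolution_unipotent_inverse[OF coA algA J nil cl[OF Tl Il] uJ1(1)] by auto
  obtain G' where G': "k_linear K A A G'" "\<And>a. a \<in> carrier A \<Longrightarrow> ?c (?c ?I ?T) G' a = conv_unit A A a"
    using convolution_unipotent_inverse[OF coA algA J nil cl[OF Il Tl] uJ1(2)] by auto
  let ?L = "?c G ?T" and ?R = "?c ?T G'"
  have L: "?c ?L ?I a = conv_unit A A a" if "a \<in> carrier A" for a
    using G(2)[OF that] convolution_assoc[OF coA algA G(1) Tl Il] by simp
  have R: "?c ?I ?R a = conv_unit A A a" if "a \<in> carrier A" for a
    using G'(2)[OF that] convolution_assoc[OF coA algA Il Tl G'(1)] by simp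
  have LR: "?L a = ?R a" if "a \<in> carrier A" for a
    by (rule convolution_inverse_unique[OF coA algA cl[OF G(1) Tl] Il cl[OF Tl G'(1)] L R that])
  have "hopf_algebra K A ?L"
  proof (intro hopf_algebra.intro bialgA hopf_algebra_axioms.intro)
    show "k_linear K A A ?L" by (rule cl[OF G(1) Tl])
    fix x assume x: "x \<in> carrier A"
    show "tlift K A (\<lambda>y z. ?L y \<otimes>\<^bsub>A\<^esub> z) (comult A x) = counit A x \<odot>\<^bsub>A\<^esub> \<one>\<^bsub>A\<^esub>"
      using L[OF x] x by (simp add: convolution_def[of _ _ _ ?L] conv_unit_def sweedler_eq)
    have "?c ?I ?L x = conv_unit A A x" using R[OF x] by (simp add: LR)
    then show "tlift K A (\<lambda>y z. y \<otimes>\<^bsub>A\<^esub> ?L z) (comult A x) = counit A x \<odot>\<^bsub>A\<^esub> \<one>\<^bsub>A\<^esub>"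
      using x by (simp add: convolution_def[of _ _ _ ?I] conv_unit_def sweedler_eq)
  qed
  then show ?thesis by blast
qed

end

section \<open>Lifting a bicolinear section to an algebra map\<close>

context hopf_algebra
begin

text \<open>The left side is \<Sum> M(t1, t4, t2 S(t3)), and the antipode axiom contracts the two
  middle legs. This makes \<open>twist\<close> right colinear.\<close>

lemma sweedler_antipode_collapse:
  assumes X: "module K X" and t: "t \<in> carrier H"
    and M1: "\<And>y g. \<lbrakk>y \<in> carrier H; g \<in> carrier H\<rbrakk> \<Longrightarrow> k_linear K H X (\<lambda>x. M x y g)"
    and M2: "\<And>x g. \<lbrakk>x \<in> carrier H; g \<in> carrier H\<rbrakk> \<Longrightarrow> k_linear K H X (\<lambda>y. M x y g)"
    and M3: "\<And>x y. \<lbrakk>x \<in> carrier H; y \<in> carrier H\<rbrakk> \<Longrightarrow> k_linear K H X (M x y)"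
  shows "sweedler K H X (\<lambda>x y. sweedler K H X (\<lambda>u1 u2. sweedler K H X
      (\<lambda>y1 y2. M u1 y2 (u2 \<otimes>\<^bsub>H\<^esub> S y1)) y) x) t = sweedler K H X (\<lambda>x y. M x y \<one>\<^bsub>H\<^esub>) t"
proof -
  have L1: "k_linear K V X (\<lambda>v. M (f v) y g)" if "y \<in> carrier H" "g \<in> carrier H" "k_linear K V H f"
    for V :: "('a, 'v, 'w) module_scheme" and f y g using k_linear_comp[OF M1] that by blast
  have L2: "k_linear K V X (\<lambda>v. M x (f v) g)" if "x \<in> carrier H" "g \<in> carrier H" "k_linear K V H f"
    for V :: "('a, 'v, 'w) module_scheme" and f x g using k_linear_comp[OF M2] that by blast
  have L3: "k_linear K V X (\<lambda>v. M x y (f v))" if "x \<in> carrier H" "y \<in> carrier H" "k_linear K V H f"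
    for V :: "('a, 'v, 'w) module_scheme" and f x y using k_linear_comp[OF M3] that by blast
  note ml = k_linear_mult_left[OF alg] k_linear_mult_right[OF alg] k_linear_id antipode_linear
    k_linear_comp[OF antipode_linear]
  note si = k_linear_sweedler_inner[OF coalg X modH] and so = k_linear_sweedler_outer[OF coalg X modH]
  have "sweedler K H X (\<lambda>x y. sweedler K H X (\<lambda>u1 u2. sweedler K H X
      (\<lambda>y1 y2. M u1 y2 (u2 \<otimes>\<^bsub>H\<^esub> S y1)) y) x) t
    = sweedler K H X (\<lambda>u1 z. sweedler K H X (\<lambda>u2 y. sweedler K H X
      (\<lambda>y1 y2. M u1 y2 (u2 \<otimes>\<^bsub>H\<^esub> S y1)) y) z) t"
    by (rule sweedler_coassoc[OF coalg X, where f="\<lambda>u1 u2 y. sweedler K H X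
      (\<lambda>y1 y2. M u1 y2 (u2 \<otimes>\<^bsub>H\<^esub> S y1)) y"]) (simp_all add: si so L1 L2 L3 ml S_closed)
  also have "\<dots> = sweedler K H X (\<lambda>u1 z. sweedler K H X (\<lambda>w y2. sweedler K H X
      (\<lambda>u2 y1. M u1 y2 (u2 \<otimes>\<^bsub>H\<^esub> S y1)) w) z) t"
    by (intro sweedler_cong[THEN fun_cong] sweedler_coassoc[OF coalg X, symmetric])
      (simp_all add: L2 L3 ml S_closed)
  also have "\<dots> = sweedler K H X (\<lambda>u1 z. sweedler K H X (\<lambda>w y2. counit H w \<odot>\<^bsub>X\<^esub> M u1 y2 \<one>\<^bsub>H\<^esub>) z) t"
  proof (intro sweedler_cong[THEN fun_cong])
    fix u1 w y2 assume c: "u1 \<in> carrier H" "w \<in> carrier H" "y2 \<in> carrier H"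
    have "sweedler K H X (\<lambda>u2 y1. M u1 y2 (u2 \<otimes>\<^bsub>H\<^esub> S y1)) w
      = M u1 y2 (sweedler K H H (\<lambda>u2 y1. u2 \<otimes>\<^bsub>H\<^esub> S y1) w)"
      using c by (intro sweedler_commute[OF M3 coalg modH X, symmetric]) (simp_all add: S_closed)
    then show "sweedler K H X (\<lambda>u2 y1. M u1 y2 (u2 \<otimes>\<^bsub>H\<^esub> S y1)) w = counit H w \<odot>\<^bsub>X\<^esub> M u1 y2 \<one>\<^bsub>H\<^esub>"
      using antipode_right[OF c(2)] c k_linear_smult[OF M3[OF c(1,3)]]
      by (simp add: sweedler_eq[OF coalg] counit_closed)
  qed
  also have "\<dots> = sweedler K H X (\<lambda>u1 z. M u1 z \<one>\<^bsub>H\<^esub>) t"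
    by (intro sweedler_cong[THEN fun_cong] sweedler_counit_left[OF coalg X]) (simp_all add: M2)
  finally show ?thesis .
qed

text \<open>The tensor \<open>\<Sum> t\<^sub>1 \<otimes> S t\<^sub>2\<close> of an integral is a separability idempotent; \<open>ad\<close>-coinvariance makes it
  left coinvariant.\<close>

lemma casimir:
  assumes X: "module K X" and t: "t \<in> carrier H" and h: "h \<in> carrier H"
    and int: "\<And>h. h \<in> carrier H \<Longrightarrow> h \<otimes>\<^bsub>H\<^esub> t = counit H h \<odot>\<^bsub>H\<^esub> t"
    and b1: "\<And>x. x \<in> carrier H \<Longrightarrow> k_linear K H X (b x)"
    and b2: "\<And>y. y \<in> carrier H \<Longrightarrow> k_linear K H X (\<lambda>x. b x y)"
  shows "sweedler K H X (\<lambda>x y. b (h \<otimes>\<^bsub>H\<^esub> x) (S y)) t = sweedler K H X (\<lambda>x y. b x (S y \<otimes>\<^bsub>H\<^esub> h)) t"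
proof -
  have L1: "k_linear K V X (\<lambda>v. b x (f v))" if "x \<in> carrier H" "k_linear K V H f"
    for V :: "('a, 'v, 'w) module_scheme" and f x using k_linear_comp[OF b1] that by blast
  have L2: "k_linear K V X (\<lambda>v. b (f v) y)" if "y \<in> carrier H" "k_linear K V H f"
    for V :: "('a, 'v, 'w) module_scheme" and f y using k_linear_comp[OF b2] that by blast
  have bc: "b x y \<in> carrier X" if "x \<in> carrier H" "y \<in> carrier H" for x y
    using k_linear_closed[OF b1] that by blast
  note ml = k_linear_mult_left[OF alg] k_linear_mult_right[OF alg] k_linear_id antipode_linear
    k_linear_comp[OF antipode_linear]
  note si = k_linear_sweedler_inner[OF coalg X modH]
  let ?B = "\<lambda>z w. sweedler K H X (\<lambda>x y. b x (S y \<otimes>\<^bsub>H\<^esub> w)) z"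
  have Bl: "k_linear K H X (\<lambda>z. ?B z w)" if "w \<in> carrier H" for w
    by (rule k_linear_sweedler_outer[OF coalg X modH k_linear_id]) (simp_all add: L1 L2 ml that S_closed)
  \<comment> \<open>The counit is inserted in order to replace \<epsilon>(h1) t by h1 t, the
    integral property. This produces b(h1 t1, S(h2 t2) h3), in which S(h2) h3 contracts.\<close>
  have "?B t h = sweedler K H X (\<lambda>h1 h2. counit H h1 \<odot>\<^bsub>X\<^esub> ?B t h2) h"
    by (rule sweedler_counit_left[OF coalg X _ h, symmetric]) (simp_all add: si L1 ml t S_closed)
  also have "\<dots> = sweedler K H X (\<lambda>h1 h2. ?B (h1 \<otimes>\<^bsub>H\<^esub> t) h2) h"
    using t by (simp add: int k_linear_smult[OF Bl] counit_closed)
  also have "\<dots> = sweedler K H X (\<lambda>h1 h2. sweedler K H X (\<lambda>u v. sweedler K H X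
      (\<lambda>x y. b (u \<otimes>\<^bsub>H\<^esub> x) (S (v \<otimes>\<^bsub>H\<^esub> y) \<otimes>\<^bsub>H\<^esub> h2)) t) h1) h"
    using t by (intro sweedler_cong[THEN fun_cong] sweedler_mult[OF bialg X]) (simp_all add: L1 L2 ml S_closed)
  also have "\<dots> = sweedler K H X (\<lambda>u z. sweedler K H X (\<lambda>v h2. sweedler K H X
      (\<lambda>x y. b (u \<otimes>\<^bsub>H\<^esub> x) (S (v \<otimes>\<^bsub>H\<^esub> y) \<otimes>\<^bsub>H\<^esub> h2)) t) z) h"
    by (rule sweedler_coassoc[OF coalg X]) (simp_all add: si L1 L2 ml t S_closed)
  also have "\<dots> = sweedler K H X (\<lambda>u z. sweedler K H X (\<lambda>x y. sweedler K H X
      (\<lambda>v h2. b (u \<otimes>\<^bsub>H\<^esub> x) (S (v \<otimes>\<^bsub>H\<^esub> y) \<otimes>\<^bsub>H\<^esub> h2)) z) t) h"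
    by (intro sweedler_cong[THEN fun_cong] sweedler_swap[OF coalg coalg X]) (simp_all add: bc t S_closed)
  also have "\<dots> = sweedler K H X (\<lambda>u z. sweedler K H X (\<lambda>x y. counit H z \<odot>\<^bsub>X\<^esub> b (u \<otimes>\<^bsub>H\<^esub> x) (S y)) t) h"
  proof (intro sweedler_cong[THEN fun_cong])
    fix u z x y assume c: "u \<in> carrier H" "z \<in> carrier H" "x \<in> carrier H" "y \<in> carrier H"
    have "sweedler K H X (\<lambda>v h2. b (u \<otimes>\<^bsub>H\<^esub> x) (S (v \<otimes>\<^bsub>H\<^esub> y) \<otimes>\<^bsub>H\<^esub> h2)) z
      = sweedler K H X (\<lambda>v h2. b (u \<otimes>\<^bsub>H\<^esub> x) (S y \<otimes>\<^bsub>H\<^esub> (S v \<otimes>\<^bsub>H\<^esub> h2))) z"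
      using c by (simp add: antipode_mult m_assoc S_closed)
    also have "\<dots> = b (u \<otimes>\<^bsub>H\<^esub> x) (S y \<otimes>\<^bsub>H\<^esub> sweedler K H H (\<lambda>v h2. S v \<otimes>\<^bsub>H\<^esub> h2) z)"
      using c by (intro sweedler_commute[where g="\<lambda>w. b (u \<otimes>\<^bsub>H\<^esub> x) (S y \<otimes>\<^bsub>H\<^esub> w)", symmetric, OF _ coalg modH X])
        (simp_all add: L1 ml S_closed)
    also have "\<dots> = counit H z \<odot>\<^bsub>X\<^esub> b (u \<otimes>\<^bsub>H\<^esub> x) (S y)"
      using c antipode_left[of z] k_linear_smult[OF b1]
      by (simp add: sweedler_eq[OF coalg] counit_closed S_closed smult_mult_right)
    finally show "sweedler K H X (\<lambda>v h2. b (u \<otimes>\<^bsub>H\<^esub> x) (S (v \<otimes>\<^bsub>H\<^esub> y) \<otimes>\<^bsub>H\<^esub> h2)) z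
      = counit H z \<odot>\<^bsub>X\<^esub> b (u \<otimes>\<^bsub>H\<^esub> x) (S y)" .
  qed
  also have "\<dots> = sweedler K H X (\<lambda>u z. counit H z \<odot>\<^bsub>X\<^esub> sweedler K H X (\<lambda>x y. b (u \<otimes>\<^bsub>H\<^esub> x) (S y)) t) h"
    using t by (intro sweedler_cong[THEN fun_cong] sweedler_commute[symmetric, OF _ coalg X X]
        k_linear_smult_right[OF X]) (simp_all add: bc S_closed counit_closed k_linear_id)
  also have "\<dots> = sweedler K H X (\<lambda>x y. b (h \<otimes>\<^bsub>H\<^esub> x) (S y)) t"
    by (rule sweedler_counit_right[OF coalg X _ h]) (simp_all add: si L2 ml t S_closed)
  finally show ?thesis by simp
qed

text \<open>The left side is \<Sum> M(t1 S(t4), t2, t3). Coassociativity gathers t2 and t3 into the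
  coproduct of one middle leg, so that \<Sum> t1 S(t3) \<otimes> t2 = 1 \<otimes> t applies. This
  makes \<open>twist\<close> left colinear.\<close>

lemma ad_coinvariant_collapse:
  assumes X: "module K X" and t: "ad_coinvariant_integral K H S t"
    and M1: "\<And>x y. \<lbrakk>x \<in> carrier H; y \<in> carrier H\<rbrakk> \<Longrightarrow> k_linear K H X (\<lambda>g. M g x y)"
    and M2: "\<And>g y. \<lbrakk>g \<in> carrier H; y \<in> carrier H\<rbrakk> \<Longrightarrow> k_linear K H X (\<lambda>x. M g x y)"
    and M3: "\<And>g x. \<lbrakk>g \<in> carrier H; x \<in> carrier H\<rbrakk> \<Longrightarrow> k_linear K H X (M g x)"
  shows "sweedler K H X (\<lambda>x y. sweedler K H X (\<lambda>u1 u2. sweedler K H X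
      (\<lambda>y1 y2. M (u1 \<otimes>\<^bsub>H\<^esub> S y2) u2 y1) y) x) t = sweedler K H X (\<lambda>x y. M \<one>\<^bsub>H\<^esub> x y) t"
proof -
  have tc: "t \<in> carrier H" using t by (simp add: ad_coinvariant_integral_def)
  have L1: "k_linear K V X (\<lambda>v. M (f v) x y)" if "x \<in> carrier H" "y \<in> carrier H" "k_linear K V H f"
    for V :: "('a, 'v, 'w) module_scheme" and f x y using k_linear_comp[OF M1] that by blast
  have L2: "k_linear K V X (\<lambda>v. M g (f v) y)" if "g \<in> carrier H" "y \<in> carrier H" "k_linear K V H f"
    for V :: "('a, 'v, 'w) module_scheme" and f g y using k_linear_comp[OF M2] that by blast
  have L3: "k_linear K V X (\<lambda>v. M g x (f v))" if "g \<in> carrier H" "x \<in> carrier H" "k_linear K V H f"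
    for V :: "('a, 'v, 'w) module_scheme" and f g x using k_linear_comp[OF M3] that by blast
  note ml = k_linear_mult_left[OF alg] k_linear_mult_right[OF alg] k_linear_id antipode_linear
    k_linear_comp[OF antipode_linear]
  note si = k_linear_sweedler_inner[OF coalg X modH] and so = k_linear_sweedler_outer[OF coalg X modH]
  let ?C = "\<lambda>g w. sweedler K H X (\<lambda>x y. M g x y) w"
  have Cb: "k_bilinear K H H X ?C"
    by (intro k_bilinearI) (simp_all add: si so L1 M2 M3 ml)
  have HH: "module K (tensor K H H)" by (rule tensor_module[OF modH modH])
  have "sweedler K H X (\<lambda>x y. sweedler K H X (\<lambda>u1 u2. sweedler K H X
      (\<lambda>y1 y2. M (u1 \<otimes>\<^bsub>H\<^esub> S y2) u2 y1) y) x) t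
    = sweedler K H X (\<lambda>u1 z. sweedler K H X (\<lambda>u2 y. sweedler K H X
      (\<lambda>y1 y2. M (u1 \<otimes>\<^bsub>H\<^esub> S y2) u2 y1) y) z) t"
    by (rule sweedler_coassoc[OF coalg X, where f="\<lambda>u1 u2 y. sweedler K H X
      (\<lambda>y1 y2. M (u1 \<otimes>\<^bsub>H\<^esub> S y2) u2 y1) y"]) (simp_all add: si so L1 L2 L3 ml S_closed)
  also have "\<dots> = sweedler K H X (\<lambda>u1 z. sweedler K H X (\<lambda>w y2. ?C (u1 \<otimes>\<^bsub>H\<^esub> S y2) w) z) t"
    by (intro sweedler_cong[THEN fun_cong] sweedler_coassoc[OF coalg X, symmetric])
      (simp_all add: L1 L2 L3 ml S_closed)
  also have "\<dots> = sweedler K H X (\<lambda>z y2. sweedler K H X (\<lambda>u1 w. ?C (u1 \<otimes>\<^bsub>H\<^esub> S y2) w) z) t"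
    by (rule sweedler_coassoc[OF coalg X, symmetric]) (simp_all add: si so L1 L2 L3 ml S_closed)
  also have "\<dots> = sweedler K H X (\<lambda>z y2. tlift K X ?C (sweedler K H (tensor K H H)
      (\<lambda>u1 w. pure K H H (u1 \<otimes>\<^bsub>H\<^esub> S y2) w) z)) t"
    by (intro sweedler_cong[THEN fun_cong] tlift_sweedler_pure[OF coalg modH modH X Cb, symmetric])
      (simp_all add: S_closed)
  also have "\<dots> = tlift K X ?C (sweedler K H (tensor K H H) (\<lambda>z y2. sweedler K H (tensor K H H)
      (\<lambda>u1 w. pure K H H (u1 \<otimes>\<^bsub>H\<^esub> S y2) w) z) t)"
    by (rule tlift_sweedler[OF coalg modH modH X Cb tc, symmetric])
      (auto intro!: sweedler_closed[OF coalg HH] pure_closed[OF modH modH] S_closed)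
  also have "\<dots> = tlift K X ?C (pure K H H \<one>\<^bsub>H\<^esub> t)"
    using t unfolding ad_coinvariant_integral_def comult3_eq[OF coalg tc] by simp
  also have "\<dots> = ?C \<one>\<^bsub>H\<^esub> t" by (rule tlift_pure[OF modH modH X Cb]) (simp_all add: tc)
  finally show ?thesis .
qed

end

context bialgebra_projection
begin

section \<open>Left and right colinear maps from \<open>H\<close> to \<open>A\<close>\<close>

abbreviation "V \<equiv> tensor_algebra K A H"

lemma algV [simp]: "k_algebra K V" by simp
lemma modV [simp]: "module K V" by simp

definition j1 :: "'a \<Rightarrow> ('a \<times> 'h \<Rightarrow> 'k) set" where "j1 a = pure K A H a \<one>\<^bsub>H\<^esub>"
definition j2 :: "'h \<Rightarrow> ('a \<times> 'h \<Rightarrow> 'k) set" where "j2 h = pure K A H \<one>\<^bsub>A\<^esub> h"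

sublocale V: k_algebra K V by (rule algV)

lemma j1_hom: "algebra_hom K A V j1"
  using algebra_hom_pure_left[OF algA algH] by (simp add: j1_def[abs_def])

lemma j2_hom: "algebra_hom K H V j2"
  using algebra_hom_pure_right[OF algA algH] by (simp add: j2_def[abs_def])

lemmas j_closed [simp] = algebra_homD(2)[OF j1_hom] algebra_homD(2)[OF j2_hom]
lemmas j_lin [simp] = algebra_homD(1)[OF j1_hom] algebra_homD(1)[OF j2_hom]
  k_linear_comp[OF algebra_homD(1)[OF j1_hom]] k_linear_comp[OF algebra_homD(1)[OF j2_hom]]

lemma j1_j2: "\<lbrakk>a \<in> carrier A; h \<in> carrier H\<rbrakk> \<Longrightarrow> j1 a \<otimes>\<^bsub>V\<^esub> j2 h = pure K A H a h"
  "\<lbrakk>a \<in> carrier A; h \<in> carrier H\<rbrakk> \<Longrightarrow> j2 h \<otimes>\<^bsub>V\<^esub> j1 a = pure K A H a h"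
  by (simp_all add: j1_def j2_def tensor_algebra_sel tensor_mult_pure)

lemma pure_V [simp]: "\<lbrakk>a \<in> carrier A; h \<in> carrier H\<rbrakk> \<Longrightarrow> pure K A H a h \<in> carrier V"
  by (simp add: tensor_algebra_sel)

lemma pure_lin_UV [simp]:
  "k_linear K W H f \<Longrightarrow> a \<in> carrier A \<Longrightarrow> k_linear K W U (\<lambda>x. pure K H A (f x) a)"
  "k_linear K W A f' \<Longrightarrow> h \<in> carrier H \<Longrightarrow> k_linear K W U (\<lambda>x. pure K H A h (f' x))"
  "k_linear K W A f' \<Longrightarrow> h \<in> carrier H \<Longrightarrow> k_linear K W V (\<lambda>x. pure K A H (f' x) h)"
  "k_linear K W H f \<Longrightarrow> a \<in> carrier A \<Longrightarrow> k_linear K W V (\<lambda>x. pure K A H a (f x))"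
  unfolding k_linear_tensor_algebra by simp_all

lemma pure_mult_V: "\<lbrakk>h \<in> carrier H; a \<in> carrier A; g \<in> carrier H; b \<in> carrier A\<rbrakk>
    \<Longrightarrow> pure K A H a h \<otimes>\<^bsub>V\<^esub> pure K A H b g = pure K A H (a \<otimes>\<^bsub>A\<^esub> b) (h \<otimes>\<^bsub>H\<^esub> g)"
  by (simp add: tensor_algebra_sel tensor_mult_pure)

lemmas rc_lin [simp] = algebra_homD(1)[OF rc_hom] k_linear_comp[OF algebra_homD(1)[OF rc_hom]]
lemmas rc_mult = algebra_homD(3)[OF rc_hom]

definition left_colinear :: "('h \<Rightarrow> 'a) \<Rightarrow> bool"
  where "left_colinear f \<longleftrightarrow> (\<forall>h \<in> carrier H. lc (f h) = convolution K H U k1 (\<lambda>y. k2 (f y)) h)"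

definition right_colinear :: "('h \<Rightarrow> 'a) \<Rightarrow> bool"
  where "right_colinear f \<longleftrightarrow> (\<forall>h \<in> carrier H. rc (f h) = convolution K H V (\<lambda>y. j1 (f y)) j2 h)"

lemma bicolinear_section_iff:
  "bicolinear_section f \<longleftrightarrow> k_linear K H A f \<and> (\<forall>h \<in> carrier H. p (f h) = h)
    \<and> left_colinear f \<and> right_colinear f"
proof (cases "k_linear K H A f")
  case f: True
  note [simp] = k_linear_closed[OF f]
  have 1: "convolution K H U k1 (\<lambda>y. k2 (f y)) h = sweedler K H (tensor K H A) (\<lambda>x y. pure K H A x (f y)) h" for h
    by (simp add: convolution_def k1_k2 sweedler_tensor_algebra)
  have 2: "convolution K H V (\<lambda>y. j1 (f y)) j2 h = sweedler K H (tensor K A H) (\<lambda>x y. pure K A H (f x) y) h" for h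
    by (simp add: convolution_def j1_j2 sweedler_tensor_algebra)
  show ?thesis using f
    by (auto simp: bicolinear_section_def left_colinear_def right_colinear_def 1 2 lc_eq rc_eq
        sweedler_tensor_algebra)
qed (simp add: bicolinear_section_def)

lemma colinear_add:
  assumes f: "k_linear K H A f" and g: "k_linear K H A g"
  shows "left_colinear f \<Longrightarrow> left_colinear g \<Longrightarrow> left_colinear (\<lambda>h. f h \<oplus>\<^bsub>A\<^esub> g h)"
    "right_colinear f \<Longrightarrow> right_colinear g \<Longrightarrow> right_colinear (\<lambda>h. f h \<oplus>\<^bsub>A\<^esub> g h)"
proof -
  note [simp] = k_linear_closed[OF f] k_linear_closed[OF g] f g
  have kf: "k2 (f y \<oplus>\<^bsub>A\<^esub> g y) = k2 (f y) \<oplus>\<^bsub>U\<^esub> k2 (g y)" "j1 (f y \<oplus>\<^bsub>A\<^esub> g y) = j1 (f y) \<oplus>\<^bsub>V\<^esub> j1 (g y)"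
    if "y \<in> carrier H" for y
    using that by (simp_all add: k_linear_add[OF k_lin(2)] k_linear_add[OF j_lin(1)])
  show "left_colinear f \<Longrightarrow> left_colinear g \<Longrightarrow> left_colinear (\<lambda>h. f h \<oplus>\<^bsub>A\<^esub> g h)"
    unfolding left_colinear_def
    by (simp add: k_linear_add[OF lc_lin(1)] kf convolution_add_right)
  show "right_colinear f \<Longrightarrow> right_colinear g \<Longrightarrow> right_colinear (\<lambda>h. f h \<oplus>\<^bsub>A\<^esub> g h)"
    unfolding right_colinear_def
    by (simp add: k_linear_add[OF rc_lin(1)] kf convolution_add_left)
qed

text \<open>The premises on \<open>lc w\<close> and \<open>rc w\<close> say that \<open>w\<close> is
  coinvariant on the respective side, so its coaction touches the \<open>A\<close>-leg only. It is
  applied to the negative of the value of \<open>twist\<close> at 1.\<close>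

lemma colinear_mult:
  assumes f: "k_linear K H A f" and w: "w \<in> carrier A"
  shows "lc w = k2 w \<Longrightarrow> left_colinear f \<Longrightarrow> left_colinear (\<lambda>h. w \<otimes>\<^bsub>A\<^esub> f h)"
    "rc w = j1 w \<Longrightarrow> right_colinear f \<Longrightarrow> right_colinear (\<lambda>h. w \<otimes>\<^bsub>A\<^esub> f h)"
proof -
  note [simp] = k_linear_closed[OF f] f w
  show "left_colinear (\<lambda>h. w \<otimes>\<^bsub>A\<^esub> f h)" if lw: "lc w = k2 w" and lf: "left_colinear f"
    unfolding left_colinear_def
  proof
    fix h assume h: "h \<in> carrier H"
    have e: "k2 w \<otimes>\<^bsub>U\<^esub> (k1 x \<otimes>\<^bsub>U\<^esub> k2 (f y)) = k1 x \<otimes>\<^bsub>U\<^esub> k2 (w \<otimes>\<^bsub>A\<^esub> f y)"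
      if "x \<in> carrier H" "y \<in> carrier H" for x y
      using that by (simp add: k1_def k2_def pure_mult_U)
    have "lc (w \<otimes>\<^bsub>A\<^esub> f h) = k2 w \<otimes>\<^bsub>U\<^esub> convolution K H U k1 (\<lambda>y. k2 (f y)) h"
      using lf h by (simp add: lc_mult lw left_colinear_def)
    also have "\<dots> = sweedler K H U (\<lambda>x y. k2 w \<otimes>\<^bsub>U\<^esub> (k1 x \<otimes>\<^bsub>U\<^esub> k2 (f y))) h"
      unfolding convolution_def using h by (intro sweedler_commute) simp_all
    finally show "lc (w \<otimes>\<^bsub>A\<^esub> f h) = convolution K H U k1 (\<lambda>y. k2 (w \<otimes>\<^bsub>A\<^esub> f y)) h"
      by (simp add: e convolution_def)
  qed
  show "right_colinear (\<lambda>h. w \<otimes>\<^bsub>A\<^esub> f h)" if rw: "rc w = j1 w" and rf: "right_colinear f"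
    unfolding right_colinear_def
  proof
    fix h assume h: "h \<in> carrier H"
    have e: "j1 w \<otimes>\<^bsub>V\<^esub> (j1 (f x) \<otimes>\<^bsub>V\<^esub> j2 y) = j1 (w \<otimes>\<^bsub>A\<^esub> f x) \<otimes>\<^bsub>V\<^esub> j2 y"
      if "x \<in> carrier H" "y \<in> carrier H" for x y
      using that by (simp add: j1_def j2_def pure_mult_V)
    have "rc (w \<otimes>\<^bsub>A\<^esub> f h) = j1 w \<otimes>\<^bsub>V\<^esub> convolution K H V (\<lambda>y. j1 (f y)) j2 h"
      using rf h by (simp add: rc_mult rw right_colinear_def)
    also have "\<dots> = sweedler K H V (\<lambda>x y. j1 w \<otimes>\<^bsub>V\<^esub> (j1 (f x) \<otimes>\<^bsub>V\<^esub> j2 y)) h"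
      unfolding convolution_def using h by (intro sweedler_commute) simp_all
    finally show "rc (w \<otimes>\<^bsub>A\<^esub> f h) = convolution K H V (\<lambda>y. j1 (w \<otimes>\<^bsub>A\<^esub> f y)) j2 h"
      by (simp add: e convolution_def)
  qed
qed

text \<open>Averaging \<open>f\<close> against the separability idempotent; adding a suitable combination of \<open>f\<close> and
  this average kills the multiplicative defect of \<open>f\<close> to first order.\<close>

definition twist :: "'h \<Rightarrow> ('h \<Rightarrow> 'a) \<Rightarrow> 'h \<Rightarrow> 'a"
  where "twist t f k = sweedler K H A (\<lambda>x y. f x \<otimes>\<^bsub>A\<^esub> f (S y \<otimes>\<^bsub>H\<^esub> k)) t"

lemma twist_linear:
  assumes f: "k_linear K H A f" and t: "t \<in> carrier H" shows "k_linear K H A (twist t f)"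
  unfolding twist_def[abs_def] by (simp add: k_linear_closed[OF f] k_linear_comp[OF f] t)

text \<open>The left coaction of \<Sum> f(t1) f(S(t2) k) has the \<open>H\<close>-leg t1 S(t4) k1,
  while t2 and t3 stay in the \<open>A\<close>-leg. Here \<open>ad\<close>-coinvariance is what
  turns t1 S(t4) into 1.\<close>

lemma twist_left_colinear:
  assumes f: "k_linear K H A f" and lf: "left_colinear f" and t: "ad_coinvariant_integral K H S t"
  shows "left_colinear (twist t f)"
  unfolding left_colinear_def
proof
  fix k assume k: "k \<in> carrier H"
  note [simp] = k_linear_closed[OF f] f k_linear_comp[OF f]
  have tc: "t \<in> carrier H" using t by (simp add: ad_coinvariant_integral_def)
  have lcf: "lc (f h) = sweedler K H U (\<lambda>x y. pure K H A x (f y)) h" if "h \<in> carrier H" for h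
    using lf that by (simp add: left_colinear_def convolution_def k1_k2)
  let ?Q = "\<lambda>y1 y2. sweedler K H U (\<lambda>c1 c2. pure K H A (S y2 \<otimes>\<^bsub>H\<^esub> c1) (f (S y1 \<otimes>\<^bsub>H\<^esub> c2))) k"
  have lcs: "lc (f (S y \<otimes>\<^bsub>H\<^esub> k)) = sweedler K H U ?Q y" if y: "y \<in> carrier H" for y
  proof -
    have "lc (f (S y \<otimes>\<^bsub>H\<^esub> k)) = sweedler K H U (\<lambda>a1 a2. sweedler K H U
        (\<lambda>c1 c2. pure K H A (a1 \<otimes>\<^bsub>H\<^esub> c1) (f (a2 \<otimes>\<^bsub>H\<^esub> c2))) k) (S y)"
      unfolding lcf[OF H.m_closed[OF S_closed[OF y] k]]
      by (rule sweedler_mult[OF bialgH]) (use y k in simp_all)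
    also have "\<dots> = sweedler K H U ?Q y"
      by (rule H.sweedler_antipode) (use y k in simp_all)
    finally show ?thesis .
  qed
  have "lc (twist t f k) = sweedler K H U (\<lambda>x y. lc (f x) \<otimes>\<^bsub>U\<^esub> lc (f (S y \<otimes>\<^bsub>H\<^esub> k))) t"
    unfolding twist_def using tc k by (subst sweedler_commute[OF lc_lin(1)]) (simp_all add: lc_mult)
  also have "\<dots> = sweedler K H U (\<lambda>x y. sweedler K H U (\<lambda>u1 u2. sweedler K H U (\<lambda>y1 y2. sweedler K H U
      (\<lambda>c1 c2. pure K H A (u1 \<otimes>\<^bsub>H\<^esub> S y2 \<otimes>\<^bsub>H\<^esub> c1) (f u2 \<otimes>\<^bsub>A\<^esub> f (S y1 \<otimes>\<^bsub>H\<^esub> c2))) k) y) x) t"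
  proof (rule sweedler_cong[THEN fun_cong])
    fix x y assume x: "x \<in> carrier H" and y: "y \<in> carrier H"
    have "lc (f x) \<otimes>\<^bsub>U\<^esub> lc (f (S y \<otimes>\<^bsub>H\<^esub> k))
      = sweedler K H U (\<lambda>u1 u2. pure K H A u1 (f u2) \<otimes>\<^bsub>U\<^esub> sweedler K H U ?Q y) x"
      unfolding lcs[OF y] lcf[OF x] using x y k
      by (intro sweedler_commute[where g="\<lambda>z. z \<otimes>\<^bsub>U\<^esub> sweedler K H U ?Q y"]) simp_all
    also have "\<dots> = sweedler K H U (\<lambda>u1 u2. sweedler K H U (\<lambda>y1 y2. pure K H A u1 (f u2) \<otimes>\<^bsub>U\<^esub> ?Q y1 y2) y) x"
      using y k by (intro sweedler_cong[THEN fun_cong] sweedler_commute) simp_all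
    also have "\<dots> = sweedler K H U (\<lambda>u1 u2. sweedler K H U (\<lambda>y1 y2. sweedler K H U (\<lambda>c1 c2.
        pure K H A u1 (f u2) \<otimes>\<^bsub>U\<^esub> pure K H A (S y2 \<otimes>\<^bsub>H\<^esub> c1) (f (S y1 \<otimes>\<^bsub>H\<^esub> c2))) k) y) x"
      using k by (intro sweedler_cong[THEN fun_cong] sweedler_commute) simp_all
    finally show "lc (f x) \<otimes>\<^bsub>U\<^esub> lc (f (S y \<otimes>\<^bsub>H\<^esub> k)) = sweedler K H U (\<lambda>u1 u2. sweedler K H U
        (\<lambda>y1 y2. sweedler K H U (\<lambda>c1 c2. pure K H A (u1 \<otimes>\<^bsub>H\<^esub> S y2 \<otimes>\<^bsub>H\<^esub> c1) (f u2 \<otimes>\<^bsub>A\<^esub> f (S y1 \<otimes>\<^bsub>H\<^esub> c2))) k) y) x"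
      by (simp add: pure_mult_U H.m_assoc)
  qed
  also have "\<dots> = sweedler K H U (\<lambda>x y. sweedler K H U
      (\<lambda>c1 c2. pure K H A (\<one>\<^bsub>H\<^esub> \<otimes>\<^bsub>H\<^esub> c1) (f x \<otimes>\<^bsub>A\<^esub> f (S y \<otimes>\<^bsub>H\<^esub> c2))) k) t"
    by (rule H.ad_coinvariant_collapse[OF _ t, where M="\<lambda>g x y. sweedler K H U
      (\<lambda>c1 c2. pure K H A (g \<otimes>\<^bsub>H\<^esub> c1) (f x \<otimes>\<^bsub>A\<^esub> f (S y \<otimes>\<^bsub>H\<^esub> c2))) k"]) (use k in simp_all)
  also have "\<dots> = sweedler K H U (\<lambda>c1 c2. sweedler K H U
      (\<lambda>x y. pure K H A (\<one>\<^bsub>H\<^esub> \<otimes>\<^bsub>H\<^esub> c1) (f x \<otimes>\<^bsub>A\<^esub> f (S y \<otimes>\<^bsub>H\<^esub> c2))) t) k"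
    by (rule sweedler_swap) (use tc k in simp_all)
  also have "\<dots> = sweedler K H U (\<lambda>c1 c2. pure K H A (\<one>\<^bsub>H\<^esub> \<otimes>\<^bsub>H\<^esub> c1) (twist t f c2)) k"
    unfolding twist_def using tc
    by (intro sweedler_cong[THEN fun_cong] sweedler_commute[symmetric]) simp_all
  finally show "lc (twist t f k) = convolution K H U k1 (\<lambda>y. k2 (twist t f y)) k"
    using k_linear_closed[OF twist_linear[OF f tc]] by (simp add: convolution_def k1_k2)
qed

text \<open>The \<open>H\<close>-leg of the right coaction is t2 S(t3) k2, with t1 and t4 in the
  \<open>A\<close>-leg, so the antipode axiom collapses it.\<close>

lemma twist_right_colinear:
  assumes f: "k_linear K H A f" and rf: "right_colinear f" and tc: "t \<in> carrier H"
  shows "right_colinear (twist t f)"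
  unfolding right_colinear_def
proof
  fix k assume k: "k \<in> carrier H"
  note [simp] = k_linear_closed[OF f] f k_linear_comp[OF f]
  have rcf: "rc (f h) = sweedler K H V (\<lambda>x y. pure K A H (f x) y) h" if "h \<in> carrier H" for h
    using rf that by (simp add: right_colinear_def convolution_def j1_j2)
  let ?Q = "\<lambda>y1 y2. sweedler K H V (\<lambda>c1 c2. pure K A H (f (S y2 \<otimes>\<^bsub>H\<^esub> c1)) (S y1 \<otimes>\<^bsub>H\<^esub> c2)) k"
  have rcs: "rc (f (S y \<otimes>\<^bsub>H\<^esub> k)) = sweedler K H V ?Q y" if y: "y \<in> carrier H" for y
  proof -
    have "rc (f (S y \<otimes>\<^bsub>H\<^esub> k)) = sweedler K H V (\<lambda>a1 a2. sweedler K H V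
        (\<lambda>c1 c2. pure K A H (f (a1 \<otimes>\<^bsub>H\<^esub> c1)) (a2 \<otimes>\<^bsub>H\<^esub> c2)) k) (S y)"
      unfolding rcf[OF H.m_closed[OF S_closed[OF y] k]]
      by (rule sweedler_mult[OF bialgH]) (use y k in simp_all)
    also have "\<dots> = sweedler K H V ?Q y"
      by (rule H.sweedler_antipode) (use y k in simp_all)
    finally show ?thesis .
  qed
  have "rc (twist t f k) = sweedler K H V (\<lambda>x y. rc (f x) \<otimes>\<^bsub>V\<^esub> rc (f (S y \<otimes>\<^bsub>H\<^esub> k))) t"
    unfolding twist_def using tc k by (subst sweedler_commute[OF rc_lin(1)]) (simp_all add: rc_mult)
  also have "\<dots> = sweedler K H V (\<lambda>x y. sweedler K H V (\<lambda>u1 u2. sweedler K H V (\<lambda>y1 y2. sweedler K H V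
      (\<lambda>c1 c2. pure K A H (f u1 \<otimes>\<^bsub>A\<^esub> f (S y2 \<otimes>\<^bsub>H\<^esub> c1)) (u2 \<otimes>\<^bsub>H\<^esub> S y1 \<otimes>\<^bsub>H\<^esub> c2)) k) y) x) t"
  proof (rule sweedler_cong[THEN fun_cong])
    fix x y assume x: "x \<in> carrier H" and y: "y \<in> carrier H"
    have "rc (f x) \<otimes>\<^bsub>V\<^esub> rc (f (S y \<otimes>\<^bsub>H\<^esub> k))
      = sweedler K H V (\<lambda>u1 u2. pure K A H (f u1) u2 \<otimes>\<^bsub>V\<^esub> sweedler K H V ?Q y) x"
      unfolding rcs[OF y] rcf[OF x] using x y k
      by (intro sweedler_commute[where g="\<lambda>z. z \<otimes>\<^bsub>V\<^esub> sweedler K H V ?Q y"]) simp_all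
    also have "\<dots> = sweedler K H V (\<lambda>u1 u2. sweedler K H V (\<lambda>y1 y2. pure K A H (f u1) u2 \<otimes>\<^bsub>V\<^esub> ?Q y1 y2) y) x"
      using y k by (intro sweedler_cong[THEN fun_cong] sweedler_commute) simp_all
    also have "\<dots> = sweedler K H V (\<lambda>u1 u2. sweedler K H V (\<lambda>y1 y2. sweedler K H V (\<lambda>c1 c2.
        pure K A H (f u1) u2 \<otimes>\<^bsub>V\<^esub> pure K A H (f (S y2 \<otimes>\<^bsub>H\<^esub> c1)) (S y1 \<otimes>\<^bsub>H\<^esub> c2)) k) y) x"
      using k by (intro sweedler_cong[THEN fun_cong] sweedler_commute) simp_all
    finally show "rc (f x) \<otimes>\<^bsub>V\<^esub> rc (f (S y \<otimes>\<^bsub>H\<^esub> k)) = sweedler K H V (\<lambda>u1 u2. sweedler K H V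
        (\<lambda>y1 y2. sweedler K H V (\<lambda>c1 c2. pure K A H (f u1 \<otimes>\<^bsub>A\<^esub> f (S y2 \<otimes>\<^bsub>H\<^esub> c1)) (u2 \<otimes>\<^bsub>H\<^esub> S y1 \<otimes>\<^bsub>H\<^esub> c2)) k) y) x"
      by (simp add: pure_mult_V H.m_assoc)
  qed
  also have "\<dots> = sweedler K H V (\<lambda>x y. sweedler K H V
      (\<lambda>c1 c2. pure K A H (f x \<otimes>\<^bsub>A\<^esub> f (S y \<otimes>\<^bsub>H\<^esub> c1)) (\<one>\<^bsub>H\<^esub> \<otimes>\<^bsub>H\<^esub> c2)) k) t"
    by (rule H.sweedler_antipode_collapse[OF _ tc, where M="\<lambda>x y g. sweedler K H V
      (\<lambda>c1 c2. pure K A H (f x \<otimes>\<^bsub>A\<^esub> f (S y \<otimes>\<^bsub>H\<^esub> c1)) (g \<otimes>\<^bsub>H\<^esub> c2)) k"]) (use k in simp_all)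
  also have "\<dots> = sweedler K H V (\<lambda>c1 c2. sweedler K H V
      (\<lambda>x y. pure K A H (f x \<otimes>\<^bsub>A\<^esub> f (S y \<otimes>\<^bsub>H\<^esub> c1)) (\<one>\<^bsub>H\<^esub> \<otimes>\<^bsub>H\<^esub> c2)) t) k"
    by (rule sweedler_swap) (use tc k in simp_all)
  also have "\<dots> = sweedler K H V (\<lambda>c1 c2. pure K A H (twist t f c1) (\<one>\<^bsub>H\<^esub> \<otimes>\<^bsub>H\<^esub> c2)) k"
    unfolding twist_def using tc
    by (intro sweedler_cong[THEN fun_cong]
        sweedler_commute[where g="\<lambda>z. pure K A H z (\<one>\<^bsub>H\<^esub> \<otimes>\<^bsub>H\<^esub> _)", symmetric]) simp_all
  finally show "rc (twist t f k) = convolution K H V (\<lambda>y. j1 (twist t f y)) j2 k"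
    using k_linear_closed[OF twist_linear[OF f tc]] by (simp add: convolution_def j1_j2)
qed

section \<open>Removing the multiplicative defect along the powers of \<open>J\<close>\<close>

definition defect :: "('h \<Rightarrow> 'a) \<Rightarrow> 'h \<Rightarrow> 'h \<Rightarrow> 'a"
  where "defect f h k = f (h \<otimes>\<^bsub>H\<^esub> k) \<ominus>\<^bsub>A\<^esub> f h \<otimes>\<^bsub>A\<^esub> f k"

text \<open>With D = \<open>defect f\<close>, the correction is g(h) = \<Sum> f(t1) D(S(t2), h), and
  v = twist(1) is mapped to 1 by \<open>p\<close>. The cocycle identity for D and
  \<open>casimir\<close> give the new defect (1 - v) D(h,k) + \<Sum> D(h,t1) D(S(t2),k) - g(h) g(k).
  Each term is, or is a sum of, products of an element of \<open>J\<close> and one of the given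
  power.\<close>

lemma lift_step:
  assumes f: "bicolinear_section f" and t: "ad_coinvariant_integral K H S t"
    and J: "ideal J A" and ker: "\<And>a. \<lbrakk>a \<in> carrier A; p a = \<zero>\<^bsub>H\<^esub>\<rbrakk> \<Longrightarrow> a \<in> J"
    and D: "\<And>h k. \<lbrakk>h \<in> carrier H; k \<in> carrier H\<rbrakk> \<Longrightarrow> defect f h k \<in> ideal_power A J (Suc n)"
  shows "\<exists>f'. bicolinear_section f'
    \<and> (\<forall>h \<in> carrier H. \<forall>k \<in> carrier H. defect f' h k \<in> ideal_power A J (Suc (Suc n)))"
proof -
  let ?I = "ideal_power A J (Suc n)" and ?I' = "ideal_power A J (Suc (Suc n))"
  note RA = A.ring_axioms
  interpret I: ideal ?I A by (rule ideal_power_ideal[OF RA J])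
  interpret I': ideal ?I' A by (rule ideal_power_ideal[OF RA J])
  have IJ: "?I \<subseteq> J" by (rule ideal_power_Suc_subset[OF RA J])
  have tc [simp]: "t \<in> carrier H" and te: "counit H t = \<one>\<^bsub>K\<^esub>"
    and int: "\<And>h. h \<in> carrier H \<Longrightarrow> h \<otimes>\<^bsub>H\<^esub> t = counit H h \<odot>\<^bsub>H\<^esub> t"
    using t by (simp_all add: ad_coinvariant_integral_def)
  have fl: "k_linear K H A f" and pf: "\<And>h. h \<in> carrier H \<Longrightarrow> p (f h) = h"
    and lf: "left_colinear f" and rf: "right_colinear f"
    using f by (simp_all add: bicolinear_section_iff)
  note [simp] = k_linear_closed[OF fl] fl k_linear_comp[OF fl]
  let ?tw = "twist t f"
  have twl: "k_linear K H A ?tw" by (rule twist_linear[OF fl tc])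
  note [simp] = k_linear_closed[OF twl]
  define v where "v = ?tw \<one>\<^bsub>H\<^esub>"
  have v [simp]: "v \<in> carrier A" by (simp add: v_def)
  have ptw: "p (?tw k) = k" if k: "k \<in> carrier H" for k
  proof -
    have "p (?tw k) = sweedler K H H (\<lambda>x y. p (f x \<otimes>\<^bsub>A\<^esub> f (S y \<otimes>\<^bsub>H\<^esub> k))) t"
      unfolding twist_def using k by (intro sweedler_commute[OF p_lin]) simp_all
    also have "\<dots> = sweedler K H H (\<lambda>x y. x \<otimes>\<^bsub>H\<^esub> S y \<otimes>\<^bsub>H\<^esub> k) t"
      using k by (simp add: p_mult pf H.m_assoc)
    also have "\<dots> = sweedler K H H (\<lambda>x y. x \<otimes>\<^bsub>H\<^esub> S y) t \<otimes>\<^bsub>H\<^esub> k"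
      using k by (intro sweedler_commute[where g="\<lambda>z. z \<otimes>\<^bsub>H\<^esub> k", symmetric]) simp_all
    finally show ?thesis using H.antipode_right[OF tc] k by (simp add: sweedler_eq te)
  qed
  \<comment> \<open>This form exhibits colinearity, as \<open>twist t f\<close> and the multiples of
    \<open>f\<close> by the coinvariant \<open>v\<close> are colinear. The form \<Sum> f(t1)
    D(S(t2), h), established in \<open>gD\<close>, shows that the values lie in the given power of
    \<open>J\<close>.\<close>
  define g where "g = (\<lambda>h. ?tw h \<oplus>\<^bsub>A\<^esub> (\<ominus>\<^bsub>A\<^esub> v) \<otimes>\<^bsub>A\<^esub> f h)"
  define f' where "f' = (\<lambda>h. f h \<oplus>\<^bsub>A\<^esub> g h)"
  have gl: "k_linear K H A g" unfolding g_def using twl by simp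
  have f'l: "k_linear K H A f'" unfolding f'_def using gl by simp
  note [simp] = k_linear_closed[OF gl]
  have pf': "p (f' h) = h" if h: "h \<in> carrier H" for h
    using h by (simp add: f'_def g_def k_linear_add[OF p_lin] p_mult pf ptw v_def
        k_linear_uminus[OF modA modH p_lin] H.l_minus H.r_neg)
  have lctw: "left_colinear ?tw" and rctw: "right_colinear ?tw"
    by (rule twist_left_colinear[OF fl lf t], rule twist_right_colinear[OF fl rf tc])
  have "lc v = convolution K H U k1 (\<lambda>y. k2 (?tw y)) \<one>\<^bsub>H\<^esub>"
    using lctw by (simp add: v_def left_colinear_def)
  also have "\<dots> = k2 v"
    unfolding convolution_def using twl k_linear_comp[OF twl]
    by (subst sweedler_one[OF bialgH]) (simp_all add: v_def algebra_homD(4)[OF k1_hom])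
  finally have lcv: "lc (\<ominus>\<^bsub>A\<^esub> v) = k2 (\<ominus>\<^bsub>A\<^esub> v)"
    by (simp add: k_linear_uminus[OF modA modU lc_lin(1)] k_linear_uminus[OF modA modU k_lin(2)])
  have "rc v = convolution K H V (\<lambda>y. j1 (?tw y)) j2 \<one>\<^bsub>H\<^esub>"
    using rctw by (simp add: v_def right_colinear_def)
  also have "\<dots> = j1 v"
    unfolding convolution_def using twl k_linear_comp[OF twl]
    by (subst sweedler_one[OF bialgH]) (simp_all add: v_def algebra_homD(4)[OF j2_hom])
  finally have rcv: "rc (\<ominus>\<^bsub>A\<^esub> v) = j1 (\<ominus>\<^bsub>A\<^esub> v)"
    by (simp add: k_linear_uminus[OF modA modV rc_lin(1)] k_linear_uminus[OF modA modV j_lin(1)])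
  have wfl: "k_linear K H A (\<lambda>h. (\<ominus>\<^bsub>A\<^esub> v) \<otimes>\<^bsub>A\<^esub> f h)" by simp
  have "left_colinear f'" "right_colinear f'"
    unfolding f'_def g_def
    by (intro colinear_add colinear_mult k_linear_plus modA k_linear_mult_right algA fl twl
        lf rf lctw rctw lcv rcv; simp)+
  then have bic: "bicolinear_section f'"
    using f'l pf' by (simp add: bicolinear_section_iff)
  let ?D = "defect f"
  have Dc [simp]: "?D h k \<in> carrier A" if "h \<in> carrier H" "k \<in> carrier H" for h k
    using that by (simp add: defect_def)
  have Dl [simp]: "k_linear K W A (\<lambda>x. ?D (b x) k)" if "k \<in> carrier H" "k_linear K W H b"
    for W :: "('k, 'u, 'v) module_scheme" and b k
    unfolding defect_def using that by (intro k_linear_diff) simp_all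
  have gD: "g h = sweedler K H A (\<lambda>x y. f x \<otimes>\<^bsub>A\<^esub> ?D (S y) h) t" if h: "h \<in> carrier H" for h
  proof -
    have "sweedler K H A (\<lambda>x y. f x \<otimes>\<^bsub>A\<^esub> ?D (S y) h) t
      = sweedler K H A (\<lambda>x y. f x \<otimes>\<^bsub>A\<^esub> f (S y \<otimes>\<^bsub>H\<^esub> h) \<ominus>\<^bsub>A\<^esub> f x \<otimes>\<^bsub>A\<^esub> f (S y \<otimes>\<^bsub>H\<^esub> \<one>\<^bsub>H\<^esub>) \<otimes>\<^bsub>A\<^esub> f h) t"
      using h by (simp add: defect_def a_minus_def A.r_distr A.r_minus A.m_assoc)
    also have "\<dots> = ?tw h \<ominus>\<^bsub>A\<^esub> sweedler K H A (\<lambda>x y. f x \<otimes>\<^bsub>A\<^esub> f (S y \<otimes>\<^bsub>H\<^esub> \<one>\<^bsub>H\<^esub>) \<otimes>\<^bsub>A\<^esub> f h) t"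
      unfolding twist_def using h by (intro sweedler_diff) simp_all
    also have "sweedler K H A (\<lambda>x y. f x \<otimes>\<^bsub>A\<^esub> f (S y \<otimes>\<^bsub>H\<^esub> \<one>\<^bsub>H\<^esub>) \<otimes>\<^bsub>A\<^esub> f h) t = v \<otimes>\<^bsub>A\<^esub> f h"
      unfolding v_def twist_def using h
      by (intro sweedler_commute[where g="\<lambda>z. z \<otimes>\<^bsub>A\<^esub> f h", symmetric]) simp_all
    finally show ?thesis using h by (simp add: g_def a_minus_def A.l_minus)
  qed
  let ?sg = "\<lambda>h k. sweedler K H A (\<lambda>x y. ?D h x \<otimes>\<^bsub>A\<^esub> ?D (S y) k) t"
  \<comment> \<open>D is a coboundary up to second order: rearranged, v D(h,k) is f(h) g(k) - g(h k)
    + g(h) f(k) plus the quadratic term \<open>?sg\<close>.\<close>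
  have fg: "f h \<otimes>\<^bsub>A\<^esub> g k = (v \<otimes>\<^bsub>A\<^esub> ?D h k \<oplus>\<^bsub>A\<^esub> (g (h \<otimes>\<^bsub>H\<^esub> k) \<ominus>\<^bsub>A\<^esub> g h \<otimes>\<^bsub>A\<^esub> f k)) \<ominus>\<^bsub>A\<^esub> ?sg h k"
    if h: "h \<in> carrier H" and k: "k \<in> carrier H" for h k
  proof -
    have "f h \<otimes>\<^bsub>A\<^esub> g k = sweedler K H A (\<lambda>x y. f h \<otimes>\<^bsub>A\<^esub> (f x \<otimes>\<^bsub>A\<^esub> ?D (S y) k)) t"
      unfolding gD[OF k] using h k by (intro sweedler_commute) simp_all
    also have "\<dots> = sweedler K H A (\<lambda>x y. f (h \<otimes>\<^bsub>H\<^esub> x) \<otimes>\<^bsub>A\<^esub> ?D (S y) k \<ominus>\<^bsub>A\<^esub> ?D h x \<otimes>\<^bsub>A\<^esub> ?D (S y) k) t"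
    proof (rule sweedler_cong[THEN fun_cong])
      fix x y assume c: "x \<in> carrier H" "y \<in> carrier H"
      have "f h \<otimes>\<^bsub>A\<^esub> f x = f (h \<otimes>\<^bsub>H\<^esub> x) \<ominus>\<^bsub>A\<^esub> ?D h x"
        using c h by (simp add: defect_def a_minus_def A.minus_add A.r_neg1 A.a_assoc[symmetric] A.r_neg)
      then show "f h \<otimes>\<^bsub>A\<^esub> (f x \<otimes>\<^bsub>A\<^esub> ?D (S y) k)
        = f (h \<otimes>\<^bsub>H\<^esub> x) \<otimes>\<^bsub>A\<^esub> ?D (S y) k \<ominus>\<^bsub>A\<^esub> ?D h x \<otimes>\<^bsub>A\<^esub> ?D (S y) k"
        using c h k by (simp add: A.m_assoc[symmetric] a_minus_def A.l_distr A.l_minus)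
    qed
    also have "\<dots> = sweedler K H A (\<lambda>x y. f (h \<otimes>\<^bsub>H\<^esub> x) \<otimes>\<^bsub>A\<^esub> ?D (S y) k) t \<ominus>\<^bsub>A\<^esub> ?sg h k"
      using h k by (intro sweedler_diff) simp_all
    \<comment> \<open>\<open>casimir\<close> carries \<open>h\<close> from the first leg of the
      idempotent to the second, into the argument of D.\<close>
    also have "sweedler K H A (\<lambda>x y. f (h \<otimes>\<^bsub>H\<^esub> x) \<otimes>\<^bsub>A\<^esub> ?D (S y) k) t
      = sweedler K H A (\<lambda>x y. f x \<otimes>\<^bsub>A\<^esub> ?D (S y \<otimes>\<^bsub>H\<^esub> h) k) t"
      by (rule H.casimir[OF modA tc h int, where b="\<lambda>x y. f x \<otimes>\<^bsub>A\<^esub> ?D y k"])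
        (use h k Dl[OF k k_linear_id[of K H]] in simp_all)
    also have "\<dots> = sweedler K H A (\<lambda>x y. f x \<otimes>\<^bsub>A\<^esub> f (S y \<otimes>\<^bsub>H\<^esub> \<one>\<^bsub>H\<^esub>) \<otimes>\<^bsub>A\<^esub> ?D h k \<oplus>\<^bsub>A\<^esub>
        (f x \<otimes>\<^bsub>A\<^esub> ?D (S y) (h \<otimes>\<^bsub>H\<^esub> k) \<ominus>\<^bsub>A\<^esub> f x \<otimes>\<^bsub>A\<^esub> ?D (S y) h \<otimes>\<^bsub>A\<^esub> f k)) t"
    proof (rule sweedler_cong[THEN fun_cong])
      fix x y assume c: "x \<in> carrier H" "y \<in> carrier H"
      let ?a = "f (S y)" and ?b = "f h" and ?c = "f k"
      \<comment> \<open>The Hochschild identity expressing D(a b, c) by a D(b, c) + D(a, b c) - D(a,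
        b) c, where \<open>ab\<close>, \<open>bz\<close> and \<open>d\<close> stand for the values
        of \<open>f\<close> on the products. With values of \<open>f\<close> as outer factors it
        holds exactly.\<close>
      have cocycle: "d \<ominus>\<^bsub>A\<^esub> ab \<otimes>\<^bsub>A\<^esub> z = a \<otimes>\<^bsub>A\<^esub> (bz \<ominus>\<^bsub>A\<^esub> b \<otimes>\<^bsub>A\<^esub> z) \<oplus>\<^bsub>A\<^esub>
          ((d \<ominus>\<^bsub>A\<^esub> a \<otimes>\<^bsub>A\<^esub> bz) \<ominus>\<^bsub>A\<^esub> (ab \<ominus>\<^bsub>A\<^esub> a \<otimes>\<^bsub>A\<^esub> b) \<otimes>\<^bsub>A\<^esub> z)"
        if "a \<in> carrier A" "b \<in> carrier A" "z \<in> carrier A" "ab \<in> carrier A" "bz \<in> carrier A" "d \<in> carrier A"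
        for a b z ab bz d
        using that by algebra
      have "?D (S y \<otimes>\<^bsub>H\<^esub> h) k = ?a \<otimes>\<^bsub>A\<^esub> ?D h k \<oplus>\<^bsub>A\<^esub>
          (?D (S y) (h \<otimes>\<^bsub>H\<^esub> k) \<ominus>\<^bsub>A\<^esub> ?D (S y) h \<otimes>\<^bsub>A\<^esub> ?c)"
        unfolding defect_def using c h k by (subst H.m_assoc) (auto intro!: cocycle)
      then show "f x \<otimes>\<^bsub>A\<^esub> ?D (S y \<otimes>\<^bsub>H\<^esub> h) k = f x \<otimes>\<^bsub>A\<^esub> f (S y \<otimes>\<^bsub>H\<^esub> \<one>\<^bsub>H\<^esub>) \<otimes>\<^bsub>A\<^esub> ?D h k \<oplus>\<^bsub>A\<^esub>
        (f x \<otimes>\<^bsub>A\<^esub> ?D (S y) (h \<otimes>\<^bsub>H\<^esub> k) \<ominus>\<^bsub>A\<^esub> f x \<otimes>\<^bsub>A\<^esub> ?D (S y) h \<otimes>\<^bsub>A\<^esub> f k)"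
        using c h k by (simp add: a_minus_def A.r_distr A.r_minus A.m_assoc)
    qed
    also have "\<dots> = sweedler K H A (\<lambda>x y. f x \<otimes>\<^bsub>A\<^esub> f (S y \<otimes>\<^bsub>H\<^esub> \<one>\<^bsub>H\<^esub>) \<otimes>\<^bsub>A\<^esub> ?D h k) t \<oplus>\<^bsub>A\<^esub>
        sweedler K H A (\<lambda>x y. f x \<otimes>\<^bsub>A\<^esub> ?D (S y) (h \<otimes>\<^bsub>H\<^esub> k) \<ominus>\<^bsub>A\<^esub> f x \<otimes>\<^bsub>A\<^esub> ?D (S y) h \<otimes>\<^bsub>A\<^esub> f k) t"
      using h k by (intro sweedler_add) simp_all
    also have "sweedler K H A (\<lambda>x y. f x \<otimes>\<^bsub>A\<^esub> ?D (S y) (h \<otimes>\<^bsub>H\<^esub> k) \<ominus>\<^bsub>A\<^esub> f x \<otimes>\<^bsub>A\<^esub> ?D (S y) h \<otimes>\<^bsub>A\<^esub> f k) t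
      = sweedler K H A (\<lambda>x y. f x \<otimes>\<^bsub>A\<^esub> ?D (S y) (h \<otimes>\<^bsub>H\<^esub> k)) t
        \<ominus>\<^bsub>A\<^esub> sweedler K H A (\<lambda>x y. f x \<otimes>\<^bsub>A\<^esub> ?D (S y) h \<otimes>\<^bsub>A\<^esub> f k) t"
      using h k by (intro sweedler_diff) simp_all
    also have "sweedler K H A (\<lambda>x y. f x \<otimes>\<^bsub>A\<^esub> ?D (S y) h \<otimes>\<^bsub>A\<^esub> f k) t = g h \<otimes>\<^bsub>A\<^esub> f k"
      unfolding gD[OF h] using h k
      by (intro sweedler_commute[where g="\<lambda>z. z \<otimes>\<^bsub>A\<^esub> f k", symmetric]) simp_all
    also have "sweedler K H A (\<lambda>x y. f x \<otimes>\<^bsub>A\<^esub> f (S y \<otimes>\<^bsub>H\<^esub> \<one>\<^bsub>H\<^esub>) \<otimes>\<^bsub>A\<^esub> ?D h k) t = v \<otimes>\<^bsub>A\<^esub> ?D h k"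
      unfolding v_def twist_def using h k
      by (intro sweedler_commute[where g="\<lambda>z. z \<otimes>\<^bsub>A\<^esub> ?D h k", symmetric]) simp_all
    finally show ?thesis using h k by (simp add: gD)
  qed
  have subI: "submodule ?I K A" "submodule ?I' K A"
    by (rule ideal_submodule[OF algA], rule ideal_power_ideal[OF RA J])+
  have gI: "g h \<in> ?I" if h: "h \<in> carrier H" for h
    unfolding gD[OF h] sweedler_eq[OF coH tc]
    by (rule tlift_mem[OF modA subI(1) comult_closed[OF coH tc] modH modH])
      (rule I.I_l_closed[OF D], use h in simp_all)
  have sgI: "?sg h k \<in> ?I'" if h: "h \<in> carrier H" and k: "k \<in> carrier H" for h k
    unfolding sweedler_eq[OF coH tc]
    by (rule tlift_mem[OF modA subI(2) comult_closed[OF coH tc] modH modH])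
      (rule ideal_power_mult[OF subsetD[OF IJ D] D], use h k in simp_all)
  have "\<one>\<^bsub>A\<^esub> \<ominus>\<^bsub>A\<^esub> v \<in> J"
    by (rule ker) (simp_all add: a_minus_def k_linear_add[OF p_lin] k_linear_uminus[OF modA modH p_lin]
        v_def ptw p_one H.r_neg)
  then have vD: "(\<one>\<^bsub>A\<^esub> \<ominus>\<^bsub>A\<^esub> v) \<otimes>\<^bsub>A\<^esub> ?D h k \<in> ?I'" if "h \<in> carrier H" "k \<in> carrier H" for h k
    using ideal_power_mult[OF _ D[OF that]] by blast
  have "defect f' h k \<in> ?I'" if h: "h \<in> carrier H" and k: "k \<in> carrier H" for h k
  proof -
    have sgc: "?sg h k \<in> carrier A" using h k by simp
    have key: "(ab \<oplus>\<^bsub>A\<^esub> ghk) \<ominus>\<^bsub>A\<^esub> (a \<oplus>\<^bsub>A\<^esub> gh) \<otimes>\<^bsub>A\<^esub> (b \<oplus>\<^bsub>A\<^esub> gk)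
      = (\<one>\<^bsub>A\<^esub> \<ominus>\<^bsub>A\<^esub> v) \<otimes>\<^bsub>A\<^esub> (ab \<ominus>\<^bsub>A\<^esub> a \<otimes>\<^bsub>A\<^esub> b) \<oplus>\<^bsub>A\<^esub> sg \<oplus>\<^bsub>A\<^esub> (\<ominus>\<^bsub>A\<^esub> (gh \<otimes>\<^bsub>A\<^esub> gk))"
      if c: "a \<in> carrier A" "b \<in> carrier A" "ab \<in> carrier A" "gh \<in> carrier A" "gk \<in> carrier A"
        "ghk \<in> carrier A" "sg \<in> carrier A"
        and e: "a \<otimes>\<^bsub>A\<^esub> gk = (v \<otimes>\<^bsub>A\<^esub> (ab \<ominus>\<^bsub>A\<^esub> a \<otimes>\<^bsub>A\<^esub> b) \<oplus>\<^bsub>A\<^esub> (ghk \<ominus>\<^bsub>A\<^esub> gh \<otimes>\<^bsub>A\<^esub> b)) \<ominus>\<^bsub>A\<^esub> sg"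
      for a b ab gh gk ghk sg
    proof -
      have "(ab \<oplus>\<^bsub>A\<^esub> ghk) \<ominus>\<^bsub>A\<^esub> (a \<oplus>\<^bsub>A\<^esub> gh) \<otimes>\<^bsub>A\<^esub> (b \<oplus>\<^bsub>A\<^esub> gk)
        = ((ab \<oplus>\<^bsub>A\<^esub> ghk) \<ominus>\<^bsub>A\<^esub> (a \<otimes>\<^bsub>A\<^esub> b \<oplus>\<^bsub>A\<^esub> gh \<otimes>\<^bsub>A\<^esub> b \<oplus>\<^bsub>A\<^esub> gh \<otimes>\<^bsub>A\<^esub> gk)) \<ominus>\<^bsub>A\<^esub> a \<otimes>\<^bsub>A\<^esub> gk"
        using c by algebra
      also have "\<dots> = (\<one>\<^bsub>A\<^esub> \<ominus>\<^bsub>A\<^esub> v) \<otimes>\<^bsub>A\<^esub> (ab \<ominus>\<^bsub>A\<^esub> a \<otimes>\<^bsub>A\<^esub> b) \<oplus>\<^bsub>A\<^esub> sg \<oplus>\<^bsub>A\<^esub> (\<ominus>\<^bsub>A\<^esub> (gh \<otimes>\<^bsub>A\<^esub> gk))"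
        unfolding e using c v by algebra
      finally show ?thesis .
    qed
    have dd: "defect f' h k = (f (h \<otimes>\<^bsub>H\<^esub> k) \<oplus>\<^bsub>A\<^esub> g (h \<otimes>\<^bsub>H\<^esub> k))
        \<ominus>\<^bsub>A\<^esub> (f h \<oplus>\<^bsub>A\<^esub> g h) \<otimes>\<^bsub>A\<^esub> (f k \<oplus>\<^bsub>A\<^esub> g k)" by (simp only: defect_def f'_def)
    have eq: "defect f' h k = (\<one>\<^bsub>A\<^esub> \<ominus>\<^bsub>A\<^esub> v) \<otimes>\<^bsub>A\<^esub> ?D h k \<oplus>\<^bsub>A\<^esub> ?sg h k \<oplus>\<^bsub>A\<^esub> (\<ominus>\<^bsub>A\<^esub> (g h \<otimes>\<^bsub>A\<^esub> g k))"
      unfolding dd using key[of "f h" "f k" "f (h \<otimes>\<^bsub>H\<^esub> k)" "g h" "g k" "g (h \<otimes>\<^bsub>H\<^esub> k)" "?sg h k"] fg[OF h k] h k sgc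
      by (simp add: defect_def[of f h k])
    have "\<ominus>\<^bsub>A\<^esub> (g h \<otimes>\<^bsub>A\<^esub> g k) \<in> ?I'"
      by (rule I'.a_inv_closed[OF ideal_power_mult[OF subsetD[OF IJ gI[OF h]] gI[OF k]]])
    then show ?thesis unfolding eq by (intro I'.a_closed vD[OF h k] sgI[OF h k])
  qed
  then show ?thesis using bic by blast
qed

lemma lift_exists:
  assumes f: "bicolinear_section f" and t: "ad_coinvariant_integral K H S t"
    and J: "ideal J A" and ker: "\<And>a. \<lbrakk>a \<in> carrier A; p a = \<zero>\<^bsub>H\<^esub>\<rbrakk> \<Longrightarrow> a \<in> J"
    and nil: "ideal_power A J (Suc n) = {\<zero>\<^bsub>A\<^esub>}"
  shows "\<exists>s. split_bialgebra K A H S p s"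
proof -
  note RA = A.ring_axioms
  have ex: "\<exists>f. bicolinear_section f
    \<and> (\<forall>h \<in> carrier H. \<forall>k \<in> carrier H. defect f h k \<in> ideal_power A J (Suc m))" for m
  proof (induction m)
    case 0
    have fl: "k_linear K H A f" and pf: "\<And>h. h \<in> carrier H \<Longrightarrow> p (f h) = h"
      using f by (simp_all add: bicolinear_section_iff)
    note [simp] = k_linear_closed[OF fl]
    have "defect f h k \<in> J" if "h \<in> carrier H" "k \<in> carrier H" for h k
      using that by (intro ker) (simp_all add: defect_def a_minus_def k_linear_add[OF p_lin]
          k_linear_uminus[OF modA modH p_lin] p_mult pf H.r_neg)
    then show ?case using f ideal_power_one[OF RA J] by (auto simp del: ideal_power.simps)
  next
    case (Suc m)
    then obtain f where f: "bicolinear_section f"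
      and D: "\<And>h k. \<lbrakk>h \<in> carrier H; k \<in> carrier H\<rbrakk> \<Longrightarrow> defect f h k \<in> ideal_power A J (Suc m)" by blast
    show ?case by (rule lift_step[OF f t J ker D])
  qed
  then obtain s where s: "bicolinear_section s"
    and D: "\<forall>h \<in> carrier H. \<forall>k \<in> carrier H. defect s h k \<in> ideal_power A J (Suc n)"
    using ex[of n] by blast
  have sl: "k_linear K H A s" and ps: "\<And>h. h \<in> carrier H \<Longrightarrow> p (s h) = h"
    using s by (simp_all add: bicolinear_section_iff)
  note [simp] = k_linear_closed[OF sl]
  have diff: "x = y" if "x \<ominus>\<^bsub>A\<^esub> y = \<zero>\<^bsub>A\<^esub>" "x \<in> carrier A" "y \<in> carrier A" for x y
  proof -
    have "x = (x \<ominus>\<^bsub>A\<^esub> y) \<oplus>\<^bsub>A\<^esub> y" using that(2,3) by algebra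
    then show ?thesis using that by simp
  qed
  have mult: "s (h \<otimes>\<^bsub>H\<^esub> k) = s h \<otimes>\<^bsub>A\<^esub> s k" if h: "h \<in> carrier H" and k: "k \<in> carrier H" for h k
  proof -
    have "s (h \<otimes>\<^bsub>H\<^esub> k) \<ominus>\<^bsub>A\<^esub> s h \<otimes>\<^bsub>A\<^esub> s k = \<zero>\<^bsub>A\<^esub>"
      using D h k unfolding nil defect_def by blast
    then show ?thesis by (rule diff) (simp_all add: h k)
  qed
  \<comment> \<open>Multiplicativity leaves s(1) an idempotent. So 1 - s(1) is an idempotent in
    \<open>J\<close>, hence in every power of \<open>J\<close>, and therefore zero.\<close>
  let ?e = "s \<one>\<^bsub>H\<^esub>" and ?i = "\<one>\<^bsub>A\<^esub> \<ominus>\<^bsub>A\<^esub> s \<one>\<^bsub>H\<^esub>"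
  have e: "?e \<in> carrier A" "?e \<otimes>\<^bsub>A\<^esub> ?e = ?e" using mult[of "\<one>\<^bsub>H\<^esub>" "\<one>\<^bsub>H\<^esub>"] by simp_all
  have ii: "?i \<otimes>\<^bsub>A\<^esub> ?i = ?i"
  proof -
    have "(\<one>\<^bsub>A\<^esub> \<oplus>\<^bsub>A\<^esub> y) \<otimes>\<^bsub>A\<^esub> z = z \<oplus>\<^bsub>A\<^esub> y \<otimes>\<^bsub>A\<^esub> z" if "y \<in> carrier A" "z \<in> carrier A" for y z
      using that by (simp only: A.l_distr A.l_one A.one_closed)
    moreover have "(\<ominus>\<^bsub>A\<^esub> ?e) \<otimes>\<^bsub>A\<^esub> ?i = \<zero>\<^bsub>A\<^esub>"
      using e by (simp add: a_minus_def A.r_distr A.l_minus A.r_minus A.l_neg)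
    ultimately show ?thesis using e(1) by (simp add: a_minus_def)
  qed
  have iJ: "?i \<in> J"
    by (rule ker) (simp_all add: a_minus_def k_linear_add[OF p_lin] k_linear_uminus[OF modA modH p_lin]
        ps p_one H.r_neg)
  have "?i \<in> ideal_power A J (Suc m)" for m
  proof (induction m)
    case 0
    then show ?case using iJ ideal_power_one[OF RA J] by simp
  next
    case (Suc m)
    then show ?case using ideal_power_mult[OF iJ Suc] ii by simp
  qed
  then have "?i = \<zero>\<^bsub>A\<^esub>" using nil by blast
  then have one: "s \<one>\<^bsub>H\<^esub> = \<one>\<^bsub>A\<^esub>" using diff[OF _ A.one_closed e(1)] by simp
  have "split_bialgebra K A H S p s"
    by (intro split_bialgebra.intro split_bialgebra_axioms.intro)
      (use s sl mult one in \<open>simp_all add: algebra_hom_def bialgebra_projection_axioms\<close>)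
  then show ?thesis by blast
qed

end

section \<open>The projection onto the quotient by the radical\<close>

lemma quot_bialgebra_sel:
  "carrier (quot_bialgebra K A J) = a_rcosets\<^bsub>A\<^esub> J"
  "mult (quot_bialgebra K A J) = rcoset_mult A J"
  "one (quot_bialgebra K A J) = J +>\<^bsub>A\<^esub> \<one>\<^bsub>A\<^esub>"
  "zero (quot_bialgebra K A J) = J"
  "add (quot_bialgebra K A J) = set_add A"
  "smult (quot_bialgebra K A J) = smult (quot_module A J)"
  "comult (quot_bialgebra K A J) = (\<lambda>X. tlift K (tensor K (quot_module A J) (quot_module A J))
      (\<lambda>x y. pure K (quot_module A J) (quot_module A J) (J +>\<^bsub>A\<^esub> x) (J +>\<^bsub>A\<^esub> y)) (comult A (SOME a. a \<in> X)))"
  "counit (quot_bialgebra K A J) = (\<lambda>X. counit A (SOME a. a \<in> X))"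
  by (simp_all add: quot_bialgebra_def module.extend_def bialg.fields_def quot_module_def ring.extend_def
      module.fields_def FactRing_def)

lemma quot_bialgebra_tensor:
  "tensor K (quot_bialgebra K A J) W = tensor K (quot_module A J) W"
  "pure K (quot_bialgebra K A J) W = pure K (quot_module A J) W"
  "tensor K W (quot_bialgebra K A J) = tensor K W (quot_module A J)"
  "pure K W (quot_bialgebra K A J) = pure K W (quot_module A J)"
  by (intro tensor_cong; simp add: quot_bialgebra_sel quot_module_simps)+

lemma k_linear_quot_bialgebra:
  "k_linear K (quot_bialgebra K A J) W f = k_linear K (quot_module A J) W f"
  by (simp add: k_linear_def quot_bialgebra_sel quot_module_simps)

lemma kernel_submodule:
  assumes V: "module K V" and W: "module K W" and f: "k_linear K V W f"
  shows "submodule {x \<in> carrier V. f x = \<zero>\<^bsub>W\<^esub>} K V"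
proof -
  interpret V: module K V by fact
  interpret W: module K W by fact
  show ?thesis
    by (rule V.submoduleI)
      (auto simp: k_linear_zero[OF V W f] k_linear_uminus[OF V W f] k_linear_add[OF f] k_linear_smult[OF f])
qed

locale hopf_quotient =
  fixes K :: "('k, 'l) ring_scheme" and A :: "('k, 'a, 'm) bialg_scheme" and J :: "'a set"
    and S :: "'a set \<Rightarrow> 'a set"
  assumes A: "bialgebra K A" and coid: "coideal K A J" and hopf: "hopf_algebra K (quot_bialgebra K A J) S"
begin

abbreviation "H \<equiv> quot_bialgebra K A J"

lemma sub: "submodule J K A" using coid by (simp add: coideal_def)

interpretation A: bialgebra K A by (rule A)
interpretation H: hopf_algebra K H S by (rule hopf)
interpretation J: abelian_subgroup J A
  by (rule submodule_abelian_subgroup[OF A.module_axioms sub])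

text \<open>Read off from the ring laws of the quotient, whose zero is the coset \<open>J\<close>:
  zero times the coset of \<open>a\<close> is zero, and \<open>rcoset_mult\<close> is the union of
  the cosets of all products of representatives, so these products lie in \<open>J\<close>.\<close>

lemma J_ideal: "ideal J A"
proof (rule idealI)
  show "ring A" by (rule A.ring_axioms)
  show "subgroup J (add_monoid A)" by (rule J.a_subgroup)
  have self: "a \<in> J +>\<^bsub>A\<^esub> a" if "a \<in> carrier A" for a by (rule J.a_rcos_self[OF that])
  have cl: "J +>\<^bsub>A\<^esub> a \<in> carrier H" if "a \<in> carrier A" for a
    using that by (auto simp: quot_bialgebra_sel A_RCOSETS_def')
  fix x a assume x: "x \<in> J" and a: "a \<in> carrier A"
  have xc: "x \<in> carrier A" using J.a_Hcarr[OF x] .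
  have "rcoset_mult A J J (J +>\<^bsub>A\<^esub> a) = J" "rcoset_mult A J (J +>\<^bsub>A\<^esub> a) J = J"
    using H.l_null[OF cl[OF a]] H.r_null[OF cl[OF a]] by (simp_all add: quot_bialgebra_sel)
  then have "J +>\<^bsub>A\<^esub> (x \<otimes>\<^bsub>A\<^esub> a) \<subseteq> J" "J +>\<^bsub>A\<^esub> (a \<otimes>\<^bsub>A\<^esub> x) \<subseteq> J"
    using x self[OF a] unfolding rcoset_mult_def by blast+
  then show "x \<otimes>\<^bsub>A\<^esub> a \<in> J" "a \<otimes>\<^bsub>A\<^esub> x \<in> J" using self xc a by blast+
qed

interpretation JI: ideal J A by (rule J_ideal)

abbreviation proj :: "'a \<Rightarrow> 'a set" where "proj a \<equiv> J +>\<^bsub>A\<^esub> a"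

lemma proj_hom: "algebra_hom K A H proj"
  unfolding algebra_hom_def
proof (intro conjI ballI)
  show "k_linear K A H proj"
  proof (rule k_linearI)
    show "proj x \<in> carrier H" if "x \<in> carrier A" for x
      using that by (auto simp: quot_bialgebra_sel A_RCOSETS_def')
    show "proj (x \<oplus>\<^bsub>A\<^esub> y) = proj x \<oplus>\<^bsub>H\<^esub> proj y" if "x \<in> carrier A" "y \<in> carrier A" for x y
      using J.a_rcos_sum[OF that] by (simp add: quot_bialgebra_sel)
    show "proj (c \<odot>\<^bsub>A\<^esub> x) = c \<odot>\<^bsub>H\<^esub> proj x" if "c \<in> carrier K" "x \<in> carrier A" for c x
      using quot_module_smult[OF A.module_axioms sub that] by (simp add: quot_bialgebra_sel)
  qed
  show "proj (x \<otimes>\<^bsub>A\<^esub> y) = proj x \<otimes>\<^bsub>H\<^esub> proj y" if "x \<in> carrier A" "y \<in> carrier A" for x y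
    using JI.rcoset_mult_add[OF that] by (simp add: quot_bialgebra_sel)
qed (simp add: quot_bialgebra_sel)

lemma proj_eq_zero: "\<lbrakk>a \<in> carrier A; proj a = \<zero>\<^bsub>H\<^esub>\<rbrakk> \<Longrightarrow> a \<in> J"
  using J.a_rcos_self[of a] by (simp add: quot_bialgebra_sel)

lemma some_proj:
  assumes "a \<in> carrier A" obtains j where "j \<in> J" "(SOME x. x \<in> proj a) = j \<oplus>\<^bsub>A\<^esub> a"
proof -
  have "(SOME x. x \<in> proj a) \<in> proj a"
    using J.a_rcos_self[OF assms] by (rule someI[of "\<lambda>x. x \<in> proj a"])
  then show ?thesis using that by (auto simp: a_r_coset_def')
qed

text \<open>Coproduct and counit of the quotient are evaluated at a representative picked by
  \<open>SOME\<close>, which differs from \<open>a\<close> by some \<open>j\<close> in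
  \<open>J\<close>. The coideal property removes the contribution of \<open>j\<close>: its coproduct
  lies in J \<otimes> A + A \<otimes> J, which proj \<otimes> proj annihilates, and its counit is
  zero.\<close>

lemma projection: "bialgebra_projection K A H S proj"
proof (intro bialgebra_projection.intro A hopf proj_hom)
  note MA = A.module_axioms and MH = H.modH and C = bialgebra_coalgebra[OF A]
  note pl = algebra_homD(1)[OF proj_hom] and pc = algebra_homD(2)[OF proj_hom]
  let ?X = "tensor K H H" and ?b = "\<lambda>x y. pure K H H (proj x) (proj y)"
  have X: "module K ?X" by (rule tensor_module[OF MH MH])
  have b: "k_bilinear K A A ?X ?b"
    by (intro k_bilinearI k_linear_pure_left[OF MH MH] k_linear_pure_right[OF MH MH] pl pc)
  let ?P = "tlift K ?X ?b"
  have P: "k_linear K (tensor K A A) ?X ?P" by (rule tlift_linear[OF MA MA X b])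
  note AA = tensor_module[OF MA MA]
  interpret X: module K ?X by (rule X)
  let ?ker = "{Y \<in> carrier (tensor K A A). ?P Y = \<zero>\<^bsub>?X\<^esub>}"
  have ker: "submodule ?ker K (tensor K A A)" by (rule kernel_submodule[OF AA X P])
  have p0: "proj j = \<zero>\<^bsub>H\<^esub>" if "j \<in> J" for j
    using J.a_rcos_const[OF that] by (simp add: quot_bialgebra_sel)
  have z: "pure K H H \<zero>\<^bsub>H\<^esub> h = \<zero>\<^bsub>?X\<^esub>" "pure K H H h \<zero>\<^bsub>H\<^esub> = \<zero>\<^bsub>?X\<^esub>" if "h \<in> carrier H" for h
    using k_linear_zero[OF MH X k_linear_pure_left[OF MH MH k_linear_id that]]
      k_linear_zero[OF MH X k_linear_pure_right[OF MH MH k_linear_id that]] by simp_all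
  have gen: "{pure K A A v w | v w. v \<in> J \<and> w \<in> carrier A} \<subseteq> ?ker"
    "{pure K A A v w | v w. v \<in> carrier A \<and> w \<in> J} \<subseteq> ?ker"
    using J.a_Hcarr pure_closed[OF MA MA] pc by (auto simp: tlift_pure[OF MA MA X b] p0 z)
  have "tensor_image K A A J (carrier A) \<subseteq> ?ker" "tensor_image K A A (carrier A) J \<subseteq> ?ker"
    unfolding tensor_image_def module_span_def using ker gen by blast+
  then have van: "?P (comult A j) = \<zero>\<^bsub>?X\<^esub>" if "j \<in> J" for j
  proof -
    have "comult A j \<in> tensor_image K A A J (carrier A) <+>\<^bsub>tensor K A A\<^esub> tensor_image K A A (carrier A) J"
      using coid that by (auto simp: coideal_def)
    then obtain u v where uv: "u \<in> ?ker" "v \<in> ?ker" "comult A j = u \<oplus>\<^bsub>tensor K A A\<^esub> v"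
      using \<open>tensor_image K A A J (carrier A) \<subseteq> ?ker\<close> \<open>tensor_image K A A (carrier A) J \<subseteq> ?ker\<close>
      unfolding set_add_def' by blast
    then show ?thesis using k_linear_add[OF P] by simp
  qed
  fix a assume a: "a \<in> carrier A"
  obtain j where j: "j \<in> J" "(SOME x. x \<in> proj a) = j \<oplus>\<^bsub>A\<^esub> a" using some_proj[OF a] .
  have jc: "j \<in> carrier A" using J.a_Hcarr[OF j(1)] .
  have "comult H (proj a) = ?P (comult A (j \<oplus>\<^bsub>A\<^esub> a))"
    by (simp add: quot_bialgebra_sel(7) j(2) quot_bialgebra_tensor)
  also have "\<dots> = ?P (comult A a)"
    using van[OF j(1)] comult_closed[OF C a] comult_closed[OF C jc] k_linear_closed[OF P]
    by (simp add: k_linear_add[OF A.comult_linear jc a] k_linear_add[OF P])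
  finally show "comult H (proj a) = sweedler K A ?X ?b a" using a by (simp add: sweedler_eq[OF C])
  have "counit A j = \<zero>\<^bsub>K\<^esub>" using coid j(1) by (auto simp: coideal_def)
  then show "counit H (proj a) = counit A a"
    using k_linear_add[OF A.counit_linear jc a] k_linear_closed[OF A.counit_linear a]
    by (simp add: quot_bialgebra_sel(8) j(2) scalars_def)
qed

section \<open>Composing the given splittings into one section\<close>

definition quot_section :: "'a set \<Rightarrow> ('a set \<Rightarrow> 'a set) \<Rightarrow> bool"
  where "quot_section I c \<longleftrightarrow> k_linear K (quot_module A J) (quot_module A I) c
    \<and> (\<forall>X \<in> carrier (quot_module A J).
        quot_lcoact K A J I (c X) = tlift K (tensor K H (quot_module A I))
            (\<lambda>h x. pure K H (quot_module A I) h (c x)) (quot_lcoact K A J J X)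
        \<and> quot_rcoact K A J I (c X) = tlift K (tensor K (quot_module A I) H)
            (\<lambda>x h. pure K (quot_module A I) H (c x) h) (quot_rcoact K A J J X)
        \<and> J <+>\<^bsub>A\<^esub> c X = X)"

lemma quot_sectionD:
  assumes "quot_section I c"
  shows "k_linear K (quot_module A J) (quot_module A I) c"
    and "X \<in> carrier (quot_module A J) \<Longrightarrow> quot_lcoact K A J I (c X)
      = tlift K (tensor K H (quot_module A I)) (\<lambda>h x. pure K H (quot_module A I) h (c x)) (quot_lcoact K A J J X)"
    and "X \<in> carrier (quot_module A J) \<Longrightarrow> quot_rcoact K A J I (c X)
      = tlift K (tensor K (quot_module A I) H) (\<lambda>x h. pure K (quot_module A I) H (c x) h) (quot_rcoact K A J J X)"
    and "X \<in> carrier (quot_module A J) \<Longrightarrow> J <+>\<^bsub>A\<^esub> c X = X"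
  using assms by (simp_all add: quot_section_def)

text \<open>Induction on the power: the identity of A/J starts it, and the step composes with the
  splitting of the next canonical map. \<open>quot_section\<close> keeps only the two colinearity
  equations and the section property, which are stable under this composition.\<close>

lemma composed_splitting:
  assumes split: "\<And>n. n \<ge> 1 \<Longrightarrow> canonical_map_splits K A J n"
  shows "\<exists>c. quot_section (ideal_power A J (Suc n)) c"
proof (induction n)
  let ?Q = "\<lambda>n. quot_module A (ideal_power A J n)"
  note MH = H.modH
  case 0
  have one: "ideal_power A J (Suc 0) = J" by (rule ideal_power_one[OF A.ring_axioms J_ideal])
  \<comment> \<open>The splitting hypothesis at 1 also states that A/J, the target of the canonical
    map from A/J^2, is a bicomodule; linearity of its coactions is taken from there.\<close>
  have "bicomodule K H (quot_module A J) (quot_lcoact K A J J) (quot_rcoact K A J J)"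
    using split[of 1] one
    by (auto simp: canonical_map_splits_def splits_in_bicomodules_def bicomodule_hom_def Let_def
        simp del: ideal_power.simps)
  then interpret M: bicomodule K H "quot_module A J" "quot_lcoact K A J J" "quot_rcoact K A J J" .
  have MQ: "module K (quot_module A J)" by (rule quot_module_module[OF A.module_axioms sub])
  have "J <+>\<^bsub>A\<^esub> X = X" if X: "X \<in> carrier (quot_module A J)" for X
  proof -
    obtain x where x: "x \<in> carrier A" "X = J +>\<^bsub>A\<^esub> x" using X by (auto simp: quot_module_simps A_RCOSETS_def')
    then show ?thesis using J.rcosets_add_eq[of X] X by (simp add: quot_module_simps)
  qed
  then show ?case unfolding one quot_section_def
    using tensor_expand[OF MH MQ k_linear_closed[OF M.lcoact_linear]]
      tensor_expand[OF MQ MH k_linear_closed[OF M.rcoact_linear]]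
    by (intro exI[of _ "\<lambda>x. x"]) (simp add: k_linear_id)
next
  case (Suc n)
  let ?I = "ideal_power A J (Suc n)" and ?I' = "ideal_power A J (Suc (Suc n))"
  let ?Q1 = "quot_module A J" and ?Q = "quot_module A ?I" and ?Q' = "quot_module A ?I'"
  note MH = H.modH
  have MQ: "module K ?Q1" "module K ?Q" "module K ?Q'"
    by (intro quot_module_module[OF A.module_axioms] sub ideal_submodule[OF bialgebra_algebra[OF A]]
        ideal_power_ideal[OF A.ring_axioms J_ideal])+
  from Suc.IH obtain c where sec: "quot_section ?I c" ..
  note c = quot_sectionD(1)[OF sec] and cl = quot_sectionD(2)[OF sec]
    and cr = quot_sectionD(3)[OF sec] and cp = quot_sectionD(4)[OF sec]
  from split[of "Suc n"] obtain s where
    "bicomodule_hom K H ?Q (quot_lcoact K A J ?I) (quot_rcoact K A J ?I)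
      ?Q' (quot_lcoact K A J ?I') (quot_rcoact K A J ?I') s"
    and sp: "\<And>Y. Y \<in> carrier ?Q \<Longrightarrow> ?I <+>\<^bsub>A\<^esub> s Y = Y"
    by (auto simp: canonical_map_splits_def splits_in_bicomodules_def Let_def simp del: ideal_power.simps)
  then interpret s: bicomodule_hom K H ?Q "quot_lcoact K A J ?I" "quot_rcoact K A J ?I"
      ?Q' "quot_lcoact K A J ?I'" "quot_rcoact K A J ?I'" s by simp
  have "bicomodule K H ?Q1 (quot_lcoact K A J J) (quot_rcoact K A J J)"
    using split[of 1] ideal_power_one[OF A.ring_axioms J_ideal]
    by (auto simp: canonical_map_splits_def splits_in_bicomodules_def bicomodule_hom_def Let_def
        simp del: ideal_power.simps)
  then interpret M: bicomodule K H ?Q1 "quot_lcoact K A J J" "quot_rcoact K A J J" .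
  note lc = k_linear_closed[OF M.lcoact_linear] and rc = k_linear_closed[OF M.rcoact_linear]
  note sc = k_linear_closed[OF s.hom_linear] and cc = k_linear_closed[OF c]
  have bl: "k_bilinear K H ?Q (tensor K H ?Q') (\<lambda>h x. pure K H ?Q' h (s x))"
    by (intro k_bilinearI k_linear_pure_left[OF MH MQ(3)] k_linear_pure_right[OF MH MQ(3)]
        s.hom_linear k_linear_id sc)
  have br: "k_bilinear K ?Q H (tensor K ?Q' H) (\<lambda>x h. pure K ?Q' H (s x) h)"
    by (intro k_bilinearI k_linear_pure_left[OF MQ(3) MH] k_linear_pure_right[OF MQ(3) MH]
        s.hom_linear k_linear_id sc)
  have 1: "quot_lcoact K A J ?I' (s (c X)) = tlift K (tensor K H ?Q') (\<lambda>h x. pure K H ?Q' h (s (c x))) (quot_lcoact K A J J X)"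
    if X: "X \<in> carrier ?Q1" for X
  proof -
    have "quot_lcoact K A J ?I' (s (c X)) = tlift K (tensor K H ?Q') (\<lambda>h x. pure K H ?Q' h (s x))
        (tlift K (tensor K H ?Q) (\<lambda>h x. pure K H ?Q h (c x)) (quot_lcoact K A J J X))"
      using s.hom_lcoact[OF cc[OF X]] cl[OF X] by simp
    also have "\<dots> = tlift K (tensor K H ?Q') (\<lambda>h x. tlift K (tensor K H ?Q') (\<lambda>h x. pure K H ?Q' h (s x))
        (pure K H ?Q h (c x))) (quot_lcoact K A J J X)"
      by (rule tlift_tlift[OF MH MQ(1) MH MQ(2) tensor_module[OF MH MQ(3)] lc[OF X] bl])
        (intro pure_closed[OF MH MQ(2)] cc)
    also have "\<dots> = tlift K (tensor K H ?Q') (\<lambda>h x. pure K H ?Q' h (s (c x))) (quot_lcoact K A J J X)"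
      by (intro tlift_cong[OF MH MQ(1) lc[OF X]] tlift_pure[OF MH MQ(2) tensor_module[OF MH MQ(3)] bl] cc)
    finally show ?thesis .
  qed
  have 2: "quot_rcoact K A J ?I' (s (c X)) = tlift K (tensor K ?Q' H) (\<lambda>x h. pure K ?Q' H (s (c x)) h) (quot_rcoact K A J J X)"
    if X: "X \<in> carrier ?Q1" for X
  proof -
    have "quot_rcoact K A J ?I' (s (c X)) = tlift K (tensor K ?Q' H) (\<lambda>x h. pure K ?Q' H (s x) h)
        (tlift K (tensor K ?Q H) (\<lambda>x h. pure K ?Q H (c x) h) (quot_rcoact K A J J X))"
      using s.hom_rcoact[OF cc[OF X]] cr[OF X] by simp
    also have "\<dots> = tlift K (tensor K ?Q' H) (\<lambda>x h. tlift K (tensor K ?Q' H) (\<lambda>x h. pure K ?Q' H (s x) h)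
        (pure K ?Q H (c x) h)) (quot_rcoact K A J J X)"
      by (rule tlift_tlift[OF MQ(1) MH MQ(2) MH tensor_module[OF MQ(3) MH] rc[OF X] br])
        (intro pure_closed[OF MQ(2) MH] cc)
    also have "\<dots> = tlift K (tensor K ?Q' H) (\<lambda>x h. pure K ?Q' H (s (c x)) h) (quot_rcoact K A J J X)"
      by (intro tlift_cong[OF MQ(1) MH rc[OF X]] tlift_pure[OF MQ(2) MH tensor_module[OF MQ(3) MH] br] cc)
    finally show ?thesis .
  qed
  have 3: "J <+>\<^bsub>A\<^esub> s (c X) = X" if X: "X \<in> carrier ?Q1" for X
  proof -
    interpret I: ideal ?I A by (rule ideal_power_ideal[OF A.ring_axioms J_ideal])
    have IJ: "?I \<subseteq> J" by (rule ideal_power_Suc_subset[OF A.ring_axioms J_ideal])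
    interpret I': ideal ?I' A by (rule ideal_power_ideal[OF A.ring_axioms J_ideal])
    have sX: "s (c X) \<subseteq> carrier A"
      using sc[OF cc[OF X]] I'.a_rcosets_carrier by (auto simp: quot_module_simps)
    \<comment> \<open>\<open>J\<close> absorbs its powers, which is why the canonical maps compose:
      adding the power and then \<open>J\<close> to a coset is adding \<open>J\<close>.\<close>
    have JI: "J <+>\<^bsub>A\<^esub> ?I = J"
    proof
      show "J <+>\<^bsub>A\<^esub> ?I \<subseteq> J" using IJ J.a_closed by (auto simp: set_add_def')
      show "J \<subseteq> J <+>\<^bsub>A\<^esub> ?I"
      proof
        fix x assume x: "x \<in> J"
        then have "x = x \<oplus>\<^bsub>A\<^esub> \<zero>\<^bsub>A\<^esub>" using J.a_Hcarr by simp
        then show "x \<in> J <+>\<^bsub>A\<^esub> ?I" using x I.zero_closed unfolding set_add_def' by blast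
      qed
    qed
    have "J <+>\<^bsub>A\<^esub> s (c X) = J <+>\<^bsub>A\<^esub> (?I <+>\<^bsub>A\<^esub> s (c X))"
      using A.add.set_mult_assoc[OF J.a_subset I.a_subset sX] JI by (simp add: set_add_def)
    then show ?thesis using sp[OF cc[OF X]] cp[OF X] by simp
  qed
  have "quot_section ?I' (\<lambda>x. s (c x))"
    unfolding quot_section_def by (intro conjI ballI 1 2 3 k_linear_comp[OF s.hom_linear c])
  then show ?case by (rule exI[of _ "\<lambda>x. s (c x)"])
qed

text \<open>Once the power of \<open>J\<close> is zero its cosets are singletons, and
  \<open>the_elem\<close> identifies the quotient with \<open>A\<close>. On A/J both coactions are
  the coproduct of \<open>H\<close>, so the coset equations become those of
  \<open>bicolinear_section\<close>.\<close>

lemma bicolinear_section_exists: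
  assumes split: "\<And>n. n \<ge> 1 \<Longrightarrow> canonical_map_splits K A J n"
    and nil: "ideal_power A J (Suc n) = {\<zero>\<^bsub>A\<^esub>}"
  shows "\<exists>f. bialgebra_projection.bicolinear_section K A H proj f"
proof -
  interpret P: bialgebra_projection K A H S proj by (rule projection)
  let ?Q = "quot_module A {\<zero>\<^bsub>A\<^esub>}" and ?Q1 = "quot_module A J"
  have z: "submodule {\<zero>\<^bsub>A\<^esub>} K A"
    by (rule A.submoduleI) auto
  interpret Z: abelian_subgroup "{\<zero>\<^bsub>A\<^esub>}" A by (rule submodule_abelian_subgroup[OF A.module_axioms z])
  have MQ: "module K ?Q" by (rule quot_module_module[OF A.module_axioms z])
  have MQ1: "module K ?Q1" by (rule quot_module_module[OF A.module_axioms sub])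
  note MH = P.modH and MA = P.modA
  have sing: "{\<zero>\<^bsub>A\<^esub>} +>\<^bsub>A\<^esub> x = {x}" if "x \<in> carrier A" for x
    using that by (auto simp: a_r_coset_def')
  have rep: "\<exists>x \<in> carrier A. X = {x}" if "X \<in> carrier ?Q" for X
    using that sing by (auto simp: quot_module_simps A_RCOSETS_def')
  have zl: "k_linear K ?Q A the_elem"
  proof (rule k_linearI)
    show "the_elem X \<in> carrier A" if "X \<in> carrier ?Q" for X using rep[OF that] by auto
    show "the_elem (X \<oplus>\<^bsub>?Q\<^esub> X') = the_elem X \<oplus>\<^bsub>A\<^esub> the_elem X'"
      if "X \<in> carrier ?Q" "X' \<in> carrier ?Q" for X X'
      using rep[OF that(1)] rep[OF that(2)] by (auto simp: quot_module_simps set_add_def')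
    show "the_elem (k \<odot>\<^bsub>?Q\<^esub> X) = k \<odot>\<^bsub>A\<^esub> the_elem X" if "k \<in> carrier K" "X \<in> carrier ?Q" for k X
      using rep[OF that(2)] quot_module_smult[OF A.module_axioms z that(1)] sing that(1) by auto
  qed
  obtain c where sec: "quot_section {\<zero>\<^bsub>A\<^esub>} c" using composed_splitting[OF split, of n] unfolding nil ..
  note c = quot_sectionD(1)[OF sec] and cl = quot_sectionD(2)[OF sec]
    and cr = quot_sectionD(3)[OF sec] and cp = quot_sectionD(4)[OF sec]
  define f where "f = (\<lambda>X. the_elem (c X))"
  have carr: "carrier H = carrier ?Q1" by (simp add: quot_bialgebra_sel quot_module_simps)
  have fl: "k_linear K H A f"
    unfolding f_def k_linear_quot_bialgebra by (rule k_linear_comp[OF zl c])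
  have cf: "c X = {f X}" if "X \<in> carrier H" for X
    proof -
    obtain x where "c X = {x}" using rep[OF k_linear_closed[OF c]] \<open>X \<in> carrier H\<close> unfolding carr by blast
    then show ?thesis by (simp add: f_def)
  qed
  note fc = k_linear_closed[OF fl]
  have pf: "proj (f X) = X" if X: "X \<in> carrier H" for X
    using cp[of X] X cf[OF X] by (simp add: carr set_add_def' a_r_coset_def')
  have coact: "quot_lcoact K A J J X = comult H X" "quot_rcoact K A J J X = comult H X" for X
    by (simp_all add: quot_lcoact_def quot_rcoact_def quot_bialgebra_sel(7) quot_bialgebra_tensor)
  have some: "(SOME a. a \<in> c X) = f X" if "X \<in> carrier H" for X using cf[OF that] by simp
  have Qc: "{\<zero>\<^bsub>A\<^esub>} +>\<^bsub>A\<^esub> x \<in> carrier ?Q" if "x \<in> carrier A" for x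
    using that by (auto simp: quot_module_simps A_RCOSETS_def')
  have cc: "c X \<in> carrier ?Q" if "X \<in> carrier H" for X using k_linear_closed[OF c] that carr by simp
  have left: "sweedler K A (tensor K H A) (\<lambda>x y. pure K H A (proj x) y) (f h)
      = sweedler K H (tensor K H A) (\<lambda>x y. pure K H A x (f y)) h" if h: "h \<in> carrier H" for h
  proof -
    let ?X = "tensor K H A" and ?b = "\<lambda>g m. pure K H A g (the_elem m)"
    note X = tensor_module[OF MH MA]
    have b: "k_bilinear K H ?Q ?X ?b"
      by (intro k_bilinearI k_linear_pure_left[OF MH MA] k_linear_pure_right[OF MH MA] zl k_linear_id
          k_linear_closed[OF zl])
    have "tlift K ?X ?b (quot_lcoact K A J {\<zero>\<^bsub>A\<^esub>} (c h))
      = tlift K ?X ?b (sweedler K A (tensor K H ?Q) (\<lambda>x y. pure K H ?Q (proj x) ({\<zero>\<^bsub>A\<^esub>} +>\<^bsub>A\<^esub> y)) (f h))"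
      using h fc by (simp add: quot_lcoact_def some sweedler_eq)
    also have "\<dots> = sweedler K A ?X (\<lambda>x y. pure K H A (proj x) (the_elem ({\<zero>\<^bsub>A\<^esub>} +>\<^bsub>A\<^esub> y))) (f h)"
      by (rule tlift_sweedler_pure[OF P.coA MH MQ X b fc[OF h] P.p_closed Qc])
    also have "\<dots> = sweedler K A ?X (\<lambda>x y. pure K H A (proj x) y) (f h)" by (simp add: sing)
    finally have 1: "tlift K ?X ?b (quot_lcoact K A J {\<zero>\<^bsub>A\<^esub>} (c h))
      = sweedler K A ?X (\<lambda>x y. pure K H A (proj x) y) (f h)" .
    have "quot_lcoact K A J {\<zero>\<^bsub>A\<^esub>} (c h) = sweedler K H (tensor K H ?Q) (\<lambda>g x. pure K H ?Q g (c x)) h"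
      using cl[of h] h carr by (simp add: coact sweedler_eq)
    then have "tlift K ?X ?b (quot_lcoact K A J {\<zero>\<^bsub>A\<^esub>} (c h)) = sweedler K H ?X (\<lambda>g x. pure K H A g (the_elem (c x))) h"
      using tlift_sweedler_pure[OF P.coH MH MQ X b h, where p="\<lambda>x y. x" and q="\<lambda>x y. c y", OF _ cc] by simp
    then show ?thesis using 1 by (simp add: f_def)
  qed
  have right: "sweedler K A (tensor K A H) (\<lambda>x y. pure K A H x (proj y)) (f h)
      = sweedler K H (tensor K A H) (\<lambda>x y. pure K A H (f x) y) h" if h: "h \<in> carrier H" for h
  proof -
    let ?X = "tensor K A H" and ?b = "\<lambda>m g. pure K A H (the_elem m) g"
    note X = tensor_module[OF MA MH]
    have b: "k_bilinear K ?Q H ?X ?b"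
      by (intro k_bilinearI k_linear_pure_left[OF MA MH] k_linear_pure_right[OF MA MH] zl k_linear_id
          k_linear_closed[OF zl])
    have "tlift K ?X ?b (quot_rcoact K A J {\<zero>\<^bsub>A\<^esub>} (c h))
      = tlift K ?X ?b (sweedler K A (tensor K ?Q H) (\<lambda>x y. pure K ?Q H ({\<zero>\<^bsub>A\<^esub>} +>\<^bsub>A\<^esub> x) (proj y)) (f h))"
      using h fc by (simp add: quot_rcoact_def some sweedler_eq)
    also have "\<dots> = sweedler K A ?X (\<lambda>x y. pure K A H (the_elem ({\<zero>\<^bsub>A\<^esub>} +>\<^bsub>A\<^esub> x)) (proj y)) (f h)"
      by (rule tlift_sweedler_pure[OF P.coA MQ MH X b fc[OF h] Qc P.p_closed])
    also have "\<dots> = sweedler K A ?X (\<lambda>x y. pure K A H x (proj y)) (f h)" by (simp add: sing)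
    finally have 1: "tlift K ?X ?b (quot_rcoact K A J {\<zero>\<^bsub>A\<^esub>} (c h))
      = sweedler K A ?X (\<lambda>x y. pure K A H x (proj y)) (f h)" .
    have "quot_rcoact K A J {\<zero>\<^bsub>A\<^esub>} (c h) = sweedler K H (tensor K ?Q H) (\<lambda>x g. pure K ?Q H (c x) g) h"
      using cr[of h] h carr by (simp add: coact sweedler_eq)
    then have "tlift K ?X ?b (quot_rcoact K A J {\<zero>\<^bsub>A\<^esub>} (c h)) = sweedler K H ?X (\<lambda>x g. pure K A H (the_elem (c x)) g) h"
      using tlift_sweedler_pure[OF P.coH MQ MH X b h, where p="\<lambda>x y. c x" and q="\<lambda>x y. y", OF cc] by simp
    then show ?thesis using 1 by (simp add: f_def)
  qed
  have "P.bicolinear_section f"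
    unfolding P.bicolinear_section_def using fl pf left right by blast
  then show ?thesis by blast
qed

end

theorem theorem4p48:
  fixes K :: "('k, 'l) ring_scheme"
    and A :: "('k, 'a, 'm) bialg_scheme"
    and J :: "'a set"
    and H :: "('k, 'a set) bialg"
    and S :: "'a set \<Rightarrow> 'a set"
  assumes "field K"
    and "bialgebra K A"
    and "J = jacobson_radical A"
    and "\<exists>n. ideal_power A J n = {\<zero>\<^bsub>A\<^esub>}"
    and "coideal K A J"
    and "H = quot_bialgebra K A J"
    and "hopf_algebra K H S"
    and "\<exists>t. ad_coinvariant_integral K H S t"
    and "\<And>n. n \<ge> 1 \<Longrightarrow> canonical_map_splits K A J n"
  shows "\<exists>(R :: ('k, 'a set, 'a) yd_quad) f S\<^sub>A S\<^sub>B.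
    yetter_drinfeld_quadruple K H S R
    \<and> bialgebra_iso K A (bosonization K R H) f
    \<and> hopf_algebra K A S\<^sub>A
    \<and> hopf_algebra K (bosonization K R H) S\<^sub>B
    \<and> (\<forall>x \<in> carrier A. f (S\<^sub>A x) = S\<^sub>B (f x))"
proof -
  interpret Q: hopf_quotient K A J S
    by (rule hopf_quotient.intro) (use assms in simp_all)
  interpret P: bialgebra_projection K A Q.H S Q.proj by (rule Q.projection)
  note RA = P.A.ring_axioms and J = Q.J_ideal
  obtain n where "ideal_power A J n = {\<zero>\<^bsub>A\<^esub>}" using assms(4) by blast
  \<comment> \<open>The given exponent may be 0; raising it by one yields the form
    \<open>Suc n\<close> by which the sections and defects are indexed.\<close>
  then have "ideal_power A J (Suc n) \<subseteq> {\<zero>\<^bsub>A\<^esub>}" using ideal_power_Suc_subset(2)[OF RA J, of n] by simp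
  moreover have "\<zero>\<^bsub>A\<^esub> \<in> ideal_power A J (Suc n)"
    using ideal_power_ideal[OF RA J, of "Suc n"] additive_subgroup.zero_closed ideal.axioms(1) by blast
  ultimately have nil: "ideal_power A J (Suc n) = {\<zero>\<^bsub>A\<^esub>}" by blast
  obtain f where f: "P.bicolinear_section f"
    using Q.bicolinear_section_exists[OF assms(9) nil] by blast
  obtain t where t: "ad_coinvariant_integral K Q.H S t" using assms(6,8) by blast
  obtain s where "split_bialgebra K A Q.H S Q.proj s"
    using P.lift_exists[OF f t J Q.proj_eq_zero nil] by blast
  then interpret B: split_bialgebra K A Q.H S Q.proj s .
  obtain SA where SA: "hopf_algebra K A SA"
    using B.antipode_exists[OF J Q.proj_eq_zero nil] by blast
  \<comment> \<open>The antipode of the bosonization is that of \<open>A\<close> conjugated by the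
    isomorphism, so compatibility is cancellation of \<open>B.iso_inv\<close> against
    \<open>B.iso\<close>.\<close>
  have "\<forall>x \<in> carrier A. B.iso (SA x) = B.iso (SA (B.iso_inv (B.iso x)))"
    by (simp add: B.iso_inv_iso)
  then show ?thesis
    unfolding assms(6) using B.yd_quadruple B.Bos_iso SA B.Bos_hopf[OF SA] by blast
qed

end
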